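(* Let $r\in\mathbb{N}$, $1\le p\le\infty$ and $f\in L_p[-1,1]$. Let $\delta,\gamma\ge0$ and suppose that $w$ is a doubling weight from the class $\mathcal{W}^{\delta,\gamma}$ with $\gamma\le r\lambda_p$. Then, for $0<\alpha<r-\delta/\lambda_p$, we have $$E_n(f)_{p,w_n}=O(n^{-\alpha})\iff\omega_\varphi^r(f,n^{-1})_{p,w_n}=O(n^{-\alpha})\qquad(n\to\infty).$$
   Context: A doubling weight is a nonnegative $w\in L_1[-1,1]$, extended by $0$ outside $[-1,1]$, for which there is a constant $L$ (the doubling constant of $w$) with $\int_{2I}w\le L\int_I w$ for all intervals $I\subset[-1,1]$, where $2I$ is the interval with the same center as $I$ and twice its length. Let $\varphi(x)=\sqrt{1-x^2}$, $\rho_n(x)=n^{-1}\sqrt{1-x^2}+n^{-2}$, and $w_n(x)=\frac{1}{\rho_n(x)}\int_{x-\rho_n(x)}^{x+\rho_n(x)}w(u)\,du$. Class $\mathcal{W}^{\delta,\gamma}$ ($\delta,\gamma\ge0$): all doubling weights $w$ for which there is a constant $\Lambda>0$ such that for all $m,n\in\mathbb{N}$ with $m\le n$ and all $x\in[-1,1]$, $w_n(x)\varphi(x)^\gamma\le\Lambda n^\delta m^{\gamma-\delta}\rho_m(x)^\gamma w_m(x)$ (with $\varphi(x)^0=1$). $\lambda_p=p$ if $p<\infty$, $\lambda_\infty=1$. For a weight $v$ on $[-1,1]$: $\|g\|_{p,v}=\left(\int_{-1}^1|g|^p v\right)^{1/p}$ if $p<\infty$, $\|g\|_{\infty,v}=\operatorname{ess\,sup}_{[-1,1]}|g|v$.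 $\Pi_n$ is the set of algebraic polynomials of degree $\le n-1$ and $E_n(f)_{p,v}=\inf_{P\in\Pi_n}\|f-P\|_{p,v}$. Symmetric difference: $\Delta_h^r(f,x)=\sum_{i=0}^r\binom ri(-1)^{r-i}f(x-rh/2+ih)$ if $x\pm rh/2\in[-1,1]$, and $0$ otherwise. Modulus: $\omega_\varphi^r(f,t)_{p,v}=\sup_{0<h\le t}\|\Delta_{h\varphi(\cdot)}^r(f,\cdot)\|_{p,v}$. *)

theory Defs
  imports
    "HOL-Probability.Essential_Supremum"
    "HOL-Computational_Algebra.Polynomial"
begin

section \<open>Doubling weights\<close>

text \<open>
  A weight on [-1,1] is represented by its extension by zero, a function on the whole real line.
  An interval with centre \<open>c\<close> and length \<open>2 * d\<close> is written \<open>{c - d..c + d}\<close>, so its double is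
  \<open>{c - 2 * d..c + 2 * d}\<close>; the inclusion or omission of endpoints does not affect the integrals.
\<close>

definition doubling_weight :: "(real \<Rightarrow> real) \<Rightarrow> bool" where
  "doubling_weight w \<longleftrightarrow>
     (\<forall>x. 0 \<le> w x) \<and> (\<forall>x. x \<notin> {-1..1} \<longrightarrow> w x = 0) \<and>
     set_integrable lebesgue {-1..1} w \<and>
     (\<exists>L. \<forall>c d. 0 < d \<longrightarrow> {c - d..c + d} \<subseteq> {-1..1} \<longrightarrow>
        (LINT u:{c - 2 * d..c + 2 * d}|lebesgue. w u) \<le> L * (LINT u:{c - d..c + d}|lebesgue. w u))"

definition phi :: "real \<Rightarrow> real" where
  "phi x = sqrt (1 - x\<^sup>2)"

definition rho :: "nat \<Rightarrow> real \<Rightarrow> real" where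
  "rho n x = sqrt (1 - x\<^sup>2) / real n + 1 / (real n)\<^sup>2"

definition weight_avg :: "(real \<Rightarrow> real) \<Rightarrow> nat \<Rightarrow> real \<Rightarrow> real" where
  "weight_avg w n x = 1 / rho n x * (LINT u:{x - rho n x..x + rho n x}|lebesgue. w u)"

text \<open>
  In the library \<open>0 powr 0 = 0\<close>, whereas the convention here is that \<open>phi x\<close> to the power \<open>0\<close> is \<open>1\<close>,
  also at the endpoints, where \<open>phi\<close> vanishes. All other bases below are positive.
\<close>

definition phi_pow :: "real \<Rightarrow> real \<Rightarrow> real" where
  "phi_pow \<gamma> x = (if \<gamma> = 0 then 1 else phi x powr \<gamma>)"

definition W_class :: "real \<Rightarrow> real \<Rightarrow> (real \<Rightarrow> real) set" where
  "W_class \<delta> \<gamma> = {w. doubling_weight w \<and>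
     (\<exists>\<Lambda>>0. \<forall>m n x. 1 \<le> m \<longrightarrow> m \<le> n \<longrightarrow> x \<in> {-1..1} \<longrightarrow>
        weight_avg w n x * phi_pow \<gamma> x
          \<le> \<Lambda> * real n powr \<delta> * real m powr (\<gamma> - \<delta>) * rho m x powr \<gamma> * weight_avg w m x)}"

section \<open>Weighted norms and best approximation\<close>

definition lambda_p :: "ereal \<Rightarrow> real" where
  "lambda_p p = (if p = \<infinity> then 1 else real_of_ereal p)"

text \<open>
  Norms take values in \<open>[0,\<infinity>]\<close>. The exponent \<open>p\<close> is meant to satisfy \<open>1 \<le> p\<close> and may be \<open>\<infinity>\<close>;
  since \<open>powr\<close> is not available on \<^typ>\<open>ennreal\<close>, the \<open>p\<close>-th root of \<open>\<infinity>\<close> is treated separately.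
\<close>

definition wnorm :: "ereal \<Rightarrow> (real \<Rightarrow> real) \<Rightarrow> (real \<Rightarrow> real) \<Rightarrow> ennreal" where
  "wnorm p v g =
     (if p = \<infinity> then esssup (lebesgue_on {-1..1}) (\<lambda>x. ennreal (\<bar>g x\<bar> * v x))
      else let I = (\<integral>\<^sup>+x. ennreal (\<bar>g x\<bar> powr real_of_ereal p * v x) \<partial>lebesgue_on {-1..1})
           in if I = \<infinity> then \<infinity> else ennreal (enn2real I powr (1 / real_of_ereal p)))"

definition Lp_interval :: "ereal \<Rightarrow> (real \<Rightarrow> real) set" where
  "Lp_interval p = {f. f \<in> borel_measurable (lebesgue_on {-1..1}) \<and> wnorm p (\<lambda>_. 1) f < \<infinity>}"

definition best_approx :: "nat \<Rightarrow> (real \<Rightarrow> real) \<Rightarrow> ereal \<Rightarrow> (real \<Rightarrow> real) \<Rightarrow> ennreal" where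
  "best_approx n f p v = (INF P\<in>{P :: real poly. degree P \<le> n - 1}. wnorm p v (\<lambda>x. f x - poly P x))"

section \<open>The modulus of smoothness\<close>

definition sym_diff :: "nat \<Rightarrow> real \<Rightarrow> (real \<Rightarrow> real) \<Rightarrow> real \<Rightarrow> real" where
  "sym_diff r h f x =
     (if x - real r * h / 2 \<in> {-1..1} \<and> x + real r * h / 2 \<in> {-1..1}
      then \<Sum>i=0..r. real (r choose i) * (-1) ^ (r - i) * f (x - real r * h / 2 + real i * h)
      else 0)"

definition modulus_phi ::
  "nat \<Rightarrow> (real \<Rightarrow> real) \<Rightarrow> real \<Rightarrow> ereal \<Rightarrow> (real \<Rightarrow> real) \<Rightarrow> ennreal" where
  "modulus_phi r f t p v = (SUP h\<in>{0<..t}. wnorm p v (\<lambda>x. sym_diff r (h * phi x) f x))"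

text \<open>
  The library's \<open>O\<close>-notation requires a normed field; this is its definition for a \<open>[0,\<infinity>]\<close>-valued
  sequence and a nonnegative real comparison sequence.
\<close>

definition ennreal_bigo :: "(nat \<Rightarrow> ennreal) \<Rightarrow> (nat \<Rightarrow> real) \<Rightarrow> bool" where
  "ennreal_bigo u b \<longleftrightarrow> (\<exists>C>0. \<forall>\<^sub>F n in sequentially. u n \<le> ennreal (C * b n))"

end

theory Submission
 imports Defs "HOL-Probability.Probability"
begin

text \<open>
 The averages \<open>w_n\<close> vary slowly: \<open>w_n x\<close> is at most a power of \<open>1 + n * \<bar>arccos x - arccos y\<bar>\<close> times
 \<open>w_n y\<close>. So weighted norm inequalities follow from pointwise bounds by rapidly decaying kernels and
 Schur's test. Inverse part: such a kernel bounds the derivatives of a polynomial (multiply by a power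
 of the Fejer kernel and expand in Chebyshev polynomials), which controls the differences of each
 block of a dyadic telescoping sum of best approximants; the class inequality gives the factor
 \<open>(m / n) ^ (r - \<delta> / \<lambda>_p)\<close>. Direct part: Whitney approximants on the cells of an equispaced grid in
 \<open>arccos x\<close> are glued together with polynomial approximations of step functions, and
 the error is bounded pointwise by averages of the differences of \<open>f\<close>.
\<close>

text \<open>The inverse part must measure with \<open>w_n\<close> a block of degree below
  \<open>m\<close> that is controlled with \<open>w_m\<close>, and \<open>w_n\<close> can be much
  larger than \<open>w_m\<close>. An \<open>r\<close>-th difference of the block carries the factor
  \<open>(h * phi x / rho m x) ^ r\<close>; its power \<lambda>_p supplies the factor
  \<open>phi x\<close> to the power \<gamma> that the class inequality requires, because \<gamma>
  \<le> r \<lambda>_p. As a weight enters a norm through its power 1 / \<lambda>_p, the growth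
  n^\<delta> costs only n^(\<delta> / \<lambda>_p). In the direct part the obstacle is that the
  modulus fixes \<open>h\<close> and lets the step \<open>h * phi x\<close> depend on
  \<open>x\<close>, while Whitney's inequality on a cell uses differences of all constant steps.
  Averaging over the steps and substituting \<open>k * phi y\<close> for the step reconciles the
  two. At the endpoints this works because a short difference that stays inside [-1,1] and is
  centred at \<open>y\<close> has step at most \<open>phi y / n\<close>. Norms occur as upper
  bounds, so that one form of Jensen's inequality serves every \<open>p\<close> from 1 to
  \<infinity>.\<close>

abbreviation lborel_nn_integral :: "(real \<Rightarrow> ennreal) \<Rightarrow> ennreal" (binder "LN " 10) where
 "lborel_nn_integral f \<equiv> nn_integral lborel f"

abbreviation eabs :: "real \<Rightarrow> ennreal" where "eabs x \<equiv> ennreal \<bar>x\<bar>"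

abbreviation L1 :: "real set \<Rightarrow> (real \<Rightarrow> real) \<Rightarrow> ennreal" where
 "L1 S f \<equiv> (\<integral>\<^sup>+x\<in>S. ennreal \<bar>f x\<bar> \<partial>lborel)"

section \<open>The angular distance and the scale function\<close>

text \<open>An angular step of 1/n moves \<open>x\<close> by about \<open>rho n x\<close>, so this
  is distance in units of the local resolution. In this metric \<open>rho n\<close> and the averages
  of a doubling weight grow at most polynomially.\<close>

definition tau :: "nat \<Rightarrow> real \<Rightarrow> real \<Rightarrow> real" where
 "tau n x y = real n * \<bar>arccos x - arccos y\<bar>"

lemma tau_nonneg [simp]: "0 <= tau n x y" by (simp add: tau_def)

lemma tau_self [simp]: "tau n x x = 0" by (simp add: tau_def)

lemma tau_commute: "tau n x y = tau n y x" by (simp add: tau_def abs_minus_commute)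

lemma tau_triangle: "tau n x z <= tau n x y + tau n y z"
proof -
 have "\<bar>arccos x - arccos z\<bar> <= \<bar>arccos x - arccos y\<bar> + \<bar>arccos y - arccos z\<bar>" by linarith
 from mult_left_mono[OF this, of "real n"] show ?thesis by (simp add: tau_def distrib_left)
qed

text \<open>The multiplicative form of the triangle inequality is the one that can be raised to a
  power when the base point of a decaying factor is moved.\<close>

lemma one_plus_tau_triangle: "1 + tau n x z <= (1 + tau n x y) * (1 + tau n y z)"
proof -
 have "0 <= tau n x y * tau n y z" by simp
 then show ?thesis using tau_triangle[of n x z y] unfolding distrib_left distrib_right by linarith
qed

lemma rho_pos: "1 <= n ==> x \<in> {-1..1} ==> 0 < rho n x"
 by (auto simp: rho_def abs_square_le_1 abs_le_iff intro!: add_nonneg_pos divide_nonneg_nonneg)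

lemma rho_ge: "x \<in> {-1..1} ==> 1 / (real n)\<^sup>2 <= rho n x" by (auto simp: rho_def abs_square_le_1 abs_le_iff)

lemma phi_nonneg: "x \<in> {-1..1} ==> 0 <= phi x" by (auto simp: phi_def abs_square_le_1 abs_le_iff)

lemma phi_le_1: "phi x <= 1" by (auto simp: phi_def)

lemma rho_phi: "rho n x = phi x / real n + 1 / (real n)\<^sup>2" by (simp add: rho_def phi_def)

lemma phi_le_rho: "1 <= n ==> phi x / real n <= rho n x" by (simp add: rho_phi)

lemma phi_sq: "x \<in> {-1..1} ==> (phi x)\<^sup>2 = 1 - x\<^sup>2" by (auto simp: phi_def abs_square_le_1 abs_le_iff)

lemma phi_arccos: "x \<in> {-1..1} ==> phi x = sin (arccos x)" by (simp add: phi_def sin_arccos)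

lemma phi_cos: "0 <= t ==> t <= pi ==> phi (cos t) = sin t" by (subst phi_arccos) (auto simp: arccos_cos)

text \<open>The sine is 1-Lipschitz, so \<open>phi\<close> changes by at most the angular distance
  d. The resulting term d / n equals (n d) / n^2 and is absorbed by the endpoint term of
  \<open>rho n y\<close>.\<close>

lemma rho_ratio:
 assumes n: "1 <= n" and x: "x \<in> {-1..1}" and y: "y \<in> {-1..1}"
 shows "rho n x <= (1 + tau n x y) * rho n y"
proof -
 define d where "d = \<bar>arccos x - arccos y\<bar>"
 have "\<bar>sin (arccos x) - sin (arccos y)\<bar> <= d"
 proof -
  have "\<bar>sin a - sin b\<bar> <= \<bar>a - b\<bar>" for a b :: real
  proof -
   have "sin a - sin b = 2 * sin ((a - b) / 2) * cos ((a + b) / 2)" by (rule sin_diff_sin)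
   then have "\<bar>sin a - sin b\<bar> = 2 * (\<bar>sin ((a - b) / 2)\<bar> * \<bar>cos ((a + b) / 2)\<bar>)" by (simp add: abs_mult)
   also have "... <= 2 * (\<bar>(a - b) / 2\<bar> * 1)" by (intro mult_left_mono mult_mono abs_sin_le_one abs_sin_x_le_abs_x) auto
   finally show ?thesis by simp
  qed
  then show ?thesis by (simp add: d_def)
 qed
 then have "phi x <= phi y + d" using x y by (simp add: phi_arccos)
 then have "rho n x <= rho n y + d / real n" using n by (simp add: rho_phi add_divide_distrib[symmetric] divide_right_mono)
 also have "d / real n = (real n * d) * (1 / (real n)\<^sup>2)" using n by (simp add: power2_eq_square)
 also have "... <= (real n * d) * rho n y" using rho_ge[OF y, of n] by (intro mult_left_mono) (auto simp: d_def)
 finally show ?thesis by (simp add: tau_def d_def algebra_simps)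
qed

text \<open>The difference of two cosines is twice a product of half-angle sines; one factor is at
  most d/2, the other at most \<open>sin b + d / 2\<close>. The quadratic term reflects the
  behaviour near the endpoints, where \<open>x\<close> depends quadratically on the angle.\<close>

lemma abs_diff_le_tau:
 assumes n: "1 <= n" and x: "x \<in> {-1..1}" and y: "y \<in> {-1..1}"
 shows "\<bar>x - y\<bar> <= rho n y * (tau n x y + (tau n x y)\<^sup>2)"
proof -
 define a where "a = arccos x" define b where "b = arccos y"
 define d where "d = \<bar>a - b\<bar>"
 have xy: "x = cos a" "y = cos b" using x y by (auto simp: a_def b_def)
 have b: "0 <= b" "b <= pi" using y by (auto simp: b_def arccos_lbound arccos_ubound)
 have "\<bar>x - y\<bar> = 2 * (\<bar>sin ((a + b) / 2)\<bar> * \<bar>sin ((b - a) / 2)\<bar>)" by (simp add: xy cos_diff_cos abs_mult)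
 also have "... <= 2 * ((sin b + d / 2) * (d / 2))"
 proof (intro mult_left_mono mult_mono)
  have "sin ((a + b) / 2) = sin (b + (a - b) / 2)" by (simp add: field_simps)
  also have "\<bar>...\<bar> <= \<bar>sin b\<bar> * \<bar>cos ((a - b) / 2)\<bar> + \<bar>cos b\<bar> * \<bar>sin ((a - b) / 2)\<bar>"
   unfolding sin_add using abs_triangle_ineq by (simp add: abs_mult[symmetric])
  also have "... <= \<bar>sin b\<bar> * 1 + 1 * \<bar>(a - b) / 2\<bar>" by (intro add_mono mult_mono abs_sin_x_le_abs_x) auto
  finally show "\<bar>sin ((a + b) / 2)\<bar> <= sin b + d / 2" using b by (simp add: d_def sin_ge_zero)
  show "\<bar>sin ((b - a) / 2)\<bar> <= d / 2" using abs_sin_x_le_abs_x[of "(b - a) / 2"] by (simp add: d_def abs_minus_commute)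
 qed (use b in \<open>auto simp: d_def sin_ge_zero\<close>)
 also have "... = (phi y + d / 2) * d" using y by (simp add: phi_arccos b_def)
 also have "... <= (phi y + d) * d" by (intro mult_right_mono) (auto simp: d_def)
 also have "... <= (phi y / real n + 1 / (real n)\<^sup>2) * (real n * d + (real n * d)\<^sup>2)"
 proof -
  have "0 <= phi y * (real n * d\<^sup>2) + d / real n" using phi_nonneg[OF y] by (auto simp: d_def)
  moreover have "(phi y / real n + 1 / (real n)\<^sup>2) * (real n * d + (real n * d)\<^sup>2)
    = (phi y + d) * d + (phi y * (real n * d\<^sup>2) + d / real n)" using n by (simp add: field_simps power2_eq_square)
  ultimately show ?thesis by simp
 qed
 finally show ?thesis by (simp add: rho_phi tau_def d_def a_def b_def)
qed

text \<open>Concavity puts the sine above its chord from 0 to pi/2 (Jordan's inequality).\<close>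

lemma sin_ge_two_div_pi:
 assumes "0 <= t" "t <= pi / 2"
 shows "2 / pi * t <= sin t"
proof -
 have "concave_on {0..pi} sin" unfolding concave_on_def by (rule f''_ge0_imp_convex[where f' = "%x. - cos x" and f'' = sin])
    (auto intro!: derivative_eq_intros simp: sin_ge_zero)
 then have "(1 - u) * sin a + u * sin b <= sin ((1 - u) * a + u * b)"
  if "0 <= u" "u <= 1" "a \<in> {0..pi}" "b \<in> {0..pi}" for u a b using that concave_onD[of "{0..pi}" sin u a b] by auto
 from this[of "2 * t / pi" 0 "pi / 2"] assms show ?thesis by (simp add: field_simps)
qed

text \<open>Sum-to-product gives the first bound, Jordan's inequality the other two, after
  reflection at pi if the half sum exceeds pi/2. These lower bounds control cosine differences and
  the denominators of Fejer kernels at both \<open>a - b\<close> and \<open>a + b\<close>.\<close>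

lemma sin_half_sum_ge:
 assumes "0 <= a" "a <= pi" "0 <= b" "b <= pi"
 shows "sin a / 2 <= sin ((a + b) / 2)" and "\<bar>a - b\<bar> / pi <= sin ((a + b) / 2)"
  and "\<bar>a - b\<bar> / pi <= sin (\<bar>a - b\<bar> / 2)"
proof -
 show 3: "\<bar>a - b\<bar> / pi <= sin (\<bar>a - b\<bar> / 2)" using sin_ge_two_div_pi[of "\<bar>a - b\<bar> / 2"] assms by (auto simp: field_simps)
 have "0 <= cos ((a - b) / 2)" using assms by (intro cos_ge_zero) auto
 have *: "sin a + sin b = 2 * (sin ((a + b) / 2) * cos ((a - b) / 2))" by (simp add: sin_plus_sin)
 have "0 <= sin ((a + b) / 2)" using assms by (intro sin_ge_zero) auto
 then have "sin ((a + b) / 2) * cos ((a - b) / 2) <= sin ((a + b) / 2) * 1" by (intro mult_left_mono) auto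
 with * sin_ge_zero[of b] assms show "sin a / 2 <= sin ((a + b) / 2)" by linarith
 show "\<bar>a - b\<bar> / pi <= sin ((a + b) / 2)"
 proof (cases "a + b <= pi")
  case True
  have "2 / pi * ((a + b) / 2) <= sin ((a + b) / 2)" using True assms by (intro sin_ge_two_div_pi) auto
  moreover have "\<bar>a - b\<bar> / pi <= (a + b) / pi" using assms by (intro divide_right_mono) auto
  moreover have "2 / pi * ((a + b) / 2) = (a + b) / pi" by (simp add: field_simps)
  ultimately show ?thesis by linarith
 next
  case False
  have "2 / pi * (pi - (a + b) / 2) <= sin (pi - (a + b) / 2)" using False assms by (intro sin_ge_two_div_pi) auto
  moreover have "\<bar>a - b\<bar> / pi <= (2 * pi - (a + b)) / pi" using assms by (intro divide_right_mono) auto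
  moreover have "2 / pi * (pi - (a + b) / 2) = (2 * pi - (a + b)) / pi" by (simp add: field_simps)
  moreover have "sin (pi - (a + b) / 2) = sin ((a + b) / 2)" by simp
  ultimately show ?thesis by linarith
 qed
qed

lemma cos_diff_ge:
 assumes "0 <= a" "a <= pi" "0 <= b" "b <= pi"
 shows "\<bar>a - b\<bar> * sin a / pi <= \<bar>cos a - cos b\<bar>" and "2 * (\<bar>a - b\<bar> / pi)\<^sup>2 <= \<bar>cos a - cos b\<bar>"
proof -
 define D where "D = \<bar>a - b\<bar>"
 have "sin ((b - a) / 2) = sin (D / 2) \<or> sin ((b - a) / 2) = - sin (D / 2)"
  using sin_minus[of "(a - b) / 2"] by (cases "a <= b") (auto simp: D_def minus_divide_left)
 then have e: "\<bar>cos a - cos b\<bar> = 2 * (sin ((a + b) / 2) * sin (D / 2))" using assms sin_ge_zero[of "(a + b) / 2"] sin_ge_zero[of "D / 2"]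
  by (auto simp: cos_diff_cos abs_mult D_def)
 note s = sin_half_sum_ge[OF assms, folded D_def]
 have "0 <= sin a" using assms by (simp add: sin_ge_zero)
 have "(sin a / 2) * (D / pi) <= sin ((a + b) / 2) * sin (D / 2)"
  using s \<open>0 <= sin a\<close> order_trans[OF _ s(1)] by (intro mult_mono) (auto simp: D_def)
 then show "D * sin a / pi <= \<bar>cos a - cos b\<bar>" unfolding e by (simp add: field_simps)
 have "(D / pi) * (D / pi) <= sin ((a + b) / 2) * sin (D / 2)" using s order_trans[OF _ s(2)] by (intro mult_mono) (auto simp: D_def)
 then show "2 * (D / pi)\<^sup>2 <= \<bar>cos a - cos b\<bar>" unfolding e by (simp add: power2_eq_square)
qed

text \<open>Converse of \<open>abs_diff_le_tau\<close>. The cosine difference has a lower bound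
  linear in the angle with factor \<open>sin a\<close>, and a quadratic one; the first is used where
  \<open>phi x\<close> is at least 1/n, the second near the endpoints, where \<open>rho n x\<close>
  is at most 2 / n^2.\<close>

lemma tau_le_of_abs_diff_le:
 assumes n: "1 <= n" and x: "x \<in> {-1..1}" and y: "y \<in> {-1..1}"
  and c: "\<bar>x - y\<bar> <= c * rho n x"
 shows "tau n x y <= pi * (1 + 2 * c)"
proof -
 define a where "a = arccos x" define b where "b = arccos y"
 define D where "D = \<bar>a - b\<bar>"
 have xy: "x = cos a" "y = cos b" using x y by (auto simp: a_def b_def)
 have ab: "0 <= a" "a <= pi" "0 <= b" "b <= pi" using x y by (auto simp: a_def b_def arccos_lbound arccos_ubound)
 have c0: "0 <= c"
 proof (rule ccontr)
  assume "\<not> 0 <= c"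
  then have "c * rho n x < 0" using rho_pos[OF n x] by (simp add: mult_neg_pos)
  with c show False by linarith
 qed
 note d = cos_diff_ge[OF ab, folded xy D_def]
 have phi: "phi x = sin a" using x by (simp add: phi_arccos a_def)
 have n0: "0 < real n" using n by simp
 show ?thesis
 proof (cases "1 / real n <= sin a")
  case True
  then have "1 / (real n)\<^sup>2 <= sin a / real n" using n0 by (simp add: power2_eq_square field_simps)
  then have "rho n x <= 2 * sin a / real n" by (simp add: rho_phi phi)
  with c0 have "c * rho n x <= c * (2 * sin a / real n)" by (rule mult_left_mono[rotated])
  from order_trans[OF order_trans[OF d(1) c] this]
  have "(D / pi) * sin a <= (2 * c / real n) * sin a" by (simp add: ac_simps)
  moreover have "0 < sin a" using True n0 by (meson less_le_trans zero_less_divide_1_iff)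
  ultimately have "D / pi <= 2 * c / real n" using mult_le_cancel_right_pos by blast
  then have "real n * D <= pi * (2 * c)" using n0 by (simp add: field_simps)
  also have "... <= pi * (1 + 2 * c)" by simp
  finally show ?thesis by (simp add: tau_def D_def a_def b_def)
 next
  case False
  then have "sin a / real n <= 1 / (real n)\<^sup>2" using n0 by (simp add: power2_eq_square field_simps)
  then have "rho n x <= 2 / (real n)\<^sup>2" by (simp add: rho_phi phi)
  with c0 have "c * rho n x <= c * (2 / (real n)\<^sup>2)" by (rule mult_left_mono[rotated])
  from order_trans[OF order_trans[OF d(2) c] this]
  have "2 * (D / pi)\<^sup>2 <= 2 * c / (real n)\<^sup>2" by (simp add: ac_simps)
  then have "(real n * D / pi)\<^sup>2 <= c" using n0 by (simp add: field_simps power2_eq_square)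
  also have "c <= (1 + 2 * c)\<^sup>2" using c0 by (simp add: power2_eq_square algebra_simps)
  finally have "(real n * D / pi)\<^sup>2 <= (1 + 2 * c)\<^sup>2" .
  then have "real n * D / pi <= 1 + 2 * c" by (rule power2_le_imp_le) (use c0 in simp)
  then have "real n * D <= (1 + 2 * c) * pi" by (simp only: pos_divide_le_eq[OF pi_gt_zero])
  then show ?thesis by (simp add: tau_def D_def a_def b_def ac_simps)
 qed
qed

section \<open>Integrals of powers of the angular distance\<close>

lemma arccos_measurable [measurable]:
 assumes [measurable]: "f \<in> borel_measurable M"
 shows "(%z. indicat_real {-1..1} (f z) * arccos (f z)) \<in> borel_measurable M"
proof -
 have "(%x. indicat_real {-1..1} x *\<^sub>R arccos x) \<in> borel_measurable borel"
  by (intro borel_measurable_continuous_on_indicator continuous_intros) auto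
 then have "(%x. indicat_real {-1..1} x * arccos x) \<in> borel_measurable borel" by simp
 from measurable_compose[OF assms this] show ?thesis .
qed

text \<open>By \<open>abs_diff_le_tau\<close> the fourth power of \<open>1 + tau n x y\<close>
  dominates 1 + ((y - x) / rho)^2, so the integral is at most that of a Cauchy density of width
  \<open>rho n x\<close>; this is where both the exponent 4 and the constant pi come from.\<close>

lemma nn_integral_tau_power:
 assumes n: "1 <= n" and x: "x \<in> {-1..1}" and M: "4 <= M"
 shows "(\<integral>\<^sup>+y\<in>{-1..1}. ennreal (1 / (1 + tau n x y) ^ M) \<partial>lborel) <= ennreal (pi * rho n x)"
proof -
 define c where "c = rho n x"
 have c: "0 < c" using rho_pos[OF n x] by (simp add: c_def)
 have le: "1 / (1 + tau n x y) ^ M <= 1 / (1 + ((y - x) / c)\<^sup>2)" if y: "y \<in> {-1..1}" for y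
 proof -
  define t where "t = tau n x y"
  have t: "0 <= t" by (simp add: t_def)
  have "\<bar>y - x\<bar> <= c * (t + t\<^sup>2)" using abs_diff_le_tau[OF n y x] by (simp add: c_def t_def tau_commute)
  then have "\<bar>(y - x) / c\<bar> <= t + t\<^sup>2" using c by (simp add: field_simps)
  then have "\<bar>(y - x) / c\<bar>\<^sup>2 <= (t + t\<^sup>2)\<^sup>2" by (intro power_mono) auto
  then have "1 + ((y - x) / c)\<^sup>2 <= 1 + (t + t\<^sup>2)\<^sup>2" unfolding power2_abs by simp
  also have "... <= (1 + t) ^ 4" using t by (simp add: power2_eq_square power4_eq_xxxx algebra_simps)
  also have "... <= (1 + t) ^ M" using t M by (intro power_increasing) auto
  finally show ?thesis unfolding t_def[symmetric] by (intro divide_left_mono) (use t in \<open>auto intro!: mult_pos_pos add_pos_nonneg\<close>)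
 qed
 have "(\<integral>\<^sup>+y\<in>{-1..1}. ennreal (1 / (1 + tau n x y) ^ M) \<partial>lborel)
   <= (\<integral>\<^sup>+y\<in>{-1..1}. ennreal (1 / (1 + ((y - x) / c)\<^sup>2)) \<partial>lborel)"
  using le by (intro nn_integral_mono) (auto simp: indicator_def intro!: ennreal_leI)
 also have "... = ennreal (c * arctan ((1 - x) / c) - c * arctan ((-1 - x) / c))"
 proof (rule nn_integral_FTC_Icc)
  fix y :: real
  show "((%y. c * arctan ((y - x) / c)) has_real_derivative 1 / (1 + ((y - x) / c)\<^sup>2)) (at y)"
   using c by (auto intro!: derivative_eq_intros simp: divide_inverse)
 qed auto
 also have "... <= ennreal (pi * c)"
 proof (rule ennreal_leI)
  have "arctan ((1 - x) / c) - arctan ((-1 - x) / c) <= pi" using arctan_ubound[of "(1 - x) / c"] arctan_lbound[of "(-1 - x) / c"] by linarith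
  from mult_left_mono[OF this, of c] c
  show "c * arctan ((1 - x) / c) - c * arctan ((-1 - x) / c) <= pi * c" by (simp add: algebra_simps)
 qed
 finally show ?thesis by (simp add: c_def)
qed

text \<open>A sharper constant than \<open>rho_ratio\<close> yields, needed for the explicit grid
  below. It comes from phi^2 = 1 - x^2: the difference of the squares is divided by
  \<open>phi x\<close> where \<open>phi x\<close> is at least 1/n, and otherwise bounds the square
  of the difference.\<close>

lemma rho_compare_near:
 assumes n: "1 <= n" and x: "x \<in> {-1..1}" and y: "y \<in> {-1..1}" and c: "\<bar>x - y\<bar> <= rho n x / 16"
 shows "rho n x / 2 <= rho n y" "rho n y <= 2 * rho n x"
proof -
 have n0: "0 < real n" using n by simp
 have main: "\<bar>phi x - phi y\<bar> <= 1 / (2 * real n)"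
 proof (cases "1 / real n <= phi x")
  case True
  then have p: "0 < phi x" using n0 by (meson less_le_trans zero_less_divide_1_iff)
  have "1 / (real n)\<^sup>2 <= phi x / real n" using n0 True by (simp add: power2_eq_square field_simps)
  then have r: "rho n x <= 2 * phi x / real n" by (simp add: rho_phi)
  have "\<bar>phi x - phi y\<bar> * phi x <= \<bar>phi x - phi y\<bar> * (phi x + phi y)" using phi_nonneg[OF y] by (intro mult_left_mono) auto
  also have "... = \<bar>(phi x)\<^sup>2 - (phi y)\<^sup>2\<bar>"
   using phi_nonneg[OF y] phi_nonneg[OF x] by (simp add: power2_eq_square square_diff_square_factored abs_mult)
  also have "... = \<bar>y - x\<bar> * \<bar>y + x\<bar>" using phi_sq[OF x] phi_sq[OF y] by (simp add: abs_mult[symmetric] power2_eq_square algebra_simps)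
  also have "... <= \<bar>y - x\<bar> * 2" using x y by (intro mult_left_mono) auto
  also have "... <= (2 * phi x / real n) / 16 * 2" using c r by (auto simp: abs_minus_commute)
  finally have "\<bar>phi x - phi y\<bar> * phi x <= 1 / (4 * real n) * phi x" by simp
  then have "\<bar>phi x - phi y\<bar> <= 1 / (4 * real n)" using p mult_le_cancel_right_pos by blast
  also have "... <= 1 / (2 * real n)" using n0 by (simp add: field_simps)
  finally show ?thesis .
 next
  case False
  then have "phi x / real n <= 1 / (real n)\<^sup>2" using n0 by (simp add: power2_eq_square field_simps)
  then have r: "rho n x <= 2 / (real n)\<^sup>2" by (simp add: rho_phi)
  have "\<bar>phi x - phi y\<bar>\<^sup>2 <= \<bar>phi x - phi y\<bar> * (phi x + phi y)"
   using phi_nonneg[OF y] phi_nonneg[OF x] unfolding power2_eq_square by (intro mult_left_mono) auto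
  also have "... = \<bar>(phi x)\<^sup>2 - (phi y)\<^sup>2\<bar>"
   using phi_nonneg[OF y] phi_nonneg[OF x] by (simp add: power2_eq_square square_diff_square_factored abs_mult)
  also have "... = \<bar>y - x\<bar> * \<bar>y + x\<bar>" using phi_sq[OF x] phi_sq[OF y] by (simp add: abs_mult[symmetric] power2_eq_square algebra_simps)
  also have "... <= \<bar>y - x\<bar> * 2" using x y by (intro mult_left_mono) auto
  also have "... <= (2 / (real n)\<^sup>2) / 16 * 2" using c r by (auto simp: abs_minus_commute)
  also have "... = (1 / (2 * real n))\<^sup>2" by (simp add: power2_eq_square)
  finally show ?thesis by (rule power2_le_imp_le) simp
 qed
 have "\<bar>rho n x - rho n y\<bar> = \<bar>phi x - phi y\<bar> / real n" using n0 by (simp add: rho_phi diff_divide_distrib[symmetric] abs_divide)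
 also have "... <= 1 / (2 * real n) / real n" using main n0 by (intro divide_right_mono) auto
 also have "... = 1 / (real n)\<^sup>2 / 2" by (simp add: power2_eq_square)
 also have "... <= rho n x / 2" using rho_ge[OF x, of n] by simp
 finally show "rho n x / 2 <= rho n y" "rho n y <= 2 * rho n x" by linarith+
qed

section \<open>Averages of doubling weights\<close>

text \<open>Polynomial growth in \<open>tau\<close> is the property of the averages on which the
  kernel estimates rest; \<open>s\<close> and \<open>K\<close> are later shared by all
  \<open>n\<close>, which makes the resulting constants independent of \<open>n\<close>.\<close>

definition slow :: "nat \<Rightarrow> nat \<Rightarrow> real \<Rightarrow> (real \<Rightarrow> real) \<Rightarrow> bool" where
 "slow n s K v \<longleftrightarrow> v \<in> borel_measurable borel \<and> (\<forall>x\<in>{-1..1}. 0 <= v x) \<and>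
   (\<forall>x\<in>{-1..1}. \<forall>y\<in>{-1..1}. v x <= K * (1 + tau n x y) ^ s * v y)"

section \<open>Masses of intervals under a doubling weight\<close>

context
 fixes w :: "real \<Rightarrow> real" and mu :: "real \<Rightarrow> real \<Rightarrow> real"
 assumes dw: "doubling_weight w"
 defines "mu \<equiv> %a b. LINT u:{a..b}|lebesgue. w u"
begin

lemma w_integrable: "integrable lebesgue w"
proof -
 have "set_integrable lebesgue {-1..1} w" using dw by (simp add: doubling_weight_def)
 moreover have "(%x. indicator {-1..1} x *\<^sub>R w x) = w" using dw by (auto simp: doubling_weight_def fun_eq_iff indicator_def)
 ultimately show ?thesis by (simp add: set_integrable_def)
qed

lemma mu_integrable: "set_integrable lebesgue {a..b} w" unfolding set_integrable_def by (rule integrable_mult_indicator[OF _ w_integrable]) auto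

lemma mu_nonneg: "0 <= mu a b" using dw by (auto simp: mu_def doubling_weight_def set_lebesgue_integral_def intro!: integral_nonneg_AE)

lemma mu_mono: "c <= a ==> b <= d ==> mu a b <= mu c d" unfolding mu_def set_lebesgue_integral_def
 using mu_integrable[of a b] mu_integrable[of c d] dw by (intro integral_mono) (auto simp: set_integrable_def doubling_weight_def indicator_def)

lemma mu_clip: "mu a b = mu (max (-1) a) (min 1 b)"
proof -
 have "(%u. indicator {a..b} u *\<^sub>R w u) = (%u. indicator {max (-1) a..min 1 b} u *\<^sub>R w u)"
  using dw by (fastforce simp: doubling_weight_def fun_eq_iff indicator_def)
 then show ?thesis by (simp add: mu_def set_lebesgue_integral_def)
qed

text \<open>Doubling is available only for intervals inside [-1,1], so each enlarged interval is
  clipped before it is doubled again. The clipped interval still contains \<open>{a..b}\<close>,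
  hence every doubling adds at least half the original length on each side or passes the end of
  [-1,1].\<close>

lemma mu_expand:
 obtains L where "1 <= L"
  and "\<And>a b k. -1 <= a ==> a < b ==> b <= 1 ==>
   mu (a - real k * (b - a) / 2) (b + real k * (b - a) / 2) <= L ^ k * mu a b"
proof -
 from dw obtain L0 where L0: "\<And>c d. 0 < d ==> {c - d..c + d} \<subseteq> {-1..1} ==>
    mu (c - 2 * d) (c + 2 * d) <= L0 * mu (c - d) (c + d)" unfolding doubling_weight_def mu_def by blast
 define L where "L = max 1 L0"
 have L: "1 <= L" by (simp add: L_def)
 have step: "mu (a - (b - a) / 2) (b + (b - a) / 2) <= L * mu a b" if "-1 <= a" "a < b" "b <= 1" for a b
 proof -
  have e: "(a + b) / 2 - (b - a) / 2 = a" "(a + b) / 2 + (b - a) / 2 = b"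
   "(a + b) / 2 - 2 * ((b - a) / 2) = a - (b - a) / 2" "(a + b) / 2 + 2 * ((b - a) / 2) = b + (b - a) / 2" by (simp_all add: field_simps)
  have "mu (a - (b - a) / 2) (b + (b - a) / 2) <= L0 * mu a b" using L0[of "(b - a) / 2" "(a + b) / 2"] that unfolding e by simp
  also have "... <= L * mu a b" by (intro mult_right_mono mu_nonneg) (simp add: L_def)
  finally show ?thesis .
 qed
 have "mu (a - real k * (b - a) / 2) (b + real k * (b - a) / 2) <= L ^ k * mu a b"
  if ab: "-1 <= a" "a < b" "b <= 1" for a b k
 proof (induction k)
  case (Suc k)
  define a' b' where "a' = max (-1) (a - real k * (b - a) / 2)" and "b' = min 1 (b + real k * (b - a) / 2)"
  have k0: "0 <= real k * (b - a)" using ab by simp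
  have a'b': "-1 <= a'" "a' <= a" "b <= b'" "b' <= 1" using ab k0 by (auto simp: a'_def b'_def)
  have "mu (a - real (Suc k) * (b - a) / 2) (b + real (Suc k) * (b - a) / 2)
    = mu (max (-1) (a - real (Suc k) * (b - a) / 2)) (min 1 (b + real (Suc k) * (b - a) / 2))" by (rule mu_clip)
  also have "... <= mu (a' - (b' - a') / 2) (b' + (b' - a') / 2)"
  proof (rule mu_mono)
   have "real (Suc k) * (b - a) = real k * (b - a) + (b - a)" by (simp add: algebra_simps)
   with a'b' ab show "a' - (b' - a') / 2 <= max (-1) (a - real (Suc k) * (b - a) / 2)"
    and "min 1 (b + real (Suc k) * (b - a) / 2) <= b' + (b' - a') / 2" by (auto simp: a'_def b'_def max_def min_def field_simps)
  qed
  also have "... <= L * mu a' b'" using a'b' ab by (intro step) auto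
  also have "mu a' b' = mu (a - real k * (b - a) / 2) (b + real k * (b - a) / 2)" unfolding a'_def b'_def by (rule mu_clip[symmetric])
  also have "L * ... <= L * (L ^ k * mu a b)" using L Suc.IH by (intro mult_left_mono) auto
  finally show ?case by simp
 qed simp
 with L that show thesis by blast
qed

text \<open>An interval centred at \<open>y\<close> may leave [-1,1], so doubling is applied to a
  one-sided interval at \<open>y\<close> that points towards 0.\<close>

lemma mu_centered_doubling:
 obtains L where "1 <= L" and "\<And>y d. y \<in> {-1..1} ==> 0 < d ==> mu (y - 2 * d) (y + 2 * d) <= L * mu (y - d) (y + d)"
proof -
 obtain L where L: "1 <= L"
  and ex: "\<And>a b k. -1 <= a ==> a < b ==> b <= 1 ==>
   mu (a - real k * (b - a) / 2) (b + real k * (b - a) / 2) <= L ^ k * mu a b" using mu_expand by metis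
 have "mu (y - 2 * d) (y + 2 * d) <= L ^ 4 * mu (y - d) (y + d)" if y: "y \<in> {-1..1}" and d: "0 < d" for y d
 proof -
  define l where "l = min d 1"
  have l: "0 < l" "l <= 1" "l <= d" "l = d \<or> l = 1" using d by (auto simp: l_def)
  \<comment> \<open>The length \<open>l\<close> is cut at 1 so that the interval fits. Four
    expansions add \<open>2 * l\<close> on each side; for \<open>l = 1\<close> this already covers
    all of [-1,1].\<close>
  define a where "a = (if y <= 0 then y else y - l)"
  have ab: "-1 <= a" "a < a + l" "a + l <= 1" using y l by (auto simp: a_def)
  have "mu (y - 2 * d) (y + 2 * d) = mu (max (-1) (y - 2 * d)) (min 1 (y + 2 * d))" by (rule mu_clip)
  also have "... <= mu (a - real 4 * (a + l - a) / 2) (a + l + real 4 * (a + l - a) / 2)" using l y by (intro mu_mono) (auto simp: a_def)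
  also have "... <= L ^ 4 * mu a (a + l)" using ab by (intro ex) auto
  also have "... <= L ^ 4 * mu (y - d) (y + d)" using L l by (intro mult_left_mono mu_mono) (auto simp: a_def)
  finally show ?thesis .
 qed
 moreover have "1 <= L ^ 4" using L by (simp add: one_le_power)
 ultimately show thesis using that by blast
qed

text \<open>Doubling is iterated about log2(D) times. Writing the constant as at most
  \<open>2 ^ a\<close> turns the exponential \<open>L ^ k\<close> into the power
  \<open>(2 ^ k) ^ a\<close>, and the least \<open>k\<close> with \<open>D <= 2 ^ k\<close>
  satisfies \<open>2 ^ k <= 2 * D\<close>.\<close>

lemma mu_growth:
 obtains a :: nat where "\<And>y d D. y \<in> {-1..1} ==> 0 < d ==> 1 <= D ==>
   mu (y - D * d) (y + D * d) <= (2 * D) ^ a * mu (y - d) (y + d)"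
proof -
 obtain L where L: "1 <= L"
  and db: "\<And>y d. y \<in> {-1..1} ==> 0 < d ==> mu (y - 2 * d) (y + 2 * d) <= L * mu (y - d) (y + d)"
  using mu_centered_doubling by metis
 obtain a :: nat where a: "L <= 2 ^ a" using real_arch_pow[of 2 L] less_imp_le by auto
 have "mu (y - D * d) (y + D * d) <= (2 * D) ^ a * mu (y - d) (y + d)"
  if y: "y \<in> {-1..1}" and d: "0 < d" and D: "1 <= D" for y d D
 proof -
  have it: "mu (y - 2 ^ k * d) (y + 2 ^ k * d) <= L ^ k * mu (y - d) (y + d)" for k
  proof (induction k)
   case (Suc k)
   have "mu (y - 2 ^ Suc k * d) (y + 2 ^ Suc k * d) <= L * mu (y - 2 ^ k * d) (y + 2 ^ k * d)" using db[of y "2 ^ k * d"] y d by (simp add: mult.assoc)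
   also have "... <= L * (L ^ k * mu (y - d) (y + d))" using Suc L by (intro mult_left_mono) auto
   finally show ?case by (simp add: mult.assoc)
  qed simp
  define k where "k = (LEAST k. D <= 2 ^ k)"
  have ex: "\<exists>k. D <= 2 ^ k" using real_arch_pow[of 2 D] less_imp_le by auto
  have k: "D <= 2 ^ k" unfolding k_def by (rule LeastI_ex[OF ex])
  have k2: "2 ^ k <= 2 * D"
  proof (cases k)
   case 0 then show ?thesis using D by simp
  next
   case (Suc j)
   then have "\<not> D <= 2 ^ j" using not_less_Least[of j "%k. D <= 2 ^ k"] by (simp add: k_def)
   then show ?thesis by (simp add: Suc)
  qed
  have "mu (y - D * d) (y + D * d) <= mu (y - 2 ^ k * d) (y + 2 ^ k * d)" using k d by (intro mu_mono) auto
  also have "... <= L ^ k * mu (y - d) (y + d)" by (rule it)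
  also have "L ^ k <= (2 ^ a) ^ k" using a L by (intro power_mono) auto
  also have "(2 ^ a) ^ k = ((2::real) ^ k) ^ a" by (simp add: power_mult[symmetric] mult.commute)
  also have "... <= (2 * D) ^ a" using k2 by (intro power_mono) auto
  finally show ?thesis by (simp add: mu_nonneg mult_right_mono)
 qed
 then show thesis using that by blast
qed

lemma weight_avg_mu: "weight_avg w n x = mu (x - rho n x) (x + rho n x) / rho n x" by (simp add: weight_avg_def mu_def)

lemma weight_avg_nonneg: "1 <= n ==> x \<in> {-1..1} ==> 0 <= weight_avg w n x"
 unfolding weight_avg_mu using rho_pos[of n x] mu_nonneg by (intro divide_nonneg_pos) auto

text \<open>The averaging interval at \<open>x\<close> lies in the one at \<open>y\<close> dilated
  by \<open>(1 + tau n x y)^2\<close>, so the mass grows by the power 2a; one further power pays for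
  exchanging the normalisation \<open>1 / rho n x\<close> for \<open>1 / rho n y\<close>.\<close>

lemma weight_avg_growth:
 obtains s K where "0 <= K" and "\<And>n x y. 1 <= n ==> x \<in> {-1..1} ==> y \<in> {-1..1} ==>
  weight_avg w n x <= K * (1 + tau n x y) ^ s * weight_avg w n y"
proof -
 from mu_growth obtain a where gr: "\<And>y d D. y \<in> {-1..1} ==> 0 < d ==> 1 <= D ==>
   mu (y - D * d) (y + D * d) <= (2 * D) ^ a * mu (y - d) (y + d)" by metis
 have "weight_avg w n x <= 2 ^ a * (1 + tau n x y) ^ (2 * a + 1) * weight_avg w n y"
  if n: "1 <= n" and x: "x \<in> {-1..1}" and y: "y \<in> {-1..1}" for n x y
 proof -
  define t where "t = tau n x y"
  have t: "0 <= t" by (simp add: t_def)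
  define D where "D = (1 + t)\<^sup>2"
  have D: "1 <= D" using t by (simp add: D_def power2_eq_square algebra_simps)
  note rx = rho_pos[OF n x] and ry = rho_pos[OF n y]
  have "\<bar>x - y\<bar> + rho n x <= rho n y * (t + t\<^sup>2) + (1 + t) * rho n y" using abs_diff_le_tau[OF n x y] rho_ratio[OF n x y] by (simp add: t_def)
  also have "... = D * rho n y" by (simp add: D_def power2_eq_square algebra_simps)
  finally have dist: "\<bar>x - y\<bar> + rho n x <= D * rho n y" .
  have "mu (x - rho n x) (x + rho n x) <= mu (y - D * rho n y) (y + D * rho n y)" using dist by (intro mu_mono) linarith+
  also have "... <= (2 * D) ^ a * mu (y - rho n y) (y + rho n y)" using y ry D by (intro gr) auto
  also have "mu (y - rho n y) (y + rho n y) = rho n y * weight_avg w n y" using ry by (simp add: weight_avg_mu)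
  finally have "mu (x - rho n x) (x + rho n x) <= (2 * D) ^ a * weight_avg w n y * rho n y" by (simp add: ac_simps)
  also have "... <= (2 * D) ^ a * weight_avg w n y * ((1 + t) * rho n x)" using rho_ratio[OF n y x] D weight_avg_nonneg[OF n y]
   by (intro mult_left_mono) (auto simp: t_def tau_commute)
  also have "... = (2 ^ a * (1 + t) ^ (2 * a + 1) * weight_avg w n y) * rho n x" by (simp add: D_def power_mult_distrib power_mult[symmetric] ac_simps)
  finally show ?thesis using rx by (simp add: weight_avg_mu[of n x] t_def pos_divide_le_eq)
 qed
 with that[of "2 ^ a" "2 * a + 1"] show thesis by simp
qed

text \<open>The weight is only Lebesgue measurable, but its distribution function is monotone, hence
  Borel, and the mass of an interval is a difference of two of its values.\<close>

lemma weight_avg_borel: "weight_avg w n \<in> borel_measurable borel"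
proof -
 define Phi where "Phi = (%y. LINT u:{..y}|lebesgue. w u)"
 have int: "set_integrable lebesgue A w" if "A \<in> sets lebesgue" for A unfolding set_integrable_def by (rule integrable_mult_indicator[OF that w_integrable])
 have "mono Phi" unfolding Phi_def set_lebesgue_integral_def using dw int[of "{.._}"]
  by (intro monoI integral_mono) (auto simp: set_integrable_def doubling_weight_def indicator_def)
 then have P[measurable]: "Phi \<in> borel_measurable borel" by (rule borel_measurable_mono)
 have mu: "mu a b = (if a <= b then Phi b - Phi a else 0)" for a b
 proof (cases "a <= b")
  case True
  have neg: "negligible {a}" by simp
  have "Phi b = (LINT u:{..<a} \<union> {a..b}|lebesgue. w u)"
   unfolding Phi_def using True by (intro arg_cong2[where f = "%A f. set_lebesgue_integral lebesgue A f"]) auto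
  also have "... = (LINT u:{..<a}|lebesgue. w u) + mu a b" unfolding mu_def by (intro set_integral_Un int) auto
  also have "(LINT u:{..<a}|lebesgue. w u) = Phi a" unfolding Phi_def set_lebesgue_integral_def
  proof (rule integral_cong_AE)
   have "AE u in lebesgue. u \<noteq> a" by (simp add: AE_lborel_singleton AE_completion)
   then show "AE u in lebesgue. indicator {..<a} u *\<^sub>R w u = indicator {..a} u *\<^sub>R w u" by eventually_elim (auto simp: indicator_def)
  qed (use int[of "{..<a}"] int[of "{..a}"] in \<open>auto simp: set_integrable_def\<close>)
  finally show ?thesis using True by simp
 next
  case False
  then show ?thesis by (simp add: mu_def set_lebesgue_integral_def)
 qed
 have "rho n \<in> borel_measurable borel" unfolding rho_def by measurable
 then show ?thesis unfolding weight_avg_mu mu by measurable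
qed

text \<open>For \<open>n\<close> between \<open>m\<close> and \<open>2 * m\<close> the interval at
  scale \<open>n\<close> lies inside the one at scale \<open>m\<close> and is at most four times
  shorter. This serves the passage from a power of two to the next one and to an intermediate
  \<open>n\<close>.\<close>

lemma weight_avg_le_4:
 assumes m: "1 <= m" and mn: "m <= n" "n <= 2 * m" and x: "x \<in> {-1..1}"
 shows "weight_avg w n x <= 4 * weight_avg w m x"
proof -
 have n: "1 <= n" using m mn by simp
 note rm = rho_pos[OF m x] and rn = rho_pos[OF n x]
 have p: "0 <= phi x" using phi_nonneg[OF x] .
 have 1: "rho n x <= rho m x" unfolding rho_phi using m mn p by (intro add_mono divide_left_mono power_mono) (auto intro!: mult_pos_pos)
 have 2: "rho m x <= 4 * rho n x"
 proof -
  have "phi x / real m <= 4 * (phi x / real n)"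
  proof -
   have "phi x * real n <= phi x * (4 * real m)" using mn p by (intro mult_left_mono) auto
   then show ?thesis using m n by (simp add: field_simps)
  qed
  moreover have "1 / (real m)\<^sup>2 <= 4 * (1 / (real n)\<^sup>2)"
  proof -
   have "(real n)\<^sup>2 <= (2 * real m)\<^sup>2" using mn by (intro power_mono) auto
   then show ?thesis using m n by (simp add: field_simps)
  qed
  ultimately show ?thesis by (simp add: rho_phi)
 qed
 have "mu (x - rho n x) (x + rho n x) <= mu (x - rho m x) (x + rho m x)" using 1 by (intro mu_mono) auto
 also have "... = weight_avg w m x * rho m x" using rm by (simp add: weight_avg_mu)
 also have "... <= weight_avg w m x * (4 * rho n x)" using 2 weight_avg_nonneg[OF m x] by (intro mult_left_mono) auto
 finally show ?thesis using rn by (simp add: weight_avg_mu[of n] pos_divide_le_eq ac_simps)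
qed

end

lemma doubling_imp_slow:
 assumes "doubling_weight w"
 obtains s K where "0 <= K" and "\<And>n. 1 <= n ==> slow n s K (weight_avg w n)"
 using weight_avg_growth[OF assms] weight_avg_borel[OF assms] weight_avg_nonneg[OF assms] unfolding slow_def by metis

section \<open>Weighted norm bounds\<close>

text \<open>For \<open>B\<close> nonnegative, \<open>lpb M p v g B\<close> says that \<open>g\<close> has weighted norm at most \<open>B\<close>.\<close>

definition lpb :: "'a measure \<Rightarrow> ereal \<Rightarrow> ('a \<Rightarrow> real) \<Rightarrow> ('a \<Rightarrow> real) \<Rightarrow> real \<Rightarrow> bool" where
 "lpb M p v g B \<longleftrightarrow>
   (if p = \<infinity> then AE x in M. \<bar>g x\<bar> * v x <= B
   else (\<integral>\<^sup>+x. ennreal (\<bar>g x\<bar> powr real_of_ereal p * v x) \<partial>M) <= ennreal (B powr real_of_ereal p))"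

text \<open>The convex function t^q lies above its tangent at \<open>c\<close>; the inequality is
  arranged without subtraction so that it can be integrated when the integrals may be
  infinite.\<close>

lemma powr_tangent:
 fixes q c t :: real
 assumes q: "1 <= q" and c: "0 < c" and t: "0 <= t"
 shows "q * c powr (q - 1) * t <= t powr q + (q - 1) * c powr q"
proof (cases "t = 0")
 case True then show ?thesis using q c by simp
next
 case False
 with t have t: "0 < t" by simp
 have cq: "c powr (q - 1) * c = c powr q" using c by (simp add: powr_mult_base mult.commute)
 have "t powr q - c powr q \<ge> q * c powr (q - 1) * (t - c)" by (rule convex_on_imp_above_tangent[OF powr_convex[OF q]])
    (use c t in \<open>auto intro!: derivative_eq_intros simp: interior_open\<close>)
 moreover have "q * c powr (q - 1) * c = q * c powr q" using cq by (simp add: mult.assoc)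
 ultimately show ?thesis unfolding right_diff_distrib left_diff_distrib mult_1 by linarith
qed

text \<open>The tangent inequality is integrated against the kernel \<open>k\<close>. Since just an
  upper bound \<open>A\<close> of the total mass is given, the tangent point is chosen as
  \<open>F / A\<close> and not as the true mean; this choice balances both sides exactly.\<close>

lemma nn_integral_jensen_powr:
 fixes g k :: "'a \<Rightarrow> real"
 assumes q: "1 <= q" and [measurable]: "g \<in> borel_measurable N" "k \<in> borel_measurable N"
  and g: "\<And>x. x \<in> space N ==> 0 <= g x" and k: "\<And>x. x \<in> space N ==> 0 <= k x"
  and A: "0 < A" "(\<integral>\<^sup>+x. ennreal (k x) \<partial>N) <= ennreal A"
  and F: "0 <= F" "ennreal F <= (\<integral>\<^sup>+x. ennreal (g x * k x) \<partial>N)"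
 shows "ennreal (F powr q) <= ennreal (A powr (q - 1)) * (\<integral>\<^sup>+x. ennreal (g x powr q * k x) \<partial>N)"
proof (cases "F = 0")
 case True then show ?thesis using q by simp
next
 case False
 with F have F0: "0 < F" by simp
 define c where "c = F / A"
 have c: "0 < c" using F0 A by (simp add: c_def)
 define I where "I = (\<integral>\<^sup>+x. ennreal (g x powr q * k x) \<partial>N)"
 have "ennreal (q * c powr (q - 1) * F) = ennreal (q * c powr (q - 1)) * ennreal F" using q F by (simp add: ennreal_mult')
 also have "... <= ennreal (q * c powr (q - 1)) * (\<integral>\<^sup>+x. ennreal (g x * k x) \<partial>N)" using F by (intro mult_left_mono) auto
 also have "... = (\<integral>\<^sup>+x. ennreal (q * c powr (q - 1)) * ennreal (g x * k x) \<partial>N)" by (intro nn_integral_cmult[symmetric]) measurable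
 also have "... <= (\<integral>\<^sup>+x. ennreal (g x powr q * k x) + ennreal ((q - 1) * c powr q) * ennreal (k x) \<partial>N)"
 proof (intro nn_integral_mono)
  fix x assume x: "x \<in> space N"
  have "q * c powr (q - 1) * g x * k x <= (g x powr q + (q - 1) * c powr q) * k x" using powr_tangent[OF q c g[OF x]] k[OF x] by (rule mult_right_mono)
  then have "ennreal (q * c powr (q - 1) * (g x * k x)) <= ennreal (g x powr q * k x + (q - 1) * c powr q * k x)" by (intro ennreal_leI) (simp add: algebra_simps)
  then show "ennreal (q * c powr (q - 1)) * ennreal (g x * k x)
    <= ennreal (g x powr q * k x) + ennreal ((q - 1) * c powr q) * ennreal (k x)" using q g[OF x] k[OF x] by (simp add: ennreal_mult' ennreal_plus)
 qed
 also have "... = I + ennreal ((q - 1) * c powr q) * (\<integral>\<^sup>+x. ennreal (k x) \<partial>N)"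
  unfolding I_def by (subst nn_integral_add) (auto simp: nn_integral_cmult)
 also have "... <= I + ennreal ((q - 1) * c powr q) * ennreal A" using A by (intro add_left_mono mult_left_mono) auto
 finally have main: "ennreal (q * c powr (q - 1) * F) <= I + ennreal ((q - 1) * c powr q * A)" using q A by (simp add: ennreal_mult')
 show ?thesis unfolding I_def[symmetric]
 proof (cases I)
  case (real i)
  have cq: "c powr (q - 1) * F = c powr q * A" using c A F0 by (simp add: c_def powr_diff)
  have "q * c powr (q - 1) * F <= i + (q - 1) * c powr q * A" using main real q A by (simp flip: ennreal_plus add: ennreal_le_iff2)
     (smt (verit) mult_nonneg_nonneg powr_ge_zero)
  moreover have "q * c powr (q - 1) * F = q * (c powr q * A)" using cq by (simp add: mult.assoc)
  ultimately have "c powr q * A <= i" by (simp add: left_diff_distrib)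
  then have "A powr (q - 1) * (c powr q * A) <= A powr (q - 1) * i" by (intro mult_left_mono) auto
  moreover have "A powr (q - 1) * (c powr q * A) = F powr q" using A F0 by (simp add: c_def powr_divide powr_diff)
  ultimately show "ennreal (F powr q) <= ennreal (A powr (q - 1)) * I" using real by (simp add: ennreal_mult'[symmetric])
 next
  case top
  then show "ennreal (F powr q) <= ennreal (A powr (q - 1)) * I" using A by (simp add: ennreal_mult_top)
 qed
qed

lemma real_of_ereal_ge_1: "1 <= p ==> p \<noteq> \<infinity> ==> 1 <= real_of_ereal p" by (cases p) (auto simp: one_ereal_def)

lemma lpb_mono_AE:
 assumes "lpb M p v g B" and "0 <= B" "B <= B'" "1 <= p"
  and "AE x in M. \<bar>f x\<bar> <= \<bar>g x\<bar>" and "AE x in M. 0 <= v x"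
 shows "lpb M p v f B'"
proof (cases "p = \<infinity>")
 case True
 have "AE x in M. \<bar>g x\<bar> * v x <= B" using assms(1) True by (simp add: lpb_def)
 with assms(5,6) have "AE x in M. \<bar>f x\<bar> * v x <= B'"
 proof eventually_elim
  case (elim x)
  then have "\<bar>f x\<bar> * v x <= \<bar>g x\<bar> * v x" by (intro mult_right_mono) auto
  with elim assms(3) show ?case by linarith
 qed
 then show ?thesis using True by (simp add: lpb_def)
next
 case False
 define q where "q = real_of_ereal p"
 have q: "1 <= q" using real_of_ereal_ge_1[OF assms(4) False] by (simp add: q_def)
 have "(\<integral>\<^sup>+x. ennreal (\<bar>f x\<bar> powr q * v x) \<partial>M) <= (\<integral>\<^sup>+x. ennreal (\<bar>g x\<bar> powr q * v x) \<partial>M)"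
  using assms(5,6) q by (intro nn_integral_mono_AE) (auto elim!: eventually_elim2 intro!: ennreal_leI mult_right_mono powr_mono2)
 also have "... <= ennreal (B powr q)" using assms(1) False by (simp add: lpb_def q_def)
 also have "... <= ennreal (B' powr q)" using assms(2,3) q by (intro ennreal_leI powr_mono2) auto
 finally show ?thesis using False by (simp add: lpb_def q_def)
qed

lemma lpb_cmult:
 assumes "lpb M p v g B" and "0 <= c" "0 <= B" and "1 <= p"
  and [measurable]: "g \<in> borel_measurable M" "v \<in> borel_measurable M"
 shows "lpb M p v (%x. c * g x) (c * B)"
proof (cases "p = \<infinity>")
 case True
 have "AE x in M. \<bar>g x\<bar> * v x <= B" using assms(1) True by (simp add: lpb_def)
 then have "AE x in M. \<bar>c * g x\<bar> * v x <= c * B"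
 proof eventually_elim
  case (elim x)
  then have "c * (\<bar>g x\<bar> * v x) <= c * B" using assms(2) by (intro mult_left_mono) auto
  then show ?case using assms(2) by (simp add: abs_mult mult.assoc)
 qed
 then show ?thesis using True by (simp add: lpb_def)
next
 case False
 define q where "q = real_of_ereal p"
 have "(\<integral>\<^sup>+x. ennreal (\<bar>c * g x\<bar> powr q * v x) \<partial>M) = (\<integral>\<^sup>+x. ennreal (c powr q) * ennreal (\<bar>g x\<bar> powr q * v x) \<partial>M)"
  using assms(2) by (intro nn_integral_cong) (simp add: abs_mult powr_mult ennreal_mult'[symmetric] mult.assoc)
 also have "... = ennreal (c powr q) * (\<integral>\<^sup>+x. ennreal (\<bar>g x\<bar> powr q * v x) \<partial>M)" by (intro nn_integral_cmult) measurable
 also have "... <= ennreal (c powr q) * ennreal (B powr q)" using assms(1) False by (intro mult_left_mono) (auto simp: lpb_def q_def)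
 also have "... = ennreal ((c * B) powr q)" using assms by (simp add: powr_mult ennreal_mult'[symmetric])
 finally show ?thesis using False by (simp add: lpb_def q_def)
qed

text \<open>The bound \<open>lpb M p v g B\<close> means that \<open>lpi p B \<bar>g x\<bar> (v x)\<close> has integral at most 1, also for \<open>p = \<infinity>\<close>.\<close>

definition lpi :: "ereal \<Rightarrow> real \<Rightarrow> real \<Rightarrow> real \<Rightarrow> ennreal" where
 "lpi p B t w = (if p = \<infinity> then if B < t * w then \<infinity> else 0 else ennreal ((t / B) powr real_of_ereal p * w))"

lemma lpi_measurable [measurable (raw)]:
 assumes [measurable]: "f \<in> borel_measurable M" "g \<in> borel_measurable M"
 shows "(%x. lpi p B (f x) (g x)) \<in> borel_measurable M" unfolding lpi_def by measurable

lemma lpi_0 [simp]: "0 <= B ==> lpi p B 0 w = 0" by (simp add: lpi_def)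

text \<open>A pointwise majorant of integral at most 1 suffices. For \<open>p = \<infinity>\<close>
  it is finite almost everywhere, and \<open>lpi\<close>, which then takes only the values 0 and
  \<infinity>, must be 0 there.\<close>

lemma lpbI:
 assumes p: "1 <= p" and B: "0 < B" and H: "H \<in> borel_measurable M" "(\<integral>\<^sup>+x. H x \<partial>M) <= 1"
  and le: "\<And>x. x \<in> space M ==> lpi p B \<bar>f x\<bar> (v x) <= H x"
 shows "lpb M p v f B"
proof (cases "p = \<infinity>")
 case True
 have "AE x in M. H x \<noteq> \<infinity>" using H by (intro nn_integral_noteq_infinite) (auto simp: top_unique)
 then have "AE x in M. \<bar>f x\<bar> * v x <= B"
  using AE_space by eventually_elim (use le True in \<open>force simp: lpi_def top_unique split: if_splits\<close>)
 then show ?thesis using True by (simp add: lpb_def)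
next
 case False
 define q where "q = real_of_ereal p"
 have "(\<integral>\<^sup>+x. ennreal (\<bar>f x\<bar> powr q * v x) \<partial>M) <= (\<integral>\<^sup>+x. ennreal (B powr q) * H x \<partial>M)"
 proof (rule nn_integral_mono)
  fix x assume "x \<in> space M"
  have "ennreal (\<bar>f x\<bar> powr q * v x) = ennreal (B powr q) * lpi p B \<bar>f x\<bar> (v x)"
   using False B by (simp add: lpi_def q_def ennreal_mult'[symmetric] powr_divide)
  also have "... <= ennreal (B powr q) * H x" using le[OF \<open>x \<in> space M\<close>] by (rule mult_left_mono) simp
  finally show "ennreal (\<bar>f x\<bar> powr q * v x) <= ennreal (B powr q) * H x" .
 qed
 also have "... = ennreal (B powr q) * (\<integral>\<^sup>+x. H x \<partial>M)" by (rule nn_integral_cmult[OF H(1)])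
 also have "... <= ennreal (B powr q) * 1" using H(2) by (rule mult_left_mono) simp
 finally show ?thesis using False by (simp add: lpb_def q_def)
qed

lemma lpbD:
 assumes p: "1 <= p" and B: "0 < B" and l: "lpb M p v g B"
  and [measurable]: "g \<in> borel_measurable M" "v \<in> borel_measurable M"
 shows "(\<integral>\<^sup>+x. lpi p B \<bar>g x\<bar> (v x) \<partial>M) <= 1"
proof (cases "p = \<infinity>")
 case True
 then have "AE x in M. \<bar>g x\<bar> * v x <= B" using l by (simp add: lpb_def)
 then have "AE x in M. lpi p B \<bar>g x\<bar> (v x) = 0" by eventually_elim (use True in \<open>simp add: lpi_def\<close>)
 then have "(\<integral>\<^sup>+x. lpi p B \<bar>g x\<bar> (v x) \<partial>M) = (\<integral>\<^sup>+x. 0 \<partial>M)" by (rule nn_integral_cong_AE)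
 then show ?thesis by simp
next
 case False
 define q where "q = real_of_ereal p"
 have "(\<integral>\<^sup>+x. lpi p B \<bar>g x\<bar> (v x) \<partial>M) = (\<integral>\<^sup>+x. ennreal (1 / B powr q) * ennreal (\<bar>g x\<bar> powr q * v x) \<partial>M)"
  using False B by (intro nn_integral_cong) (simp add: lpi_def q_def powr_divide ennreal_mult'[symmetric])
 also have "... = ennreal (1 / B powr q) * (\<integral>\<^sup>+x. ennreal (\<bar>g x\<bar> powr q * v x) \<partial>M)" by (rule nn_integral_cmult) measurable
 also have "... <= ennreal (1 / B powr q) * ennreal (B powr q)" using l False by (intro mult_left_mono) (auto simp: lpb_def q_def)
 also have "... = 1" using B by (simp add: ennreal_mult'[symmetric])
 finally show ?thesis .
qed

text \<open>A change of weight by a factor \<open>K\<close> is charged with \<open>K\<close> instead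
  of \<open>K\<close> to the power 1/p, which is valid for all \<open>p\<close> at once because (c
  K)^q \<ge> c K. The spare factor \<open>c\<close> in the bound buys \<open>1 / c\<close> in the
  integral.\<close>

lemma lpi_scale:
 assumes p: "1 <= p" and B: "0 < B" and c: "1 <= c" and K: "1 <= K" and t: "0 <= t" and v: "v <= K * u" and u: "0 <= u"
 shows "lpi p (c * K * B) t v <= ennreal (1 / c) * lpi p B t u"
proof (cases "p = \<infinity>")
 case True
 have "B < t * u" if "c * K * B < t * v"
 proof -
  have "1 * (K * B) <= c * (K * B)" using c K B by (intro mult_right_mono) auto
  then have "K * B < t * v" using that by (simp add: mult.assoc)
  also have "t * v <= t * (K * u)" using v t by (rule mult_left_mono)
  finally have "K * B < K * (t * u)" by (simp add: ac_simps)
  then show ?thesis using K by simp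
 qed
 then show ?thesis using True c by (simp add: lpi_def ennreal_mult_top)
next
 case False
 define q where "q = real_of_ereal p"
 have q: "1 <= q" using real_of_ereal_ge_1[OF p False] by (simp add: q_def)
 have cK: "1 * 1 <= c * K" using c K by (intro mult_mono) auto
 then have "(c * K) powr 1 <= (c * K) powr q" using q by (intro powr_mono) auto
 then have "(t / B) powr q / (c * K) powr q <= (t / B) powr q / (c * K)" using cK c K by (intro divide_left_mono) auto
 then have "(t / B) powr q / (c * K) powr q * v <= (t / B) powr q / (c * K) * (K * u)"
  using v K u cK by (intro order_trans[OF mult_left_mono mult_right_mono]) auto
 moreover have "(t / (c * K * B)) powr q = (t / B) powr q / (c * K) powr q" using t B c K by (simp add: powr_divide powr_mult)
 ultimately have "(t / (c * K * B)) powr q * v <= 1 / c * ((t / B) powr q * u)" using K c by simp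
 then show ?thesis using False c by (simp add: lpi_def q_def ennreal_mult'[symmetric] ennreal_leI)
qed

text \<open>The condition on \<open>k\<close> and \<open>k'\<close> lets the kernel absorb the change of the weight from \<open>v\<close> to \<open>u\<close>.\<close>

lemma lpi_jensen:
 assumes p: "1 <= p" and B: "0 < B" and [measurable]: "g \<in> borel_measurable N" "u \<in> borel_measurable N"
   "k \<in> borel_measurable N" "k' \<in> borel_measurable N"
  and g: "\<And>y. y \<in> space N ==> 0 <= g y" and k: "\<And>y. y \<in> space N ==> 0 <= k y" and k': "\<And>y. y \<in> space N ==> 0 <= k' y"
  and v: "0 <= v" and kk': "\<And>y. y \<in> space N ==> v * k y <= u y * k' y"
  and A: "0 < A" "(\<integral>\<^sup>+y. ennreal (k y) \<partial>N) <= ennreal A" "(\<integral>\<^sup>+y. ennreal (k' y) \<partial>N) <= ennreal A"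
  and F: "0 <= F" "ennreal F <= (\<integral>\<^sup>+y. ennreal (g y * k y) \<partial>N)"
 shows "lpi p (A * B) F v <= ennreal (1 / A) * (\<integral>\<^sup>+y. lpi p B (g y) (u y) * ennreal (k' y) \<partial>N)"
proof (cases "p = \<infinity>")
 case True
 show ?thesis
 proof (cases "(\<integral>\<^sup>+y. lpi p B (g y) (u y) * ennreal (k' y) \<partial>N) = \<infinity>")
  case False
  \<comment> \<open>Finiteness of the integral forces \<open>lpi\<close>, which is 0 or \<infinity>
    here, to vanish wherever \<open>k' y\<close> is positive; at such \<open>y\<close> the bound
    \<open>g y * u y <= B\<close> holds.\<close>
  then have "AE y in N. lpi p B (g y) (u y) * ennreal (k' y) \<noteq> \<infinity>" by (intro nn_integral_noteq_infinite) measurable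
  then have ae: "AE y in N. ennreal (g y * k y) * ennreal v <= ennreal B * ennreal (k' y)" using AE_space
  proof eventually_elim
   case (elim y)
   note y = elim(2)
   have "k' y = 0 \<or> g y * u y <= B" using elim k'[OF y] True by (auto simp: lpi_def ennreal_top_mult split: if_splits)
   then have "(g y * u y) * k' y <= B * k' y" using k'[OF y] by (auto intro: mult_right_mono)
   moreover have "g y * (v * k y) <= g y * (u y * k' y)" using kk'[OF y] g[OF y] by (rule mult_left_mono)
   ultimately have "g y * k y * v <= B * k' y" by (simp add: ac_simps)
   then show ?case using v B by (simp add: ennreal_mult'[symmetric] ennreal_mult''[symmetric] ennreal_leI)
  qed
  have "ennreal (F * v) = ennreal F * ennreal v" using v F by (simp add: ennreal_mult)
  also have "... <= (\<integral>\<^sup>+y. ennreal (g y * k y) \<partial>N) * ennreal v" using F(2) by (rule mult_right_mono) simp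
  also have "... = (\<integral>\<^sup>+y. ennreal (g y * k y) * ennreal v \<partial>N)" by (rule nn_integral_multc[symmetric]) measurable
  also have "... <= (\<integral>\<^sup>+y. ennreal B * ennreal (k' y) \<partial>N)" by (rule nn_integral_mono_AE[OF ae])
  also have "... = ennreal B * (\<integral>\<^sup>+y. ennreal (k' y) \<partial>N)" by (rule nn_integral_cmult) measurable
  also have "... <= ennreal B * ennreal A" using A(3) by (rule mult_left_mono) simp
  also have "... = ennreal (A * B)" using A B by (simp add: ennreal_mult'[symmetric] mult.commute)
  finally have "F * v <= A * B" using A B by simp
  then show ?thesis using True by (simp add: lpi_def)
 qed (use A in \<open>simp add: ennreal_mult_top\<close>)
next
 case False
 define q where "q = real_of_ereal p"
 have q: "1 <= q" using real_of_ereal_ge_1[OF p False] by (simp add: q_def)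
 define I where "I = (\<integral>\<^sup>+y. ennreal ((g y / B) powr q * k y) \<partial>N)"
 have "ennreal (1 / B) * ennreal F <= ennreal (1 / B) * (\<integral>\<^sup>+y. ennreal (g y * k y) \<partial>N)" using F(2) by (rule mult_left_mono) simp
 also have "... = (\<integral>\<^sup>+y. ennreal (1 / B) * ennreal (g y * k y) \<partial>N)" by (rule nn_integral_cmult[symmetric]) measurable
 also have "... = (\<integral>\<^sup>+y. ennreal (g y / B * k y) \<partial>N)" using B by (simp add: ennreal_mult'[symmetric])
 finally have "ennreal (F / B) <= (\<integral>\<^sup>+y. ennreal (g y / B * k y) \<partial>N)" using B by (simp add: ennreal_mult'[symmetric])
 then have "ennreal ((F / B) powr q) <= ennreal (A powr (q - 1)) * I" unfolding I_def using g k A F B by (intro nn_integral_jensen_powr[OF q]) auto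
 then have "ennreal (v / A powr q) * ennreal ((F / B) powr q) <= ennreal (v / A powr q) * (ennreal (A powr (q - 1)) * I)" by (rule mult_left_mono) simp
 also have "... = ennreal (1 / A) * (ennreal v * I)" using A v by (simp add: mult.assoc[symmetric] ennreal_mult'[symmetric] powr_diff)
 also have "ennreal v * I = (\<integral>\<^sup>+y. ennreal v * ennreal ((g y / B) powr q * k y) \<partial>N)"
  unfolding I_def by (rule nn_integral_cmult[symmetric]) measurable
 also have "... <= (\<integral>\<^sup>+y. lpi p B (g y) (u y) * ennreal (k' y) \<partial>N)"
 proof (rule nn_integral_mono)
  fix y assume y: "y \<in> space N"
  have "(g y / B) powr q * (v * k y) <= (g y / B) powr q * (u y * k' y)" using kk'[OF y] by (rule mult_left_mono) simp
  then show "ennreal v * ennreal ((g y / B) powr q * k y) <= lpi p B (g y) (u y) * ennreal (k' y)"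
   using False k'[OF y] v by (simp add: lpi_def q_def ennreal_mult'[symmetric] ennreal_mult''[symmetric] ennreal_leI ac_simps)
 qed
 finally have "ennreal (v / A powr q) * ennreal ((F / B) powr q) <= ennreal (1 / A) * (\<integral>\<^sup>+y. lpi p B (g y) (u y) * ennreal (k' y) \<partial>N)"
  by (simp add: mult_left_mono)
 moreover have "ennreal (v / A powr q) * ennreal ((F / B) powr q) = lpi p (A * B) F v"
  using False A B F v by (simp add: lpi_def q_def ennreal_mult'[symmetric] powr_divide powr_mult ac_simps)
 ultimately show ?thesis by simp
qed

text \<open>Minkowski's inequality, seen as Jensen's inequality for the counting measure with masses
  \<open>b i\<close>: the sum of the \<open>\<bar>g i x\<bar>\<close> is the sum of the quotients
  \<open>\<bar>g i x\<bar> / b i\<close> against these masses.\<close>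

lemma lpb_sum:
 fixes g :: "'i \<Rightarrow> 'a \<Rightarrow> real"
 assumes I: "finite I" "I \<noteq> {}" and p: "1 <= p"
  and b: "\<And>i. i \<in> I ==> 0 < b i" and le: "\<And>i. i \<in> I ==> lpb M p v (g i) (b i)"
  and g[measurable]: "\<And>i. i \<in> I ==> g i \<in> borel_measurable M" and [measurable]: "v \<in> borel_measurable M"
  and v: "\<And>x. x \<in> space M ==> 0 <= v x"
 shows "lpb M p v (%x. \<Sum>i\<in>I. \<bar>g i x\<bar>) (sum b I)"
proof -
 define S where "S = sum b I"
 have S: "0 < S" using I b by (simp add: S_def sum_pos)
 define H where "H x = ennreal (1 / S) * (\<Sum>i\<in>I. lpi p (b i) \<bar>g i x\<bar> (v x) * ennreal (b i))" for x
 have sb: "(\<Sum>i\<in>I. ennreal (b i)) = ennreal S" using b by (simp add: S_def sum_ennreal less_imp_le)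
 have "lpb M p v (%x. \<Sum>i\<in>I. \<bar>g i x\<bar>) S"
 proof (rule lpbI[OF p S])
  show "H \<in> borel_measurable M" unfolding H_def[abs_def] by measurable
  have "(\<integral>\<^sup>+x. H x \<partial>M) = ennreal (1 / S) * (\<Sum>i\<in>I. (\<integral>\<^sup>+x. lpi p (b i) \<bar>g i x\<bar> (v x) \<partial>M) * ennreal (b i))"
   unfolding H_def by (subst nn_integral_cmult) (auto simp: nn_integral_sum nn_integral_multc)
  also have "... <= ennreal (1 / S) * (\<Sum>i\<in>I. 1 * ennreal (b i))" using b le by (intro mult_left_mono sum_mono mult_right_mono lpbD p) auto
  also have "... = 1" using S by (simp add: sb ennreal_mult'[symmetric])
  finally show "(\<integral>\<^sup>+x. H x \<partial>M) <= 1" .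
  fix x assume x: "x \<in> space M"
  have 1: "lpi p 1 (\<bar>g i x\<bar> / b i) (v x) = lpi p (b i) \<bar>g i x\<bar> (v x)" if "i \<in> I" for i using b[OF that] by (simp add: lpi_def)
  have "lpi p (S * 1) (\<Sum>i\<in>I. \<bar>g i x\<bar>) (v x) <= ennreal (1 / S) * (\<integral>\<^sup>+i. lpi p 1 (\<bar>g i x\<bar> / b i) (v x) * ennreal (b i) \<partial>count_space I)"
  proof (rule lpi_jensen[OF p, where k = b])
   show "(\<integral>\<^sup>+i. ennreal (b i) \<partial>count_space I) <= ennreal S" "(\<integral>\<^sup>+i. ennreal (b i) \<partial>count_space I) <= ennreal S"
    using I by (simp_all add: nn_integral_count_space_finite sb)
   have "(\<integral>\<^sup>+i. ennreal (\<bar>g i x\<bar> / b i * b i) \<partial>count_space I) = (\<Sum>i\<in>I. eabs (g i x))"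
    using I b by (simp add: nn_integral_count_space_finite)
     (intro arg_cong[where f = ennreal] sum.cong refl, auto dest!: b)
   then show "ennreal (\<Sum>i\<in>I. \<bar>g i x\<bar>) <= (\<integral>\<^sup>+i. ennreal (\<bar>g i x\<bar> / b i * b i) \<partial>count_space I)"
    by (simp add: sum_ennreal)
  qed (use b S v[OF x] in \<open>auto intro!: sum_nonneg simp: less_imp_le\<close>)
  then show "lpi p S \<bar>\<Sum>i\<in>I. \<bar>g i x\<bar>\<bar> (v x) <= H x" using I 1 by (simp add: H_def nn_integral_count_space_finite sum_nonneg)
 qed
 then show ?thesis unfolding S_def .
qed

lemma lpb_add:
 assumes "1 <= p" "0 < a" "0 < b" "lpb M p v f a" "lpb M p v g b"
  and [measurable]: "f \<in> borel_measurable M" "g \<in> borel_measurable M" "v \<in> borel_measurable M"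
  and v: "\<And>x. x \<in> space M ==> 0 <= v x"
 shows "lpb M p v (%x. \<bar>f x\<bar> + \<bar>g x\<bar>) (a + b)"
proof -
 have "lpb M p v (%x. \<Sum>i\<in>{False, True}. \<bar>(if i then g else f) x\<bar>) (\<Sum>i\<in>{False, True}. if i then b else a)"
  using assms by (intro lpb_sum) (auto simp: assms)
 then show ?thesis by simp
qed

text \<open>Schur's test with two weights: Jensen in \<open>y\<close> for fixed \<open>x\<close>,
  with the passage from \<open>v x\<close> to \<open>u y\<close> paid by replacing \<open>k\<close>
  with \<open>k'\<close>, then Fubini and the column bound of \<open>k'\<close>. The two spaces may
  differ, since the source will also be a space of pairs of points and steps.\<close>

lemma lpb_schur:
 fixes v F :: "'a \<Rightarrow> real" and u g :: "'b \<Rightarrow> real" and k k' :: "'a \<Rightarrow> 'b \<Rightarrow> real"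
 assumes M: "sigma_finite_measure M" and N: "sigma_finite_measure N" and p: "1 <= p"
  and [measurable]: "v \<in> borel_measurable M" "u \<in> borel_measurable N" "g \<in> borel_measurable N"
   "case_prod k \<in> borel_measurable (M \<Otimes>\<^sub>M N)" "case_prod k' \<in> borel_measurable (M \<Otimes>\<^sub>M N)"
  and v: "\<And>x. x \<in> space M ==> 0 <= v x"
  and k: "\<And>x y. x \<in> space M ==> y \<in> space N ==> 0 <= k x y"
  and k': "\<And>x y. x \<in> space M ==> y \<in> space N ==> 0 <= k' x y"
  and kk': "\<And>x y. x \<in> space M ==> y \<in> space N ==> v x * k x y <= u y * k' x y"
  and A: "0 < A" "\<And>x. x \<in> space M ==> (\<integral>\<^sup>+y. ennreal (k x y) \<partial>N) <= ennreal A"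
   "\<And>x. x \<in> space M ==> (\<integral>\<^sup>+y. ennreal (k' x y) \<partial>N) <= ennreal A"
   "\<And>y. y \<in> space N ==> (\<integral>\<^sup>+x. ennreal (k' x y) \<partial>M) <= ennreal A"
  and F: "\<And>x. x \<in> space M ==> eabs (F x) <= (\<integral>\<^sup>+y. ennreal (\<bar>g y\<bar> * k x y) \<partial>N)"
  and B: "0 < B" "lpb N p u g B"
 shows "lpb M p v F (A * B)"
proof -
 interpret M: sigma_finite_measure M by (rule M)
 interpret N: sigma_finite_measure N by (rule N)
 interpret pair_sigma_finite M N ..
 have km[measurable]: "k x \<in> borel_measurable N" "k' x \<in> borel_measurable N" if "x \<in> space M" for x
  using measurable_compose[OF measurable_Pair1'[OF that] assms(7)]
   measurable_compose[OF measurable_Pair1'[OF that] assms(8)] by simp_all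
 have Qm[measurable]: "(%(x, y). lpi p B \<bar>g y\<bar> (u y) * ennreal (k' x y)) \<in> borel_measurable (M \<Otimes>\<^sub>M N)"
 proof -
  have "(%z. lpi p B \<bar>g (snd z)\<bar> (u (snd z)) * ennreal (case_prod k' z)) \<in> borel_measurable (M \<Otimes>\<^sub>M N)" by measurable
  then show ?thesis by (simp add: case_prod_beta')
 qed
 have AB: "0 < A * B" using A B by simp
 show ?thesis
 proof (rule lpbI[OF p AB])
  show "(%x. ennreal (1 / A) * (\<integral>\<^sup>+y. lpi p B \<bar>g y\<bar> (u y) * ennreal (k' x y) \<partial>N)) \<in> borel_measurable M" by measurable
  have "(\<integral>\<^sup>+x. ennreal (1 / A) * (\<integral>\<^sup>+y. lpi p B \<bar>g y\<bar> (u y) * ennreal (k' x y) \<partial>N) \<partial>M)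
   = ennreal (1 / A) * (\<integral>\<^sup>+y. (\<integral>\<^sup>+x. lpi p B \<bar>g y\<bar> (u y) * ennreal (k' x y) \<partial>M) \<partial>N)"
   using Fubini'[OF Qm] by (subst nn_integral_cmult) auto
  also have "... <= ennreal (1 / A) * (\<integral>\<^sup>+y. lpi p B \<bar>g y\<bar> (u y) * ennreal A \<partial>N)"
  proof (intro mult_left_mono nn_integral_mono)
   fix y assume y: "y \<in> space N"
   have m: "(%x. k' x y) \<in> borel_measurable M" using measurable_compose[OF measurable_Pair2'[OF y] assms(8)] by simp
   show "(\<integral>\<^sup>+x. lpi p B \<bar>g y\<bar> (u y) * ennreal (k' x y) \<partial>M) <= lpi p B \<bar>g y\<bar> (u y) * ennreal A"
    using A(4)[OF y] m by (subst nn_integral_cmult) (auto intro: mult_left_mono)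
  qed simp
  also have "... = ennreal (1 / A) * ennreal A * (\<integral>\<^sup>+y. lpi p B \<bar>g y\<bar> (u y) \<partial>N)"
   by (subst nn_integral_multc) (auto simp: ac_simps)
  also have "... <= 1" using lpbD[OF p B] A by (simp add: ennreal_mult'[symmetric])
  finally show "(\<integral>\<^sup>+x. ennreal (1 / A) * (\<integral>\<^sup>+y. lpi p B \<bar>g y\<bar> (u y) * ennreal (k' x y) \<partial>N) \<partial>M) <= 1" .
  fix x assume x: "x \<in> space M"
  show "lpi p (A * B) \<bar>F x\<bar> (v x) <= ennreal (1 / A) * (\<integral>\<^sup>+y. lpi p B \<bar>g y\<bar> (u y) * ennreal (k' x y) \<partial>N)"
   using x k k' v kk' A F by (intro lpi_jensen[OF p B(1), where k = "k x"] km) auto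
 qed
qed

text \<open>The Borel counterpart of \<open>lebesgue_on {-1..1}\<close>, on which kernels in two
  variables are jointly measurable; \<open>wnorm_le_iff_lpb\<close> passes between the two.\<close>

abbreviation M0 :: "real measure" where "M0 \<equiv> restrict_space lborel {-1..1}"

lemma sigma_finite_M0: "sigma_finite_measure M0" by (rule sigma_finite_measure_restrict_space[OF sigma_finite_lborel]) simp

lemma wnorm_le_iff_lpb:
 assumes p: "1 <= p" and B: "0 <= B" and [measurable]: "g \<in> borel_measurable borel" "v \<in> borel_measurable borel"
 shows "wnorm p v g <= ennreal B \<longleftrightarrow> lpb M0 p v g B"
proof -
 have nn: "(\<integral>\<^sup>+x. h x \<partial>lebesgue_on {-1..1}) = (\<integral>\<^sup>+x. h x \<partial>M0)" for h :: "real \<Rightarrow> ennreal"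
  by (simp add: nn_integral_restrict_space nn_integral_completion)
 show ?thesis
 proof (cases "p = \<infinity>")
  case True
  have m: "(%x. ennreal (\<bar>g x\<bar> * v x)) \<in> borel_measurable (lebesgue_on {-1..1})"
   by (intro measurable_restrict_space1 measurable_completion) measurable
  have "esssup (lebesgue_on {-1..1}) (%x. ennreal (\<bar>g x\<bar> * v x)) <= ennreal B \<longleftrightarrow>
   (AE x in lebesgue_on {-1..1}. ennreal (\<bar>g x\<bar> * v x) <= ennreal B)"
   using esssup_I[OF m, of "ennreal B"] esssup_AE[of "%x. ennreal (\<bar>g x\<bar> * v x)" "lebesgue_on {-1..1}"] by (auto elim!: eventually_mono)
  also have "... \<longleftrightarrow> (AE x in M0. \<bar>g x\<bar> * v x <= B)" using B by (simp add: AE_restrict_space_iff AE_completion_iff ennreal_le_iff)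
  finally show ?thesis using True by (simp add: wnorm_def lpb_def)
 next
  case False
  define q where "q = real_of_ereal p"
  have q: "1 <= q" using real_of_ereal_ge_1[OF p False] by (simp add: q_def)
  define I where "I = (\<integral>\<^sup>+x. ennreal (\<bar>g x\<bar> powr q * v x) \<partial>M0)"
  have "wnorm p v g = (if I = \<infinity> then \<infinity> else ennreal (enn2real I powr (1 / q)))" using False by (simp add: wnorm_def nn Let_def I_def q_def)
  also have "... <= ennreal B \<longleftrightarrow> I <= ennreal (B powr q)"
  proof (cases I)
   case (real i)
   have "i powr (1 / q) <= B \<longleftrightarrow> i <= B powr q"
   proof
    assume "i powr (1 / q) <= B"
    then have "(i powr (1 / q)) powr q <= B powr q" using q by (intro powr_mono2) auto
    then show "i <= B powr q" using q real by (simp add: powr_powr)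
   next
    assume "i <= B powr q"
    then have "i powr (1 / q) <= (B powr q) powr (1 / q)" using q real by (intro powr_mono2) auto
    then show "i powr (1 / q) <= B" using q B by (simp add: powr_powr)
   qed
   then show ?thesis using real B by (simp add: ennreal_le_iff)
  qed (simp add: top_unique)
  finally show ?thesis using False by (simp add: lpb_def I_def q_def)
 qed
qed

section \<open>Chebyshev polynomials\<close>

fun chebT :: "nat \<Rightarrow> real poly" where
 "chebT 0 = 1"
| "chebT (Suc 0) = [:0, 1:]"
| "chebT (Suc (Suc n)) = [:0, 2:] * chebT (Suc n) - chebT n"

fun chebU :: "nat \<Rightarrow> real poly" where
 "chebU 0 = 1"
| "chebU (Suc 0) = [:0, 2:]"
| "chebU (Suc (Suc n)) = [:0, 2:] * chebU (Suc n) - chebU n"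

lemma poly_chebT_cos: "poly (chebT n) (cos t) = cos (real n * t)"
proof (induction n rule: chebT.induct)
 case (3 n)
 have "cos (real (Suc (Suc n)) * t) + cos (real n * t) = 2 * cos t * cos (real (Suc n) * t)"
  using cos_add[of "real (Suc n) * t" t] cos_diff[of "real (Suc n) * t" t] by (simp add: algebra_simps)
 then show ?case using 3 by simp
qed auto

lemma poly_chebU_cos: "sin t * poly (chebU n) (cos t) = sin (real (Suc n) * t)"
proof (induction n rule: chebU.induct)
 case 2 show ?case using sin_double[of t] by (simp add: mult.commute)
next
 case (3 n)
 have "sin (real (Suc (Suc (Suc n))) * t) + sin (real (Suc n) * t) = 2 * cos t * sin (real (Suc (Suc n)) * t)"
  using sin_add[of "real (Suc (Suc n)) * t" t] sin_diff[of "real (Suc (Suc n)) * t" t] by (simp add: algebra_simps)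
 moreover have "sin t * poly (chebU (Suc (Suc n))) (cos t)
   = 2 * cos t * (sin t * poly (chebU (Suc n)) (cos t)) - sin t * poly (chebU n) (cos t)" by (simp add: algebra_simps)
 ultimately show ?case using 3 by simp
qed auto

text \<open>The cosine of an open interval of angles is infinite, so it determines a polynomial;
  leaving out the angles 0 and pi permits division by the sine.\<close>

lemma poly_eqI_cos:
 fixes p q :: "real poly"
 assumes "\<And>t. 0 < t ==> t < pi ==> poly p (cos t) = poly q (cos t)"
 shows "p = q"
proof (rule ccontr)
 assume "p \<noteq> q"
 then have "finite {x. poly (p - q) x = 0}" by (intro poly_roots_finite) simp
 moreover have "{-1<..<1} \<subseteq> {x. poly (p - q) x = 0}"
 proof
  fix x :: real assume "x \<in> {-1<..<1}"
  then show "x \<in> {x. poly (p - q) x = 0}" using assms[of "arccos x"] arccos_lt_bounded[of x] by simp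
 qed
 ultimately have "finite {-1<..<1::real}" by (rule finite_subset[rotated])
 then show False using infinite_Ioo[of "-1::real" 1] by simp
qed

lemma poly_pderiv_chebT_cos: "sin t * poly (pderiv (chebT n)) (cos t) = real n * sin (real n * t)"
proof -
 have "((%t. poly (chebT n) (cos t)) has_real_derivative poly (pderiv (chebT n)) (cos t) * (- sin t)) (at t)"
  by (auto intro!: derivative_eq_intros DERIV_chain2[OF poly_DERIV])
 moreover have "((%t. cos (real n * t)) has_real_derivative - sin (real n * t) * real n) (at t)" by (auto intro!: derivative_eq_intros)
 ultimately have "poly (pderiv (chebT n)) (cos t) * (- sin t) = - sin (real n * t) * real n" unfolding poly_chebT_cos by (rule DERIV_unique)
 then show ?thesis by (simp add: mult.commute)
qed

lemma pderiv_chebT: "pderiv (chebT (Suc n)) = smult (real (Suc n)) (chebU n)"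
proof (rule poly_eqI_cos)
 fix t assume t: "0 < t" "t < pi"
 then have "sin t \<noteq> 0" using sin_gt_zero[of t] by auto
 moreover have "sin t * poly (pderiv (chebT (Suc n))) (cos t) = sin t * poly (smult (real (Suc n)) (chebU n)) (cos t)"
  using poly_pderiv_chebT_cos[of t "Suc n"] poly_chebU_cos[of t n] by (simp add: mult.left_commute)
 ultimately show "poly (pderiv (chebT (Suc n))) (cos t) = poly (smult (real (Suc n)) (chebU n)) (cos t)" by simp
qed

lemma chebU_eq_chebT: "chebU (Suc (Suc n)) = chebU n + smult 2 (chebT (Suc (Suc n)))"
proof (rule poly_eqI_cos)
 fix t assume t: "0 < t" "t < pi"
 then have "sin t \<noteq> 0" using sin_gt_zero[of t] by auto
 moreover have "sin (real (Suc (Suc (Suc n))) * t) - sin (real (Suc n) * t) = 2 * sin t * cos (real (Suc (Suc n)) * t)"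
  using sin_add[of "real (Suc (Suc n)) * t" t] sin_diff[of "real (Suc (Suc n)) * t" t] by (simp add: algebra_simps)
 then have "sin t * poly (chebU (Suc (Suc n))) (cos t) = sin t * poly (chebU n + smult 2 (chebT (Suc (Suc n)))) (cos t)"
  unfolding poly_chebU_cos poly_add poly_smult poly_chebT_cos distrib_left by simp
 ultimately show "poly (chebU (Suc (Suc n))) (cos t) = poly (chebU n + smult 2 (chebT (Suc (Suc n)))) (cos t)" by (metis mult_cancel_left)
qed

section \<open>The Chebyshev differential equation and bounds for derivatives\<close>

lemma chebT_ode: "[:1, 0, -1:] * pderiv (pderiv (chebT n)) - [:0, 1:] * pderiv (chebT n) + smult ((real n)\<^sup>2) (chebT n) = 0"
proof (rule poly_eqI_cos)
 fix t assume t: "0 < t" "t < pi"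
 then have s: "sin t \<noteq> 0" using sin_gt_zero[of t] by auto
 have "((%t. sin t * poly (pderiv (chebT n)) (cos t)) has_real_derivative
   cos t * poly (pderiv (chebT n)) (cos t) + sin t * (poly (pderiv (pderiv (chebT n))) (cos t) * (- sin t))) (at t)"
  by (auto intro!: derivative_eq_intros DERIV_chain2[OF poly_DERIV])
 moreover have "((%t. real n * sin (real n * t)) has_real_derivative real n * (cos (real n * t) * real n)) (at t)" by (auto intro!: derivative_eq_intros)
 ultimately have "cos t * poly (pderiv (chebT n)) (cos t) + sin t * (poly (pderiv (pderiv (chebT n))) (cos t) * (- sin t))
   = real n * (cos (real n * t) * real n)" unfolding poly_pderiv_chebT_cos using DERIV_unique by blast
 moreover have "sin t * (poly (pderiv (pderiv (chebT n))) (cos t) * (- sin t))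
   = - ((1 - cos t * cos t) * poly (pderiv (pderiv (chebT n))) (cos t))"
 proof -
  have "sin t * sin t = 1 - cos t * cos t" using sin_cos_squared_add[of t] by (simp add: power2_eq_square)
  from this[symmetric] show ?thesis by simp
 qed
 ultimately have "cos t * poly (pderiv (chebT n)) (cos t) - (1 - cos t * cos t) * poly (pderiv (pderiv (chebT n))) (cos t)
   = (real n)\<^sup>2 * poly (chebT n) (cos t)" unfolding poly_chebT_cos by (simp add: power2_eq_square algebra_simps)
 then show "poly ([:1, 0, -1:] * pderiv (pderiv (chebT n)) - [:0, 1:] * pderiv (chebT n) + smult ((real n)\<^sup>2) (chebT n)) (cos t) = poly 0 (cos t)"
  by (simp add: algebra_simps)
qed

text \<open>The differential equation differentiated \<open>i\<close> times. It expresses the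
  derivative of order \<open>i + 2\<close> through the two previous ones with leading factor 1 - x^2
  = phi^2, which is the recursion behind the Bernstein bound.\<close>

lemma chebT_ode_higher:
 "[:1, 0, -1:] * (pderiv ^^ Suc (Suc i)) (chebT n) - smult (2 * real i + 1) ([:0, 1:] * (pderiv ^^ Suc i) (chebT n))
   + smult ((real n)\<^sup>2 - (real i)\<^sup>2) ((pderiv ^^ i) (chebT n)) = 0"
proof (induction i)
 case 0
 show ?case using chebT_ode[of n] by (simp only: funpow.simps o_apply id_apply of_nat_0 mult_zero_right add_0_left smult_1_left power_zero_numeral diff_zero)
next
 case (Suc i)
 define D0 D1 D2 where "D0 = (pderiv ^^ i) (chebT n)" and "D1 = pderiv D0" and "D2 = pderiv D1"
 have e: "[:1, 0, -1:] * D2 - smult (2 * real i + 1) ([:0, 1:] * D1) + smult ((real n)\<^sup>2 - (real i)\<^sup>2) D0 = 0"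
  using Suc unfolding D0_def D1_def D2_def by (simp only: funpow.simps o_apply)
 have "pderiv ([:1, 0, -1:] * D2 - smult (2 * real i + 1) ([:0, 1:] * D1) + smult ((real n)\<^sup>2 - (real i)\<^sup>2) D0) = 0" by (simp only: e pderiv_0)
 then have ev: "poly (pderiv ([:1, 0, -1:] * D2 - smult (2 * real i + 1) ([:0, 1:] * D1) + smult ((real n)\<^sup>2 - (real i)\<^sup>2) D0)) x = 0" for x
  by (simp only: poly_0)
 have "[:1, 0, -1:] * pderiv D2 - smult (2 * real (Suc i) + 1) ([:0, 1:] * D2)
   + smult ((real n)\<^sup>2 - (real (Suc i))\<^sup>2) D1 = 0"
 proof (rule poly_eqI_cos)
  fix t :: real
  show "poly ([:1, 0, -1:] * pderiv D2 - smult (2 * real (Suc i) + 1) ([:0, 1:] * D2)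
    + smult ((real n)\<^sup>2 - (real (Suc i))\<^sup>2) D1) (cos t) = poly 0 (cos t)"
   using ev[of "cos t"] unfolding pderiv_add pderiv_diff pderiv_mult pderiv_smult D1_def[symmetric] D2_def[symmetric]
   by (simp add: pderiv_pCons power2_eq_square algebra_simps del: mult_pCons_left mult_pCons_right)
 qed
 then show ?case unfolding D0_def D1_def D2_def by (simp only: funpow.simps o_apply)
qed

lemma abs_chebT_le_1: "x \<in> {-1..1} ==> \<bar>poly (chebT n) x\<bar> <= 1" using poly_chebT_cos[of n "arccos x"] by simp

lemma higher_pderiv_smult: "(pderiv ^^ i) (smult (c::real) p) = smult c ((pderiv ^^ i) p)" by (induction i) (auto simp: pderiv_smult)

lemma higher_pderiv_add: "(pderiv ^^ i) (p + q) = (pderiv ^^ i) p + (pderiv ^^ i) (q :: real poly)" by (induction i) (auto simp: pderiv_add)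

lemma higher_pderiv_0: "(pderiv ^^ i) (0 :: real poly) = 0" by (induction i) auto

lemma higher_pderiv_sum: "(pderiv ^^ i) (\<Sum>k\<in>A. f k) = (\<Sum>k\<in>A. (pderiv ^^ i) (f k :: real poly))"
 by (induction A rule: infinite_finite_induct) (auto simp: higher_pderiv_add higher_pderiv_0)

text \<open>Each derivative costs n times 2n: T_n' is n times U_(n-1), and U_(n-1) is a sum of
  first-kind polynomials with coefficients at most 2. The inner induction runs in steps of two along
  \<open>chebU_eq_chebT\<close>.\<close>

lemma chebT_markov:
 "x \<in> {-1..1} ==> \<bar>poly ((pderiv ^^ i) (chebT n)) x\<bar> <= 4 ^ i * real n ^ (2 * i)"
proof (induction i arbitrary: n)
 case 0 then show ?case using abs_chebT_le_1 by simp
next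
 case (Suc i)
 have U: "\<bar>poly ((pderiv ^^ i) (chebU k)) x\<bar> <= 2 * real (Suc k) * (4 ^ i * real (Suc k) ^ (2 * i))" for k
 proof (induction k rule: chebU.induct)
  case 1
  have "\<bar>poly ((pderiv ^^ i) (chebT 0)) x\<bar> <= 4 ^ i * real 0 ^ (2 * i)" using Suc by blast
  also have "... <= 4 ^ i * 1" by (intro mult_left_mono) (auto simp: power_0_left)
  finally show ?case by simp
 next
  case 2
  have "\<bar>poly ((pderiv ^^ i) (chebT (Suc 0))) x\<bar> <= 4 ^ i * real (Suc 0) ^ (2 * i)" using Suc by blast
  moreover have "chebU (Suc 0) = smult 2 (chebT (Suc 0))" by simp
  ultimately have "\<bar>poly ((pderiv ^^ i) (chebU (Suc 0))) x\<bar> <= 2 * 4 ^ i" by (simp only: higher_pderiv_smult poly_smult abs_mult) simp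
  also have "... <= 2 * real (Suc (Suc 0)) * (4 ^ i * real (Suc (Suc 0)) ^ (2 * i))"
  proof -
   have "(1::real) <= 2 ^ (2 * i)" by simp
   then have "(1::real) <= 2 * 2 ^ (2 * i)" by linarith
   then show ?thesis by simp
  qed
  finally show ?case .
 next
  case (3 k)
  have "\<bar>poly ((pderiv ^^ i) (chebU (Suc (Suc k)))) x\<bar>
    <= \<bar>poly ((pderiv ^^ i) (chebU k)) x\<bar> + 2 * \<bar>poly ((pderiv ^^ i) (chebT (Suc (Suc k)))) x\<bar>"
   unfolding chebU_eq_chebT higher_pderiv_add higher_pderiv_smult poly_add poly_smult by (rule order_trans[OF abs_triangle_ineq]) (simp add: abs_mult)
  also have "... <= 2 * real (Suc k) * (4 ^ i * real (Suc k) ^ (2 * i)) + 2 * (4 ^ i * real (Suc (Suc k)) ^ (2 * i))"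
   by (intro add_mono mult_left_mono 3(2) Suc(1)[OF Suc(2)]) simp_all
  also have "... <= 2 * real (Suc k) * (4 ^ i * real (Suc (Suc (Suc k))) ^ (2 * i)) + 2 * (4 ^ i * real (Suc (Suc (Suc k))) ^ (2 * i))"
   by (intro add_mono mult_left_mono power_mono) auto
  also have "... <= 2 * real (Suc (Suc (Suc k))) * (4 ^ i * real (Suc (Suc (Suc k))) ^ (2 * i))"
  proof -
   define Y where "Y = (4::real) ^ i * real (Suc (Suc (Suc k))) ^ (2 * i)"
   have "0 <= Y" by (simp add: Y_def)
   then show ?thesis unfolding Y_def[symmetric] by (simp add: algebra_simps)
  qed
  finally show ?case .
 qed
 show ?case
 proof (cases n)
  case 0
  have "(pderiv ^^ Suc i) (1::real poly) = 0" by (induction i) (auto simp: pderiv_1)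
  then show ?thesis using 0 by simp
 next
  case (Suc k)
  have "(pderiv ^^ Suc i) (chebT n) = smult (real (Suc k)) ((pderiv ^^ i) (chebU k))" unfolding Suc funpow_Suc_right comp_def pderiv_chebT higher_pderiv_smult ..
  then have "\<bar>poly ((pderiv ^^ Suc i) (chebT n)) x\<bar> = real (Suc k) * \<bar>poly ((pderiv ^^ i) (chebU k)) x\<bar>" by (simp add: abs_mult)
  also have "... <= real (Suc k) * (2 * real (Suc k) * (4 ^ i * real (Suc k) ^ (2 * i)))" by (rule mult_left_mono[OF U]) simp
  also have "... = (2 * 4 ^ i) * real (Suc k) ^ (2 * Suc i)" by simp
  also have "... <= 4 ^ Suc i * real (Suc k) ^ (2 * Suc i)" by (intro mult_right_mono) auto
  finally show ?thesis by (simp add: Suc)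
 qed
qed

text \<open>Two-step induction along the differentiated equation: division by phi^2 turns bounds for
  the orders \<open>i\<close> and \<open>i + 1\<close> into one for \<open>i + 2\<close>.\<close>

lemma chebT_bernstein:
 "\<exists>C\<ge>0. \<forall>n\<ge>1. \<forall>x\<in>{-1..1}. 1 / real n <= phi x \<longrightarrow>
   \<bar>poly ((pderiv ^^ i) (chebT n)) x\<bar> <= C * (real n / phi x) ^ i"
proof (induction i rule: induct_nat_012)
 case 0
 show ?case by (rule exI[of _ 1]) (auto simp: abs_chebT_le_1)
next
 case 1
 have "\<bar>poly (pderiv (chebT n)) x\<bar> <= real n / phi x" if "n \<ge> 1" "x \<in> {-1..1}" "1 / real n <= phi x" for n x
 proof -
  have p: "0 < phi x" using that by (meson less_le_trans of_nat_0_less_iff zero_less_divide_1_iff zero_less_one order_less_le_trans)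
  have "phi x * poly (pderiv (chebT n)) x = real n * sin (real n * arccos x)" using poly_pderiv_chebT_cos[of "arccos x" n] that by (simp add: phi_arccos)
  then have "phi x * \<bar>poly (pderiv (chebT n)) x\<bar> = real n * \<bar>sin (real n * arccos x)\<bar>" using p by (metis abs_mult abs_of_nat abs_of_pos)
  also have "... <= real n * 1" by (intro mult_left_mono) auto
  finally show ?thesis using p by (simp add: field_simps)
 qed
 then show ?case by (intro exI[of _ 1]) auto
next
 case (ge2 i)
 from ge2 obtain C0 C1 where C0: "0 <= C0" "\<And>n x. n \<ge> 1 ==> x \<in> {-1..1} ==> 1 / real n <= phi x ==>
   \<bar>poly ((pderiv ^^ i) (chebT n)) x\<bar> <= C0 * (real n / phi x) ^ i"
  and C1: "0 <= C1" "\<And>n x. n \<ge> 1 ==> x \<in> {-1..1} ==> 1 / real n <= phi x ==>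
   \<bar>poly ((pderiv ^^ Suc i) (chebT n)) x\<bar> <= C1 * (real n / phi x) ^ Suc i" by metis
 have "\<bar>poly ((pderiv ^^ Suc (Suc i)) (chebT n)) x\<bar> <= ((2 * real i + 1) * C1 + (1 + (real i)\<^sup>2) * C0) * (real n / phi x) ^ Suc (Suc i)"
  if n: "n \<ge> 1" and x: "x \<in> {-1..1}" and nx: "1 / real n <= phi x" for n x
 proof -
  have p: "0 < phi x" using n nx by (meson less_le_trans of_nat_0_less_iff zero_less_divide_1_iff zero_less_one order_less_le_trans)
  define y where "y = real n / phi x"
  define D0 D1 D2 where "D0 = poly ((pderiv ^^ i) (chebT n)) x"
   and "D1 = poly ((pderiv ^^ Suc i) (chebT n)) x" and "D2 = poly ((pderiv ^^ Suc (Suc i)) (chebT n)) x"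
  have y0: "0 < y" using n p by (simp add: y_def)
  have "poly ([:1, 0, -1:] * (pderiv ^^ Suc (Suc i)) (chebT n) - smult (2 * real i + 1) ([:0, 1:] * (pderiv ^^ Suc i) (chebT n))
   + smult ((real n)\<^sup>2 - (real i)\<^sup>2) ((pderiv ^^ i) (chebT n))) x = 0" unfolding chebT_ode_higher by simp
  then have "(1 - x * x) * D2 - (2 * real i + 1) * (x * D1) + ((real n)\<^sup>2 - (real i)\<^sup>2) * D0 = 0"
   by (simp add: D0_def D1_def D2_def left_diff_distrib mult.left_commute)
  moreover have "(phi x)\<^sup>2 = 1 - x * x" using phi_sq[OF x] by (simp add: power2_eq_square)
  ultimately have e: "(phi x)\<^sup>2 * D2 = (2 * real i + 1) * (x * D1) - ((real n)\<^sup>2 - (real i)\<^sup>2) * D0" by simp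
  have "(phi x)\<^sup>2 * \<bar>D2\<bar> = \<bar>(phi x)\<^sup>2 * D2\<bar>" by (simp add: abs_mult)
  also have "... <= \<bar>(2 * real i + 1) * (x * D1)\<bar> + \<bar>((real n)\<^sup>2 - (real i)\<^sup>2) * D0\<bar>" unfolding e by (rule abs_triangle_ineq4)
  also have "... = (2 * real i + 1) * (\<bar>x\<bar> * \<bar>D1\<bar>) + \<bar>(real n)\<^sup>2 - (real i)\<^sup>2\<bar> * \<bar>D0\<bar>" by (simp add: abs_mult)
  also have "... <= (2 * real i + 1) * (1 * (C1 * y ^ Suc i)) + ((real n)\<^sup>2 * (1 + (real i)\<^sup>2)) * (C0 * y ^ i)"
  proof (intro add_mono mult_mono)
   show "\<bar>D1\<bar> <= C1 * y ^ Suc i" unfolding D1_def y_def by (rule C1(2)[OF n x nx])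
   show "\<bar>D0\<bar> <= C0 * y ^ i" unfolding D0_def y_def by (rule C0(2)[OF n x nx])
   have "(real i)\<^sup>2 <= (real n)\<^sup>2 * (real i)\<^sup>2" using n by (simp add: mult_le_cancel_right1)
   moreover have "0 <= (real n)\<^sup>2" "0 <= (real i)\<^sup>2" by simp_all
   ultimately show "\<bar>(real n)\<^sup>2 - (real i)\<^sup>2\<bar> <= (real n)\<^sup>2 * (1 + (real i)\<^sup>2)"
    unfolding distrib_left abs_le_iff mult_1_right by linarith
  qed (use x in auto)
  also have "... <= (2 * real i + 1) * C1 * ((real n)\<^sup>2 * y ^ i) + (1 + (real i)\<^sup>2) * C0 * ((real n)\<^sup>2 * y ^ i)"
  proof -
   \<comment> \<open>Here \<open>phi x\<close> at least 1/n is used: it makes the term with the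
     derivative of order \<open>i + 1\<close> no larger than the one with the factor n^2.\<close>
   have "y <= (real n)\<^sup>2"
   proof -
    have "1 / phi x <= real n" using nx n p by (simp add: field_simps)
    then have "real n * (1 / phi x) <= real n * real n" by (intro mult_left_mono) auto
    then show ?thesis by (simp add: y_def power2_eq_square)
   qed
   then have "y * y ^ i <= (real n)\<^sup>2 * y ^ i" using y0 by (intro mult_right_mono) auto
   then have "(2 * real i + 1) * C1 * (y * y ^ i) <= (2 * real i + 1) * C1 * ((real n)\<^sup>2 * y ^ i)" using C1(1) by (intro mult_left_mono) auto
   then show ?thesis by (simp add: algebra_simps)
  qed
  also have "... = ((2 * real i + 1) * C1 + (1 + (real i)\<^sup>2) * C0) * ((real n)\<^sup>2 * y ^ i)" by (simp add: algebra_simps)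
  also have "(real n)\<^sup>2 * y ^ i = (phi x)\<^sup>2 * y ^ Suc (Suc i)" using p by (simp add: y_def power2_eq_square field_simps)
  finally have "(phi x)\<^sup>2 * \<bar>D2\<bar> <= (phi x)\<^sup>2 * (((2 * real i + 1) * C1 + (1 + (real i)\<^sup>2) * C0) * y ^ Suc (Suc i))"
   by (simp add: ac_simps)
  then show ?thesis using p unfolding D2_def y_def by (subst (asm) mult_le_cancel_left_pos) auto
 qed
 moreover have "0 <= (2 * real i + 1) * C1 + (1 + (real i)\<^sup>2) * C0" using C0 C1 by auto
 ultimately show ?case by blast
qed

text \<open>Inside, \<open>1 / rho n x\<close> is comparable with n / phi (Bernstein), near the
  endpoints with n^2 (Markov). The passage to a larger \<open>N\<close> uses that
  \<open>N * rho N x\<close> decreases in \<open>N\<close>; the factor n / N is kept because it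
  cancels the degree when U is written as a derivative of T.\<close>

lemma chebT_deriv_bound:
 obtains C where "0 <= C"
  and "\<And>N n x. 1 <= N ==> n <= N ==> x \<in> {-1..1} ==>
   \<bar>poly ((pderiv ^^ i) (chebT n)) x\<bar> <= C * (real n / real N / rho N x) ^ i"
proof -
 from chebT_bernstein[of i] obtain C where C: "0 <= C"
  "\<And>n x. n \<ge> 1 ==> x \<in> {-1..1} ==> 1 / real n <= phi x ==>
   \<bar>poly ((pderiv ^^ i) (chebT n)) x\<bar> <= C * (real n / phi x) ^ i" by metis
 have A: "\<bar>poly ((pderiv ^^ i) (chebT n)) x\<bar> <= (8 ^ i + C * 2 ^ i) * (1 / rho n x) ^ i"
  if n: "1 <= n" and x: "x \<in> {-1..1}" for n x
 proof (cases "1 / real n <= phi x")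
  case True
  then have p: "0 < phi x" using n by (meson less_le_trans of_nat_0_less_iff zero_less_divide_1_iff zero_less_one order_less_le_trans)
  have "1 / (real n)\<^sup>2 <= phi x / real n" using n True by (simp add: power2_eq_square field_simps)
  then have r: "rho n x <= 2 * phi x / real n" by (simp add: rho_phi)
  then have "real n / phi x <= 2 * (1 / rho n x)" using rho_pos[OF n x] p n by (simp add: field_simps)
  then have "(real n / phi x) ^ i <= (2 * (1 / rho n x)) ^ i" using p by (intro power_mono) auto
  then have "C * (real n / phi x) ^ i <= C * (2 ^ i * (1 / rho n x) ^ i)" using C(1) unfolding power_mult_distrib by (intro mult_left_mono) auto
  also have "... <= (8 ^ i + C * 2 ^ i) * (1 / rho n x) ^ i" using rho_pos[OF n x] by (simp add: algebra_simps)
  finally show ?thesis using C(2)[OF n x True] by linarith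
 next
  case False
  then have "phi x / real n <= 1 / (real n)\<^sup>2" using n by (simp add: power2_eq_square field_simps)
  then have r: "rho n x <= 2 / (real n)\<^sup>2" by (simp add: rho_phi)
  then have "(real n)\<^sup>2 <= 2 * (1 / rho n x)" using rho_pos[OF n x] n by (simp add: field_simps)
  then have "((real n)\<^sup>2) ^ i <= (2 * (1 / rho n x)) ^ i" by (intro power_mono) auto
  then have "4 ^ i * real n ^ (2 * i) <= 4 ^ i * (2 ^ i * (1 / rho n x) ^ i)" unfolding power_mult_distrib power_mult[symmetric] by (intro mult_left_mono) auto
  also have "... = 8 ^ i * (1 / rho n x) ^ i" by (simp add: power_mult_distrib[symmetric] mult.assoc[symmetric])
  also have "... <= (8 ^ i + C * 2 ^ i) * (1 / rho n x) ^ i" using rho_pos[OF n x] C(1) by (intro mult_right_mono) auto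
  finally show ?thesis using chebT_markov[OF x, of i n] by linarith
 qed
 have "\<bar>poly ((pderiv ^^ i) (chebT n)) x\<bar> <= (8 ^ i + C * 2 ^ i) * (real n / real N / rho N x) ^ i"
  if N: "1 <= N" and nN: "n <= N" and x: "x \<in> {-1..1}" for N n x
 proof (cases "n = 0")
  case True
  show ?thesis
  proof (cases i)
   case 0 then show ?thesis using abs_chebT_le_1[OF x, of n] C(1) by simp
  next
   case (Suc j)
   have "(pderiv ^^ Suc j) (1::real poly) = 0" by (induction j) (auto simp: pderiv_1)
   then show ?thesis using True Suc by simp
  qed
 next
  case False
  then have n: "1 <= n" by simp
  have "real N * rho N x = phi x + 1 / real N" using N by (simp add: rho_phi field_simps power2_eq_square)
  also have "... <= phi x + 1 / real n" using n nN by (simp add: frac_le)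
  also have "... = real n * rho n x" using n by (simp add: rho_phi field_simps power2_eq_square)
  finally have "1 / rho n x <= real n / real N / rho N x" using n N rho_pos[OF n x] rho_pos[OF N x] by (simp add: field_simps)
  then have "(1 / rho n x) ^ i <= (real n / real N / rho N x) ^ i" using rho_pos[OF n x] by (intro power_mono) auto
  then have "(8 ^ i + C * 2 ^ i) * (1 / rho n x) ^ i <= (8 ^ i + C * 2 ^ i) * (real n / real N / rho N x) ^ i" using C(1) by (intro mult_left_mono) auto
  with A[OF n x] show ?thesis by linarith
 qed
 with C(1) that[of "8 ^ i + C * 2 ^ i"] show thesis by auto
qed

lemma higher_pderiv_mult:
 "(pderiv ^^ n) (p * q :: real poly) = (\<Sum>k\<le>n. smult (real (n choose k)) ((pderiv ^^ k) p * (pderiv ^^ (n - k)) q))"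
proof (induction n)
 case (Suc n)
 define a b where "a = (%k. (pderiv ^^ k) p)" and "b = (%k. (pderiv ^^ k) q)"
 have ab: "pderiv (a k) = a (Suc k)" "pderiv (b k) = b (Suc k)" for k by (simp_all add: a_def b_def)
 have "(pderiv ^^ Suc n) (p * q) = pderiv (\<Sum>k\<le>n. smult (real (n choose k)) (a k * b (n - k)))" using Suc by (simp add: a_def b_def)
 also have "... = (\<Sum>k\<le>n. smult (real (n choose k)) (a (Suc k) * b (n - k)) + smult (real (n choose k)) (a k * b (Suc n - k)))"
  unfolding higher_pderiv_sum[of 1, simplified] by (intro sum.cong refl) (auto simp: pderiv_smult pderiv_mult ab smult_add_right Suc_diff_le ac_simps)
 also have "... = (\<Sum>k\<le>n. smult (real (n choose k)) (a (Suc k) * b (n - k))) + (\<Sum>k\<le>n. smult (real (n choose k)) (a k * b (Suc n - k)))"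
  by (rule sum.distrib)
 also have "(\<Sum>k\<le>n. smult (real (n choose k)) (a k * b (Suc n - k))) = (\<Sum>k\<le>Suc n. smult (real (n choose k)) (a k * b (Suc n - k)))" by simp
 also have "... = a 0 * b (Suc n) + (\<Sum>k\<le>n. smult (real (n choose Suc k)) (a (Suc k) * b (n - k)))" by (subst sum.atMost_Suc_shift) simp
 also have "(\<Sum>k\<le>n. smult (real (n choose k)) (a (Suc k) * b (n - k))) + ...
   = a 0 * b (Suc n) + (\<Sum>k\<le>n. smult (real (Suc n choose Suc k)) (a (Suc k) * b (n - k)))" by (simp add: sum.distrib[symmetric] smult_add_left algebra_simps)
 also have "... = (\<Sum>k\<le>Suc n. smult (real (Suc n choose k)) (a k * b (Suc n - k)))" by (subst sum.atMost_Suc_shift) simp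
 finally show ?case by (simp add: a_def b_def)
qed simp

lemma coeff_chebU: "(\<forall>i>n. coeff (chebU n) i = 0) \<and> coeff (chebU n) n = 2 ^ n"
 by (induction n rule: chebU.induct) (auto simp: coeff_pCons split: nat.splits)

lemma coeff_chebT: "i > n ==> coeff (chebT n) i = 0" by (induction n arbitrary: i rule: chebT.induct) (auto simp: coeff_pCons split: nat.splits)

section \<open>Expansion in Chebyshev polynomials of the second kind\<close>

lemma chebU_expand:
 assumes "\<And>i. N <= i ==> coeff R i = 0"
 shows "\<exists>c. R = (\<Sum>k<N. smult (c k) (chebU k))" using assms
proof (induction N arbitrary: R)
 case 0
 then show ?case by (auto intro: poly_eqI)
next
 case (Suc N)
 define a where "a = coeff R N / 2 ^ N"
 have "coeff (R - smult a (chebU N)) i = 0" if "N <= i" for i using coeff_chebU[of N] Suc(2)[of i] that by (cases "i = N") (auto simp: a_def)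
 from Suc(1)[OF this] obtain c where c: "R - smult a (chebU N) = (\<Sum>k<N. smult (c k) (chebU k))" by blast
 have "R = (\<Sum>k<Suc N. smult ((c(N := a)) k) (chebU k))" using c by (simp add: algebra_simps)
 then show ?case by blast
qed

text \<open>With x = cos t the integrand becomes a product of two sines, whose antiderivative
  \<open>F\<close> is explicit. The fundamental theorem is used in its interior form because
  \<open>arccos\<close> is not differentiable at the endpoints.\<close>

lemma chebU_orthogonal:
 "((%x. poly (chebU k) x * (poly (chebU l) x * sqrt (1 - x\<^sup>2))) has_integral (if k = l then pi / 2 else 0)) {-1..1}"
proof -
 define F :: "real \<Rightarrow> real" where "F = (%t. if k = l then t / 2 - sin (2 * real (Suc k) * t) / (4 * real (Suc k))
   else sin ((real k - real l) * t) / (2 * (real k - real l)) - sin (real (k + l + 2) * t) / (2 * real (k + l + 2)))"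
 have F: "(F has_real_derivative sin (real (Suc k) * t) * sin (real (Suc l) * t)) (at t)" for t
 proof (cases "k = l")
  case True
  define K where "K = real (Suc k)"
  have K: "K \<noteq> 0" by (simp add: K_def)
  have "F = (%t. t / 2 - sin (2 * K * t) / (4 * K))" using True by (simp add: F_def K_def)
  then have "(F has_real_derivative 1 / 2 - cos (2 * real (Suc k) * t) / 2) (at t)" unfolding K_def[symmetric] using K by (auto intro!: derivative_eq_intros)
  moreover have "1 / 2 - cos (2 * real (Suc k) * t) / 2 = sin (real (Suc k) * t) * sin (real (Suc l) * t)"
   using cos_double_sin[of "K * t"] unfolding True[symmetric] K_def[symmetric] by (simp add: power2_eq_square mult.assoc diff_divide_distrib)
  ultimately show ?thesis by simp
 next
  case False
  define K1 K2 where "K1 = real k - real l" and "K2 = real (k + l + 2)"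
  have K: "K1 \<noteq> 0" "K2 \<noteq> 0" using False by (simp_all add: K1_def K2_def del: of_nat_add)
  have "F = (%t. sin (K1 * t) / (2 * K1) - sin (K2 * t) / (2 * K2))" using False by (simp add: F_def K1_def K2_def)
  then have "(F has_real_derivative cos ((real k - real l) * t) / 2 - cos (real (k + l + 2) * t) / 2) (at t)"
   unfolding K1_def[symmetric] K2_def[symmetric] using K by (auto intro!: derivative_eq_intros)
  moreover have "cos ((real k - real l) * t) / 2 - cos (real (k + l + 2) * t) / 2 = sin (real (Suc k) * t) * sin (real (Suc l) * t)"
   using cos_diff[of "real (Suc k) * t" "real (Suc l) * t"] cos_add[of "real (Suc k) * t" "real (Suc l) * t"] by (simp add: algebra_simps)
  ultimately show ?thesis by simp
 qed
 have Fc: "continuous_on S F" for S using F by (intro DERIV_continuous_on) (auto intro: has_field_derivative_at_within)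
 have "((%x. poly (chebU k) x * (poly (chebU l) x * sqrt (1 - x\<^sup>2))) has_integral (- F (arccos 1) - - F (arccos (-1)))) {-1..1}"
 proof (rule fundamental_theorem_of_calculus_interior)
  show "continuous_on {-1..1} (%x. - F (arccos x))" by (intro continuous_intros continuous_on_compose2[OF Fc[of UNIV]]) auto
  fix x :: real assume x: "x \<in> {-1<..<1}"
  define t where "t = arccos x"
  have t: "x = cos t" "sin t = sqrt (1 - x\<^sup>2)" using x by (auto simp: t_def sin_arccos)
  have s: "0 < sqrt (1 - x\<^sup>2)" using x by (auto simp: abs_square_less_1 abs_less_iff)
  have "((%x. - F (arccos x)) has_real_derivative - (sin (real (Suc k) * t) * sin (real (Suc l) * t) * inverse (- sqrt (1 - x\<^sup>2)))) (at x)"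
   unfolding t_def by (rule DERIV_minus[OF DERIV_chain2[OF F DERIV_arccos]]) (use x in auto)
  moreover have "- (sin (real (Suc k) * t) * sin (real (Suc l) * t) * inverse (- sqrt (1 - x\<^sup>2)))
    = poly (chebU k) x * (poly (chebU l) x * sqrt (1 - x\<^sup>2))" unfolding poly_chebU_cos[symmetric] using s t by (simp add: field_simps)
  ultimately show "((%x. - F (arccos x)) has_vector_derivative poly (chebU k) x * (poly (chebU l) x * sqrt (1 - x\<^sup>2))) (at x)"
   by (simp add: has_real_derivative_iff_has_vector_derivative)
 qed simp
 moreover have "- F (arccos 1) - - F (arccos (-1)) = (if k = l then pi / 2 else 0)"
 proof -
  have "sin ((real k - real l) * pi) = 0" by (simp add: sin_times_pi_eq_0)
  moreover have "sin (real m * pi) = 0" for m by simp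
  from this[of "2 * Suc k"] this[of "k + l + 2"] have "sin (2 * real (Suc k) * pi) = 0" "sin (real (k + l + 2) * pi) = 0"
   by (simp_all only: of_nat_mult of_nat_numeral)
  ultimately show ?thesis by (auto simp: F_def)
 qed
 ultimately show ?thesis by simp
qed

lemma abs_chebU_weight_le_1: "x \<in> {-1..1} ==> \<bar>poly (chebU k) x * sqrt (1 - x\<^sup>2)\<bar> <= 1"
 using poly_chebU_cos[of "arccos x" k] by (simp add: sin_arccos mult.commute)

text \<open>The second kind is chosen because U_l times its weight sqrt(1 - x^2) is a sine and so at
  most 1; coefficients are then controlled by the unweighted L1 norm.\<close>

lemma chebU_coeff_bound:
 assumes R: "R = (\<Sum>k<N. smult (c k) (chebU k))" and l: "l < N"
 shows "\<bar>c l\<bar> <= integral {-1..1} (%x. \<bar>poly R x\<bar>)"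
proof -
 have "((%x. \<Sum>k<N. c k * (poly (chebU k) x * (poly (chebU l) x * sqrt (1 - x\<^sup>2)))) has_integral
   (\<Sum>k<N. c k * (if k = l then pi / 2 else 0))) {-1..1}" by (intro has_integral_sum has_integral_mult_right chebU_orthogonal) auto
 also have "(%x. \<Sum>k<N. c k * (poly (chebU k) x * (poly (chebU l) x * sqrt (1 - x\<^sup>2))))
   = (%x. poly R x * (poly (chebU l) x * sqrt (1 - x\<^sup>2)))" by (simp add: R poly_sum sum_distrib_right mult.assoc fun_eq_iff)
 also have "(\<Sum>k<N. c k * (if k = l then pi / 2 else 0)) = c l * (pi / 2)" using l by (simp add: if_distrib sum.delta cong: if_cong)
 finally have hi: "((%x. poly R x * (poly (chebU l) x * sqrt (1 - x\<^sup>2))) has_integral c l * (pi / 2)) {-1..1}" .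
 have "norm (integral {-1..1} (%x. poly R x * (poly (chebU l) x * sqrt (1 - x\<^sup>2)))) <= integral {-1..1} (%x. \<bar>poly R x\<bar>)"
 proof (rule integral_norm_bound_integral)
  show "(%x. poly R x * (poly (chebU l) x * sqrt (1 - x\<^sup>2))) integrable_on {-1..1}" using hi by blast
  show "(%x. \<bar>poly R x\<bar>) integrable_on {-1..1}" by (intro integrable_continuous_interval continuous_intros)
  fix x :: real assume x: "x \<in> {-1..1}"
  have "\<bar>poly R x\<bar> * \<bar>poly (chebU l) x * sqrt (1 - x\<^sup>2)\<bar> <= \<bar>poly R x\<bar> * 1"
   by (rule mult_left_mono[OF abs_chebU_weight_le_1[OF x]]) simp
  then show "norm (poly R x * (poly (chebU l) x * sqrt (1 - x\<^sup>2))) <= \<bar>poly R x\<bar>" by (simp add: abs_mult)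
 qed
 then have "\<bar>c l\<bar> * (pi / 2) <= integral {-1..1} (%x. \<bar>poly R x\<bar>)" using hi by (simp add: integral_unique abs_mult)
 moreover have "\<bar>c l\<bar> * 1 <= \<bar>c l\<bar> * (pi / 2)" using pi_ge_two by (intro mult_left_mono) auto
 ultimately show ?thesis by simp
qed

text \<open>Each U_k is the derivative of T_(k+1) divided by k + 1, so its \<open>j\<close>-th
  derivative is bounded by \<open>1 / rho N x ^ Suc j\<close> with a gain of 1 / N. The
  \<open>N\<close> terms of the expansion consume exactly this gain.\<close>

lemma poly_deriv_bound_unweighted:
 obtains C where "0 <= C"
  and "\<And>N R x. 1 <= N ==> (\<And>i. N <= i ==> coeff R i = 0) ==> x \<in> {-1..1} ==>
   \<bar>poly ((pderiv ^^ j) R) x\<bar> <= C / rho N x ^ Suc j * integral {-1..1} (%z. \<bar>poly R z\<bar>)"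
proof (rule chebT_deriv_bound[of "Suc j"], goal_cases)
 case (1 C)
 note C = 1(2) 1(3)
 show thesis
 proof (rule that[OF C(1)], goal_cases)
  case (1 N R x)
  note N = 1(1) and R = 1(2) and x = 1(3)
  define I where "I = integral {-1..1} (%z. \<bar>poly R z\<bar>)"
  note rp = rho_pos[OF N x]
  from chebU_expand[OF R] obtain c where c: "R = (\<Sum>k<N. smult (c k) (chebU k))" by blast
  have U: "\<bar>poly ((pderiv ^^ j) (chebU k)) x\<bar> <= C / rho N x ^ Suc j / real N" if "k < N" for k
  proof -
   have "(pderiv ^^ Suc j) (chebT (Suc k)) = smult (real (Suc k)) ((pderiv ^^ j) (chebU k))" unfolding funpow_Suc_right comp_def pderiv_chebT higher_pderiv_smult ..
   then have "real (Suc k) * \<bar>poly ((pderiv ^^ j) (chebU k)) x\<bar> = \<bar>poly ((pderiv ^^ Suc j) (chebT (Suc k))) x\<bar>" by (simp add: abs_mult)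
   also have "... <= C * (real (Suc k) / real N / rho N x) ^ Suc j" using that N x by (intro C(2)) auto
   also have "... = C * ((real (Suc k) / real N) ^ j * (real (Suc k) / real N)) / rho N x ^ Suc j" by (simp add: power_divide power_mult_distrib ac_simps)
   also have "... <= C * (1 * (real (Suc k) / real N)) / rho N x ^ Suc j"
    using C(1) that rp by (intro divide_right_mono mult_left_mono mult_right_mono power_le_one) auto
   also have "... = real (Suc k) * (C / rho N x ^ Suc j / real N)" by (simp add: ac_simps)
   finally show ?thesis by (rule mult_left_le_imp_le) simp
  qed
  have "\<bar>poly ((pderiv ^^ j) R) x\<bar> = \<bar>\<Sum>k<N. c k * poly ((pderiv ^^ j) (chebU k)) x\<bar>"
   by (subst c) (simp add: higher_pderiv_sum higher_pderiv_smult poly_sum)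
  also have "... <= (\<Sum>k<N. \<bar>c k * poly ((pderiv ^^ j) (chebU k)) x\<bar>)" by (rule sum_abs)
  also have "... <= (\<Sum>k<N. I * (C / rho N x ^ Suc j / real N))"
  proof (intro sum_mono)
   fix k assume "k \<in> {..<N}"
   then have k: "k < N" by simp
   show "\<bar>c k * poly ((pderiv ^^ j) (chebU k)) x\<bar> <= I * (C / rho N x ^ Suc j / real N)"
    unfolding abs_mult I_def using chebU_coeff_bound[OF c k] U[OF k] by (intro mult_mono) (auto intro: order_trans[OF abs_ge_zero])
  qed
  also have "... = C / rho N x ^ Suc j * I" using N by simp
  finally show ?case by (simp add: I_def)
 qed
qed

section \<open>Localised bounds for derivatives of polynomials\<close>

text \<open>With nonnegative coefficients the maximum and the sum of the coefficients are both the
  value at 0, and the property passes to products. So powers of the Fejer kernel need no explicit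
  coefficients.\<close>

definition cospoly :: "nat \<Rightarrow> (real \<Rightarrow> real) \<Rightarrow> bool" where
 "cospoly N J \<longleftrightarrow> (\<exists>a. (\<forall>k. 0 <= a k) \<and> (\<forall>u. J u = (\<Sum>k\<le>N. a k * cos (real k * u))))"

lemma cospoly_cos: "k <= N ==> cospoly N (%u. cos (real k * u))" unfolding cospoly_def
 by (rule exI[of _ "%i. if i = k then 1 else 0"]) (simp add: if_distrib[of "%x. x * _"] sum.delta cong: if_cong)

lemma cospoly_add: "cospoly N f ==> cospoly N g ==> cospoly N (%u. f u + g u)" unfolding cospoly_def
proof (elim exE conjE)
 fix a b assume "\<forall>k. 0 <= a k" "\<forall>u. f u = (\<Sum>k\<le>N. a k * cos (real k * u))"
  "\<forall>k. 0 <= b k" "\<forall>u. g u = (\<Sum>k\<le>N. b k * cos (real k * u))"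
 then show "\<exists>c. (\<forall>k. 0 <= c k) \<and> (\<forall>u. f u + g u = (\<Sum>k\<le>N. c k * cos (real k * u)))"
  by (intro exI[of _ "%k. a k + b k"]) (simp add: sum.distrib distrib_right)
qed

lemma cospoly_cmult: "0 <= c ==> cospoly N f ==> cospoly N (%u. c * f u)" unfolding cospoly_def
proof (elim exE conjE)
 fix a assume "0 <= c" "\<forall>k. 0 <= a k" "\<forall>u. f u = (\<Sum>k\<le>N. a k * cos (real k * u))"
 then show "\<exists>d. (\<forall>k. 0 <= d k) \<and> (\<forall>u. c * f u = (\<Sum>k\<le>N. d k * cos (real k * u)))"
  by (intro exI[of _ "%k. c * a k"]) (simp add: sum_distrib_left mult.assoc)
qed

lemma cospoly_0: "cospoly N (%u. 0)" unfolding cospoly_def by (rule exI[of _ "%_. 0"]) simp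

lemma cospoly_sum: "(\<And>i. i \<in> A ==> cospoly N (f i)) ==> cospoly N (%u. \<Sum>i\<in>A. f i u)"
 by (induction A rule: infinite_finite_induct) (auto simp: cospoly_0 cospoly_add)

lemma cospoly_cos_mult:
 assumes "k <= N" "l <= M"
 shows "cospoly (N + M) (%u. cos (real k * u) * cos (real l * u))"
proof -
 have "cos (real k * u) * cos (real l * u) = 1 / 2 * cos (real (k + l) * u) + 1 / 2 * cos (real (max k l - min k l) * u)" for u
 proof -
  have "cos (real k * u - real l * u) = cos (real (max k l - min k l) * u)"
  proof (cases "k <= l")
   case True
   then have "real (max k l - min k l) * u = - (real k * u - real l * u)" by (simp add: of_nat_diff max_def min_def algebra_simps)
   then show ?thesis by (simp only: cos_minus)
  qed (simp add: of_nat_diff max_def min_def algebra_simps)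
  moreover have "cos (real (k + l) * u) = cos (real k * u) * cos (real l * u) - sin (real k * u) * sin (real l * u)" by (simp only: of_nat_add distrib_right cos_add)
  ultimately show ?thesis using cos_diff[of "real k * u" "real l * u"] by linarith
 qed
 moreover have "cospoly (N + M) (%u. 1 / 2 * cos (real (k + l) * u) + 1 / 2 * cos (real (max k l - min k l) * u))"
  using assms by (intro cospoly_add cospoly_cmult cospoly_cos) auto
 ultimately show ?thesis by simp
qed

lemma cospoly_mult:
 assumes "cospoly N f" "cospoly M g"
 shows "cospoly (N + M) (%u. f u * g u)"
proof -
 obtain a where a: "\<And>k. 0 <= a k" "\<And>u. f u = (\<Sum>k\<le>N. a k * cos (real k * u))" using assms(1) unfolding cospoly_def by blast
 obtain b where b: "\<And>k. 0 <= b k" "\<And>u. g u = (\<Sum>k\<le>M. b k * cos (real k * u))" using assms(2) unfolding cospoly_def by blast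
 have "(%u. f u * g u) = (%u. \<Sum>k\<le>N. \<Sum>l\<le>M. (a k * b l) * (cos (real k * u) * cos (real l * u)))"
 proof
  fix u
  have "f u * g u = (\<Sum>k\<le>N. \<Sum>l\<le>M. (a k * cos (real k * u)) * (b l * cos (real l * u)))" by (simp only: a(2) b(2) sum_product)
  also have "... = (\<Sum>k\<le>N. \<Sum>l\<le>M. (a k * b l) * (cos (real k * u) * cos (real l * u)))" by (intro sum.cong refl) (simp only: ac_simps)
  finally show "f u * g u = (\<Sum>k\<le>N. \<Sum>l\<le>M. (a k * b l) * (cos (real k * u) * cos (real l * u)))" .
 qed
 moreover have "cospoly (N + M) (%u. \<Sum>k\<le>N. \<Sum>l\<le>M. (a k * b l) * (cos (real k * u) * cos (real l * u)))"
  using a(1) b(1) by (intro cospoly_sum cospoly_cmult cospoly_cos_mult) auto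
 ultimately show ?thesis by simp
qed

lemma cospoly_power:
 assumes "cospoly N f"
 shows "cospoly (s * N) (%u. f u ^ s)"
proof (induction s)
 case 0
 show ?case using cospoly_cos[of 0 0] by simp
next
 case (Suc s)
 show ?case using cospoly_mult[OF assms Suc] by simp
qed

text \<open>The Fejer kernel in real form, the squared modulus of the sum of exp(i j u) over j < m,
  normalised to the value 1 at 0.\<close>

definition fejer :: "nat \<Rightarrow> real \<Rightarrow> real" where
 "fejer m u = ((\<Sum>j<m. cos (real j * u))\<^sup>2 + (\<Sum>j<m. sin (real j * u))\<^sup>2) / (real m)\<^sup>2"

lemma cospoly_fejer: "cospoly (m - 1) (fejer m)"
proof -
 have "fejer m = (%u. 1 / (real m)\<^sup>2 * (\<Sum>i<m. \<Sum>j<m. cos (real (max i j - min i j) * u)))"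
 proof
  fix u
  have c: "cos (real i * u) * cos (real j * u) + sin (real i * u) * sin (real j * u) = cos (real (max i j - min i j) * u)" for i j
  proof -
   have "cos (real i * u - real j * u) = cos (real (max i j - min i j) * u)"
   proof (cases "i <= j")
    case True
    then have "real (max i j - min i j) * u = - (real i * u - real j * u)" by (simp add: of_nat_diff max_def min_def algebra_simps)
    then show ?thesis by (simp only: cos_minus)
   qed (simp add: of_nat_diff max_def min_def algebra_simps)
   then show ?thesis by (simp add: cos_diff)
  qed
  have "(\<Sum>j<m. cos (real j * u))\<^sup>2 + (\<Sum>j<m. sin (real j * u))\<^sup>2 = (\<Sum>i<m. \<Sum>j<m. cos (real (max i j - min i j) * u))"
   unfolding power2_eq_square sum_product sum.distrib[symmetric] c ..
  then show "fejer m u = 1 / (real m)\<^sup>2 * (\<Sum>i<m. \<Sum>j<m. cos (real (max i j - min i j) * u))" by (simp add: fejer_def)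
 qed
 moreover have "cospoly (m - 1) (%u. 1 / (real m)\<^sup>2 * (\<Sum>i<m. \<Sum>j<m. cos (real (max i j - min i j) * u)))"
  by (intro cospoly_cmult cospoly_sum cospoly_cos) auto
 ultimately show ?thesis by simp
qed

lemma fejer_nonneg: "0 <= fejer m u" by (simp add: fejer_def)

lemma fejer_0: "1 <= m ==> fejer m 0 = 1" by (simp add: fejer_def)

lemma fejer_le_1: "1 <= m ==> fejer m u <= 1"
proof -
 assume m: "1 <= m"
 obtain a where a: "\<And>k. 0 <= a k" "\<And>u. fejer m u = (\<Sum>k\<le>m - 1. a k * cos (real k * u))" using cospoly_fejer[of m] unfolding cospoly_def by metis
 have "fejer m u <= (\<Sum>k\<le>m - 1. a k * 1)" unfolding a(2) by (intro sum_mono mult_left_mono a(1)) auto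
 also have "... = fejer m 0" by (simp add: a(2))
 finally show ?thesis using fejer_0[OF m] by simp
qed

text \<open>Multiplication by 2 sin(u/2) telescopes both trigonometric sums, and the squares of the
  results add up to 2 - 2 cos(m u), which is at most 4.\<close>

lemma fejer_sin: "(sin (u / 2))\<^sup>2 * fejer m u <= 1 / (real m)\<^sup>2"
proof -
 define C S where "C = (\<Sum>j<m. cos (real j * u))" and "S = (\<Sum>j<m. sin (real j * u))"
 have C: "2 * sin (u / 2) * C = sin ((real m - 1 / 2) * u) + sin (u / 2)" unfolding C_def
 proof (induction m)
  case 0
  have "sin (- (u / 2)) = - sin (u / 2)" by (rule sin_minus)
  then show ?case by simp
 next
  case (Suc m)
  have "2 * sin (u / 2) * cos (real m * u) = sin ((real (Suc m) - 1 / 2) * u) - sin ((real m - 1 / 2) * u)"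
   using sin_add[of "real m * u" "u / 2"] sin_diff[of "real m * u" "u / 2"] by (simp add: algebra_simps add_divide_distrib[symmetric])
  then show ?case using Suc by (simp add: distrib_left)
 qed
 have S: "2 * sin (u / 2) * S = cos (u / 2) - cos ((real m - 1 / 2) * u)" unfolding S_def
 proof (induction m)
  case 0
  have "cos (- (u / 2)) = cos (u / 2)" by (rule cos_minus)
  then show ?case by simp
 next
  case (Suc m)
  have "2 * sin (u / 2) * sin (real m * u) = cos ((real m - 1 / 2) * u) - cos ((real (Suc m) - 1 / 2) * u)"
   using cos_add[of "real m * u" "u / 2"] cos_diff[of "real m * u" "u / 2"] by (simp add: algebra_simps add_divide_distrib[symmetric])
  then show ?case using Suc by (simp add: distrib_left)
 qed
 have "4 * ((sin (u / 2))\<^sup>2 * (C\<^sup>2 + S\<^sup>2)) = (2 * sin (u / 2) * C)\<^sup>2 + (2 * sin (u / 2) * S)\<^sup>2"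
  by (simp add: power2_eq_square algebra_simps)
 also have "... = ((sin ((real m - 1 / 2) * u))\<^sup>2 + (cos ((real m - 1 / 2) * u))\<^sup>2) + ((sin (u / 2))\<^sup>2 + (cos (u / 2))\<^sup>2)
   - 2 * (cos ((real m - 1 / 2) * u) * cos (u / 2) - sin ((real m - 1 / 2) * u) * sin (u / 2))" unfolding C S power2_eq_square by (simp add: algebra_simps)
 also have "... = 2 - 2 * cos ((real m - 1 / 2) * u + u / 2)" by (simp add: cos_add)
 also have "... <= 4" using cos_ge_minus_one[of "(real m - 1 / 2) * u + u / 2"] by linarith
 finally have "(sin (u / 2))\<^sup>2 * (C\<^sup>2 + S\<^sup>2) <= 1" by simp
 then have "(sin (u / 2))\<^sup>2 * (C\<^sup>2 + S\<^sup>2) / (real m)\<^sup>2 <= 1 / (real m)\<^sup>2" by (intro divide_right_mono) auto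
 then show ?thesis by (simp add: fejer_def C_def S_def)
qed

text \<open>For \<open>real m * d\<close> up to pi the trivial bound 1 is enough; beyond that
  \<open>fejer_sin\<close> applies. The hypothesis is in terms of \<open>d\<close> so that it serves
  differences and sums of angles alike.\<close>

lemma fejer_decay:
 assumes m: "1 <= m" and d: "0 <= d" "d / pi <= \<bar>sin (u / 2)\<bar>"
 shows "fejer m u <= ((1 + pi) / (1 + real m * d))\<^sup>2"
proof (cases "real m * d <= pi")
 case True
 have "1 <= (1 + pi) / (1 + real m * d)" using True d by (subst pos_le_divide_eq) (auto intro!: add_pos_nonneg)
 then have "1 <= ((1 + pi) / (1 + real m * d))\<^sup>2" using power_mono[of 1 _ 2] by fastforce
 then show ?thesis using fejer_le_1[OF m, of u] by linarith
next
 case False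
 then have md: "pi < real m * d" by simp
 then have d0: "0 < d" using m by (metis mult_zero_right not_less pi_gt_zero less_asym d(1) order_le_less)
 have "(d / pi)\<^sup>2 * fejer m u <= (sin (u / 2))\<^sup>2 * fejer m u"
  using d by (intro mult_right_mono fejer_nonneg) (metis abs_le_square_iff abs_of_nonneg divide_nonneg_pos pi_gt_zero)
 also have "... <= 1 / (real m)\<^sup>2" by (rule fejer_sin)
 finally have "(d / pi)\<^sup>2 * fejer m u <= 1 / (real m)\<^sup>2" .
 moreover have "0 < (d / pi)\<^sup>2" using d0 by simp
 ultimately have "fejer m u <= 1 / (real m)\<^sup>2 / (d / pi)\<^sup>2" by (simp only: pos_le_divide_eq mult.commute)
 also have "... = (pi / (real m * d))\<^sup>2" by (simp add: power_divide power_mult_distrib)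
 also have "... <= ((1 + pi) / (1 + real m * d))\<^sup>2"
 proof -
  define X where "X = real m * d"
  have "pi < X" using md by (simp add: X_def)
  moreover from this have "0 < X" using pi_gt_zero by linarith
  ultimately have X: "pi < X" "0 < X" "0 < 1 + X" by simp_all
  have "pi * (1 + X) <= (1 + pi) * X" using X(1) by (simp add: algebra_simps)
  then have "pi <= (1 + pi) * X / (1 + X)" by (simp only: pos_le_divide_eq[OF X(3)])
  then have "pi / X <= (1 + pi) / (1 + X)" by (simp only: pos_divide_le_eq[OF X(2)] times_divide_eq_left)
  moreover have "0 <= pi / X" by (rule divide_nonneg_pos) (use X in auto)
  ultimately show ?thesis unfolding X_def[symmetric] by (intro power_mono)
 qed
 finally show ?thesis .
qed

text \<open>All cosines in the sum are at least cos(pi/3) = 1/2 on this range. This bounds from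
  below the mass by which the step polynomials are normalised.\<close>

lemma fejer_ge:
 assumes m: "1 <= m" and u: "\<bar>u\<bar> <= 1 / real m"
 shows "1 / 4 <= fejer m u"
proof -
 have "1 / 2 <= cos (real j * u)" if "j < m" for j
 proof -
  have "\<bar>real j * u\<bar> <= real m * (1 / real m)" unfolding abs_mult using that u by (intro mult_mono) auto
  also have "... <= pi / 3" using m pi_gt3 by simp
  finally have "cos (pi / 3) <= cos \<bar>real j * u\<bar>" using pi_gt_zero by (intro cos_monotone_0_pi_le) auto
  then show ?thesis by (simp add: cos_60)
 qed
 then have "(\<Sum>j<m. 1 / 2) <= (\<Sum>j<m. cos (real j * u))" by (intro sum_mono) auto
 then have "(real m / 2)\<^sup>2 <= (\<Sum>j<m. cos (real j * u))\<^sup>2" by (intro power_mono) auto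
 then have "(real m / 2)\<^sup>2 <= (\<Sum>j<m. cos (real j * u))\<^sup>2 + (\<Sum>j<m. sin (real j * u))\<^sup>2" by (simp add: add_increasing2)
 then have "(real m / 2)\<^sup>2 / (real m)\<^sup>2 <= fejer m u" unfolding fejer_def by (rule divide_right_mono) simp
 then show ?thesis using m by (simp add: power_divide)
qed

lemma continuous_on_tau: "continuous_on {-1..1} (%z. tau n x z)" unfolding tau_def by (intro continuous_intros) auto

lemma continuous_on_poly_tau: "continuous_on {-1..1} (%z. \<bar>poly Q z\<bar> / (1 + tau m x z) ^ k)" for Q :: "real poly"
proof (intro continuous_on_divide continuous_on_rabs continuous_on_power continuous_on_add continuous_on_const continuous_on_tau ballI)
 fix z
 have "0 < 1 + tau m x z" by (simp add: add_pos_nonneg)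
 then show "(1 + tau m x z) ^ k \<noteq> 0" by simp
qed (intro continuous_intros)

lemma rho_scale:
 assumes S: "1 <= S" and x: "x \<in> {-1..1}"
 shows "rho m x <= (real S)\<^sup>2 * rho (S * m) x"
proof -
 have "1 * (phi x / real m) <= real S * (phi x / real m)" using S phi_nonneg[OF x] by (intro mult_right_mono) auto
 moreover have "(real S)\<^sup>2 * rho (S * m) x = real S * (phi x / real m) + 1 / (real m)\<^sup>2" using S by (simp add: rho_phi distrib_left power2_eq_square)
 ultimately show ?thesis by (simp add: rho_phi)
qed

text \<open>The peak function at \<open>x\<close> is the sum of Fejer powers at \<open>t - z\<close>
  and \<open>t + z\<close>: it is even in \<open>z\<close>, hence an algebraic polynomial in
  \<open>cos z\<close>, and both summands are nonnegative. Its Chebyshev coefficients sum in modulus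
  to at most 2, so its derivatives at \<open>x\<close> obey the Chebyshev bounds.\<close>

lemma localizer:
 obtains Cg where "\<And>i. 0 <= Cg i"
  and "\<And>m x. 1 <= m ==> x \<in> {-1..1} ==> \<exists>G. degree G <= s * (m - 1) \<and> 1 <= poly G x
    \<and> (\<forall>z\<in>{-1..1}. \<bar>poly G z\<bar> <= 2 * (1 + pi) ^ (2 * s) / (1 + tau m x z) ^ (2 * s))
    \<and> (\<forall>i. \<bar>poly ((pderiv ^^ i) G) x\<bar> <= Cg i / rho m x ^ i)"
proof -
 have "\<forall>i. \<exists>C\<ge>0. \<forall>N n x. 1 <= N \<longrightarrow> n <= N \<longrightarrow> x \<in> {-1..1} \<longrightarrow>
   \<bar>poly ((pderiv ^^ i) (chebT n)) x\<bar> <= C * (real n / real N / rho N x) ^ i" using chebT_deriv_bound by metis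
 then obtain C where C: "\<And>i. 0 <= C i" "\<And>i N n x. 1 <= N ==> n <= N ==> x \<in> {-1..1} ==>
   \<bar>poly ((pderiv ^^ i) (chebT n)) x\<bar> <= C i * (real n / real N / rho N x) ^ i" by metis
 \<comment> \<open>Keeps the comparison degree \<open>S * m\<close> positive when
   \<open>s = 0\<close>.\<close>
 define S where "S = max 1 s"
 have S1: "1 <= S" by (simp add: S_def)
 define Cg where "Cg i = 2 * (C i * (real S)\<^sup>2 ^ i)" for i
 have ex: "\<exists>G. degree G <= s * (m - 1) \<and> 1 <= poly G x
    \<and> (\<forall>z\<in>{-1..1}. \<bar>poly G z\<bar> <= 2 * (1 + pi) ^ (2 * s) / (1 + tau m x z) ^ (2 * s))
    \<and> (\<forall>i. \<bar>poly ((pderiv ^^ i) G) x\<bar> <= Cg i / rho m x ^ i)"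
  if m: "1 <= m" and x: "x \<in> {-1..1}" for m x
 proof -
  define t where "t = arccos x"
  have t: "x = cos t" "0 <= t" "t <= pi" using x by (auto simp: t_def arccos_lbound arccos_ubound)
  obtain a where a: "\<And>k. 0 <= a k" "\<And>u. fejer m u ^ s = (\<Sum>k\<le>s * (m - 1). a k * cos (real k * u))"
   using cospoly_power[OF cospoly_fejer[of m], of s] unfolding cospoly_def by metis
  have sa: "(\<Sum>k\<le>s * (m - 1). a k) = 1" using a(2)[of 0] fejer_0[OF m] by simp
  define G where "G = (\<Sum>k\<le>s * (m - 1). smult (2 * (a k * cos (real k * t))) (chebT k))"
  have G: "poly G (cos z) = fejer m (t - z) ^ s + fejer m (t + z) ^ s" for z
  proof -
   have "2 * (cos (real k * t) * cos (real k * z)) = cos (real k * (t - z)) + cos (real k * (t + z))" for k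
    using cos_add[of "real k * t" "real k * z"] cos_diff[of "real k * t" "real k * z"] by (simp add: algebra_simps)
   then have "2 * (a k * cos (real k * t)) * cos (real k * z) = a k * cos (real k * (t - z)) + a k * cos (real k * (t + z))" for k
    by (simp add: distrib_left[symmetric] mult.left_commute mult.assoc)
   then show ?thesis by (simp add: G_def poly_sum poly_chebT_cos a(2) sum.distrib)
  qed
  have "degree G <= s * (m - 1)" unfolding G_def
  proof (rule degree_sum_le)
   fix k assume "k \<in> {..s * (m - 1)}"
   then have "degree (chebT k) <= s * (m - 1)" using coeff_chebT[of k] by (intro degree_le) auto
   then show "degree (smult (2 * (a k * cos (real k * t))) (chebT k)) <= s * (m - 1)" by (rule order_trans[OF degree_smult_le])
  qed simp
  moreover have "1 <= poly G x" unfolding t(1) G using fejer_0[OF m] fejer_nonneg[of m "t + t"] by simp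
  moreover have "\<forall>z\<in>{-1..1}. \<bar>poly G z\<bar> <= 2 * (1 + pi) ^ (2 * s) / (1 + tau m x z) ^ (2 * s)"
  proof
   fix z :: real assume z: "z \<in> {-1..1}"
   define y where "y = arccos z"
   have y: "z = cos y" "0 <= y" "y <= pi" using z by (auto simp: y_def arccos_lbound arccos_ubound)
   note sh = sin_half_sum_ge[OF t(2,3) y(2,3)]
   have tau: "tau m x z = real m * \<bar>t - y\<bar>" by (simp add: tau_def t_def y_def)
   have "\<bar>t - y\<bar> / pi <= \<bar>sin ((t - y) / 2)\<bar>"
   proof -
    have "\<bar>sin ((t - y) / 2)\<bar> = \<bar>sin (\<bar>t - y\<bar> / 2)\<bar>"
    proof -
     have "(t - y) / 2 = \<bar>t - y\<bar> / 2 \<or> (t - y) / 2 = - (\<bar>t - y\<bar> / 2)" by linarith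
     then show ?thesis by (elim disjE) (simp_all only: sin_minus abs_minus_cancel)
    qed
    with sh(3) show ?thesis by linarith
   qed
   then have 1: "fejer m (t - y) ^ s <= ((1 + pi) / (1 + tau m x z))\<^sup>2 ^ s" unfolding tau by (intro power_mono fejer_nonneg fejer_decay[OF m]) auto
   have 2: "fejer m (t + y) ^ s <= ((1 + pi) / (1 + tau m x z))\<^sup>2 ^ s" unfolding tau using sh(2) by (intro power_mono fejer_nonneg fejer_decay[OF m]) auto
   have "\<bar>poly G z\<bar> = fejer m (t - y) ^ s + fejer m (t + y) ^ s" unfolding y(1) G using fejer_nonneg by simp
   also have "... <= 2 * ((1 + pi) / (1 + tau m x z)) ^ (2 * s)" using 1 2 by (simp add: power_mult)
   finally show "\<bar>poly G z\<bar> <= 2 * (1 + pi) ^ (2 * s) / (1 + tau m x z) ^ (2 * s)" by (simp add: power_divide)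
  qed
  moreover have "\<forall>i. \<bar>poly ((pderiv ^^ i) G) x\<bar> <= Cg i / rho m x ^ i"
  proof
   fix i
   define N where "N = S * m"
   have N: "1 <= N" "s * (m - 1) <= N" using S1 m by (auto simp: N_def S_def intro!: mult_le_mono)
   have "rho m x <= (real S)\<^sup>2 * rho N x" unfolding N_def using S1 x by (rule rho_scale)
   then have r: "1 / rho N x <= (real S)\<^sup>2 / rho m x" using rho_pos[OF m x] rho_pos[OF N(1) x] by (simp add: field_simps)
   have T: "\<bar>poly ((pderiv ^^ i) (chebT k)) x\<bar> <= C i * ((real S)\<^sup>2 / rho m x) ^ i" if "k <= s * (m - 1)" for k
   proof -
    have k: "k <= N" using that N by simp
    have "\<bar>poly ((pderiv ^^ i) (chebT k)) x\<bar> <= C i * (real k / real N / rho N x) ^ i" by (rule C(2)[OF N(1) k x])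
    also have "... <= C i * ((real S)\<^sup>2 / rho m x) ^ i"
    proof (intro mult_left_mono power_mono C(1))
     have "real k / real N / rho N x <= 1 / rho N x" using k N rho_pos[OF N(1) x] by (intro divide_right_mono) auto
     with r show "real k / real N / rho N x <= (real S)\<^sup>2 / rho m x" by linarith
     show "0 <= real k / real N / rho N x" using rho_pos[OF N(1) x] by simp
    qed
    finally show ?thesis .
   qed
   have "\<bar>poly ((pderiv ^^ i) G) x\<bar> <= (\<Sum>k\<le>s * (m - 1). \<bar>2 * (a k * cos (real k * t)) * poly ((pderiv ^^ i) (chebT k)) x\<bar>)"
    unfolding G_def higher_pderiv_sum higher_pderiv_smult poly_sum poly_smult by (rule sum_abs)
   also have "... <= (\<Sum>k\<le>s * (m - 1). 2 * (a k * 1) * (C i * ((real S)\<^sup>2 / rho m x) ^ i))" unfolding abs_mult using T a(1)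
    by (intro sum_mono mult_mono) (auto intro!: mult_left_le)
   also have "... = (\<Sum>k\<le>s * (m - 1). a k) * (2 * (C i * ((real S)\<^sup>2 / rho m x) ^ i))" unfolding sum_distrib_right by (intro sum.cong refl) simp
   also have "... = Cg i / rho m x ^ i" unfolding sa by (simp add: Cg_def power_divide)
   finally show "\<bar>poly ((pderiv ^^ i) G) x\<bar> <= Cg i / rho m x ^ i" .
  qed
  ultimately show ?thesis by blast
 qed
 have "0 <= Cg i" for i using C(1) by (simp add: Cg_def)
 with ex that show thesis by blast
qed

text \<open>The unweighted bound is applied to \<open>Q * G\<close> with the peak polynomial
  \<open>G\<close> at \<open>x\<close>, which localises the integral at the cost of a fixed factor
  in the degree. Strong induction on the order then removes \<open>G\<close> through Leibniz'
  rule.\<close>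

lemma poly_deriv_bound:
 obtains C where "0 <= C"
  and "\<And>m Q x. 1 <= m ==> degree Q < m ==> x \<in> {-1..1} ==>
   \<bar>poly ((pderiv ^^ j) Q) x\<bar>
    <= C / rho m x ^ Suc j * integral {-1..1} (%z. \<bar>poly Q z\<bar> / (1 + tau m x z) ^ (2 * s))"
proof -
 define I where "I m Q x = integral {-1..1} (%z. \<bar>poly Q z\<bar> / (1 + tau m x z) ^ (2 * s))" for m :: nat and Q :: "real poly" and x
 obtain Cg where Cg: "\<And>i. 0 <= Cg i"
  and Gex: "\<And>m x. 1 <= m ==> x \<in> {-1..1} ==> \<exists>G. degree G <= s * (m - 1) \<and> 1 <= poly G x
    \<and> (\<forall>z\<in>{-1..1}. \<bar>poly G z\<bar> <= 2 * (1 + pi) ^ (2 * s) / (1 + tau m x z) ^ (2 * s))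
    \<and> (\<forall>i. \<bar>poly ((pderiv ^^ i) G) x\<bar> <= Cg i / rho m x ^ i)" using localizer[of s] by metis
 have I0: "0 <= I m Q x" for m Q x unfolding I_def by (intro integral_nonneg integrable_continuous_interval continuous_on_poly_tau)
    (simp add: add_nonneg_nonneg)
 have "\<exists>C\<ge>0. \<forall>m Q x. 1 <= m \<longrightarrow> degree Q < m \<longrightarrow> x \<in> {-1..1} \<longrightarrow>
   \<bar>poly ((pderiv ^^ j) Q) x\<bar> <= C / rho m x ^ Suc j * I m Q x"
 proof (induction j rule: less_induct)
  case (less j)
  then have "\<forall>i. \<exists>C. i < j \<longrightarrow> 0 <= C \<and> (\<forall>m Q x. 1 <= m \<longrightarrow> degree Q < m \<longrightarrow> x \<in> {-1..1} \<longrightarrow>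
   \<bar>poly ((pderiv ^^ i) Q) x\<bar> <= C / rho m x ^ Suc i * I m Q x)" by blast
  then obtain Cq where Cq: "\<And>i. i < j ==> 0 <= Cq i" "\<And>i m Q x. i < j ==> 1 <= m ==> degree Q < m ==> x \<in> {-1..1} ==>
   \<bar>poly ((pderiv ^^ i) Q) x\<bar> <= Cq i / rho m x ^ Suc i * I m Q x" by metis
  obtain C0 where C0: "0 <= C0" "\<And>N R x. 1 <= N ==> (\<And>i. N <= i ==> coeff R i = 0) ==> x \<in> {-1..1} ==>
   \<bar>poly ((pderiv ^^ j) R) x\<bar> <= C0 / rho N x ^ Suc j * integral {-1..1} (%z. \<bar>poly R z\<bar>)"
   using poly_deriv_bound_unweighted[of j] by metis
  define Ca where "Ca = C0 * (real (s + 1))\<^sup>2 ^ Suc j * (2 * (1 + pi) ^ (2 * s))"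
  define C where "C = Ca + (\<Sum>i<j. real (j choose i) * (Cq i * Cg (j - i)))"
  have C: "0 <= C" using C0(1) Cq(1) Cg by (auto simp: C_def Ca_def intro!: add_nonneg_nonneg sum_nonneg)
  have "\<bar>poly ((pderiv ^^ j) Q) x\<bar> <= C / rho m x ^ Suc j * I m Q x"
   if m: "1 <= m" and Q: "degree Q < m" and x: "x \<in> {-1..1}" for m Q x
  proof -
   note rm = rho_pos[OF m x]
   obtain G where G: "degree G <= s * (m - 1)" "1 <= poly G x"
    "\<And>z. z \<in> {-1..1} ==> \<bar>poly G z\<bar> <= 2 * (1 + pi) ^ (2 * s) / (1 + tau m x z) ^ (2 * s)"
    "\<And>i. \<bar>poly ((pderiv ^^ i) G) x\<bar> <= Cg i / rho m x ^ i" using Gex[OF m x] by blast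
   define N where "N = (s + 1) * m"
   have N: "1 <= N" using m by (simp add: N_def)
   have "degree (Q * G) < N"
   proof -
    have "degree (Q * G) <= degree Q + degree G" by (rule degree_mult_le)
    also have "... < m + s * (m - 1)" using Q G(1) by simp
    also have "... <= N" unfolding N_def by (simp add: algebra_simps)
    finally show ?thesis .
   qed
   then have co: "coeff (Q * G) i = 0" if "N <= i" for i using that by (intro coeff_eq_0) simp
   have rN: "1 / rho N x <= (real (s + 1))\<^sup>2 / rho m x"
   proof -
    have "rho m x <= (real (s + 1))\<^sup>2 * rho N x" unfolding N_def using x by (intro rho_scale) auto
    then show ?thesis using rm rho_pos[OF N x] by (simp add: field_simps)
   qed
   have R: "\<bar>poly ((pderiv ^^ j) (Q * G)) x\<bar> <= Ca / rho m x ^ Suc j * I m Q x"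
   proof -
    have "integral {-1..1} (%z. \<bar>poly (Q * G) z\<bar>) <=
      integral {-1..1} (%z. 2 * (1 + pi) ^ (2 * s) * (\<bar>poly Q z\<bar> / (1 + tau m x z) ^ (2 * s)))"
    proof (rule integral_le)
     show "(%z. \<bar>poly (Q * G) z\<bar>) integrable_on {-1..1}" by (intro integrable_continuous_interval continuous_intros)
     show "(%z. 2 * (1 + pi) ^ (2 * s) * (\<bar>poly Q z\<bar> / (1 + tau m x z) ^ (2 * s))) integrable_on {-1..1}"
      by (intro integrable_continuous_interval continuous_on_mult_left continuous_on_poly_tau)
     fix z :: real assume z: "z \<in> {-1..1}"
     show "\<bar>poly (Q * G) z\<bar> <= 2 * (1 + pi) ^ (2 * s) * (\<bar>poly Q z\<bar> / (1 + tau m x z) ^ (2 * s))"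
      using mult_left_mono[OF G(3)[OF z], of "\<bar>poly Q z\<bar>"] by (simp add: abs_mult ac_simps)
    qed
    also have "... = 2 * (1 + pi) ^ (2 * s) * I m Q x" by (simp only: integral_mult_right I_def)
    finally have i: "integral {-1..1} (%z. \<bar>poly (Q * G) z\<bar>) <= 2 * (1 + pi) ^ (2 * s) * I m Q x" .
    have "\<bar>poly ((pderiv ^^ j) (Q * G)) x\<bar> <= C0 / rho N x ^ Suc j * integral {-1..1} (%z. \<bar>poly (Q * G) z\<bar>)"
     by (rule C0(2)[OF N co x])
    also have "... <= (C0 * ((real (s + 1))\<^sup>2 / rho m x) ^ Suc j) * (2 * (1 + pi) ^ (2 * s) * I m Q x)"
    proof (rule mult_mono[OF _ i])
     have "(1 / rho N x) ^ Suc j <= ((real (s + 1))\<^sup>2 / rho m x) ^ Suc j" using rN rho_pos[OF N x] by (intro power_mono) auto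
     from mult_left_mono[OF this C0(1)]
     show "C0 / rho N x ^ Suc j <= C0 * ((real (s + 1))\<^sup>2 / rho m x) ^ Suc j" by (simp add: power_divide)
     show "0 <= C0 * ((real (s + 1))\<^sup>2 / rho m x) ^ Suc j" using C0(1) rm by simp
     show "0 <= integral {-1..1} (%z. \<bar>poly (Q * G) z\<bar>)" by (intro integral_nonneg integrable_continuous_interval continuous_intros) auto
    qed
    also have "... = Ca / rho m x ^ Suc j * I m Q x" unfolding Ca_def power_divide by simp
    finally show ?thesis .
   qed
   define a where "a i = poly ((pderiv ^^ i) Q) x" for i
   define b where "b i = poly ((pderiv ^^ i) G) x" for i
   have "poly ((pderiv ^^ j) (Q * G)) x = (\<Sum>i\<le>j. real (j choose i) * (a i * b (j - i)))" by (simp add: higher_pderiv_mult poly_sum a_def b_def)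
   also have "... = (\<Sum>i<j. real (j choose i) * (a i * b (j - i))) + a j * b 0" by (simp add: lessThan_Suc_atMost[symmetric])
   finally have "a j * b 0 = poly ((pderiv ^^ j) (Q * G)) x - (\<Sum>i<j. real (j choose i) * (a i * b (j - i)))" by simp
   then have "\<bar>a j * b 0\<bar> <= \<bar>poly ((pderiv ^^ j) (Q * G)) x\<bar> + \<bar>\<Sum>i<j. real (j choose i) * (a i * b (j - i))\<bar>"
    using abs_triangle_ineq4 by metis
   also have "... <= Ca / rho m x ^ Suc j * I m Q x + (\<Sum>i<j. real (j choose i) * (Cq i * Cg (j - i)) * (I m Q x / rho m x ^ Suc j))"
   proof (intro add_mono R order_trans[OF sum_abs] sum_mono)
    fix i assume "i \<in> {..<j}"
    then have i: "i < j" by simp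
    have "\<bar>a i\<bar> * \<bar>b (j - i)\<bar> <= (Cq i / rho m x ^ Suc i * I m Q x) * (Cg (j - i) / rho m x ^ (j - i))"
     unfolding a_def b_def using Cq(1)[OF i] I0 rm by (intro mult_mono Cq(2)[OF i m Q x] G(4)) auto
    also have "... = (Cq i * Cg (j - i)) * (I m Q x / rho m x ^ Suc j)"
    proof -
     have "rho m x ^ Suc j = rho m x ^ Suc i * rho m x ^ (j - i)" using i by (simp add: power_add[symmetric])
     then show ?thesis by (simp only: times_divide_eq_left times_divide_eq_right divide_divide_eq_left ac_simps)
    qed
    finally show "\<bar>real (j choose i) * (a i * b (j - i))\<bar> <= real (j choose i) * (Cq i * Cg (j - i)) * (I m Q x / rho m x ^ Suc j)"
     using mult_left_mono[of "\<bar>a i\<bar> * \<bar>b (j - i)\<bar>" _ "real (j choose i)"] by (simp only: abs_mult abs_of_nat mult.assoc of_nat_0_le_iff)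
   qed
   also have "... = C / rho m x ^ Suc j * I m Q x" by (simp add: C_def sum_distrib_right distrib_right add_divide_distrib sum_divide_distrib)
   finally have "\<bar>a j\<bar> * \<bar>b 0\<bar> <= C / rho m x ^ Suc j * I m Q x" by (simp add: abs_mult)
   moreover have "\<bar>a j\<bar> * 1 <= \<bar>a j\<bar> * \<bar>b 0\<bar>" using G(2) by (intro mult_left_mono) (auto simp: b_def)
   ultimately show ?thesis by (simp add: a_def)
  qed
  with C show ?case by blast
 qed
 then show thesis using that unfolding I_def by blast
qed

section \<open>Weighted bounds for symmetric differences\<close>

text \<open>Both end points in [-1,1] mean \<open>K * phi x\<close> at most 1 - |x|; after squaring,
  the factor 1 - |x| of phi^2 cancels.\<close>

lemma abs_add_phi_le:
 fixes K x :: real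
 assumes K: "0 < K" and x: "-1 < x" "x < 1" and d: "x - K * phi x \<in> {-1..1}" "x + K * phi x \<in> {-1..1}"
 shows "K\<^sup>2 * (1 + \<bar>x\<bar>) <= 1 - \<bar>x\<bar>"
proof -
 have p: "0 <= phi x" using x by (intro phi_nonneg) auto
 have 1: "K * phi x <= 1 - \<bar>x\<bar>" using d by (auto simp: abs_if)
 have "(K * phi x)\<^sup>2 <= (1 - \<bar>x\<bar>)\<^sup>2" using 1 p K by (intro power_mono) auto
 moreover have "(phi x)\<^sup>2 = (1 - \<bar>x\<bar>) * (1 + \<bar>x\<bar>)" using phi_sq[of x] x by (simp add: power2_eq_square algebra_simps abs_mult_self_eq)
 ultimately have "(1 - \<bar>x\<bar>) * (K\<^sup>2 * (1 + \<bar>x\<bar>)) <= (1 - \<bar>x\<bar>) * (1 - \<bar>x\<bar>)"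
  by (simp add: power_mult_distrib power2_eq_square ac_simps)
 moreover have "0 < 1 - \<bar>x\<bar>" using x by auto
 ultimately show ?thesis using mult_le_cancel_left_pos by blast
qed

text \<open>On the domain of the difference the map from \<open>x\<close> to
  \<open>x + c * K * phi x\<close> has derivative at least 1/2, so a change of variables costs a
  factor 2. The domain is an interval \<open>{-x0..x0}\<close> together with the two endpoints,
  where \<open>phi\<close> vanishes and which form a null set.\<close>

lemma nn_integral_shift_phi:
 fixes H :: "real \<Rightarrow> ennreal" and c K :: real
 assumes [measurable]: "H \<in> borel_measurable borel" and K: "0 < K" and c: "\<bar>c\<bar> <= 1"
 shows "(LN x. H (x + c * K * phi x) * indicator {x \<in> {-1..1}. x - K * phi x \<in> {-1..1} \<and> x + K * phi x \<in> {-1..1}} x)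
   <= 2 * (\<integral>\<^sup>+x\<in>{-1..1}. H x \<partial>lborel)"
proof -
 define Dom where "Dom = {x \<in> {-1..1}. x - K * phi x \<in> {-1..1} \<and> x + K * phi x \<in> {-1..1}}"
 \<comment> \<open>The solution of K^2 (1 + x) = 1 - x, the equality case of
   \<open>abs_add_phi_le\<close>.\<close>
 define x0 where "x0 = (1 - K\<^sup>2) / (1 + K\<^sup>2)"
 have K2: "0 < 1 + K\<^sup>2" by (simp add: add_pos_nonneg)
 have x01: "x0 < 1" using K K2 by (simp add: x0_def field_simps)
 have x0e: "K\<^sup>2 * (1 + x0) = 1 - x0" using K2 by (simp add: x0_def field_simps)
 have le: "\<bar>x\<bar> <= x0" if "K\<^sup>2 * (1 + \<bar>x\<bar>) <= 1 - \<bar>x\<bar>" for x using that K2 by (simp add: x0_def field_simps)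
 have ge: "K\<^sup>2 * (1 + \<bar>x\<bar>) <= 1 - \<bar>x\<bar>" if "\<bar>x\<bar> <= x0" for x using that K2 by (simp add: x0_def field_simps)
 have sub: "Dom \<subseteq> {-x0..x0} \<union> {-1, 1}"
 proof
  fix x assume x: "x \<in> Dom"
  show "x \<in> {-x0..x0} \<union> {-1, 1}"
  proof (cases "x = 1 \<or> x = -1")
   case False
   then have "\<bar>x\<bar> <= x0" using x by (intro le abs_add_phi_le K) (auto simp: Dom_def)
   then show ?thesis by (auto simp: abs_le_iff)
  qed auto
 qed
 define g where "g x = x + c * K * phi x" for x
 have "(LN x. H (g x) * indicator Dom x) <= (LN x. H (g x) * indicator {-x0..x0} x)"
 proof (rule nn_integral_mono_AE)
  have "AE x in lborel. x \<noteq> 1" "AE x in lborel. x \<noteq> (-1::real)" by (rule AE_lborel_singleton)+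
  then show "AE x in lborel. H (g x) * indicator Dom x <= H (g x) * indicator {-x0..x0} x"
  proof eventually_elim
   case (elim x)
   then show ?case using sub by (auto simp: indicator_def)
  qed
 qed
 also have "... <= 2 * (\<integral>\<^sup>+x\<in>{-1..1}. H x \<partial>lborel)"
 proof (cases "0 < x0")
  case False
  have "(LN x. H (g x) * indicator {-x0..x0} x) = (LN x. 0)"
  proof (rule nn_integral_cong_AE)
   have "AE x in lborel. x \<noteq> (0::real)" by (rule AE_lborel_singleton)
   then show "AE x in lborel. H (g x) * indicator {-x0..x0} x = 0" by eventually_elim (use False in \<open>auto simp: indicator_def\<close>)
  qed
  then show ?thesis by simp
 next
  case True
  define g' where "g' x = 1 + c * K * (- x / phi x)" for x
  have lt1: "\<bar>x\<bar> < 1" if "x \<in> {-x0..x0}" for x using that x01 by auto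
  have ppos: "0 < phi x" if "x \<in> {-x0..x0}" for x using lt1[OF that] by (simp add: phi_def abs_square_less_1)
  have der: "(g has_real_derivative g' x) (at x)" if "x \<in> {-x0..x0}" for x
  proof -
   have "0 < 1 - x\<^sup>2" using lt1[OF that] by (simp add: abs_square_less_1)
   then have "((%x. sqrt (1 - x\<^sup>2)) has_real_derivative inverse (sqrt (1 - x\<^sup>2)) / 2 * (- (2 * x))) (at x)"
    by (intro DERIV_chain2[OF DERIV_real_sqrt]) (auto intro!: derivative_eq_intros)
   moreover have "inverse (sqrt (1 - x\<^sup>2)) / 2 * (- (2 * x)) = - x / sqrt (1 - x\<^sup>2)" by (simp add: inverse_eq_divide)
   ultimately have "((%x. sqrt (1 - x\<^sup>2)) has_real_derivative - x / sqrt (1 - x\<^sup>2)) (at x)" by (simp only:)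
   then have "(phi has_real_derivative - x / phi x) (at x)" unfolding phi_def[abs_def] .
   then show ?thesis unfolding g_def g'_def by (intro DERIV_add DERIV_ident DERIV_cmult)
  qed
  have g'half: "1 / 2 <= g' x" if "x \<in> {-x0..x0}" for x
  proof -
   have "\<bar>x\<bar> <= x0" using that by auto
   note k = ge[OF this]
   define y where "y = \<bar>x\<bar>"
   have y: "0 <= y" "y < 1" using lt1[OF that] by (auto simp: y_def)
   \<comment> \<open>The domain condition and \<open>y <= (1 + y) / 2\<close> show that K |x| is at
     most half of \<open>phi x\<close>; this is the bound on the derivative of
     \<open>K * phi\<close>.\<close>
   have "(K * y)\<^sup>2 * (1 + y) = (K\<^sup>2 * (1 + y)) * y\<^sup>2" by (simp add: power_mult_distrib)
   also have "... <= (1 - y) * y\<^sup>2" using k by (intro mult_right_mono) (auto simp: y_def)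
   also have "... <= (1 - y) * ((1 + y) / 2)\<^sup>2" using y by (intro mult_left_mono power_mono) auto
   also have "... = ((1 - y) * (1 + y) / 4) * (1 + y)" by (simp add: power2_eq_square)
   finally have "(K * y)\<^sup>2 <= (1 - y) * (1 + y) / 4" using y by (simp add: mult_le_cancel_right)
   also have "... = (phi x / 2)\<^sup>2"
   proof -
    have "(phi x)\<^sup>2 = 1 - x\<^sup>2" using lt1[OF that] by (intro phi_sq) auto
    moreover have "(1 - y) * (1 + y) = 1 - x\<^sup>2" by (simp add: y_def algebra_simps power2_eq_square abs_mult_self_eq)
    ultimately show ?thesis by (simp add: power_divide)
   qed
   finally have "K * y <= phi x / 2" by (rule power2_le_imp_le) (use ppos[OF that] in simp)
   then have Ky: "K * y / phi x <= 1 / 2" using ppos[OF that] by (simp add: field_simps)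
   have "\<bar>c * K * (- x / phi x)\<bar> = \<bar>c\<bar> * (K * y / phi x)" using K ppos[OF that] by (simp add: abs_mult y_def abs_divide)
   also have "... <= 1 * (1 / 2)" using c Ky K y ppos[OF that] by (intro mult_mono) auto
   finally show ?thesis unfolding g'_def by linarith
  qed
  have cont: "continuous_on {-x0..x0} g'" unfolding g'_def phi_def by (intro continuous_intros) (use ppos phi_def in force)
  have phi0: "K * phi x0 = 1 - x0" "phi (- x0) = phi x0"
  proof -
   have "0 < phi x0" using True by (intro ppos) auto
   have "(K * phi x0)\<^sup>2 = (K\<^sup>2 * (1 + x0)) * (1 - x0)"
   proof -
    have "(phi x0)\<^sup>2 = (1 + x0) * (1 - x0)" using phi_sq[of x0] True x01 by (simp add: power2_eq_square algebra_simps)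
    then show ?thesis by (simp add: power_mult_distrib)
   qed
   also have "... = (1 - x0)\<^sup>2" unfolding x0e by (simp add: power2_eq_square)
   finally show "K * phi x0 = 1 - x0" using \<open>0 < phi x0\<close> K x01 by (subst (asm) power2_eq_iff_nonneg) auto
  qed (simp add: phi_def)
  have "\<bar>c * (1 - x0)\<bar> <= 1 * (1 - x0)" unfolding abs_mult using c x01 by (intro mult_mono) auto
  moreover have "g (-x0) = - x0 + c * (1 - x0)" "g x0 = x0 + c * (1 - x0)" by (simp_all only: g_def phi0 mult.assoc)
  moreover have "- 1 <= - x0 + y" "x0 + y <= 1" if "\<bar>y\<bar> <= 1 * (1 - x0)" for y using that by (auto simp: abs_le_iff)
  ultimately have gb: "-1 <= g (-x0)" "g x0 <= 1" by metis+
  have "(LN x. H (g x) * indicator {-x0..x0} x) <= (LN x. 2 * (H (g x) * ennreal (g' x) * indicator {-x0..x0} x))"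
  proof (rule nn_integral_mono)
   fix x
   show "H (g x) * indicator {-x0..x0} x <= 2 * (H (g x) * ennreal (g' x) * indicator {-x0..x0} x)"
   proof (cases "x \<in> {-x0..x0}")
    case True
    have "ennreal (2 * (1 / 2)) = ennreal 2 * ennreal (1 / 2)" by (rule ennreal_mult) auto
    then have "1 = ennreal 2 * ennreal (1 / 2)" by simp
    also have "... <= ennreal 2 * ennreal (g' x)" using g'half[OF True] by (intro mult_left_mono ennreal_leI) auto
    finally have "H (g x) * 1 <= H (g x) * (ennreal 2 * ennreal (g' x))" by (intro mult_left_mono) auto
    then show ?thesis using True by (simp add: ac_simps)
   qed simp
  qed
  also have "... = 2 * (\<integral>\<^sup>+x\<in>{-x0..x0}. H (g x) * ennreal (g' x) \<partial>lborel)"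
  proof (rule nn_integral_cmult)
   have [measurable]: "g \<in> borel_measurable borel" "g' \<in> borel_measurable borel" unfolding g_def g'_def phi_def by measurable
   show "(%x. H (g x) * ennreal (g' x) * indicator {-x0..x0} x) \<in> borel_measurable lborel" by measurable
  qed
  also have "(\<integral>\<^sup>+x\<in>{-x0..x0}. H (g x) * ennreal (g' x) \<partial>lborel) = (\<integral>\<^sup>+x\<in>{g (-x0)..g x0}. H x \<partial>lborel)"
   by (rule nn_integral_substitution_aux[symmetric])
     (use der cont g'half True in \<open>force intro: order_trans[of 0 "1/2"]\<close>)+
  also have "2 * (\<integral>\<^sup>+x\<in>{g (-x0)..g x0}. H x \<partial>lborel) <= 2 * (\<integral>\<^sup>+x\<in>{-1..1}. H x \<partial>lborel)"
   using gb by (intro mult_left_mono nn_integral_mono) (auto simp: indicator_def)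
  finally show ?thesis .
 qed
 finally show ?thesis by (simp add: g_def Dom_def)
qed

section \<open>Finite differences with a constant step\<close>

definition fdiff :: "nat \<Rightarrow> real \<Rightarrow> (real \<Rightarrow> real) \<Rightarrow> real \<Rightarrow> real" where
 "fdiff r h f a = (\<Sum>i\<le>r. real (r choose i) * (-1) ^ (r - i) * f (a + real i * h))"

lemma sym_diff_fdiff:
 "sym_diff r h f x =
  (if x - real r * h / 2 \<in> {-1..1} \<and> x + real r * h / 2 \<in> {-1..1} then fdiff r h f (x - real r * h / 2) else 0)"
 by (simp add: sym_diff_def fdiff_def atMost_atLeast0)

lemma fdiff_0 [simp]: "fdiff 0 h f a = f a" by (simp add: fdiff_def)

lemma fdiff_Suc: "fdiff (Suc r) h f a = fdiff r h (%y. f (y + h) - f y) a"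
proof -
 define g where "g i = f (a + real i * h)" for i
 have "fdiff (Suc r) h f a = (\<Sum>i\<le>Suc r. real (Suc r choose i) * (-1) ^ (Suc r - i) * g i)" by (simp add: fdiff_def g_def)
 also have "... = (-1) ^ Suc r * g 0 + (\<Sum>i\<le>r. real (Suc r choose Suc i) * (-1) ^ (r - i) * g (Suc i))" by (subst sum.atMost_Suc_shift) simp
 also have "(\<Sum>i\<le>r. real (Suc r choose Suc i) * (-1) ^ (r - i) * g (Suc i))
   = (\<Sum>i\<le>r. real (r choose i) * (-1) ^ (r - i) * g (Suc i)) + (\<Sum>i\<le>r. real (r choose Suc i) * (-1) ^ (r - i) * g (Suc i))"
  by (simp add: sum.distrib[symmetric] distrib_right)
 finally have 1: "fdiff (Suc r) h f a = (\<Sum>i\<le>r. real (r choose i) * (-1) ^ (r - i) * g (Suc i))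
   + ((-1) ^ Suc r * g 0 + (\<Sum>i\<le>r. real (r choose Suc i) * (-1) ^ (r - i) * g (Suc i)))" by simp
 have "(-1) ^ Suc r * g 0 + (\<Sum>i\<le>r. real (r choose Suc i) * (-1) ^ (r - i) * g (Suc i))
   = (\<Sum>i\<le>Suc r. real (r choose i) * (-1) ^ (Suc r - i) * g i)" by (subst sum.atMost_Suc_shift) simp
 also have "... = (\<Sum>i\<le>r. real (r choose i) * (-1) ^ (Suc r - i) * g i)" by simp
 also have "... = (\<Sum>i\<le>r. - (real (r choose i) * (-1) ^ (r - i) * g i))" by (intro sum.cong refl) (simp add: Suc_diff_le)
 finally have 2: "(-1) ^ Suc r * g 0 + (\<Sum>i\<le>r. real (r choose Suc i) * (-1) ^ (r - i) * g (Suc i))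
   = (\<Sum>i\<le>r. - (real (r choose i) * (-1) ^ (r - i) * g i))" .
 have e: "f (a + real i * h + h) - f (a + real i * h) = g (Suc i) - g i" for i by (simp add: g_def algebra_simps)
 have "fdiff r h (%y. f (y + h) - f y) a = (\<Sum>i\<le>r. real (r choose i) * (-1) ^ (r - i) * (g (Suc i) - g i))" by (simp only: fdiff_def e)
 then show ?thesis unfolding 1 2 by (simp add: right_diff_distrib sum_subtractf sum_negf)
qed

lemma fdiff_add: "fdiff r h (%x. f x + g x) a = fdiff r h f a + fdiff r h g a" by (simp add: fdiff_def distrib_left sum.distrib)

lemma fdiff_diff: "fdiff r h (%x. f x - g x) a = fdiff r h f a - fdiff r h g a" by (simp add: fdiff_def right_diff_distrib sum_subtractf)

lemma higher_pderiv_pcompose_shift: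
 "(pderiv ^^ r) (pcompose Q [:h, 1:]) = pcompose ((pderiv ^^ r) Q) [:h :: real, 1:]"
proof (induction r)
 case (Suc r)
 have "pderiv [:h, 1:] = 1" by (simp add: pderiv_pCons)
 then show ?case using Suc by (simp add: pderiv_pcompose)
qed simp

lemma higher_pderiv_diff: "(pderiv ^^ i) (p - q) = (pderiv ^^ i) p - (pderiv ^^ i) (q :: real poly)" by (induction i) (auto simp: pderiv_diff)

text \<open>Iterated mean value theorem: one difference of \<open>Q\<close> is again a polynomial,
  whose derivative of order \<open>r\<close> is \<open>h\<close> times a value of the derivative of
  order \<open>r + 1\<close>.\<close>

lemma fdiff_poly_bound:
 assumes "0 < h" and "\<And>y. y \<in> {a..a + real r * h} ==> \<bar>poly ((pderiv ^^ r) Q) y\<bar> <= M"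
 shows "\<bar>fdiff r h (poly Q) a\<bar> <= h ^ r * M" using assms(2)
proof (induction r arbitrary: Q M)
 case (Suc r)
 define Q' where "Q' = pcompose Q [:h, 1:] - Q"
 have Q': "poly Q' y = poly Q (y + h) - poly Q y" for y by (simp add: Q'_def poly_pcompose add.commute)
 have "\<bar>poly ((pderiv ^^ r) Q') y\<bar> <= h * M" if y: "y \<in> {a..a + real r * h}" for y
 proof -
  define D where "D = (pderiv ^^ r) Q"
  have "poly ((pderiv ^^ r) Q') y = poly D (y + h) - poly D y" by (simp add: Q'_def higher_pderiv_diff higher_pderiv_pcompose_shift poly_pcompose D_def add.commute)
  also obtain \<xi> where \<xi>: "y < \<xi>" "\<xi> < y + h" "poly D (y + h) - poly D y = (y + h - y) * poly (pderiv D) \<xi>"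
   using poly_MVT[of y "y + h" D] assms(1) by auto
  note \<xi>(3)
  finally have e: "poly ((pderiv ^^ r) Q') y = h * poly ((pderiv ^^ Suc r) Q) \<xi>" by (simp add: D_def)
  have "\<bar>poly ((pderiv ^^ Suc r) Q) \<xi>\<bar> <= M" using \<xi> y by (intro Suc.prems) (auto simp: algebra_simps)
  then show ?thesis unfolding e using assms(1) by (simp add: abs_mult)
 qed
 from Suc.IH[of Q', OF this] have "\<bar>fdiff r h (poly Q') a\<bar> <= h ^ r * (h * M)" by simp
 moreover have "fdiff (Suc r) h (poly Q) a = fdiff r h (poly Q') a"
  unfolding fdiff_Suc by (rule arg_cong[where f = "%f. fdiff r h f a"]) (simp add: Q' fun_eq_iff)
 ultimately show ?case by (simp add: mult.assoc mult.left_commute)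
qed simp

section \<open>Shifts and symmetric differences in weighted norms\<close>

lemma space_M0 [simp]: "space M0 = {-1..1}" by (simp add: space_restrict_space)

lemma nn_integral_M0: "(\<integral>\<^sup>+x. f x \<partial>M0) = (\<integral>\<^sup>+x\<in>{-1..1}. f x \<partial>lborel)" by (simp add: nn_integral_restrict_space)

lemma borel_measurable_M0: "f \<in> borel_measurable borel ==> f \<in> borel_measurable M0" by (intro measurable_restrict_space1) simp

lemma AE_M0: "(AE x in M0. P x) \<longleftrightarrow> (AE x in lborel. x \<in> {-1..1} \<longrightarrow> P x)" by (simp add: AE_restrict_space_iff)

lemma phi_measurable [measurable]: "phi \<in> borel_measurable borel" unfolding phi_def[abs_def] by measurable

lemma rho_measurable [measurable]: "rho n \<in> borel_measurable borel" unfolding rho_def[abs_def] by measurable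

lemma slowD:
 assumes "slow n s K v"
 shows "v \<in> borel_measurable borel" "\<And>x. x \<in> {-1..1} ==> 0 <= v x"
  "\<And>x y. x \<in> {-1..1} ==> y \<in> {-1..1} ==> v x <= K * (1 + tau n x y) ^ s * v y" using assms by (auto simp: slow_def)

lemma phi_dom_segment:
 assumes x: "x \<in> {-1..1}" and d: "x - k * phi x \<in> {-1..1}" "x + k * phi x \<in> {-1..1}" and c: "\<bar>c\<bar> <= 1" and k: "0 <= k"
 shows "x + c * k * phi x \<in> {-1..1}" "\<bar>x - (x + c * k * phi x)\<bar> <= k * phi x"
proof -
 have p: "0 <= k * phi x" using phi_nonneg[OF x] k by simp
 have "\<bar>c * (k * phi x)\<bar> <= 1 * (k * phi x)" unfolding abs_mult[of c] using c p by (intro mult_mono) auto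
 then show "x + c * k * phi x \<in> {-1..1}" "\<bar>x - (x + c * k * phi x)\<bar> <= k * phi x" using d by (auto simp: mult.assoc)
qed

text \<open>The shift moves a point by at most r/2 times \<open>rho n x\<close>, hence by a bounded
  \<open>tau\<close>, and the weight changes by a bounded factor. The factor 2 of the change of
  variables is cancelled by the 1/2 that \<open>lpi_scale\<close> yields for the doubled
  bound.\<close>

lemma lpb_shift:
 assumes v: "slow n s K v" and K: "0 <= K" and n: "1 <= n" and p: "1 <= p" and h: "0 < h" "h <= 1 / real n" and r: "1 <= r"
  and c: "\<bar>c\<bar> <= 1" and g[measurable]: "g \<in> borel_measurable borel" and B: "0 < B" "lpb M0 p v g B"
 shows "lpb M0 p v (%x. if x - real r * h / 2 * phi x \<in> {-1..1} \<and> x + real r * h / 2 * phi x \<in> {-1..1}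
   then g (x + c * (real r * h / 2) * phi x) else 0) (2 * (1 + K * (1 + pi * (1 + real r)) ^ s) * B)"
proof -
 define k where "k = real r * h / 2"
 have k: "0 < k" using r h by (simp add: k_def)
 define Kw where "Kw = K * (1 + pi * (1 + real r)) ^ s"
 have Kw: "0 <= Kw" using K by (simp add: Kw_def add_nonneg_nonneg)
 define Dom where "Dom = {x \<in> {-1..1}. x - k * phi x \<in> {-1..1} \<and> x + k * phi x \<in> {-1..1}}"
 define f where "f x = (if x - k * phi x \<in> {-1..1} \<and> x + k * phi x \<in> {-1..1} then g (x + c * k * phi x) else 0)" for x
 note [measurable] = slowD(1)[OF v]
 have vle: "v x <= Kw * v (x + c * k * phi x)" and ym: "x + c * k * phi x \<in> {-1..1}" if x: "x \<in> Dom" for x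
 proof -
  have x1: "x \<in> {-1..1}" and d: "x - k * phi x \<in> {-1..1}" "x + k * phi x \<in> {-1..1}" using x by (auto simp: Dom_def)
  note seg = phi_dom_segment[OF x1 d c less_imp_le[OF k]]
  show ym: "x + c * k * phi x \<in> {-1..1}" by (rule seg)
  have "k * phi x <= real r / 2 * rho n x"
  proof -
   have "h * phi x <= 1 / real n * phi x" using h phi_nonneg[OF x1] by (intro mult_right_mono) auto
   also have "... <= rho n x" using phi_le_rho[OF n, of x] by simp
   finally have "real r / 2 * (h * phi x) <= real r / 2 * rho n x" by (intro mult_left_mono) auto
   then show ?thesis by (simp add: k_def)
  qed
  with seg(2) have "\<bar>x - (x + c * k * phi x)\<bar> <= real r / 2 * rho n x" by linarith
  from tau_le_of_abs_diff_le[OF n x1 ym this]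
  have t: "tau n x (x + c * k * phi x) <= pi * (1 + real r)" by simp
  have "v x <= K * (1 + tau n x (x + c * k * phi x)) ^ s * v (x + c * k * phi x)" by (rule slowD(3)[OF v x1 ym])
  also have "... <= Kw * v (x + c * k * phi x)" unfolding Kw_def using K t slowD(2)[OF v ym] by (intro mult_right_mono mult_left_mono power_mono) auto
  finally show "v x <= Kw * v (x + c * k * phi x)" .
 qed
 have fD: "f x = 0" if "x \<in> {-1..1}" "x \<notin> Dom" for x using that by (auto simp: f_def Dom_def)
 have fg: "f x = g (x + c * k * phi x)" if "x \<in> Dom" for x using that by (auto simp: f_def Dom_def)
 define H where "H x = ennreal (1 / 2) * (lpi p B \<bar>g (x + c * k * phi x)\<bar> (v (x + c * k * phi x)) * indicator Dom x)" for x
 have [measurable]: "H \<in> borel_measurable borel" unfolding H_def[abs_def] Dom_def by measurable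
 show ?thesis unfolding k_def[symmetric] f_def[symmetric] Kw_def[symmetric]
 proof (rule lpbI[OF p])
  have "(\<integral>\<^sup>+x. H x \<partial>M0) <= (LN x. H x)" unfolding nn_integral_M0 by (intro nn_integral_mono) (simp add: indicator_def)
  also have "... = ennreal (1 / 2) * (LN x. lpi p B \<bar>g (x + c * k * phi x)\<bar> (v (x + c * k * phi x)) * indicator Dom x)"
   unfolding H_def Dom_def by (rule nn_integral_cmult) measurable
  also have "... <= ennreal (1 / 2) * (2 * (\<integral>\<^sup>+x\<in>{-1..1}. lpi p B \<bar>g x\<bar> (v x) \<partial>lborel))"
   unfolding Dom_def using k c by (intro mult_left_mono nn_integral_shift_phi[where H = "%x. lpi p B \<bar>g x\<bar> (v x)"]) auto
  also have "... <= ennreal (1 / 2) * (2 * 1)" unfolding nn_integral_M0[symmetric] by (intro mult_left_mono lpbD[OF p B] borel_measurable_M0) auto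
  also have "... = 1" by (simp add: ennreal_mult'[symmetric] del: ennreal_half flip: ennreal_numeral)
  finally show "(\<integral>\<^sup>+x. H x \<partial>M0) <= 1" .
  fix x assume "x \<in> space M0"
  then show "lpi p (2 * (1 + Kw) * B) \<bar>f x\<bar> (v x) <= H x"
  proof (cases "x \<in> Dom")
   case True
   note v0 = slowD(2)[OF v ym[OF True]]
   have "v x <= (1 + Kw) * v (x + c * k * phi x)" using vle[OF True] v0 by (simp add: distrib_right)
   then have "lpi p (2 * (1 + Kw) * B) \<bar>f x\<bar> (v x) <= ennreal (1 / 2) * lpi p B \<bar>f x\<bar> (v (x + c * k * phi x))"
    using Kw v0 by (intro lpi_scale p B) auto
   then show ?thesis using True by (simp add: H_def fg)
  qed (use fD Kw B in simp)
 qed (use Kw B in \<open>auto intro!: borel_measurable_M0\<close>)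
qed

lemma sym_diff_measurable:
 assumes [measurable]: "f \<in> borel_measurable borel"
 shows "(%x. sym_diff r (h * phi x) f x) \<in> borel_measurable borel" unfolding sym_diff_def by measurable

lemma lpb_sym_diff:
 assumes K: "0 <= K" and r: "1 <= r"
 obtains C where "0 < C" and "\<And>n v p h g B. slow n s K v ==> 1 <= n ==> 1 <= p ==> 0 < h ==> h <= 1 / real n ==>
   g \<in> borel_measurable borel ==> 0 < B ==> lpb M0 p v g B ==> lpb M0 p v (%x. sym_diff r (h * phi x) g x) (C * B)"
proof -
 define C1 where "C1 = 2 * (1 + K * (1 + pi * (1 + real r)) ^ s)"
 have C1: "0 < C1" unfolding C1_def using K by (intro mult_pos_pos add_pos_nonneg) (auto intro!: mult_nonneg_nonneg)
 have "lpb M0 p v (%x. sym_diff r (h * phi x) g x) (2 ^ r * C1 * B)"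
  if v: "slow n s K v" and n: "1 <= n" and p: "1 <= p" and h: "0 < h" "h <= 1 / real n"
   and g[measurable]: "g \<in> borel_measurable borel" and B: "0 < B" "lpb M0 p v g B" for n v p h g B
 proof -
  define c where "c i = (2 * real i - real r) / real r" for i
  define sh where "sh i x = (if x - real r * h / 2 * phi x \<in> {-1..1} \<and> x + real r * h / 2 * phi x \<in> {-1..1}
   then g (x + c i * (real r * h / 2) * phi x) else 0)" for i x
  note vm = slowD(1)[OF v]
  have shm: "sh i \<in> borel_measurable borel" for i unfolding sh_def[abs_def] by measurable
  have "lpb M0 p v (%x. \<Sum>i\<le>r. \<bar>real (r choose i) * sh i x\<bar>) (\<Sum>i\<le>r. real (r choose i) * (C1 * B))"
  proof (rule lpb_sum[OF _ _ p])
   fix i assume "i \<in> {..r}"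
   then have i: "i <= r" by simp
   show "0 < real (r choose i) * (C1 * B)" using i C1 B by (simp add: zero_less_binomial)
   have "\<bar>c i\<bar> <= 1" using i r by (auto simp: c_def abs_le_iff field_simps)
   then have "lpb M0 p v (sh i) (C1 * B)" unfolding sh_def[abs_def] C1_def using B by (intro lpb_shift[OF v K n p h r _ g]) auto
   then show "lpb M0 p v (%x. real (r choose i) * sh i x) (real (r choose i) * (C1 * B))" using C1 B by (intro lpb_cmult p borel_measurable_M0 shm vm) auto
  qed (use shm vm slowD(2)[OF v] in \<open>auto intro!: borel_measurable_M0\<close>)
  then have S: "lpb M0 p v (%x. \<Sum>i\<le>r. \<bar>real (r choose i) * sh i x\<bar>) (2 ^ r * C1 * B)"
   by (simp add: sum_distrib_right[symmetric] of_nat_sum[symmetric] choose_row_sum mult.assoc del: of_nat_sum)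
  show ?thesis
  proof (rule lpb_mono_AE[OF S _ order_refl p])
   have "\<bar>sym_diff r (h * phi x) g x\<bar> <= \<bar>\<Sum>i\<le>r. \<bar>real (r choose i) * sh i x\<bar>\<bar>" for x
   proof -
    have e: "x - real r * (h * phi x) / 2 = x - real r * h / 2 * phi x"
     "x + real r * (h * phi x) / 2 = x + real r * h / 2 * phi x"
     "x - real r * h / 2 * phi x + real i * (h * phi x) = x + c i * (real r * h / 2) * phi x" for i using r by (simp_all add: c_def field_simps)
    have "sym_diff r (h * phi x) g x = (\<Sum>i\<le>r. real (r choose i) * (-1) ^ (r - i) * sh i x)"
     unfolding sym_diff_fdiff fdiff_def e sh_def by (auto simp: sum.neutral)
    also have "\<bar>...\<bar> <= (\<Sum>i\<le>r. \<bar>real (r choose i) * (-1) ^ (r - i) * sh i x\<bar>)" by (rule sum_abs)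
    also have "... = (\<Sum>i\<le>r. \<bar>real (r choose i) * sh i x\<bar>)" by (intro sum.cong refl) (simp add: abs_mult power_abs)
    finally show ?thesis by simp
   qed
   then show "AE x in M0. \<bar>sym_diff r (h * phi x) g x\<bar> <= \<bar>\<Sum>i\<le>r. \<bar>real (r choose i) * sh i x\<bar>\<bar>" by simp
   show "AE x in M0. 0 <= v x" using slowD(2)[OF v] by (intro AE_I2) simp
  qed (use C1 B in auto)
 qed
 with C1 that[of "2 ^ r * C1"] show thesis by simp
qed

section \<open>Decaying kernels and slow weights\<close>

definition kern :: "nat \<Rightarrow> nat \<Rightarrow> real \<Rightarrow> real \<Rightarrow> real" where
 "kern n M x z = 1 / (1 + tau n x z) ^ M / rho n x"

lemma kern_nonneg: "1 <= n ==> x \<in> {-1..1} ==> 0 <= kern n M x z"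
 using rho_pos[of n x] by (simp add: kern_def add_nonneg_nonneg)

lemma arccos_M0: "arccos \<in> borel_measurable M0"
proof -
 have "arccos \<in> borel_measurable (restrict_space borel {-1..1})" by (intro borel_measurable_continuous_on_restrict continuous_intros) auto
 moreover have "borel_measurable M0 = borel_measurable (restrict_space borel {-1..1::real})" by (intro measurable_cong_sets) (auto simp: sets_restrict_space)
 ultimately show ?thesis by simp
qed

lemma tau_measurable:
 assumes f: "f \<in> measurable N M0" and g: "g \<in> measurable N M0"
 shows "(%z. tau n (f z) (g z)) \<in> borel_measurable N"
proof -
 have [measurable]: "(%z. arccos (f z)) \<in> borel_measurable N" "(%z. arccos (g z)) \<in> borel_measurable N"
  using measurable_compose[OF f arccos_M0] measurable_compose[OF g arccos_M0] by simp_all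
 show ?thesis unfolding tau_def by measurable
qed

lemma kern_measurable:
 assumes f: "f \<in> measurable N M0" and g: "g \<in> measurable N M0"
 shows "(%z. kern n M (f z) (g z)) \<in> borel_measurable N"
proof -
 have [measurable]: "(%z. rho n (f z)) \<in> borel_measurable N" using measurable_compose[OF f borel_measurable_M0[OF rho_measurable]] by simp
 note [measurable] = tau_measurable[OF f g]
 show ?thesis unfolding kern_def by measurable
qed

lemma nn_integral_kern:
 assumes n: "1 <= n" and x: "x \<in> {-1..1}" and M: "4 <= M"
 shows "(\<integral>\<^sup>+z. ennreal (kern n M x z) \<partial>M0) <= ennreal pi"
proof -
 have [measurable]: "(%z. tau n x z) \<in> borel_measurable M0" using x by (intro tau_measurable) auto
 note rp = rho_pos[OF n x]
 have "(\<integral>\<^sup>+z. ennreal (kern n M x z) \<partial>M0) = (\<integral>\<^sup>+z. ennreal (1 / (1 + tau n x z) ^ M) * ennreal (1 / rho n x) \<partial>M0)"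
  using rp by (intro nn_integral_cong) (simp add: kern_def ennreal_mult''[symmetric])
 also have "... = (\<integral>\<^sup>+z. ennreal (1 / (1 + tau n x z) ^ M) \<partial>M0) * ennreal (1 / rho n x)" by (rule nn_integral_multc) measurable
 also have "... <= ennreal (pi * rho n x) * ennreal (1 / rho n x)"
  using nn_integral_tau_power[OF n x M] by (intro mult_right_mono) (auto simp: nn_integral_M0)
 also have "... = ennreal pi" using rp by (simp add: ennreal_mult''[symmetric])
 finally show ?thesis .
qed

text \<open>One power of decay pays for replacing the normalisation at \<open>x\<close> by the one
  at \<open>z\<close>; integrals in the first variable therefore need the exponent 5 instead of
  4.\<close>

lemma kern_swap:
 assumes n: "1 <= n" and x: "x \<in> {-1..1}" and z: "z \<in> {-1..1}"
 shows "kern n (Suc M) x z <= kern n M z x"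
proof -
 have "rho n z <= (1 + tau n x z) * rho n x" using rho_ratio[OF n z x] by (simp add: tau_commute)
 then have "1 / rho n x <= (1 + tau n x z) / rho n z" using rho_pos[OF n x] rho_pos[OF n z] by (simp add: field_simps)
 moreover have t: "0 < 1 + tau n x z" by (simp add: add_pos_nonneg)
 ultimately have "1 / (1 + tau n x z) ^ Suc M * (1 / rho n x) <= 1 / (1 + tau n x z) ^ Suc M * ((1 + tau n x z) / rho n z)" by (intro mult_left_mono) auto
 also have "... = kern n M z x" using t by (simp add: kern_def tau_commute)
 finally show ?thesis by (simp add: kern_def)
qed

lemma nn_integral_kern':
 assumes n: "1 <= n" and z: "z \<in> {-1..1}" and M: "5 <= M"
 shows "(\<integral>\<^sup>+x. ennreal (kern n M x z) \<partial>M0) <= ennreal pi"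
proof -
 obtain M' where M': "M = Suc M'" "4 <= M'" using M by (cases M) auto
 have "(\<integral>\<^sup>+x. ennreal (kern n M x z) \<partial>M0) <= (\<integral>\<^sup>+x. ennreal (kern n M' z x) \<partial>M0)"
  unfolding M' using kern_swap[OF n _ z] by (intro nn_integral_mono ennreal_leI) auto
 also have "... <= ennreal pi" by (rule nn_integral_kern[OF n z M'(2)])
 finally show ?thesis .
qed

text \<open>\<open>s\<close> powers of decay absorb the growth of the weight. In the exponent
  \<open>s + 5\<close> used below, \<open>s\<close> powers go to the weight, one to the
  normalisation and four to integrability.\<close>

lemma kern_weight:
 assumes v: "slow n s K v" and n: "1 <= n" and x: "x \<in> {-1..1}" and z: "z \<in> {-1..1}"
 shows "v x * kern n (s + M) x z <= v z * (K * kern n M x z)"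
proof -
 have t: "0 < 1 + tau n x z" by (simp add: add_pos_nonneg)
 have "v x * kern n (s + M) x z <= (K * (1 + tau n x z) ^ s * v z) * kern n (s + M) x z" using slowD(3)[OF v x z] kern_nonneg[OF n x] by (rule mult_right_mono)
 also have "... = v z * (K * kern n M x z)" using t by (simp add: kern_def power_add)
 finally show ?thesis .
qed

text \<open>Schur's test on a source space that carries a map \<open>b\<close> to [-1,1] whose image
  measure is at most Lebesgue measure. It covers both functions on [-1,1] and functions of a point
  and a step.\<close>

lemma lpb_kern:
 fixes u :: "'b \<Rightarrow> real"
 assumes v: "slow n s K v" and K: "0 <= K" and n: "1 <= n" and p: "1 <= p"
  and N: "sigma_finite_measure N" and b[measurable]: "b \<in> measurable N M0"
  and push: "\<And>g. g \<in> borel_measurable M0 ==> (\<integral>\<^sup>+z. g (b z) \<partial>N) <= (\<integral>\<^sup>+y. g y \<partial>M0)"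
  and u: "u \<in> borel_measurable N"
  and F: "\<And>x. x \<in> {-1..1} ==> eabs (F x) <= (\<integral>\<^sup>+z. ennreal (\<bar>u z\<bar> * kern n (s + 5) x (b z)) \<partial>N)"
  and B: "0 < B" "lpb N p (%z. v (b z)) u B"
 shows "lpb M0 p v F (pi * (1 + K) * B)"
proof (rule lpb_schur[OF sigma_finite_M0 N p, where u = "%z. v (b z)" and g = u
  and k = "%x z. kern n (s + 5) x (b z)" and k' = "%x z. K * kern n 5 x (b z)"])
 have vm: "v \<in> borel_measurable M0" by (rule borel_measurable_M0[OF slowD(1)[OF v]])
 show "(%z. v (b z)) \<in> borel_measurable N" by (rule measurable_compose[OF b vm])
 have km: "(%w. kern n M (fst w) (b (snd w))) \<in> borel_measurable (M0 \<Otimes>\<^sub>M N)" for M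
  by (rule kern_measurable[OF measurable_fst measurable_compose[OF measurable_snd b]])
 show "(%(x, z). kern n (s + 5) x (b z)) \<in> borel_measurable (M0 \<Otimes>\<^sub>M N)"
  "(%(x, z). K * kern n 5 x (b z)) \<in> borel_measurable (M0 \<Otimes>\<^sub>M N)"
  using km borel_measurable_times[OF borel_measurable_const[of K] km[of 5]] by (simp_all add: case_prod_beta')
 have le: "ennreal pi <= ennreal (pi * (1 + K))" using K by (intro ennreal_leI) simp
 have Kle: "(\<integral>\<^sup>+z. ennreal (K * f z) \<partial>M0) <= ennreal (pi * (1 + K))"
  if f: "f \<in> borel_measurable M0" "(\<integral>\<^sup>+z. ennreal (f z) \<partial>M0) <= ennreal pi" for f
 proof -
  have "(\<integral>\<^sup>+z. ennreal (K * f z) \<partial>M0) = ennreal K * (\<integral>\<^sup>+z. ennreal (f z) \<partial>M0)"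
   using K f(1) by (subst nn_integral_cmult[symmetric]) (auto simp: ennreal_mult')
  also have "... <= ennreal K * ennreal pi" using f(2) by (rule mult_left_mono) simp
  also have "... <= ennreal (pi * (1 + K))" using K by (simp add: ennreal_mult'[symmetric] algebra_simps)
  finally show ?thesis .
 qed
 have b1: "b z \<in> {-1..1}" if "z \<in> space N" for z using measurable_space[OF b that] by simp
 show "(\<integral>\<^sup>+x. ennreal (K * kern n 5 x (b z)) \<partial>M0) <= ennreal (pi * (1 + K))" if "z \<in> space N" for z
  using b1[OF that] nn_integral_kern'[OF n b1[OF that], of 5] by (intro Kle kern_measurable) auto
 fix x :: real assume x: "x \<in> space M0"
 then have x1: "x \<in> {-1..1}" by simp
 have m1: "(%z. kern n M x z) \<in> borel_measurable M0" for M using x by (auto intro!: kern_measurable)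
 show "(\<integral>\<^sup>+z. ennreal (kern n (s + 5) x (b z)) \<partial>N) <= ennreal (pi * (1 + K))"
  using push[of "%z. ennreal (kern n (s + 5) x z)"] m1 nn_integral_kern[OF n x1, of "s + 5"] le by (auto intro: order_trans)
 show "(\<integral>\<^sup>+z. ennreal (K * kern n 5 x (b z)) \<partial>N) <= ennreal (pi * (1 + K))"
  using push[of "%z. ennreal (K * kern n 5 x z)"] Kle[OF m1 nn_integral_kern[OF n x1]] m1 by (auto intro: order_trans)
 show "eabs (F x) <= (\<integral>\<^sup>+z. ennreal (\<bar>u z\<bar> * kern n (s + 5) x (b z)) \<partial>N)" by (rule F[OF x1])
 fix z assume "z \<in> space N"
 then have z: "b z \<in> {-1..1}" by (rule b1)
 show "0 <= kern n (s + 5) x (b z)" "0 <= K * kern n 5 x (b z)" using kern_nonneg[OF n x1] K by auto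
 show "v x * kern n (s + 5) x (b z) <= v (b z) * (K * kern n 5 x (b z))" by (rule kern_weight[OF v n x1 z])
qed (use slowD[OF v] u B K in \<open>auto intro!: borel_measurable_M0 mult_pos_pos add_pos_nonneg\<close>)

lemma fdiff_step_0: "fdiff (Suc r) 0 f a = 0" unfolding fdiff_Suc by (simp add: fdiff_def)

text \<open>The localised mean that \<open>poly_deriv_bound\<close> puts in place of a sup norm;
  after division by \<open>rho m x\<close> it is an integral against an essentially normalised
  kernel.\<close>

definition local_avg :: "nat \<Rightarrow> nat \<Rightarrow> real poly \<Rightarrow> real \<Rightarrow> real" where
 "local_avg s m Q x = integral {-1..1} (%z. \<bar>poly Q z\<bar> / (1 + tau m x z) ^ (2 * s)) / rho m x"

lemma integrable_poly_tau: "(%z. \<bar>poly Q z\<bar> / (1 + tau m x z) ^ k) integrable_on {-1..1}"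
 by (intro integrable_continuous_interval continuous_on_poly_tau)

lemma poly_tau_nonneg: "0 <= \<bar>poly Q z\<bar> / (1 + tau m x z) ^ k" by (simp add: add_nonneg_nonneg)

lemma local_avg_nonneg: "1 <= m ==> x \<in> {-1..1} ==> 0 <= local_avg s m Q x" unfolding local_avg_def
 by (intro divide_nonneg_pos rho_pos integral_nonneg integrable_poly_tau poly_tau_nonneg)

lemma local_avg_smult: "0 <= c ==> local_avg s m (smult c Q) x = c * local_avg s m Q x"
 using integral_mult_right[of "{-1..1}" c "%z. \<bar>poly Q z\<bar> / (1 + tau m x z) ^ (2 * s)"] by (simp add: local_avg_def abs_mult)

text \<open>The difference is bounded by the derivative of order \<open>r\<close> along the segment.
  The segment has bounded \<open>tau\<close> diameter, so \<open>rho\<close> and the localised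
  integral can be moved from its points \<open>y\<close> to the centre \<open>x\<close>; the
  constant \<open>T\<close> measures this.\<close>

lemma sym_diff_poly_bound:
 assumes r: "1 <= r"
 obtains C where "0 <= C"
  and "\<And>m n h Q x. 1 <= m ==> m <= n ==> 0 < h ==> h <= 1 / real n ==> degree Q < m ==> x \<in> {-1..1} ==>
   \<bar>sym_diff r (h * phi x) (poly Q) x\<bar> <= C * (h * phi x / rho m x) ^ r * local_avg s m Q x"
proof -
 define I where "I m Q x = integral {-1..1} (%z. \<bar>poly Q z\<bar> / (1 + tau m x z) ^ (2 * s))" for m :: nat and Q :: "real poly" and x
 obtain C0 where C0: "0 <= C0"
  and PB: "\<And>m Q x. 1 <= m ==> degree Q < m ==> x \<in> {-1..1} ==>
   \<bar>poly ((pderiv ^^ r) Q) x\<bar> <= C0 / rho m x ^ Suc r * I m Q x" unfolding I_def by (rule poly_deriv_bound[of r s]) blast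
 define T where "T = 1 + pi * (1 + real r)"
 have T: "1 <= T" by (simp add: T_def)
 define C where "C = C0 * T ^ Suc r * T ^ (2 * s)"
 have C: "0 <= C" using C0 T by (simp add: C_def)
 show thesis
 proof (rule that[OF C], goal_cases)
  case (1 m n h Q x)
  note m = 1(1) and mn = 1(2) and h = 1(3) 1(4) and Q = 1(5) and x = 1(6)
  define H where "H = h * phi x"
  note rx = rho_pos[OF m x]
  have H0: "0 <= H" using h phi_nonneg[OF x] by (simp add: H_def)
  have rhs: "0 <= C * (h * phi x / rho m x) ^ r * local_avg s m Q x"
   using C h phi_nonneg[OF x] rx local_avg_nonneg[OF m x] by (intro mult_nonneg_nonneg zero_le_power divide_nonneg_pos) auto
  show ?case
  proof (cases "x - real r * H / 2 \<in> {-1..1} \<and> x + real r * H / 2 \<in> {-1..1}")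
   case False
   then have "sym_diff r H (poly Q) x = 0" unfolding sym_diff_fdiff by (simp only: if_False)
   then show ?thesis using rhs unfolding H_def by simp
  next
   case True
   note True' = True
   then have sd: "sym_diff r (h * phi x) (poly Q) x = fdiff r H (poly Q) (x - real r * H / 2)" by (simp add: sym_diff_fdiff H_def)
   show ?thesis
   proof (cases "H = 0")
    case True
    \<comment> \<open>The step is zero where \<open>phi\<close> vanishes; the difference is then
      zero as well because its order is at least 1.\<close>
    then show ?thesis using rhs sd r by (cases r) (simp_all add: fdiff_step_0)
   next
    case False
    with H0 have Hp: "0 < H" by simp
    have Hr: "H <= rho m x"
    proof -
     have "h <= 1 / real m" using h mn m by (meson frac_le le_numeral_extra(4) of_nat_0_less_iff of_nat_mono order_trans zero_le_one less_le_trans zero_less_one)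
     then have "H <= 1 / real m * phi x" unfolding H_def using phi_nonneg[OF x] by (intro mult_right_mono) auto
     also have "... <= rho m x" using phi_le_rho[OF m, of x] by simp
     finally show ?thesis .
    qed
    have "\<bar>poly ((pderiv ^^ r) Q) y\<bar> <= C / rho m x ^ Suc r * I m Q x"
     if y: "y \<in> {x - real r * H / 2..x - real r * H / 2 + real r * H}" for y
    proof -
     have y2: "x - real r * H / 2 <= y" "y <= x + real r * H / 2" using y by (auto simp: field_simps)
     then have y1: "y \<in> {-1..1}" using True' by auto
     have "\<bar>x - y\<bar> <= real r * H / 2" using y2 by linarith
     also have "real r * H / 2 = real r / 2 * H" by simp
     also have "... <= real r / 2 * rho m x" using Hr by (intro mult_left_mono) auto
     finally have "tau m x y <= pi * (1 + 2 * (real r / 2))" by (rule tau_le_of_abs_diff_le[OF m x y1])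
     then have t: "1 + tau m x y <= T" by (simp add: T_def)
     have "rho m x <= (1 + tau m x y) * rho m y" by (rule rho_ratio[OF m x y1])
     also have "... <= T * rho m y" using t rho_pos[OF m y1] by (intro mult_right_mono) auto
     finally have "1 / rho m y <= T / rho m x" using rx rho_pos[OF m y1] by (simp add: field_simps)
     then have rpow: "(1 / rho m y) ^ Suc r <= (T / rho m x) ^ Suc r" using rho_pos[OF m y1] by (intro power_mono) auto
     have "I m Q y <= integral {-1..1} (%z. T ^ (2 * s) * (\<bar>poly Q z\<bar> / (1 + tau m x z) ^ (2 * s)))" unfolding I_def
     proof (rule integral_le)
      show "(%z. \<bar>poly Q z\<bar> / (1 + tau m y z) ^ (2 * s)) integrable_on {-1..1}" by (rule integrable_poly_tau)
      show "(%z. T ^ (2 * s) * (\<bar>poly Q z\<bar> / (1 + tau m x z) ^ (2 * s))) integrable_on {-1..1}"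
       by (intro integrable_continuous_interval continuous_on_mult_left continuous_on_poly_tau)
      fix z :: real
      have p: "0 < 1 + tau m y z" "0 < 1 + tau m x z" by (simp_all add: add_pos_nonneg)
      have "1 + tau m x z <= (1 + tau m x y) * (1 + tau m y z)" by (rule one_plus_tau_triangle)
      also have "... <= T * (1 + tau m y z)" using t p by (intro mult_right_mono) auto
      finally have "1 / (1 + tau m y z) <= T / (1 + tau m x z)" using p by (simp add: field_simps)
      then have "(1 / (1 + tau m y z)) ^ (2 * s) <= (T / (1 + tau m x z)) ^ (2 * s)" using p by (intro power_mono) auto
      from mult_left_mono[OF this, of "\<bar>poly Q z\<bar>"]
      show "\<bar>poly Q z\<bar> / (1 + tau m y z) ^ (2 * s) <= T ^ (2 * s) * (\<bar>poly Q z\<bar> / (1 + tau m x z) ^ (2 * s))"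
       by (simp add: power_divide mult.commute)
     qed
     also have "... = T ^ (2 * s) * I m Q x" by (simp only: integral_mult_right I_def)
     finally have Iy: "I m Q y <= T ^ (2 * s) * I m Q x" .
     have I0: "0 <= I m Q y" for y unfolding I_def by (intro integral_nonneg integrable_poly_tau poly_tau_nonneg)
     have "\<bar>poly ((pderiv ^^ r) Q) y\<bar> <= C0 * (1 / rho m y) ^ Suc r * I m Q y" using PB[OF m Q y1] by (simp add: power_divide)
     also have "... <= C0 * (T / rho m x) ^ Suc r * (T ^ (2 * s) * I m Q x)" using C0 T rx I0 by (intro mult_mono mult_left_mono rpow Iy) auto
     also have "... = C / rho m x ^ Suc r * I m Q x" unfolding C_def power_divide by simp
     finally show ?thesis .
    qed
    from fdiff_poly_bound[OF Hp this]
    have "\<bar>sym_diff r (h * phi x) (poly Q) x\<bar> <= H ^ r * (C / rho m x ^ Suc r * I m Q x)" unfolding sd .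
    also have "... = C * (h * phi x / rho m x) ^ r * local_avg s m Q x"
     unfolding local_avg_def I_def[symmetric] H_def[symmetric] by (simp add: power_divide ac_simps)
    finally show ?thesis .
   qed
  qed
 qed
qed

lemma poly_borel [measurable]: "poly (Q :: real poly) \<in> borel_measurable borel" by (intro borel_measurable_continuous_onI continuous_intros)

lemma lpb_local_avg:
 assumes v: "slow m s K v" and K: "0 <= K" and m: "1 <= m" and p: "1 <= p" and B: "0 < B" "lpb M0 p v (poly Q) B"
 shows "lpb M0 p v (local_avg (s + 5) m Q) (pi * (1 + K) * B)"
proof (rule lpb_kern[OF v K m p sigma_finite_M0 measurable_ident_sets[OF refl] _ _ _ B])
 fix x :: real assume x: "x \<in> {-1..1}"
 note rx = rho_pos[OF m x]
 define J where "J = integral {-1..1} (%z. \<bar>poly Q z\<bar> / (1 + tau m x z) ^ (2 * (s + 5)))"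
 have "((%z. \<bar>poly Q z\<bar> / (1 + tau m x z) ^ (2 * (s + 5))) has_integral J) {-1..1}"
  unfolding J_def by (intro integrable_integral integrable_poly_tau)
 then have J: "(\<integral>\<^sup>+z\<in>{-1..1}. ennreal (\<bar>poly Q z\<bar> / (1 + tau m x z) ^ (2 * (s + 5))) \<partial>lborel) = ennreal J"
  using poly_tau_nonneg by (intro nn_integral_has_integral_lebesgue') auto
 have [measurable]: "(%z. tau m x z) \<in> borel_measurable M0" using x by (intro tau_measurable) auto
 have [measurable]: "poly Q \<in> borel_measurable M0" by (intro borel_measurable_M0 poly_borel)
 have "eabs (local_avg (s + 5) m Q x) = ennreal (local_avg (s + 5) m Q x)" using local_avg_nonneg[OF m x] by simp
 also have "... = ennreal J * ennreal (1 / rho m x)" using rx by (simp add: local_avg_def J_def ennreal_mult''[symmetric])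
 also have "... = (\<integral>\<^sup>+z. ennreal (\<bar>poly Q z\<bar> / (1 + tau m x z) ^ (2 * (s + 5))) * ennreal (1 / rho m x) \<partial>M0)"
  unfolding J[symmetric] nn_integral_M0[symmetric] by (rule nn_integral_multc[symmetric]) measurable
 also have "... <= (\<integral>\<^sup>+z. ennreal (\<bar>poly Q z\<bar> * kern m (s + 5) x z) \<partial>M0)"
 proof (rule nn_integral_mono)
  fix z
  have "(1 + tau m x z) ^ (s + 5) <= (1 + tau m x z) ^ (2 * (s + 5))" by (intro power_increasing) auto
  moreover have p: "0 < (1 + tau m x z) ^ (s + 5)" by (intro zero_less_power) (simp add: add_pos_nonneg)
  ultimately have "1 / (1 + tau m x z) ^ (2 * (s + 5)) <= 1 / (1 + tau m x z) ^ (s + 5)" by (intro divide_left_mono) auto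
  then have "1 / (1 + tau m x z) ^ (2 * (s + 5)) / rho m x <= kern m (s + 5) x z" unfolding kern_def using rx by (intro divide_right_mono) auto
  then have "\<bar>poly Q z\<bar> * (1 / (1 + tau m x z) ^ (2 * (s + 5)) / rho m x) <= \<bar>poly Q z\<bar> * kern m (s + 5) x z" by (intro mult_left_mono) auto
  then show "ennreal (\<bar>poly Q z\<bar> / (1 + tau m x z) ^ (2 * (s + 5))) * ennreal (1 / rho m x) <= ennreal (\<bar>poly Q z\<bar> * kern m (s + 5) x z)"
   using rx by (simp add: ennreal_mult''[symmetric] ennreal_leI)
 qed
 finally show "eabs (local_avg (s + 5) m Q x) <= (\<integral>\<^sup>+z. ennreal (\<bar>poly Q z\<bar> * kern m (s + 5) x z) \<partial>M0)" .
qed (auto intro!: borel_measurable_M0 poly_borel)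

lemma lpb_weight_mono:
 assumes p: "1 <= p" and c: "1 <= c" and B: "0 < B" "lpb M0 p v g B"
  and g[measurable]: "g \<in> borel_measurable borel" and v[measurable]: "v \<in> borel_measurable borel"
  and v': "\<And>x. x \<in> {-1..1} ==> v' x <= c * v x" and v0: "\<And>x. x \<in> {-1..1} ==> 0 <= v x"
 shows "lpb M0 p v' g (c * B)"
proof (rule lpbI[OF p _ _ lpbD[OF p B]])
 fix x assume "x \<in> space M0"
 then show "lpi p (c * B) \<bar>g x\<bar> (v' x) <= lpi p B \<bar>g x\<bar> (v x)"
  using lpi_scale[OF p B(1) order_refl c, of "\<bar>g x\<bar>" "v' x" "v x"] v' v0 by simp
qed (use c B in \<open>auto intro!: borel_measurable_M0\<close>)

text \<open>A slow weight is bounded on [-1,1] because \<open>tau n x 0\<close> is at most n pi. The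
  bound depends on \<open>n\<close>, so it serves only for one fixed polynomial or for a constant
  that can be chosen after \<open>n\<close>.\<close>

lemma lpb_bounded:
 assumes v: "slow n s K v" and K: "0 <= K" and p: "1 <= p" and A: "0 < A" "\<And>x. x \<in> {-1..1} ==> \<bar>g x\<bar> <= A"
 shows "lpb M0 p v g (2 * (1 + K * (1 + real n * pi) ^ s * v 0) * A)"
proof -
 define V where "V = K * (1 + real n * pi) ^ s * v 0"
 have v0: "0 <= v 0" by (rule slowD(2)[OF v]) simp
 have V: "0 <= V" using v0 K by (simp add: V_def add_nonneg_nonneg)
 have vV: "v x <= V" if x: "x \<in> {-1..1}" for x
 proof -
  have "\<bar>arccos x - arccos 0\<bar> <= pi" using arccos_lbound[of x] arccos_ubound[of x] x by (auto simp: arccos_0 abs_le_iff)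
  then have "tau n x 0 <= real n * pi" unfolding tau_def by (intro mult_left_mono) auto
  then have "K * (1 + tau n x 0) ^ s * v 0 <= V" unfolding V_def using K v0 by (intro mult_right_mono mult_left_mono power_mono) auto
  moreover have "v x <= K * (1 + tau n x 0) ^ s * v 0" by (rule slowD(3)[OF v x]) simp
  ultimately show ?thesis by linarith
 qed
 show ?thesis unfolding V_def[symmetric]
 proof (rule lpbI[OF p])
  show "(\<integral>\<^sup>+x. ennreal (1 / 2) \<partial>M0) <= 1"
   by (simp add: emeasure_restrict_space ennreal_mult''[symmetric] del: ennreal_half flip: ennreal_numeral)
  fix x assume "x \<in> space M0"
  then have x: "x \<in> {-1..1}" by simp
  have "lpi p (2 * (1 + V) * A) \<bar>g x\<bar> (v x) <= ennreal (1 / 2) * lpi p A \<bar>g x\<bar> 1" using V vV[OF x] by (intro lpi_scale p A) auto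
  also have "lpi p A \<bar>g x\<bar> 1 <= 1" using A(1) A(2)[OF x] real_of_ereal_ge_1[OF p] by (auto simp: lpi_def intro!: powr_le1)
  finally show "lpi p (2 * (1 + V) * A) \<bar>g x\<bar> (v x) <= ennreal (1 / 2)" by (simp add: mult_left_mono)
 qed (use V A in auto)
qed

section \<open>The inverse estimate\<close>

lemma lambda_p_ge_1: "1 <= p ==> 1 <= lambda_p p" by (auto simp: lambda_p_def real_of_ereal_ge_1)

lemma sym_diff_diff: "sym_diff r h (%x. f x - g x) x = sym_diff r h f x - sym_diff r h g x" by (simp add: sym_diff_fdiff fdiff_diff)

definition W_ineq :: "real \<Rightarrow> real \<Rightarrow> real \<Rightarrow> (real \<Rightarrow> real) \<Rightarrow> bool" where
 "W_ineq \<Lambda> \<delta> \<gamma> w \<longleftrightarrow> (\<forall>m n x. 1 <= m \<longrightarrow> m <= n \<longrightarrow> x \<in> {-1..1} \<longrightarrow>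
    weight_avg w n x * phi_pow \<gamma> x
     <= \<Lambda> * real n powr \<delta> * real m powr (\<gamma> - \<delta>) * rho m x powr \<gamma> * weight_avg w m x)"

text \<open>The exponent \<gamma> may be raised, since \<open>phi x\<close> is at most
  \<open>m * rho m x\<close>. It will be raised to r \<lambda>_p, the power of \<open>phi\<close>
  that an \<open>r\<close>-th difference supplies.\<close>

lemma W_ineq_raise:
 assumes W: "W_ineq \<Lambda> \<delta> \<gamma> w" and \<Lambda>: "0 < \<Lambda>" and dw: "doubling_weight w" and \<gamma>\<beta>: "\<gamma> <= \<beta>"
  and m: "1 <= m" and mn: "m <= n" and x: "-1 < x" "x < 1"
 shows "phi x powr \<beta> * weight_avg w n x
   <= \<Lambda> * real n powr \<delta> * real m powr (\<beta> - \<delta>) * rho m x powr \<beta> * weight_avg w m x"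
proof -
 have x1: "x \<in> {-1..1}" using x by simp
 have ph: "0 < phi x" using x by (simp add: phi_def abs_square_less_1 abs_less_iff)
 note rm = rho_pos[OF m x1]
 have wm: "0 <= weight_avg w m x" by (rule weight_avg_nonneg[OF dw m x1])
 have wn: "0 <= weight_avg w n x" by (rule weight_avg_nonneg[OF dw _ x1]) (use m mn in simp)
 have "phi x powr \<beta> * weight_avg w n x = phi x powr (\<beta> - \<gamma>) * (weight_avg w n x * phi_pow \<gamma> x)"
  using ph by (simp add: phi_pow_def powr_add[symmetric] mult.left_commute mult.commute)
 also have "... <= (real m * rho m x) powr (\<beta> - \<gamma>) *
   (\<Lambda> * real n powr \<delta> * real m powr (\<gamma> - \<delta>) * rho m x powr \<gamma> * weight_avg w m x)"
 proof (rule mult_mono)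
  have "phi x <= real m * rho m x" using m by (simp add: rho_phi field_simps power2_eq_square)
  then show "phi x powr (\<beta> - \<gamma>) <= (real m * rho m x) powr (\<beta> - \<gamma>)" using ph \<gamma>\<beta> by (intro powr_mono2) auto
  show "weight_avg w n x * phi_pow \<gamma> x <= \<Lambda> * real n powr \<delta> * real m powr (\<gamma> - \<delta>) * rho m x powr \<gamma> * weight_avg w m x"
   using W m mn x1 unfolding W_ineq_def by blast
  show "0 <= weight_avg w n x * phi_pow \<gamma> x" using wn by (simp add: phi_pow_def)
 qed simp
 also have "... = \<Lambda> * real n powr \<delta> * (real m powr (\<beta> - \<gamma>) * real m powr (\<gamma> - \<delta>)) * (rho m x powr (\<beta> - \<gamma>) * rho m x powr \<gamma>) * weight_avg w m x"
  using m rm by (simp add: powr_mult ac_simps)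
 also have "... = \<Lambda> * real n powr \<delta> * real m powr (\<beta> - \<delta>) * rho m x powr \<beta> * weight_avg w m x"
  by (simp add: powr_add[symmetric])
 finally show ?thesis .
qed

text \<open>The pointwise bound of the difference, raised to the power \<lambda>_p, contains exactly
  the power of \<open>phi / rho m\<close> that trades \<open>w_n\<close> for \<open>w_m\<close>. The
  gain (m / n)^r of the difference and the loss (n / m)^(\<delta> / \<lambda>_p) of the weight
  combine to the stated power.\<close>

lemma lpb_sym_diff_poly:
 assumes r: "1 <= r" and p: "1 <= p" and dw: "doubling_weight w" and K: "0 <= K" and sl: "\<And>n. 1 <= n ==> slow n s K (weight_avg w n)"
  and \<Lambda>: "0 < \<Lambda>" and W: "W_ineq \<Lambda> \<delta> \<gamma> w" and \<gamma>: "\<gamma> <= real r * lambda_p p"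
 obtains D where "0 < D" and "\<And>m n h Q B. 1 <= m ==> m <= n ==> 0 < h ==> h <= 1 / real n ==> degree Q < m ==>
   0 < B ==> lpb M0 p (weight_avg w m) (poly Q) B ==>
   lpb M0 p (weight_avg w n) (%x. sym_diff r (h * phi x) (poly Q) x) (D * (real m / real n) powr (real r - \<delta> / lambda_p p) * B)"
proof (rule sym_diff_poly_bound[OF r, of "s + 5"], goal_cases)
 case (1 C)
 note C = 1(2) and Cb = 1(3)
 define l where "l = lambda_p p"
 have l1: "1 <= l" using p by (simp add: l_def lambda_p_ge_1)
 define e where "e = real r - \<delta> / l"
 define D where "D = (1 + C) * (1 + \<Lambda>) * (pi * (1 + K))"
 have D: "0 < D" using C \<Lambda> K by (simp add: D_def add_pos_nonneg)
 have "lpb M0 p (weight_avg w n) (%x. sym_diff r (h * phi x) (poly Q) x) (D * (real m / real n) powr e * B)"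
  if m: "1 <= m" and mn: "m <= n" and h: "0 < h" "h <= 1 / real n" and Q: "degree Q < m"
   and B: "0 < B" "lpb M0 p (weight_avg w m) (poly Q) B" for m n h Q B
 proof -
  define A where "A = local_avg (s + 5) m Q"
  define F where "F x = sym_diff r (h * phi x) (poly Q) x" for x
  define B' where "B' = pi * (1 + K) * B"
  have B'0: "0 <= B'" using K B by (simp add: B'_def)
  have LA: "lpb M0 p (weight_avg w m) A B'" unfolding A_def B'_def by (rule lpb_local_avg[OF sl[OF m] K m p B])
  have n: "1 <= n" using m mn by simp
  have A0: "0 <= A x" if "x \<in> {-1..1}" for x unfolding A_def by (rule local_avg_nonneg[OF m that])
  define c where "c = (1 + C) * (1 + \<Lambda>) * (real m / real n) powr e"
  have c0: "0 < c" using C \<Lambda> m mn by (simp add: c_def)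
  then have c: "0 <= c" by simp
  \<comment> \<open>One pointwise inequality serves both cases of the norm, with
    \<open>l = 1\<close> for \<open>p = \<infinity>\<close>. It is stated away from the endpoints,
    where \<open>phi\<close> is positive and powers can be split.\<close>
  have pt: "\<bar>F x\<bar> powr l * weight_avg w n x <= c powr l * (\<bar>A x\<bar> powr l * weight_avg w m x)" if x: "-1 < x" "x < 1" for x
  proof -
   have x1: "x \<in> {-1..1}" using x by simp
   have ph: "0 < phi x" using x by (simp add: phi_def abs_square_less_1 abs_less_iff)
   note rm = rho_pos[OF m x1]
   have wm: "0 <= weight_avg w m x" by (rule weight_avg_nonneg[OF dw m x1])
   have wn: "0 <= weight_avg w n x" by (rule weight_avg_nonneg[OF dw n x1])
   have pl: "((a::real) ^ r) powr l = a powr (real r * l)" if "0 < a" for a using that by (simp add: powr_realpow[symmetric] powr_powr)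
   have "\<bar>F x\<bar> <= (1 + C) * (h * phi x / rho m x) ^ r * A x"
   proof -
    have "\<bar>F x\<bar> <= C * (h * phi x / rho m x) ^ r * A x" unfolding F_def A_def by (rule Cb[OF m mn h Q x1])
    also have "... <= (1 + C) * (h * phi x / rho m x) ^ r * A x" using h ph rm A0[OF x1] by (intro mult_right_mono) auto
    finally show ?thesis .
   qed
   then have "\<bar>F x\<bar> powr l <= ((1 + C) * (h * phi x / rho m x) ^ r * A x) powr l" using l1 by (intro powr_mono2) auto
   also have "... = (1 + C) powr l * (h powr (real r * l) * (phi x powr (real r * l) / rho m x powr (real r * l))) * \<bar>A x\<bar> powr l"
    using C h ph rm A0[OF x1] by (simp add: powr_mult pl powr_divide)
   also have "... <= (1 + C) powr l * ((1 / real n) powr (real r * l) * (phi x powr (real r * l) / rho m x powr (real r * l))) * \<bar>A x\<bar> powr l"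
    using C h l1 by (intro mult_right_mono mult_left_mono powr_mono2) auto
   finally have "\<bar>F x\<bar> powr l * weight_avg w n x <=
     ((1 + C) powr l * ((1 / real n) powr (real r * l) * (phi x powr (real r * l) / rho m x powr (real r * l))) * \<bar>A x\<bar> powr l) * weight_avg w n x"
    using wn by (rule mult_right_mono)
   also have "... = ((1 + C) powr l * (1 / real n) powr (real r * l) / rho m x powr (real r * l) * \<bar>A x\<bar> powr l) * (phi x powr (real r * l) * weight_avg w n x)"
    by simp
   also have "... <= ((1 + C) powr l * (1 / real n) powr (real r * l) / rho m x powr (real r * l) * \<bar>A x\<bar> powr l) *
     (\<Lambda> * real n powr \<delta> * real m powr (real r * l - \<delta>) * rho m x powr (real r * l) * weight_avg w m x)"
    using \<gamma> by (intro mult_left_mono W_ineq_raise[OF W \<Lambda> dw _ m mn x]) (auto simp: l_def)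
   also have "... = (1 + C) powr l * \<Lambda> * ((1 / real n) powr (real r * l) * real n powr \<delta> * real m powr (real r * l - \<delta>)) * (\<bar>A x\<bar> powr l * weight_avg w m x)"
    using rm by simp
   \<comment> \<open>The exponents of \<open>n\<close> and \<open>m\<close> are opposite, so
     everything depends on m / n alone; dividing by \<open>l\<close> turns r l - \<delta> into
     \<open>e\<close>.\<close>
   also have "(1 / real n) powr (real r * l) * real n powr \<delta> * real m powr (real r * l - \<delta>) = (real m / real n) powr (e * l)"
   proof -
    have el: "e * l = real r * l - \<delta>" using l1 by (simp add: e_def left_diff_distrib)
    show ?thesis unfolding el using n m by (simp add: powr_divide powr_diff)
   qed
   also have "(1 + C) powr l * \<Lambda> * (real m / real n) powr (e * l) * (\<bar>A x\<bar> powr l * weight_avg w m x)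
     <= c powr l * (\<bar>A x\<bar> powr l * weight_avg w m x)"
   proof (rule mult_right_mono)
    have "\<Lambda> <= (1 + \<Lambda>) powr 1" using \<Lambda> by simp
    also have "... <= (1 + \<Lambda>) powr l" using \<Lambda> l1 by (intro powr_mono) auto
    finally have "(1 + C) powr l * \<Lambda> * (real m / real n) powr (e * l) <= (1 + C) powr l * (1 + \<Lambda>) powr l * (real m / real n) powr (e * l)"
     by (intro mult_right_mono mult_left_mono) auto
    also have "... = c powr l" using C \<Lambda> by (simp add: c_def powr_mult powr_powr)
    finally show "(1 + C) powr l * \<Lambda> * (real m / real n) powr (e * l) <= c powr l" .
   qed (use wm in simp)
   finally show ?thesis .
  qed
  have AEx: "AE x in M0. -1 < x \<and> x < 1"
  proof -
   have "AE x in lborel. x \<noteq> (1::real)" "AE x in lborel. x \<noteq> (-1::real)" by (rule AE_lborel_singleton)+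
   then have "AE x in lborel. x \<in> {-1..1} \<longrightarrow> -1 < x \<and> x < (1::real)" by eventually_elim auto
   then show ?thesis by (simp only: AE_M0)
  qed
  have "lpb M0 p (weight_avg w n) F (c * B')"
  proof (cases "p = \<infinity>")
   case True
   then have l: "l = 1" by (simp add: l_def lambda_p_def)
   have "AE x in M0. \<bar>A x\<bar> * weight_avg w m x <= B'" using LA True by (simp add: lpb_def)
   then have "AE x in M0. \<bar>F x\<bar> * weight_avg w n x <= c * B'" using AEx
   proof eventually_elim
    case (elim x)
    have "\<bar>F x\<bar> * weight_avg w n x <= c * (\<bar>A x\<bar> * weight_avg w m x)" using pt[of x] elim c by (simp add: l)
    also have "... <= c * B'" using elim c by (intro mult_left_mono) auto
    finally show ?case .
   qed
   then show ?thesis using True by (simp add: lpb_def)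
  next
   case False
   then have l: "real_of_ereal p = l" by (simp add: l_def lambda_p_def)
   have "(\<integral>\<^sup>+x. ennreal (\<bar>F x\<bar> powr l * weight_avg w n x) \<partial>M0) <= (\<integral>\<^sup>+x. ennreal (c powr l * (\<bar>A x\<bar> powr l * weight_avg w m x)) \<partial>M0)"
   proof (rule nn_integral_mono_AE)
    from AEx show "AE x in M0. ennreal (\<bar>F x\<bar> powr l * weight_avg w n x) <= ennreal (c powr l * (\<bar>A x\<bar> powr l * weight_avg w m x))"
     by eventually_elim (auto intro!: ennreal_leI pt)
   qed
   also have "... <= ennreal ((c * B') powr l)"
   proof -
    \<comment> \<open>The factor \<open>c\<close> is put into the polynomial, whose measurability is
      immediate, and reappears outside the average by homogeneity.\<close>
    have "lpb M0 p (weight_avg w m) (%x. c * A x) (c * B')"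
    proof -
     have "lpb M0 p (weight_avg w m) (poly (smult c Q)) (c * B)"
     proof -
      have "poly (smult c Q) = (%x. c * poly Q x)" by (simp add: fun_eq_iff)
      then show ?thesis using lpb_cmult[OF B(2) c _ p] B(1) slowD(1)[OF sl[OF m]] by (simp add: borel_measurable_M0 poly_borel)
     qed
     then have "lpb M0 p (weight_avg w m) (local_avg (s + 5) m (smult c Q)) (pi * (1 + K) * (c * B))" using c0 B by (intro lpb_local_avg[OF sl[OF m] K m p]) auto
     moreover have "local_avg (s + 5) m (smult c Q) = (%x. c * A x)" by (simp add: fun_eq_iff local_avg_smult[OF c] A_def)
     ultimately show ?thesis by (simp add: B'_def ac_simps)
    qed
    then show ?thesis using False c by (simp add: lpb_def l abs_mult powr_mult mult.assoc)
   qed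
   finally show ?thesis using False by (simp add: lpb_def l)
  qed
  moreover have "c * B' = D * (real m / real n) powr e * B" by (simp add: c_def D_def B'_def)
  ultimately show ?thesis by (simp add: F_def[abs_def])
 qed
 with D that[of D] show thesis unfolding e_def l_def by blast
qed

lemma powr_geometric_sum:
 fixes a :: real
 assumes "0 < a"
 shows "(\<Sum>i\<le>k. (2 ^ i :: real) powr a) <= (2 ^ k) powr a * (2 powr a / (2 powr a - 1))"
proof -
 define q where "q = (2::real) powr a"
 have q: "1 < q" using assms by (simp add: q_def)
 have e: "(2 ^ i :: real) powr a = q ^ i" for i by (simp add: q_def powr_realpow[symmetric] powr_powr powr_power mult.commute)
 have "(\<Sum>i\<le>k. q ^ i) * (q - 1) = q ^ Suc k - 1" using power_diff_1_eq[of q "Suc k"] q by (simp add: lessThan_Suc_atMost mult.commute)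
 then have "(\<Sum>i\<le>k. q ^ i) = (q ^ Suc k - 1) / (q - 1)" using q by (simp add: field_simps)
 also have "... <= q ^ Suc k / (q - 1)" using q by (intro divide_right_mono) auto
 also have "... = q ^ k * (q / (q - 1))" by simp
 finally show ?thesis unfolding e q_def[symmetric] .
qed

text \<open>Doubling the bound yields a polynomial from the infimum without asking that it be
  attained.\<close>

lemma best_approx_obtain:
 assumes "best_approx n f p v <= ennreal B" and "0 < B" and "1 <= n"
  and p: "1 <= p" and f: "f \<in> borel_measurable borel" and v: "v \<in> borel_measurable borel"
 obtains P where "degree P < n" and "lpb M0 p v (%x. f x - poly P x) (2 * B)"
proof -
 have "ennreal B < ennreal (2 * B)" using assms(2) by (simp add: ennreal_less_iff)
 with assms(1) have "(INF P\<in>{P :: real poly. degree P <= n - 1}. wnorm p v (%x. f x - poly P x)) < ennreal (2 * B)"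
  unfolding best_approx_def by (rule le_less_trans)
 then obtain P where P: "degree P <= n - 1" "wnorm p v (%x. f x - poly P x) < ennreal (2 * B)" unfolding INF_less_iff by auto
 have "lpb M0 p v (%x. f x - poly P x) (2 * B)"
 proof (subst wnorm_le_iff_lpb[symmetric])
  show "(%x. f x - poly P x) \<in> borel_measurable borel" using f poly_borel by (rule borel_measurable_diff)
 qed (use P assms in auto)
 moreover have "degree P < n" using P(1) assms(3) by linarith
 ultimately show thesis using that by blast
qed

text \<open>The block at level i contributes (2^i / n)^e 2^(-\<alpha> i). As \<alpha> < e, the
  geometric sum is dominated by its last term, where 2^i is about n, and this gives n^(-\<alpha>).
  The initial polynomial contributes the smaller n^(-e), and the remainder beyond the last block is
  treated by the plain boundedness of differences.\<close>

theorem inverse_estimate: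
 assumes r: "1 <= r" and p: "1 <= p" and f: "f \<in> borel_measurable borel"
  and dw: "doubling_weight w" and \<Lambda>: "0 < \<Lambda>" and W: "W_ineq \<Lambda> \<delta> \<gamma> w" and \<gamma>: "\<gamma> <= real r * lambda_p p"
  and \<alpha>: "0 < \<alpha>" "\<alpha> < real r - \<delta> / lambda_p p"
  and E: "ennreal_bigo (%n. best_approx n f p (weight_avg w n)) (%n. real n powr (-\<alpha>))"
 shows "ennreal_bigo (%n. modulus_phi r f (1 / real n) p (weight_avg w n)) (%n. real n powr (-\<alpha>))"
proof -
 define e where "e = real r - \<delta> / lambda_p p"
 have e: "\<alpha> < e" using \<alpha> by (simp add: e_def)
 obtain s K where K: "0 <= K" and sl: "\<And>n. 1 <= n ==> slow n s K (weight_avg w n)" by (rule doubling_imp_slow[OF dw]) blast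
 have wb: "weight_avg w n \<in> borel_measurable borel" for n by (rule weight_avg_borel[OF dw])
 obtain C1 where C1: "0 < C1" and L1: "\<And>n v p h g B. slow n s K v ==> 1 <= n ==> 1 <= p ==> 0 < h ==> h <= 1 / real n ==>
   g \<in> borel_measurable borel ==> 0 < B ==> lpb M0 p v g B ==> lpb M0 p v (%x. sym_diff r (h * phi x) g x) (C1 * B)"
  by (rule lpb_sym_diff[OF K r, of s]) blast
 obtain D where D: "0 < D" and L2: "\<And>m n h Q B. 1 <= m ==> m <= n ==> 0 < h ==> h <= 1 / real n ==> degree Q < m ==>
   0 < B ==> lpb M0 p (weight_avg w m) (poly Q) B ==>
   lpb M0 p (weight_avg w n) (%x. sym_diff r (h * phi x) (poly Q) x) (D * (real m / real n) powr e * B)"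
  unfolding e_def by (rule lpb_sym_diff_poly[OF r p dw K sl \<Lambda> W \<gamma>]) blast+
 from E obtain C0 N0 where C0: "0 < C0" and E0: "\<And>n. N0 <= n ==> best_approx n f p (weight_avg w n) <= ennreal (C0 * real n powr (-\<alpha>))"
  unfolding ennreal_bigo_def eventually_sequentially by blast
 \<comment> \<open>Levels from \<open>N0\<close> on suffice because 2^i exceeds i.\<close>
 define k0 where "k0 = N0"
 have k0: "N0 <= 2 ^ i" if "k0 <= i" for i using that less_exp[of i] unfolding k0_def by linarith
 define b where "b i = 2 * (C0 * (2 ^ i :: real) powr (-\<alpha>))" for i :: nat
 have b0: "0 < b i" for i using C0 by (simp add: b_def)
 have "\<exists>P. degree P < 2 ^ i \<and> lpb M0 p (weight_avg w (2 ^ i)) (%x. f x - poly P x) (b i)" if "k0 <= i" for i :: nat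
 proof -
  have "best_approx (2 ^ i) f p (weight_avg w (2 ^ i)) <= ennreal (C0 * (2 ^ i :: real) powr (-\<alpha>))" using E0[OF k0[OF that]] by simp
  then obtain Q where "degree Q < 2 ^ i" "lpb M0 p (weight_avg w (2 ^ i)) (%x. f x - poly Q x) (2 * (C0 * (2 ^ i :: real) powr (-\<alpha>)))"
   by (rule best_approx_obtain[OF _ _ _ p f wb]) (use C0 in auto)
  then show ?thesis unfolding b_def by blast
 qed
 then obtain P where P: "\<And>i. k0 <= i ==> degree (P i) < 2 ^ i"
  and fP: "\<And>i. k0 <= i ==> lpb M0 p (weight_avg w (2 ^ i)) (%x. f x - poly (P i) x) (b i)" by metis
 have fPb: "(%x. f x - poly (P i) x) \<in> borel_measurable borel" for i using f poly_borel by (rule borel_measurable_diff)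
 obtain A0 where A0: "0 < A0" "lpb M0 p (weight_avg w (2 ^ k0)) (poly (P k0)) A0"
 proof -
  have "bounded (poly (P k0) ` {-1..1})" by (intro compact_imp_bounded compact_continuous_image continuous_intros) auto
  then obtain A where A': "\<forall>x\<in>{-1..1}. \<bar>poly (P k0) x\<bar> <= A" unfolding bounded_iff by auto
  then have A: "\<And>x. x \<in> {-1..1} ==> \<bar>poly (P k0) x\<bar> <= A" by blast
  have "\<bar>poly (P k0) 0\<bar> <= A" by (rule A) simp
  then have A0: "0 <= A" using abs_ge_zero[of "poly (P k0) 0"] by linarith
  define V where "V = K * (1 + real (2 ^ k0) * pi) ^ s * weight_avg w (2 ^ k0) 0"
  have "lpb M0 p (weight_avg w (2 ^ k0)) (poly (P k0)) (2 * (1 + V) * (A + 1))"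
   unfolding V_def using A A0 by (intro lpb_bounded[OF sl K p]) (auto intro: order_trans[OF A])
  moreover have "0 <= V" unfolding V_def using K weight_avg_nonneg[OF dw, of "2 ^ k0" 0] by (auto intro!: mult_nonneg_nonneg add_nonneg_nonneg)
  ultimately show thesis using A0 by (intro that[of "2 * (1 + V) * (A + 1)"]) auto
 qed
 \<comment> \<open>Bounds \<open>b i + 4 * b (i - 1)\<close>: the factor 4 carries the previous
   approximant over to the weight of level \<open>i\<close>, and 2^\<alpha> is the ratio of the two
   rates.\<close>
 define c2 where "c2 = 2 * C0 + 8 * C0 * 2 powr \<alpha>"
 have c2: "0 < c2" using C0 by (simp add: c2_def add_pos_pos)
 have diffP: "lpb M0 p (weight_avg w (2 ^ i)) (poly (P i - P (i - 1))) (c2 * (2 ^ i) powr (-\<alpha>))" if i: "k0 < i" for i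
 proof -
  obtain j where j: "i = Suc j" "k0 <= j" using i by (cases i) auto
  have "lpb M0 p (weight_avg w (2 ^ i)) (%x. f x - poly (P j) x) (4 * b j)"
  proof (rule lpb_weight_mono[OF p _ _ fP[OF j(2)] fPb wb])
   fix x :: real assume "x \<in> {-1..1}"
   then show "weight_avg w (2 ^ i) x <= 4 * weight_avg w (2 ^ j) x" using j by (intro weight_avg_le_4[OF dw]) auto
  qed (use b0[of j] weight_avg_nonneg[OF dw, of "2 ^ j"] in auto)
  moreover have "lpb M0 p (weight_avg w (2 ^ i)) (%x. f x - poly (P i) x) (b i)" using fP i by simp
  ultimately have L: "lpb M0 p (weight_avg w (2 ^ i)) (%x. \<bar>f x - poly (P i) x\<bar> + \<bar>f x - poly (P j) x\<bar>) (b i + 4 * b j)"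
   using b0 fPb wb weight_avg_nonneg[OF dw, of "2 ^ i"] by (intro lpb_add p borel_measurable_M0) auto
  have be: "b i + 4 * b j = c2 * (2 ^ i) powr (-\<alpha>)"
  proof -
   have e1: "(2 ^ i :: real) powr (-\<alpha>) = 2 powr (-\<alpha>) * (2 ^ j) powr (-\<alpha>)" unfolding j(1) power_Suc by (rule powr_mult)
   have "2 powr \<alpha> * 2 powr (-\<alpha>) = (1::real)" by (simp add: powr_add[symmetric])
   then have e2: "(2 ^ j :: real) powr (-\<alpha>) = 2 powr \<alpha> * (2 ^ i) powr (-\<alpha>)" unfolding e1 mult.assoc[symmetric] by simp
   show ?thesis unfolding b_def c2_def e2 by (simp add: distrib_right)
  qed
  show ?thesis
  proof (rule lpb_mono_AE[OF L _ _ p])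
   show "b i + 4 * b j <= c2 * (2 ^ i) powr (-\<alpha>)" using be by simp
   show "0 <= b i + 4 * b j" using b0[of i] b0[of j] by simp
   show "AE x in M0. \<bar>poly (P i - P (i - 1)) x\<bar> <= \<bar>\<bar>f x - poly (P i) x\<bar> + \<bar>f x - poly (P j) x\<bar>\<bar>"
    using j by (intro AE_I2) auto
   show "AE x in M0. 0 <= weight_avg w (2 ^ i) x" using weight_avg_nonneg[OF dw, of "2 ^ i"] by (intro AE_I2) auto
  qed
 qed
 define G where "G = 2 powr (e - \<alpha>) / (2 powr (e - \<alpha>) - 1)"
 have G: "0 < G" using e by (simp add: G_def)
 define c3 where "c3 = D * (2 ^ k0) powr e * A0 + D * c2 * G"
 \<comment> \<open>Collects \<open>C1\<close> for the difference operator, 4 for passing from the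
   weight at \<open>2 ^ k\<close> to the one at \<open>n\<close>, 2 for the near-best choice and
   2^\<alpha> for n < 2 * 2^k.\<close>
 define c4 where "c4 = C1 * (4 * (2 * C0 * 2 powr \<alpha>))"
 have c34: "0 < c3" "0 < c4" using D A0 c2 G C1 C0 by (auto simp: c3_def c4_def intro!: add_pos_pos)
 have main: "lpb M0 p (weight_avg w n) (%x. sym_diff r (h * phi x) f x) ((c3 + c4) * real n powr (-\<alpha>))"
  if n: "2 ^ k0 <= n" and h: "0 < h" "h <= 1 / real n" for n h
 proof -
  have n1: "1 <= n" using n by (meson one_le_numeral one_le_power order_trans)
  define k where "k = (LEAST k. n < 2 ^ Suc k)"
  have ex: "\<exists>k. n < 2 ^ Suc k" using less_exp[of "Suc n"] by (intro exI[of _ n]) linarith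
  have k1: "n < 2 ^ Suc k" unfolding k_def by (rule LeastI_ex[OF ex])
  have k2: "2 ^ k <= n"
  proof (cases k)
   case 0 then show ?thesis using n1 by simp
  next
   case (Suc j)
   then show ?thesis using not_less_Least[of j "%k. n < 2 ^ Suc k"] by (simp add: k_def)
  qed
  have k0k: "k0 <= k"
  proof (rule ccontr)
   assume "\<not> k0 <= k"
   then have "(2::nat) ^ Suc k <= 2 ^ k0" by (intro power_increasing) auto
   with n k1 show False by simp
  qed
  note slv = sl[OF n1]
  define g where "g i = (if i = k0 then poly (P k0) else poly (P i - P (i - 1)))" for i
  define B where "B i = (if i = k0 then D * (real (2 ^ k0) / real n) powr e * A0
    else D * (real (2 ^ i) / real n) powr e * (c2 * (2 ^ i) powr (-\<alpha>)))" for i :: nat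
  have gb: "g i \<in> borel_measurable borel" for i unfolding g_def by (auto intro: poly_borel)
  have B0: "0 < B i" for i using D A0 c2 n1 by (simp add: B_def)
  have gB: "lpb M0 p (weight_avg w n) (%x. sym_diff r (h * phi x) (g i) x) (B i)" if i: "i \<in> {k0..k}" for i
  proof -
   have i2: "(2::nat) ^ i <= n"
   proof -
    have "(2::nat) ^ i <= 2 ^ k" using i by (intro power_increasing) auto
    with k2 show ?thesis by linarith
   qed
   show ?thesis
   proof (cases "i = k0")
    case True
    have "lpb M0 p (weight_avg w n) (%x. sym_diff r (h * phi x) (poly (P k0)) x) (D * (real (2 ^ k0) / real n) powr e * A0)"
     using A0 P[of k0] i2 True by (intro L2 h) auto
    then show ?thesis by (simp add: g_def B_def True)
   next
    case False
    have dg: "degree (P i - P (i - 1)) < 2 ^ i"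
    proof -
     have "degree (P (i - 1)) < 2 ^ (i - 1)" using i False by (intro P) auto
     also have "(2::nat) ^ (i - 1) <= 2 ^ i" by (intro power_increasing) auto
     finally show ?thesis using P[of i] i by (intro le_less_trans[OF degree_diff_le_max]) auto
    qed
    have "lpb M0 p (weight_avg w n) (%x. sym_diff r (h * phi x) (poly (P i - P (i - 1))) x)
      (D * (real (2 ^ i) / real n) powr e * (c2 * (2 ^ i) powr (-\<alpha>)))" using i2 dg diffP[of i] i False c2 by (intro L2 h) auto
    then show ?thesis by (simp add: g_def B_def False)
   qed
  qed
  define S where "S x = (\<Sum>i\<in>{k0..k}. \<bar>sym_diff r (h * phi x) (g i) x\<bar>)" for x
  have S1: "lpb M0 p (weight_avg w n) S (sum B {k0..k})" unfolding S_def[abs_def]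
   using k0k gB B0 gb wb slowD(2)[OF slv] by (intro lpb_sum p borel_measurable_M0 sym_diff_measurable) auto
  have npos: "0 < real n" using n1 by simp
  have ne: "real n powr (-e) <= real n powr (-\<alpha>)" using e n1 by (intro powr_mono) auto
  have sumB: "sum B {k0..k} <= c3 * real n powr (-\<alpha>)"
  proof -
   have "sum B {k0..k} = B k0 + sum B {k0<..k}" using k0k by (simp add: sum.head)
   also have "B k0 = D * (2 ^ k0) powr e * A0 * real n powr (-e)" by (simp add: B_def powr_divide powr_minus_divide)
   also have "... <= D * (2 ^ k0) powr e * A0 * real n powr (-\<alpha>)" using ne D A0 by (intro mult_left_mono) auto
   also have "sum B {k0<..k} <= (\<Sum>i\<in>{k0<..k}. D * c2 * real n powr (-e) * (2 ^ i) powr (e - \<alpha>))"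
   proof (rule sum_mono)
    fix i assume i: "i \<in> {k0<..k}"
    show "B i <= D * c2 * real n powr (-e) * (2 ^ i) powr (e - \<alpha>)"
    proof -
     have "(2 ^ i :: real) powr (e - \<alpha>) = (2 ^ i) powr e * (2 ^ i) powr (-\<alpha>)" by (simp add: powr_add[symmetric])
     moreover have "(real (2 ^ i) / real n) powr e = (2 ^ i) powr e * real n powr (-e)" by (simp add: powr_divide powr_minus_divide)
     ultimately show ?thesis using i by (simp add: B_def)
    qed
   qed
   also have "... <= (\<Sum>i\<le>k. D * c2 * real n powr (-e) * (2 ^ i) powr (e - \<alpha>))" using D c2 by (intro sum_mono2) auto
   also have "... = D * c2 * real n powr (-e) * (\<Sum>i\<le>k. (2 ^ i) powr (e - \<alpha>))" by (simp add: sum_distrib_left)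
   also have "... <= D * c2 * real n powr (-e) * ((2 ^ k) powr (e - \<alpha>) * G)"
    unfolding G_def using D c2 e by (intro mult_left_mono powr_geometric_sum) auto
   also have "... <= D * c2 * real n powr (-e) * (real n powr (e - \<alpha>) * G)"
   proof -
    have "(2 ^ k :: real) <= real n" using k2 by (metis of_nat_le_iff of_nat_numeral of_nat_power)
    then have "(2 ^ k :: real) powr (e - \<alpha>) <= real n powr (e - \<alpha>)" using e by (intro powr_mono2) auto
    then show ?thesis using D c2 G by (intro mult_left_mono mult_right_mono) auto
   qed
   also have "... = D * c2 * G * (real n powr (-e) * real n powr (e - \<alpha>))" by simp
   also have "real n powr (-e) * real n powr (e - \<alpha>) = real n powr (-\<alpha>)" by (simp add: powr_add[symmetric])
   finally show ?thesis by (simp add: c3_def distrib_right)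
  qed
  have S2: "lpb M0 p (weight_avg w n) (%x. sym_diff r (h * phi x) (%x. f x - poly (P k) x) x) (c4 * real n powr (-\<alpha>))"
  proof -
   have "lpb M0 p (weight_avg w n) (%x. f x - poly (P k) x) (4 * b k)"
   proof (rule lpb_weight_mono[OF p _ _ fP[OF k0k] fPb wb])
    fix x :: real assume "x \<in> {-1..1}"
    then show "weight_avg w n x <= 4 * weight_avg w (2 ^ k) x" using k1 k2 by (intro weight_avg_le_4[OF dw]) auto
   qed (use b0[of k] weight_avg_nonneg[OF dw, of "2 ^ k"] in auto)
   then have 1: "lpb M0 p (weight_avg w n) (%x. sym_diff r (h * phi x) (%x. f x - poly (P k) x) x) (C1 * (4 * b k))"
    using b0[of k] by (intro L1[OF slv n1 p h fPb]) auto
   have "real n <= 2 * 2 ^ k" using k1 by (metis less_imp_le of_nat_le_iff of_nat_numeral of_nat_power power_Suc)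
   then have "real n powr \<alpha> <= (2 * 2 ^ k) powr \<alpha>" using \<alpha> by (intro powr_mono2) auto
   moreover define X Y where "X = (2 ^ k :: real) powr \<alpha>" and "Y = real n powr \<alpha>"
   ultimately have "Y <= 2 powr \<alpha> * X" by (simp add: powr_mult)
   moreover have "0 < X" "0 < Y" using npos by (simp_all add: X_def Y_def)
   ultimately have "1 / X <= 2 powr \<alpha> * (1 / Y)" by (simp add: field_simps)
   then have "(2 ^ k) powr (-\<alpha>) <= 2 powr \<alpha> * real n powr (-\<alpha>)" by (simp only: powr_minus_divide X_def Y_def)
   then have "C0 * (2 ^ k) powr (-\<alpha>) <= C0 * (2 powr \<alpha> * real n powr (-\<alpha>))" using C0 by (intro mult_left_mono) auto
   then have "4 * b k <= 4 * (2 * C0 * 2 powr \<alpha>) * real n powr (-\<alpha>)" unfolding b_def mult.assoc by linarith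
   from mult_left_mono[OF this less_imp_le[OF C1]]
   have 2: "C1 * (4 * b k) <= c4 * real n powr (-\<alpha>)" unfolding c4_def by (simp only: mult.assoc)
   show ?thesis by (rule lpb_mono_AE[OF 1 _ 2 p]) (use C1 b0[of k] slowD(2)[OF slv] in \<open>auto intro!: AE_I2\<close>)
  qed
  have S3: "lpb M0 p (weight_avg w n) S (c3 * real n powr (-\<alpha>))"
   by (rule lpb_mono_AE[OF S1 _ sumB p]) (use B0 slowD(2)[OF slv] in \<open>auto intro!: AE_I2 sum_nonneg simp: less_imp_le\<close>)
  have Sm: "S \<in> borel_measurable borel" unfolding S_def[abs_def] by (intro borel_measurable_sum borel_measurable_abs sym_diff_measurable gb)
  have "lpb M0 p (weight_avg w n) (%x. \<bar>S x\<bar> + \<bar>sym_diff r (h * phi x) (%x. f x - poly (P k) x) x\<bar>) (c3 * real n powr (-\<alpha>) + c4 * real n powr (-\<alpha>))"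
   using c34 npos S2 S3 slowD(2)[OF slv] by (intro lpb_add p borel_measurable_M0 Sm sym_diff_measurable fPb wb) auto
  then show ?thesis unfolding distrib_right[symmetric]
  proof (rule lpb_mono_AE[OF _ _ order_refl p])
   show "AE x in M0. \<bar>sym_diff r (h * phi x) f x\<bar> <= \<bar>\<bar>S x\<bar> + \<bar>sym_diff r (h * phi x) (%x. f x - poly (P k) x) x\<bar>\<bar>"
   proof (rule AE_I2)
    fix x
    define L where "L g = sym_diff r (h * phi x) g x" for g
    have Ld: "L (poly (P i - P j)) = L (poly (P i)) - L (poly (P j))" for i j
     unfolding L_def using sym_diff_diff[of r "h * phi x" "poly (P i)" "poly (P j)" x] by (simp add: fun_eq_iff[symmetric] poly_diff[abs_def])
    have "(\<Sum>i\<in>{k0..m}. L (g i)) = L (poly (P m))" if "k0 <= m" for m using that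
    proof (induction m rule: dec_induct)
     case base then show ?case by (simp add: g_def)
    next
     case (step m)
     then have "(\<Sum>i\<in>{k0..Suc m}. L (g i)) = L (poly (P m)) + L (poly (P (Suc m) - P m))" by (simp add: g_def)
     then show ?case by (simp add: Ld)
    qed
    from this[OF k0k] have "L (poly (P k)) = (\<Sum>i\<in>{k0..k}. L (g i))" by simp
    also have "\<bar>...\<bar> <= S x" unfolding S_def L_def by (rule sum_abs)
    finally have "\<bar>L (poly (P k))\<bar> <= S x" .
    moreover have "L f = L (poly (P k)) + L (%x. f x - poly (P k) x)" unfolding L_def sym_diff_diff by simp
    ultimately show "\<bar>sym_diff r (h * phi x) f x\<bar> <= \<bar>\<bar>S x\<bar> + \<bar>sym_diff r (h * phi x) (%x. f x - poly (P k) x) x\<bar>\<bar>"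
     unfolding L_def by linarith
   qed
   show "AE x in M0. 0 <= weight_avg w n x" using slowD(2)[OF slv] by (intro AE_I2) auto
  qed (use c34 in auto)
 qed
 show ?thesis unfolding ennreal_bigo_def
 proof (intro exI[of _ "c3 + c4"] conjI eventually_sequentiallyI[of "2 ^ k0"])
  fix n :: nat assume n: "2 ^ k0 <= n"
  have n1: "1 <= n" using n by (meson one_le_numeral one_le_power order_trans)
  show "modulus_phi r f (1 / real n) p (weight_avg w n) <= ennreal ((c3 + c4) * real n powr (-\<alpha>))" unfolding modulus_phi_def
  proof (rule SUP_least)
   fix h assume "h \<in> {0<..1 / real n}"
   then show "wnorm p (weight_avg w n) (%x. sym_diff r (h * phi x) f x) <= ennreal ((c3 + c4) * real n powr (-\<alpha>))"
    using c34 main[OF n] by (subst wnorm_le_iff_lpb[OF p _ sym_diff_measurable[OF f] wb]) auto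
  qed
 qed (use c34 in simp)
qed

section \<open>Whitney approximation on an interval\<close>

lemma ex_antiderivative_poly: "\<exists>F :: real poly. pderiv F = f \<and> poly F 0 = 0 \<and> degree F <= Suc (degree f)"
proof -
 define F where "F = (\<Sum>i\<le>degree f. monom (coeff f i / real (Suc i)) (Suc i))"
 have "pderiv F = (\<Sum>i\<le>degree f. monom (coeff f i) i)"
  unfolding F_def higher_pderiv_sum[of 1, simplified] by (intro sum.cong refl) (simp add: pderiv_monom del: of_nat_Suc)
 then have 1: "pderiv F = f" by (simp add: poly_as_sum_of_monoms)
 have 2: "poly F 0 = 0" by (simp add: F_def poly_sum poly_monom)
 have 3: "degree F <= Suc (degree f)" unfolding F_def by (intro degree_sum_le) (auto intro: order_trans[OF degree_monom_le])
 show ?thesis using 1 2 3 by blast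
qed

lemma ex_higher_antiderivative_poly: "\<exists>F :: real poly. (pderiv ^^ r) F = f"
proof (induction r arbitrary: f)
 case (Suc r)
 obtain g where g: "pderiv g = f" using ex_antiderivative_poly by blast
 obtain F where "(pderiv ^^ r) F = g" using Suc by blast
 with g show ?case by auto
qed auto

lemma nn_integral_translate:
 fixes f :: "real \<Rightarrow> ennreal"
 assumes [measurable]: "f \<in> borel_measurable borel"
 shows "(LN x. f (x + c)) = (LN x. f x)" using nn_integral_real_affine[of f 1 c] by (simp add: add.commute)

lemma nn_integral_dilate:
 fixes f :: "real \<Rightarrow> ennreal"
 assumes [measurable]: "f \<in> borel_measurable borel" and c: "0 < c"
 shows "(LN x. f (c * x)) = ennreal (1 / c) * (LN x. f x)"
proof -
 have "(LN x. f x) = ennreal c * (LN x. f (c * x))" using nn_integral_real_affine[of f c 0] c by simp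
 then have "ennreal (1 / c) * (LN x. f x) = ennreal (1 / c) * ennreal c * (LN x. f (c * x))" by (simp add: mult.assoc)
 also have "ennreal (1 / c) * ennreal c = 1" using c by (simp add: ennreal_mult''[symmetric])
 finally show ?thesis by simp
qed

lemma poly_diff_le_nn_integral:
 fixes D :: "real poly"
 assumes "a <= b"
 shows "eabs (poly D b - poly D a) <= L1 {a..b} (poly (pderiv D))"
proof -
 have hi: "((%s. poly (pderiv D) s) has_integral (poly D b - poly D a)) {a..b}" using assms by (intro fundamental_theorem_of_calculus)
   (auto simp: has_real_derivative_iff_has_vector_derivative[symmetric] intro: has_field_derivative_at_within[OF poly_DERIV])
 have ai: "(%s. \<bar>poly (pderiv D) s\<bar>) integrable_on {a..b}" by (intro integrable_continuous_interval continuous_intros)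
 have "\<bar>poly D b - poly D a\<bar> <= integral {a..b} (%s. \<bar>poly (pderiv D) s\<bar>)"
  using integral_norm_bound_integral[of "%s. poly (pderiv D) s" "{a..b}" "%s. \<bar>poly (pderiv D) s\<bar>"] hi ai by (auto simp: integral_unique)
 moreover have "L1 {a..b} (poly (pderiv D)) = ennreal (integral {a..b} (%s. \<bar>poly (pderiv D) s\<bar>))"
  using ai by (intro nn_integral_has_integral_lebesgue') (auto intro: integrable_integral)
 ultimately show ?thesis by (simp add: ennreal_leI)
qed

text \<open>Each further difference integrates a derivative over a window of length
  \<open>t\<close>. Fubini exchanges window and interval, so every order after the first gains a
  factor \<open>t\<close> and lengthens the interval by \<open>t\<close>.\<close>

lemma fdiff_poly_L1:
 assumes t: "0 < t"
 shows "eabs (fdiff (Suc r) t (poly Q) v)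
  <= ennreal (t ^ r) * L1 {v..v + real (Suc r) * t} (poly ((pderiv ^^ Suc r) Q))"
proof (induction r arbitrary: Q)
 case 0
 have "fdiff (Suc 0) t (poly Q) v = poly Q (v + t) - poly Q v" by (simp add: fdiff_Suc)
 then show ?case using poly_diff_le_nn_integral[of v "v + t" Q] t by simp
next
 case (Suc r)
 define Q' where "Q' = pcompose Q [:t, 1:] - Q"
 have Q': "poly Q' y = poly Q (y + t) - poly Q y" for y by (simp add: Q'_def poly_pcompose add.commute)
 define D where "D = (pderiv ^^ Suc r) Q"
 define g where "g s = eabs (poly (pderiv D) s)" for s
 have [measurable]: "g \<in> borel_measurable borel" unfolding g_def[abs_def] by measurable
 have DQ: "poly ((pderiv ^^ Suc r) Q') s = poly D (s + t) - poly D s" for s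
  by (simp add: Q'_def higher_pderiv_diff[of "Suc r", simplified] higher_pderiv_pcompose_shift[of "Suc r", simplified] poly_pcompose D_def add.commute)
 have "fdiff (Suc (Suc r)) t (poly Q) v = fdiff (Suc r) t (poly Q') v"
  unfolding fdiff_Suc[of "Suc r"] by (rule arg_cong[where f = "%f. fdiff (Suc r) t f v"]) (simp add: Q' fun_eq_iff)
 then have A: "eabs (fdiff (Suc (Suc r)) t (poly Q) v) <= ennreal (t ^ r) *
   L1 {v..v + real (Suc r) * t} (%s. poly D (s + t) - poly D s)" using Suc.IH[of Q'] unfolding DQ by simp
 have "L1 {v..v + real (Suc r) * t} (%s. poly D (s + t) - poly D s)
   <= (LN s. LN u. g (u + s) * (indicator {0..t} u * indicator {v..v + real (Suc r) * t} s))"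
 proof (rule nn_integral_mono)
  fix s
  have "eabs (poly D (s + t) - poly D s) <= (LN u. g u * indicator {s..s + t} u)" unfolding g_def using t by (intro poly_diff_le_nn_integral) auto
  also have "... = (LN u. g (u + s) * indicator {s..s + t} (u + s))" by (rule nn_integral_translate[symmetric]) measurable
  also have "... = (LN u. g (u + s) * indicator {0..t} u)" by (intro nn_integral_cong) (auto simp: indicator_def)
  finally show "eabs (poly D (s + t) - poly D s) * indicator {v..v + real (Suc r) * t} s
    <= (LN u. g (u + s) * (indicator {0..t} u * indicator {v..v + real (Suc r) * t} s))" by (cases "s \<in> {v..v + real (Suc r) * t}") auto
 qed
 also have "... = (LN u. LN s. g (u + s) * (indicator {0..t} u * indicator {v..v + real (Suc r) * t} s))" by (rule lborel_pair.Fubini') measurable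
 also have "... <= (LN u. (LN s. g s * indicator {v..v + real (Suc (Suc r)) * t} s) * indicator {0..t} u)"
 proof (rule nn_integral_mono)
  fix u
  show "(LN s. g (u + s) * (indicator {0..t} u * indicator {v..v + real (Suc r) * t} s))
   <= (LN s. g s * indicator {v..v + real (Suc (Suc r)) * t} s) * indicator {0..t} u"
  proof (cases "u \<in> {0..t}")
   case True
   have "(LN s. g (u + s) * indicator {v..v + real (Suc r) * t} s)
     <= (LN s. g (s + u) * indicator {v..v + real (Suc (Suc r)) * t} (s + u))" using True by (intro nn_integral_mono) (auto simp: indicator_def algebra_simps)
   also have "... = (LN s. g s * indicator {v..v + real (Suc (Suc r)) * t} s)" by (rule nn_integral_translate) measurable
   finally show ?thesis using True by simp
  qed simp
 qed
 also have "... = (LN s. g s * indicator {v..v + real (Suc (Suc r)) * t} s) * ennreal t" using t by (subst nn_integral_cmult) (auto simp: nn_integral_indicator)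
 finally have "ennreal (t ^ r) * L1 {v..v + real (Suc r) * t} (%s. poly D (s + t) - poly D s)
   <= ennreal (t ^ r) * ((LN s. g s * indicator {v..v + real (Suc (Suc r)) * t} s) * ennreal t)" by (rule mult_left_mono) simp
 also have "... = ennreal (t ^ Suc r) * (LN s. g s * indicator {v..v + real (Suc (Suc r)) * t} s)" using t by (simp add: ennreal_mult' ac_simps)
 finally show ?case using A unfolding g_def D_def by (simp only: funpow.simps o_apply)
qed

text \<open>The derivative is approximated first and the approximant integrated from 0; on an
  interval of length at most 1 this does not increase the error.\<close>

lemma poly_taylor_L1:
 assumes c: "0 <= c" "c <= 1"
 shows "\<exists>q. degree q < Suc r \<and> (\<forall>x\<in>{0..c}. eabs (poly G x - poly q x)
   <= L1 {0..c} (poly ((pderiv ^^ Suc r) G)))"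
proof (induction r arbitrary: G)
 case 0
 have "eabs (poly G x - poly [:poly G 0:] x) <= L1 {0..c} (poly (pderiv G))"
  if x: "x \<in> {0..c}" for x
 proof -
  have "eabs (poly G x - poly G 0) <= L1 {0..x} (poly (pderiv G))" using x by (intro poly_diff_le_nn_integral) auto
  also have "... <= L1 {0..c} (poly (pderiv G))" using x by (intro nn_integral_mono) (auto simp: indicator_def)
  finally show ?thesis by simp
 qed
 then show ?case by (intro exI[of _ "[:poly G 0:]"]) auto
next
 case (Suc r)
 define J where "J = L1 {0..c} (%s. poly ((pderiv ^^ Suc (Suc r)) G) s)"
 have J: "L1 {0..c} (poly ((pderiv ^^ Suc r) (pderiv G))) = J" unfolding J_def by (simp only: funpow_Suc_right o_apply)
 obtain q where q: "degree q < Suc r" "\<And>x. x \<in> {0..c} ==> eabs (poly (pderiv G) x - poly q x) <= J"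
  using Suc[of "pderiv G"] unfolding J by blast
 obtain A where A: "pderiv A = q" "poly A 0 = 0" "degree A <= Suc (degree q)" using ex_antiderivative_poly by blast
 have "eabs (poly G x - poly ([:poly G 0:] + A) x) <= J" if x: "x \<in> {0..c}" for x
 proof (cases "x = 0")
  case False
  then have x0: "0 < x" using x by simp
  define E where "E = G - [:poly G 0:] - A"
  have "\<exists>\<xi>>0. \<xi> < x \<and> poly E x - poly E 0 = (x - 0) * poly (pderiv E) \<xi>" by (rule poly_MVT[OF x0])
  then obtain \<xi> where \<xi>: "0 < \<xi>" "\<xi> < x" "poly E x - poly E 0 = (x - 0) * poly (pderiv E) \<xi>" by blast
  have "poly E 0 = 0" by (simp add: E_def A)
  moreover have "pderiv E = pderiv G - q" by (simp add: E_def pderiv_diff A pderiv_pCons)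
  ultimately have "poly E x = x * (poly (pderiv G) \<xi> - poly q \<xi>)" using \<xi>(3) by simp
  then have "\<bar>poly E x\<bar> <= 1 * \<bar>poly (pderiv G) \<xi> - poly q \<xi>\<bar>" using x c by (simp add: abs_mult mult_left_le_one_le)
  then have "eabs (poly E x) <= eabs (poly (pderiv G) \<xi> - poly q \<xi>)" by (intro ennreal_leI) simp
  also have "... <= J" using \<xi> x by (intro q) auto
  finally show ?thesis by (simp add: E_def algebra_simps)
 qed (simp add: A)
 moreover have "degree ([:poly G 0:] + A) < Suc (Suc r)" using A(3) q(1) by (intro degree_add_less) auto
 ultimately show ?case unfolding J_def by blast
qed

lemma fdiff_poly_const:
 assumes t: "0 < t" and "\<And>y. poly ((pderiv ^^ r) p) y = c"
 shows "fdiff r t (poly p) a = c * t ^ r" using assms(2)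
proof (induction r arbitrary: p c)
 case (Suc r)
 define Q' where "Q' = pcompose p [:t, 1:] - p"
 have Q': "poly Q' y = poly p (y + t) - poly p y" for y by (simp add: Q'_def poly_pcompose add.commute)
 have "poly ((pderiv ^^ r) Q') y = c * t" for y
 proof -
  define D where "D = (pderiv ^^ r) p"
  have "poly ((pderiv ^^ r) Q') y = poly D (y + t) - poly D y" by (simp add: Q'_def higher_pderiv_diff higher_pderiv_pcompose_shift poly_pcompose D_def add.commute)
  also obtain \<xi> where "poly D (y + t) - poly D y = (y + t - y) * poly (pderiv D) \<xi>" using poly_MVT[of y "y + t" D] t by auto
  note this
  also have "poly (pderiv D) \<xi> = c" using Suc.prems by (simp add: D_def)
  finally show ?thesis by simp
 qed
 from Suc.IH[OF this] have "fdiff r t (poly Q') a = c * t * t ^ r" .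
 moreover have "fdiff (Suc r) t (poly p) a = fdiff r t (poly Q') a"
  unfolding fdiff_Suc by (rule arg_cong[where f = "%f. fdiff r t f a"]) (simp add: Q' fun_eq_iff)
 ultimately show ?case by simp
qed simp

section \<open>Steklov averages of order r and their error\<close>

lemma higher_pderiv_pcompose_linear:
 "(pderiv ^^ r) (pcompose Q [:x, k:]) = smult (k ^ r) (pcompose ((pderiv ^^ r) Q) [:x, k :: real:])"
proof (induction r)
 case (Suc r)
 have "pderiv [:x, k:] = [:k:]" by (simp add: pderiv_pCons)
 then show ?case using Suc by (simp add: pderiv_pcompose pderiv_smult mult.commute)
qed simp

text \<open>For an \<open>r\<close>-fold antiderivative \<open>F\<close> of f, the quotient of the
  \<open>r\<close>-th difference of \<open>F\<close> with step \<open>i * t\<close> by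
  \<open>(i * t) ^ r\<close> is a spline average of f. The binomial signs are those for which f
  minus the combination is an average of \<open>r\<close>-th differences of f.\<close>

definition steklov :: "nat \<Rightarrow> real \<Rightarrow> real poly \<Rightarrow> real poly" where
 "steklov r t F = (\<Sum>i=1..r. smult ((-1) ^ (i + 1) * real (r choose i) / (real i * t) ^ r)
   (\<Sum>j\<le>r. smult (real (r choose j) * (-1) ^ (r - j)) (pcompose F [:real j * (real i * t), 1:])))"

lemma poly_steklov:
 "poly (steklov r t F) x = (\<Sum>i=1..r. (-1) ^ (i + 1) * real (r choose i) / (real i * t) ^ r * fdiff r (real i * t) (poly F) x)"
 by (simp add: steklov_def poly_sum fdiff_def poly_pcompose add.commute)

lemma higher_pderiv_steklov: "(pderiv ^^ k) (steklov r t F) = steklov r t ((pderiv ^^ k) F)"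
 unfolding steklov_def higher_pderiv_sum higher_pderiv_smult higher_pderiv_pcompose_shift ..

text \<open>For fixed \<open>x\<close> the \<open>r\<close>-th difference of f is viewed as a
  function of its step \<open>v\<close>. It is the derivative of order \<open>r\<close> of an
  explicit polynomial in \<open>v\<close>, whose own \<open>r\<close>-th difference with step
  \<open>t\<close> is, up to sign and \<open>t ^ r\<close>, the error; \<open>fdiff_poly_L1\<close>
  then compares the two.\<close>

lemma steklov_error:
 assumes t: "0 < t" and F: "(pderiv ^^ Suc r) F = f"
 shows "eabs (poly f x - poly (steklov (Suc r) t F) x)
  <= ennreal (1 / t) * L1 {0..real (Suc r) * t} (%v. fdiff (Suc r) v (poly f) x)"
proof -
 define n where "n = Suc r"
 obtain p :: "real poly" where p: "(pderiv ^^ n) p = [:(-1) ^ n * poly f x:]" using ex_higher_antiderivative_poly by blast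
 \<comment> \<open>The summand for i is divided by \<open>real i ^ n\<close> to undo the chain rule.
   The term i = 0 does not depend on \<open>v\<close> and is integrated separately as
   \<open>p\<close>.\<close>
 define \<Gamma> where "\<Gamma> = (\<Sum>i=1..n. smult ((-1) ^ (n - i) * real (n choose i) / real i ^ n) (pcompose F [:x, real i:])) + p"
 have sg: "(-1::real) ^ n * (-1) ^ (n - i) = (-1) ^ i" if "i <= n" for i
 proof -
  have "(-1::real) ^ n * (-1) ^ (n - i) = (-1) ^ i * ((-1) ^ (n - i) * (-1) ^ (n - i))" using that by (metis (no_types) le_add_diff_inverse mult.assoc power_add)
  then show ?thesis by (simp add: power_mult_distrib[symmetric])
 qed
 have G1: "poly ((pderiv ^^ n) \<Gamma>) v = fdiff n v (poly f) x" for v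
 proof -
  have "poly ((pderiv ^^ n) \<Gamma>) v = (\<Sum>i=1..n. (-1) ^ (n - i) * real (n choose i) * poly f (x + real i * v)) + (-1) ^ n * poly f x"
   unfolding \<Gamma>_def higher_pderiv_add higher_pderiv_sum higher_pderiv_smult higher_pderiv_pcompose_linear p F[folded n_def]
   by (simp add: poly_sum poly_pcompose mult.commute)
  also have "... = (\<Sum>i\<in>insert 0 {1..n}. (-1) ^ (n - i) * real (n choose i) * poly f (x + real i * v))" by simp
  also have "insert 0 {1..n} = {..n}" by auto
  finally show ?thesis by (simp add: fdiff_def mult.commute)
 qed
 have G2: "fdiff n t (poly \<Gamma>) 0 = (-1) ^ n * t ^ n * (poly f x - poly (steklov n t F) x)"
 proof -
  have fs: "fdiff n t (poly (pcompose F [:x, real i:])) 0 = fdiff n (real i * t) (poly F) x" for i by (simp add: fdiff_def poly_pcompose ac_simps)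
  have "fdiff n t (poly \<Gamma>) 0 = fdiff n t (%v. \<Sum>i=1..n. (-1) ^ (n - i) * real (n choose i) / real i ^ n * poly (pcompose F [:x, real i:]) v) 0 + fdiff n t (poly p) 0"
   unfolding fdiff_add[symmetric] by (rule arg_cong[where f = "%f. fdiff n t f 0"]) (simp add: \<Gamma>_def poly_sum fun_eq_iff)
  also have "fdiff n t (poly p) 0 = (-1) ^ n * poly f x * t ^ n" by (rule fdiff_poly_const[OF t]) (simp add: p)
  also have "fdiff n t (%v. \<Sum>i=1..n. (-1) ^ (n - i) * real (n choose i) / real i ^ n * poly (pcompose F [:x, real i:]) v) 0
    = (\<Sum>i=1..n. (-1) ^ (n - i) * real (n choose i) / real i ^ n * fdiff n t (poly (pcompose F [:x, real i:])) 0)"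
   unfolding fdiff_def sum_distrib_left by (subst sum.swap) (simp add: ac_simps)
  also have "... = (\<Sum>i=1..n. (-1) ^ n * t ^ n * - ((-1) ^ (i + 1) * real (n choose i) / (real i * t) ^ n * fdiff n (real i * t) (poly F) x))"
  proof (rule sum.cong[OF refl])
   fix i assume "i \<in> {1..n}"
   then have i: "1 <= i" "i <= n" by auto
   have "(-1::real) ^ (n - i) = (-1) ^ n * (-1) ^ i"
   proof -
    have "(-1::real) ^ n * ((-1) ^ n * (-1) ^ (n - i)) = (-1) ^ n * (-1) ^ i" using sg[OF i(2)] by simp
    then show ?thesis by (simp add: mult.assoc[symmetric] power_mult_distrib[symmetric])
   qed
   then show "(-1) ^ (n - i) * real (n choose i) / real i ^ n * fdiff n t (poly (pcompose F [:x, real i:])) 0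
    = (-1) ^ n * t ^ n * - ((-1) ^ (i + 1) * real (n choose i) / (real i * t) ^ n * fdiff n (real i * t) (poly F) x)"
    unfolding fs using t by (simp add: power_mult_distrib)
  qed
  also have "... = (-1) ^ n * t ^ n * - poly (steklov n t F) x" unfolding poly_steklov sum_distrib_left[symmetric] sum_negf ..
  finally show ?thesis by (simp add: algebra_simps)
 qed
 have "eabs (fdiff n t (poly \<Gamma>) 0) <= ennreal (t ^ r) * L1 {0..real n * t} (%v. fdiff n v (poly f) x)"
  using fdiff_poly_L1[OF t, of r \<Gamma> 0] unfolding G1[unfolded n_def] n_def by simp
 then have "ennreal (1 / t ^ n) * eabs (fdiff n t (poly \<Gamma>) 0)
   <= ennreal (1 / t ^ n) * (ennreal (t ^ r) * L1 {0..real n * t} (%v. fdiff n v (poly f) x))" by (rule mult_left_mono) simp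
 also have "... = ennreal (1 / t) * L1 {0..real n * t} (%v. fdiff n v (poly f) x)"
  using t by (simp add: mult.assoc[symmetric] ennreal_mult''[symmetric] n_def)
 also have "ennreal (1 / t ^ n) * eabs (fdiff n t (poly \<Gamma>) 0) = eabs (poly f x - poly (steklov n t F) x)"
  using t by (simp add: G2 abs_mult power_abs ennreal_mult''[symmetric])
 finally show ?thesis by (simp add: n_def)
qed

text \<open>Three errors of size e/3: truncation of f, approximation of the truncation by continuous
  functions converging almost everywhere, and Weierstrass. The continuous functions are truncated
  too, which gives the constant majorant for dominated convergence.\<close>

lemma poly_dense_L1:
 fixes f :: "real \<Rightarrow> real"
 assumes f[measurable]: "f \<in> borel_measurable borel" and fin: "L1 {0..1} f < \<infinity>" and e: "0 < e"
 shows "\<exists>g :: real poly. L1 {0..1} (%x. f x - poly g x) <= ennreal e"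
proof -
 define M where "M = restrict_space lborel {0..1::real}"
 have M: "(\<integral>\<^sup>+x. h x \<partial>M) = (\<integral>\<^sup>+x\<in>{0..1}. h x \<partial>lborel)" for h by (simp add: M_def nn_integral_restrict_space)
 have bM: "h \<in> borel_measurable M" if "h \<in> borel_measurable borel" for h :: "real \<Rightarrow> real"
  unfolding M_def using that by (intro measurable_restrict_space1) simp
 define cl where "cl k y = max (- real k) (min (real k) y)" for k :: nat and y :: real
 have cl_abs: "\<bar>cl k y\<bar> <= \<bar>y\<bar>" "\<bar>cl k y\<bar> <= real k" for k y by (auto simp: cl_def)
 have clf[measurable]: "(%x. cl k (f x)) \<in> borel_measurable borel" for k unfolding cl_def by measurable
 have "(%k. \<integral>\<^sup>+x. ennreal (norm (f x - cl k (f x))) \<partial>M) \<longlonglongrightarrow> 0"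
 proof (rule nn_integral_dominated_convergence_norm[where w = "%x. \<bar>f x\<bar>"])
  show "(\<integral>\<^sup>+x. eabs (f x) \<partial>M) < \<infinity>" using fin by (simp add: M)
  show "AE x in M. (%k. cl k (f x)) \<longlonglongrightarrow> f x"
  proof (rule AE_I2)
   fix x
   have "\<forall>\<^sub>F k in sequentially. cl k (f x) = f x"
   proof (rule eventually_sequentiallyI)
    fix k assume "nat \<lceil>\<bar>f x\<bar>\<rceil> <= k"
    then have "\<bar>f x\<bar> <= real k" by linarith
    then show "cl k (f x) = f x" by (auto simp: cl_def)
   qed
   then show "(%k. cl k (f x)) \<longlonglongrightarrow> f x" by (rule tendsto_eventually)
  qed
 qed (auto intro!: bM clf f AE_I2 simp: cl_abs)
 then have "\<forall>\<^sub>F k in sequentially. (\<integral>\<^sup>+x. ennreal (norm (f x - cl k (f x))) \<partial>M) < ennreal (e / 3)"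
  using e by (intro order_tendstoD) auto
 then obtain k where k: "(\<integral>\<^sup>+x. eabs (f x - cl k (f x)) \<partial>M) < ennreal (e / 3)" unfolding eventually_sequentially by auto
 have "(%x. cl k (f x)) \<in> borel_measurable (lebesgue_on UNIV)" using measurable_completion[of "%x. cl k (f x)" lborel borel] clf by simp
 then have "(%x. cl k (f x)) measurable_on UNIV" by (subst measurable_on_iff_borel_measurable) auto
 then obtain N g where N: "negligible N" and g: "\<And>n. continuous_on UNIV (g n)"
  and lim: "\<And>x. x \<notin> N ==> (%n. g n x) \<longlonglongrightarrow> cl k (f x)" unfolding measurable_on_def by auto
 have gb: "g n \<in> borel_measurable borel" for n by (rule borel_measurable_continuous_onI[OF g])
 then have clg[measurable]: "(%x. cl k (g n x)) \<in> borel_measurable borel" for n unfolding cl_def by measurable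
 have AEN: "AE x in M. x \<notin> N"
 proof -
  have "AE x in lebesgue. x \<notin> N" using N unfolding negligible_iff_null_sets by (rule AE_not_in)
  then have "AE x in lborel. x \<notin> N" by (simp add: AE_completion_iff)
  then have "AE x in lborel. x \<in> {0..1} \<longrightarrow> x \<notin> N" by eventually_elim auto
  then show ?thesis unfolding M_def by (subst AE_restrict_space_iff) auto
 qed
 have "(%n. \<integral>\<^sup>+x. ennreal (norm (cl k (f x) - cl k (g n x))) \<partial>M) \<longlonglongrightarrow> 0"
 proof (rule nn_integral_dominated_convergence_norm[where w = "%x. real k"])
  have "(\<integral>\<^sup>+x. ennreal (real k) \<partial>M) = ennreal (real k) * emeasure M (space M)" by simp
  also have "emeasure M (space M) = 1" by (simp add: M_def emeasure_restrict_space space_restrict_space)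
  finally show "(\<integral>\<^sup>+x. ennreal (real k) \<partial>M) < \<infinity>" by (simp add: ennreal_mult_less_top)
  from AEN show "AE x in M. (%n. cl k (g n x)) \<longlonglongrightarrow> cl k (f x)"
  proof eventually_elim
   case (elim x)
   have "(%n. cl k (g n x)) \<longlonglongrightarrow> cl k (cl k (f x))"
    unfolding cl_def[of k "g _ _"] cl_def[of k "cl k (f x)"] by (intro tendsto_max tendsto_min tendsto_const lim[OF elim])
   also have "cl k (cl k (f x)) = cl k (f x)" by (auto simp: cl_def)
   finally show ?case .
  qed
 qed (auto intro!: bM clf clg AE_I2 simp: cl_abs)
 then have "\<forall>\<^sub>F n in sequentially. (\<integral>\<^sup>+x. ennreal (norm (cl k (f x) - cl k (g n x))) \<partial>M) < ennreal (e / 3)"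
  using e by (intro order_tendstoD) auto
 then obtain n where n: "(\<integral>\<^sup>+x. eabs (cl k (f x) - cl k (g n x)) \<partial>M) < ennreal (e / 3)" unfolding eventually_sequentially by auto
 have "continuous_on {0..1} (%x. cl k (g n x))" unfolding cl_def by (intro continuous_intros continuous_on_subset[OF g]) auto
 then obtain h where h: "real_polynomial_function h" "\<And>x. x \<in> {0..1} ==> \<bar>cl k (g n x) - h x\<bar> < e / 3"
  using e by (elim Stone_Weierstrass_real_polynomial_function[rotated, of _ _ "e / 3"]) auto
 obtain a m where a: "h = (%x. \<Sum>i\<le>m. a i * x ^ i)" using h(1) unfolding real_polynomial_function_iff_sum by blast
 define p where "p = (\<Sum>i\<le>m. monom (a i) i)"
 have p: "poly p x = h x" for x by (simp add: p_def a poly_sum poly_monom)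
 have "(\<integral>\<^sup>+x. eabs (f x - poly p x) \<partial>M) <=
   (\<integral>\<^sup>+x. eabs (f x - cl k (f x)) + (eabs (cl k (f x) - cl k (g n x)) + ennreal (e / 3)) \<partial>M)"
 proof (rule nn_integral_mono)
  fix x assume "x \<in> space M"
  then have "x \<in> {0..1}" by (simp add: M_def space_restrict_space)
  from h(2)[OF this] have "\<bar>f x - poly p x\<bar> <= \<bar>f x - cl k (f x)\<bar> + (\<bar>cl k (f x) - cl k (g n x)\<bar> + e / 3)" unfolding p by linarith
  then show "eabs (f x - poly p x) <= eabs (f x - cl k (f x)) + (eabs (cl k (f x) - cl k (g n x)) + ennreal (e / 3))"
   using e by (simp add: ennreal_plus[symmetric] ennreal_leI del: ennreal_plus)
 qed
 also have "... = (\<integral>\<^sup>+x. eabs (f x - cl k (f x)) \<partial>M) + ((\<integral>\<^sup>+x. eabs (cl k (f x) - cl k (g n x)) \<partial>M) + (\<integral>\<^sup>+x. ennreal (e / 3) \<partial>M))"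
 proof -
  have 1: "(%x. \<bar>f x - cl k (f x)\<bar>) \<in> borel_measurable borel" by measurable
  have 2: "(%x. \<bar>cl k (f x) - cl k (g n x)\<bar>) \<in> borel_measurable borel" by measurable
  note m = measurable_compose[OF bM[OF 1] measurable_ennreal] measurable_compose[OF bM[OF 2] measurable_ennreal]
  show ?thesis unfolding nn_integral_add[OF m(1) borel_measurable_add[OF m(2) borel_measurable_const]] nn_integral_add[OF m(2) borel_measurable_const] ..
 qed
 also have "(\<integral>\<^sup>+x. ennreal (e / 3) \<partial>M) = ennreal (e / 3)" by (simp add: M_def emeasure_restrict_space space_restrict_space)
 also have "(\<integral>\<^sup>+x. eabs (f x - cl k (f x)) \<partial>M) + ((\<integral>\<^sup>+x. eabs (cl k (f x) - cl k (g n x)) \<partial>M) + ennreal (e / 3)) <= ennreal (e / 3) + (ennreal (e / 3) + ennreal (e / 3))"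
  using k n by (intro add_mono) auto
 also have "... = ennreal e" using e by (simp add: ennreal_plus[symmetric] del: ennreal_plus)
 finally show ?thesis unfolding M by blast
qed

text \<open>An averaged L1 modulus on [0,1]: the triangle consists of the starting points and steps
  whose \<open>r\<close>-th difference stays in [0,1]. The integrand is left general so that a
  positive constant can be added to the differences.\<close>

definition diff_mass :: "nat \<Rightarrow> (real \<Rightarrow> real \<Rightarrow> real) \<Rightarrow> ennreal" where
 "diff_mass r U = (LN v. (LN x. ennreal (U x v) * indicator {(x, v). 0 <= x \<and> 0 < v \<and> x + real r * v <= 1} (x, v)))"

lemma fdiff_measurable' [measurable (raw)]:
 assumes [measurable]: "f \<in> borel_measurable borel" "a \<in> borel_measurable M" "h \<in> borel_measurable M"
 shows "(%x. fdiff r (h x) f (a x)) \<in> borel_measurable M" unfolding fdiff_def by measurable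

lemma sets_triangle [measurable]: "{(x, v). 0 <= x \<and> 0 < v \<and> x + real r * v <= 1} \<in> sets (borel \<Otimes>\<^sub>M borel)"
proof -
 have "{z \<in> space (borel \<Otimes>\<^sub>M borel). 0 <= (fst z :: real) \<and> 0 < (snd z :: real) \<and> fst z + real r * snd z <= 1} \<in> sets (borel \<Otimes>\<^sub>M borel)"
  by measurable
 then show ?thesis by (simp add: space_pair_measure case_prod_beta')
qed

text \<open>The Steklov average with step \<open>t\<close> is close to f, and its derivative of
  order \<open>r\<close> is a combination of differences of f with the steps \<open>i * t\<close>.
  For a suitable \<open>t\<close> in a dyadic range these are small as well, so the average can be
  replaced by its Taylor polynomial.\<close>

lemma whitney_poly:
 fixes r :: nat
 assumes r: "1 <= r"
 obtains C where "0 < C" and "\<And>f :: real poly. \<And>e. 0 < e ==> \<exists>q. degree q < r \<and>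
  L1 {0..1/2} (%x. poly f x - poly q x) <= ennreal C * diff_mass r (%x v. \<bar>fdiff r v (poly f) x\<bar>) + ennreal e"
proof -
 \<comment> \<open>Steps reach up to r * 2 * \<eta>, and an \<open>r\<close>-th difference takes r
   of them; \<eta> makes their total 1/2, so differences started in [0,1/2] stay in [0,1].\<close>
 define \<eta> where "\<eta> = 1 / (4 * (real r)\<^sup>2)"
 have \<eta>: "0 < \<eta>" using r by (simp add: \<eta>_def)
 have r\<eta>: "real r * (real r * (2 * \<eta>)) = 1 / 2" using r by (simp add: \<eta>_def power2_eq_square)
 define c where "c = 2 ^ r / \<eta> ^ r"
 have c: "0 < c" using \<eta> by (simp add: c_def)
 define C where "C = 1 / \<eta> + c * (real r / \<eta>)"
 have C: "0 < C" using \<eta> c by (simp add: C_def add_pos_nonneg)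
 have "\<exists>q. degree q < r \<and>
  L1 {0..1/2} (%x. poly f x - poly q x) <= ennreal C * diff_mass r (%x v. \<bar>fdiff r v (poly f) x\<bar>) + ennreal e"
  if e: "0 < e" for f :: "real poly" and e
 proof (cases "diff_mass r (%x v. \<bar>fdiff r v (poly f) x\<bar>)")
  case top
  then show ?thesis using C r by (intro exI[of _ 0]) (simp add: ennreal_mult_top)
 next
  case (real \<omega>)
  define d where "d x v = eabs (fdiff r v (poly f) x)" for x v
  define T where "T = {(x, v). 0 <= x \<and> 0 < v \<and> x + real r * v <= (1::real)}"
  have [measurable]: "T \<in> sets (borel \<Otimes>\<^sub>M borel)" unfolding T_def by measurable
  have [measurable]: "case_prod d \<in> borel_measurable (borel \<Otimes>\<^sub>M borel)" unfolding d_def case_prod_beta' by measurable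
  have \<omega>: "(LN v. (LN x. d x v * indicator T (x, v))) = ennreal \<omega>" using real by (simp add: diff_mass_def d_def T_def)
  obtain F where F: "(pderiv ^^ r) F = f" using ex_higher_antiderivative_poly by blast
  have inT: "(x, v) \<in> T" if "x \<in> {0..1/2}" "0 < v" "v <= real r * (2 * \<eta>)" for x v
  proof -
   have "real r * v <= real r * (real r * (2 * \<eta>))" using that by (intro mult_left_mono) auto
   then show ?thesis using that r\<eta> by (auto simp: T_def)
  qed
  have A: "L1 {0..1/2} (%x. poly f x - poly (steklov r t F) x) <= ennreal (1 / \<eta>) * ennreal \<omega>"
   if t: "t \<in> {\<eta>..2 * \<eta>}" for t
  proof -
   have t0: "0 < t" using t \<eta> by auto
   obtain r' where r': "r = Suc r'" using r by (cases r) auto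
   have "L1 {0..1/2} (%x. poly f x - poly (steklov r t F) x)
    <= (LN x. ennreal (1 / \<eta>) * (LN v. d x v * indicator T (x, v)))"
   proof (rule nn_integral_mono)
    fix x :: real
    show "eabs (poly f x - poly (steklov r t F) x) * indicator {0..1/2} x <= ennreal (1 / \<eta>) * (LN v. d x v * indicator T (x, v))"
    proof (cases "x \<in> {0..1/2}")
     case True
     have "eabs (poly f x - poly (steklov r t F) x) <= ennreal (1 / t) * (\<integral>\<^sup>+v\<in>{0..real r * t}. d x v \<partial>lborel)"
      using steklov_error[OF t0 F[unfolded r'], of x] by (simp only: r' d_def)
     also have "... <= ennreal (1 / \<eta>) * (LN v. d x v * indicator T (x, v))"
     proof (rule mult_mono)
      show "ennreal (1 / t) <= ennreal (1 / \<eta>)" using t \<eta> by (intro ennreal_leI divide_left_mono) auto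
      show "(\<integral>\<^sup>+v\<in>{0..real r * t}. d x v \<partial>lborel) <= (LN v. d x v * indicator T (x, v))"
      proof (rule nn_integral_mono_AE)
       have "AE v in lborel. v \<noteq> (0::real)" by (rule AE_lborel_singleton)
       then show "AE v in lborel. d x v * indicator {0..real r * t} v <= d x v * indicator T (x, v)"
       proof eventually_elim
        case (elim v)
        have "v <= real r * (2 * \<eta>)" if "v <= real r * t" using that t mult_left_mono[of t "2 * \<eta>" "real r"] by auto
        then show ?case using inT[OF True, of v] elim by (auto simp: indicator_def)
       qed
      qed
     qed auto
     finally show ?thesis using True by simp
    qed simp
   qed
   also have "... = ennreal (1 / \<eta>) * (LN x. (LN v. d x v * indicator T (x, v)))" by (rule nn_integral_cmult) measurable
   also have "(LN x. (LN v. d x v * indicator T (x, v))) = ennreal \<omega>" unfolding \<omega>[symmetric] by (rule lborel_pair.Fubini') measurable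
   finally show ?thesis .
  qed
  \<comment> \<open>The L1 size of all differences of f that enter the derivative of order
    \<open>r\<close> of the Steklov average with step \<open>t\<close>.\<close>
  define S where "S t = (\<Sum>i=1..r. (\<integral>\<^sup>+x\<in>{0..1/2}. d x (real i * t) \<partial>lborel))" for t
  have Sint: "(\<integral>\<^sup>+t\<in>{\<eta>..2 * \<eta>}. S t \<partial>lborel) <= ennreal (real r * \<omega>)"
  proof -
   have "(\<integral>\<^sup>+t\<in>{\<eta>..2 * \<eta>}. S t \<partial>lborel) = (\<Sum>i=1..r. (LN t. (\<integral>\<^sup>+x\<in>{0..1/2}. d x (real i * t) \<partial>lborel) * indicator {\<eta>..2 * \<eta>} t))"
    unfolding S_def sum_distrib_right by (rule nn_integral_sum) measurable
   also have "... <= (\<Sum>i=1..r. ennreal \<omega>)"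
   proof (rule sum_mono)
    fix i assume "i \<in> {1..r}"
    then have i: "1 <= i" "i <= r" by auto
    define h where "h v = (LN x. d x v * indicator T (x, v))" for v
    have [measurable]: "h \<in> borel_measurable borel" unfolding h_def by measurable
    have "(LN t. (\<integral>\<^sup>+x\<in>{0..1/2}. d x (real i * t) \<partial>lborel) * indicator {\<eta>..2 * \<eta>} t) <= (LN t. h (real i * t))"
    proof (rule nn_integral_mono)
     fix t :: real
     show "(\<integral>\<^sup>+x\<in>{0..1/2}. d x (real i * t) \<partial>lborel) * indicator {\<eta>..2 * \<eta>} t <= h (real i * t)"
     proof (cases "t \<in> {\<eta>..2 * \<eta>}")
      case True
      have "0 < real i * t" "real i * t <= real r * (2 * \<eta>)" using True \<eta> i by (auto intro!: mult_mono mult_pos_pos)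
      then show ?thesis unfolding h_def using True inT by (auto intro!: nn_integral_mono simp: indicator_def)
     qed simp
    qed
    also have "... = ennreal (1 / real i) * (LN v. h v)" using i by (intro nn_integral_dilate) auto
    also have "... <= 1 * ennreal \<omega>" unfolding h_def \<omega> using i by (intro mult_right_mono) (auto simp: ennreal_le_1)
    finally show "(LN t. (\<integral>\<^sup>+x\<in>{0..1/2}. d x (real i * t) \<partial>lborel) * indicator {\<eta>..2 * \<eta>} t) <= ennreal \<omega>" by simp
   qed
   also have "... = ennreal (real r * \<omega>)" using real by (simp add: ennreal_mult' ennreal_of_nat_eq_real_of_nat)
   finally show ?thesis .
  qed
  define e' where "e' = e * \<eta> / c"
  have e': "0 < e'" using e \<eta> c by (simp add: e'_def)
  \<comment> \<open>A good step exists by comparison with the mean of \<open>S\<close> over the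
    range. The extra e' makes the comparison strict and is chosen so that it adds exactly
    \<open>e\<close> in the end.\<close>
  have "\<exists>t\<in>{\<eta>..2 * \<eta>}. S t <= ennreal ((real r * \<omega> + e') / \<eta>)"
  proof (rule ccontr)
   assume "\<not> ?thesis"
   then have "S t \<ge> ennreal ((real r * \<omega> + e') / \<eta>)" if "t \<in> {\<eta>..2 * \<eta>}" for t using that by (auto simp: not_le intro: less_imp_le)
   then have "(\<integral>\<^sup>+t\<in>{\<eta>..2 * \<eta>}. ennreal ((real r * \<omega> + e') / \<eta>) \<partial>lborel) <= (\<integral>\<^sup>+t\<in>{\<eta>..2 * \<eta>}. S t \<partial>lborel)"
    by (intro nn_integral_mono) (auto simp: indicator_def)
   also have "(\<integral>\<^sup>+t\<in>{\<eta>..2 * \<eta>}. ennreal ((real r * \<omega> + e') / \<eta>) \<partial>lborel) = ennreal ((real r * \<omega> + e') / \<eta>) * ennreal \<eta>"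
    using \<eta> by (subst nn_integral_cmult_indicator) auto
   also have "... = ennreal (real r * \<omega> + e')" using \<eta> by (simp add: ennreal_mult''[symmetric])
   finally have "ennreal (real r * \<omega> + e') <= ennreal (real r * \<omega>)" using Sint by (rule order_trans)
   then show False using e' real by (simp add: ennreal_le_iff)
  qed
  then obtain t where t: "t \<in> {\<eta>..2 * \<eta>}" "S t <= ennreal ((real r * \<omega> + e') / \<eta>)" by blast
  have t0: "0 < t" using t \<eta> by auto
  define G where "G = steklov r t F"
  have Gd: "(pderiv ^^ r) G = steklov r t f" by (simp add: G_def higher_pderiv_steklov F)
  obtain r' where r': "r = Suc r'" using r by (cases r) auto
  obtain q where q: "degree q < r" "\<And>x. x \<in> {0..1/2} ==> eabs (poly G x - poly q x) <= L1 {0..1/2} (poly (steklov r t f))"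
   using poly_taylor_L1[of "1/2" r' G] Gd unfolding r' by auto
  have J: "L1 {0..1/2} (poly (steklov r t f)) <= ennreal c * S t"
  proof -
   have "L1 {0..1/2} (poly (steklov r t f)) <= (LN s. ennreal c * (\<Sum>i=1..r. d s (real i * t) * indicator {0..1/2} s))"
   proof (rule nn_integral_mono)
    fix s :: real
    have "\<bar>poly (steklov r t f) s\<bar> <= (\<Sum>i=1..r. \<bar>(-1) ^ (i + 1) * real (r choose i) / (real i * t) ^ r * fdiff r (real i * t) (poly f) s\<bar>)"
     unfolding poly_steklov by (rule sum_abs)
    also have "... <= (\<Sum>i=1..r. c * \<bar>fdiff r (real i * t) (poly f) s\<bar>)"
    proof (rule sum_mono)
     fix i assume "i \<in> {1..r}"
     then have i: "1 <= i" "i <= r" by auto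
     have "real (r choose i) <= 2 ^ r" using binomial_le_pow2[of r i] by (metis of_nat_le_iff of_nat_numeral of_nat_power)
     moreover have "\<eta> ^ r <= (real i * t) ^ r"
     proof (rule power_mono)
      have "1 * \<eta> <= real i * t" using i t \<eta> by (intro mult_mono) auto
      then show "\<eta> <= real i * t" by simp
     qed (use \<eta> in simp)
     ultimately have "real (r choose i) / (real i * t) ^ r <= c" unfolding c_def using \<eta> by (intro frac_le) auto
     moreover have "\<bar>(-1) ^ (i + 1) * real (r choose i) / (real i * t) ^ r * fdiff r (real i * t) (poly f) s\<bar>
      = real (r choose i) / (real i * t) ^ r * \<bar>fdiff r (real i * t) (poly f) s\<bar>" using t0 by (simp add: abs_mult power_abs)
     ultimately show "\<bar>(-1) ^ (i + 1) * real (r choose i) / (real i * t) ^ r * fdiff r (real i * t) (poly f) s\<bar> <= c * \<bar>fdiff r (real i * t) (poly f) s\<bar>"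
      by (simp only: mult_right_mono abs_ge_zero)
    qed
    finally have "eabs (poly (steklov r t f) s) <= ennreal c * (\<Sum>i=1..r. d s (real i * t))"
     using c by (simp add: d_def sum_ennreal ennreal_mult'[symmetric] sum_distrib_left[symmetric] ennreal_leI sum_nonneg)
    then show "eabs (poly (steklov r t f) s) * indicator {0..1/2} s <= ennreal c * (\<Sum>i=1..r. d s (real i * t) * indicator {0..1/2} s)"
     by (cases "s \<in> {0..1/2}") auto
   qed
   also have "... = ennreal c * (LN s. (\<Sum>i=1..r. d s (real i * t) * indicator {0..1/2} s))" by (rule nn_integral_cmult) (simp add: d_def)
   also have "(LN s. (\<Sum>i=1..r. d s (real i * t) * indicator {0..1/2} s)) = S t" unfolding S_def by (rule nn_integral_sum) (simp add: d_def)
   finally show ?thesis .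
  qed
  have "L1 {0..1/2} (%x. poly f x - poly q x)
    <= (LN x. eabs (poly f x - poly G x) * indicator {0..1/2} x + ennreal c * S t * indicator {0..1/2} x)"
  proof (rule nn_integral_mono)
   fix x :: real
   show "eabs (poly f x - poly q x) * indicator {0..1/2} x <= eabs (poly f x - poly G x) * indicator {0..1/2} x + ennreal c * S t * indicator {0..1/2} x"
   proof (cases "x \<in> {0..1/2}")
    case True
    have "eabs (poly f x - poly q x) <= ennreal (\<bar>poly f x - poly G x\<bar> + \<bar>poly G x - poly q x\<bar>)" by (intro ennreal_leI) linarith
    also have "... = eabs (poly f x - poly G x) + eabs (poly G x - poly q x)" by (rule ennreal_plus) auto
    also have "... <= eabs (poly f x - poly G x) + ennreal c * S t" using q(2)[OF True] J by (intro add_left_mono) (rule order_trans)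
    finally show ?thesis using True by simp
   qed simp
  qed
  also have "... = L1 {0..1/2} (%x. poly f x - poly G x) + ennreal c * S t * ennreal (1/2)"
   by (subst nn_integral_add) (auto simp: nn_integral_cmult_indicator)
  also have "... <= ennreal (1 / \<eta>) * ennreal \<omega> + ennreal c * ennreal ((real r * \<omega> + e') / \<eta>) * 1"
  proof -
   have "(1/2 :: real) <= 1" by simp
   then have h: "ennreal (1/2) <= 1" by (simp only: ennreal_le_1)
   show ?thesis unfolding G_def by (intro add_mono A mult_mono h mult_left_mono t) simp_all
  qed
  also have "... = ennreal (1 / \<eta> * \<omega> + c * ((real r * \<omega> + e') / \<eta>))"
   using \<eta> c real e' by (simp add: ennreal_mult'[symmetric] ennreal_plus[symmetric] del: ennreal_plus)
  also have "1 / \<eta> * \<omega> + c * ((real r * \<omega> + e') / \<eta>) = C * \<omega> + e"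
   using \<eta> c by (simp add: C_def e'_def distrib_left distrib_right add_divide_distrib)
  also have "ennreal (C * \<omega> + e) = ennreal C * diff_mass r (%x v. \<bar>fdiff r v (poly f) x\<bar>) + ennreal e"
   using C e real by (simp add: ennreal_mult' ennreal_plus)
  finally show ?thesis using q(1) by blast
 qed
 with C that show thesis by blast
qed

section \<open>Whitney's inequality for integrable functions\<close>

lemma fdiff_cong: "(\<And>i. i <= r ==> f (a + real i * h) = g (a + real i * h)) ==> fdiff r h f a = fdiff r h g a"
 unfolding fdiff_def by (intro sum.cong refl) auto

lemma fdiff_poly_eq_0:
 assumes "degree q < r" "0 < h"
 shows "fdiff r h (poly q) a = 0"
proof -
 have z: "(pderiv ^^ r) p = 0" if "degree p < r" for p :: "real poly" using that
 proof (induction r arbitrary: p)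
  case (Suc r)
  show ?case
  proof (cases "degree p")
   case 0
   then obtain c where "p = [:c:]" using degree_eq_zeroE by blast
   then have "pderiv p = 0" by (simp add: pderiv_pCons)
   then show ?thesis by (simp add: funpow_Suc_right higher_pderiv_0 del: funpow.simps)
  next
   case (Suc k)
   then have "degree (pderiv p) < r" using Suc.prems by (simp add: degree_pderiv)
   from Suc.IH[OF this] show ?thesis by (simp add: funpow_Suc_right del: funpow.simps)
  qed
 qed simp
 show ?thesis using fdiff_poly_const[OF assms(2), of r q 0] z[OF assms(1)] by simp
qed

lemma abs_fdiff_le: "\<bar>fdiff r h f a\<bar> <= (\<Sum>i\<le>r. real (r choose i) * \<bar>f (a + real i * h)\<bar>)"
 unfolding fdiff_def by (rule order_trans[OF sum_abs]) (simp add: abs_mult power_abs)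

text \<open>For a fixed step every shift contributes at most the L1 norm, and steps lie in (0,1].
  This stability allows the passage from polynomials to integrable functions.\<close>

lemma diff_mass_le:
 assumes r: "1 <= r" and [measurable]: "f \<in> borel_measurable borel"
 shows "diff_mass r (%x v. \<bar>fdiff r v f x\<bar>) <= ennreal (2 ^ r) * L1 {0..1} f"
proof -
 define I where "I = L1 {0..1} f"
 have "diff_mass r (%x v. \<bar>fdiff r v f x\<bar>) <= (LN v. (ennreal (2 ^ r) * I) * indicator {0..1} v)" unfolding diff_mass_def
 proof (rule nn_integral_mono)
  fix v :: real
  show "(LN x. eabs (fdiff r v f x) * indicator {(x, v). 0 <= x \<and> 0 < v \<and> x + real r * v <= 1} (x, v))
   <= ennreal (2 ^ r) * I * indicator {0..1} v"
  proof (cases "0 < v \<and> real r * v <= 1")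
   case False
   then have "indicator {(x, v). 0 <= x \<and> 0 < v \<and> x + real r * v <= 1} (x, v) = (0::ennreal)" for x by (auto simp: indicator_def)
   then show ?thesis by simp
  next
   case True
   have "1 * v <= real r * v" using True r by (intro mult_right_mono) auto
   then have "v <= 1" using True by linarith
   then have v1: "v \<in> {0..1}" using True by simp
   have "(LN x. eabs (fdiff r v f x) * indicator {(x, v). 0 <= x \<and> 0 < v \<and> x + real r * v <= 1} (x, v))
    <= (LN x. (\<Sum>i\<le>r. ennreal (real (r choose i)) * (eabs (f (x + real i * v)) * indicator {0..1} (x + real i * v))))"
   proof (rule nn_integral_mono)
    fix x
    show "eabs (fdiff r v f x) * indicator {(x, v). 0 <= x \<and> 0 < v \<and> x + real r * v <= 1} (x, v)
     <= (\<Sum>i\<le>r. ennreal (real (r choose i)) * (eabs (f (x + real i * v)) * indicator {0..1} (x + real i * v)))"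
    proof (cases "0 <= x \<and> x + real r * v <= 1")
     case True': True
     have ind: "x + real i * v \<in> {0..1}" if "i <= r" for i
     proof -
      have "real i * v <= real r * v" using that True by (intro mult_right_mono) auto
      then have "x + real i * v <= 1" using True' by linarith
      then show ?thesis using True True' by simp
     qed
     have "eabs (fdiff r v f x) <= ennreal (\<Sum>i\<le>r. real (r choose i) * \<bar>f (x + real i * v)\<bar>)" by (intro ennreal_leI abs_fdiff_le)
     also have "... = (\<Sum>i\<le>r. ennreal (real (r choose i)) * (eabs (f (x + real i * v)) * indicator {0..1} (x + real i * v)))"
      using ind by (subst sum_ennreal[symmetric]) (auto simp: ennreal_mult' intro!: sum.cong)
     finally show ?thesis using True True' by (simp add: indicator_def)
    qed (auto simp: indicator_def)
   qed
   also have "... = (\<Sum>i\<le>r. ennreal (real (r choose i)) * (LN x. eabs (f (x + real i * v)) * indicator {0..1} (x + real i * v)))"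
    by (subst nn_integral_sum) (auto simp: nn_integral_cmult)
   also have "... = (\<Sum>i\<le>r. ennreal (real (r choose i)) * I)" unfolding I_def
    by (intro sum.cong refl arg_cong2[where f = "(*)"]) (rule nn_integral_translate, measurable)
   also have "... = ennreal (\<Sum>i\<le>r. real (r choose i)) * I" by (simp only: sum_distrib_right[symmetric] sum_ennreal of_nat_0_le_iff)
   also have "(\<Sum>i\<le>r. real (r choose i)) = 2 ^ r" by (simp add: of_nat_sum[symmetric] choose_row_sum del: of_nat_sum)
   finally show ?thesis using v1 by simp
  qed
 qed
 also have "... = ennreal (2 ^ r) * I" by (subst nn_integral_cmult_indicator) auto
 finally show ?thesis unfolding I_def .
qed

text \<open>The triangle contains the rectangle of starting points up to 1/2 and steps up to 1/(2r),
  of area 1/(4r). The constant therefore contributes enough to swallow approximation errors, and no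
  additive error term remains afterwards.\<close>

lemma diff_mass_add_const:
 assumes r: "1 <= r" and [measurable]: "f \<in> borel_measurable borel" and e: "0 <= e"
 shows "diff_mass r (%x v. \<bar>fdiff r v f x\<bar>) + ennreal (e / (4 * real r)) <= diff_mass r (%x v. \<bar>fdiff r v f x\<bar> + e)"
proof -
 define T where "T = {(x, v). 0 <= x \<and> 0 < v \<and> x + real r * v <= (1::real)}"
 have [measurable]: "T \<in> sets (borel \<Otimes>\<^sub>M borel)" unfolding T_def by measurable
 have r0: "0 < real r" using r by simp
 have "ennreal (e / (4 * real r)) = ennreal (e / 2) * ennreal (1 / (2 * real r))" using e r by (simp add: ennreal_mult''[symmetric])
 also have "... = (LN v. ennreal (e / 2) * indicator {0<..1 / (2 * real r)} v)" by (subst nn_integral_cmult_indicator) auto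
 also have "... <= (LN v. (LN x. ennreal e * indicator T (x, v)))"
 proof (rule nn_integral_mono)
  fix v :: real
  show "ennreal (e / 2) * indicator {0<..1 / (2 * real r)} v <= (LN x. ennreal e * indicator T (x, v))"
  proof (cases "v \<in> {0<..1 / (2 * real r)}")
   case True
   have rv: "real r * v <= 1 / 2" using True r0 by (simp add: field_simps)
   have "ennreal (e / 2) = (LN x. ennreal e * indicator {0..1/2} x)"
   proof -
    have "ennreal (e / 2) = ennreal e * ennreal (1 / 2)" using e by (subst ennreal_mult''[symmetric]) auto
    also have "ennreal (1 / 2) = emeasure lborel {0..1/2::real}" by simp
    finally show ?thesis by (subst nn_integral_cmult_indicator) auto
   qed
   also have "... <= (LN x. ennreal e * indicator T (x, v))" using True rv by (intro nn_integral_mono) (auto simp: T_def indicator_def)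
   finally show ?thesis using True by simp
  qed simp
 qed
 finally have 1: "ennreal (e / (4 * real r)) <= (LN v. (LN x. ennreal e * indicator T (x, v)))" .
 have "diff_mass r (%x v. \<bar>fdiff r v f x\<bar> + e)
  = (LN v. (LN x. eabs (fdiff r v f x) * indicator T (x, v) + ennreal e * indicator T (x, v)))"
  unfolding diff_mass_def T_def using e by (simp add: ennreal_plus distrib_right)
 also have "... = (LN v. (LN x. eabs (fdiff r v f x) * indicator T (x, v)) + (LN x. ennreal e * indicator T (x, v)))"
  by (intro nn_integral_cong nn_integral_add) measurable
 also have "... = (LN v. (LN x. eabs (fdiff r v f x) * indicator T (x, v))) + (LN v. (LN x. ennreal e * indicator T (x, v)))"
  by (rule nn_integral_add) measurable
 finally show ?thesis using 1 unfolding diff_mass_def T_def[symmetric] by (simp add: add_left_mono)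
qed

lemma whitney_L1:
 fixes r :: nat
 assumes r: "1 <= r"
 obtains C where "0 < C" and "\<And>f e. f \<in> borel_measurable borel ==> L1 {0..1} f < \<infinity> ==> 0 < e ==>
  \<exists>q. degree q < r \<and> L1 {0..1/2} (%x. f x - poly q x) <= ennreal C * diff_mass r (%x v. \<bar>fdiff r v f x\<bar> + e)"
proof (rule whitney_poly[OF r], goal_cases)
 case (1 C)
 note C = 1(2) and wp = 1(3)
 show thesis
 proof (rule that[OF C], goal_cases)
  case (1 f e)
  note f[measurable] = 1(1) and fin = 1(2) and e = 1(3)
  \<comment> \<open>\<open>E\<close> is what the slack \<open>e\<close> contributes to the right
    side. \<open>d\<close> is chosen so that replacing f by the polynomial costs E/2 in total; the
    other half is the error allowed in \<open>whitney_poly\<close>.\<close>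
  define E where "E = C * (e / (4 * real r))"
  have E: "0 < E" using C e r by (simp add: E_def)
  define d where "d = E / (2 * (1 + C * 2 ^ r))"
  have p: "0 < 1 + C * 2 ^ r" using C by (simp add: add_pos_pos)
  have d: "0 < d" using E p by (simp add: d_def)
  obtain g :: "real poly" where g: "L1 {0..1} (%x. f x - poly g x) <= ennreal d" using poly_dense_L1[OF f fin d] by blast
  have E2: "0 < E / 2" using E by simp
  obtain q where q: "degree q < r" "L1 {0..1/2} (%x. poly g x - poly q x)
    <= ennreal C * diff_mass r (%x v. \<bar>fdiff r v (poly g) x\<bar>) + ennreal (E / 2)" using wp[OF E2, of g] by blast
  have m: "diff_mass r (%x v. \<bar>fdiff r v (poly g) x\<bar>) <= diff_mass r (%x v. \<bar>fdiff r v f x\<bar>) + ennreal (2 ^ r * d)"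
  proof -
   define T where "T = {(x, v). 0 <= x \<and> 0 < v \<and> x + real r * v <= (1::real)}"
   have [measurable]: "T \<in> sets (borel \<Otimes>\<^sub>M borel)" unfolding T_def by measurable
   define fg where "fg x = f x - poly g x" for x
   have [measurable]: "fg \<in> borel_measurable borel" unfolding fg_def by measurable
   have "diff_mass r (%x v. \<bar>fdiff r v (poly g) x\<bar>) <=
    (LN v. (LN x. eabs (fdiff r v f x) * indicator T (x, v) + eabs (fdiff r v fg x) * indicator T (x, v)))" unfolding diff_mass_def T_def[symmetric]
   proof (intro nn_integral_mono)
    fix x v
    have "fdiff r v fg x = fdiff r v f x - fdiff r v (poly g) x" unfolding fg_def by (rule fdiff_diff)
    then have "\<bar>fdiff r v (poly g) x\<bar> <= \<bar>fdiff r v f x\<bar> + \<bar>fdiff r v fg x\<bar>" by linarith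
    then have "eabs (fdiff r v (poly g) x) <= eabs (fdiff r v f x) + eabs (fdiff r v fg x)" by (simp add: ennreal_plus[symmetric] ennreal_leI del: ennreal_plus)
    then show "eabs (fdiff r v (poly g) x) * indicator T (x, v) <= eabs (fdiff r v f x) * indicator T (x, v) + eabs (fdiff r v fg x) * indicator T (x, v)"
     unfolding distrib_right[symmetric] by (rule mult_right_mono) simp
   qed
   also have "... = (LN v. (LN x. eabs (fdiff r v f x) * indicator T (x, v)) + (LN x. eabs (fdiff r v fg x) * indicator T (x, v)))"
    by (intro nn_integral_cong nn_integral_add) measurable
   also have "... = diff_mass r (%x v. \<bar>fdiff r v f x\<bar>) + diff_mass r (%x v. \<bar>fdiff r v fg x\<bar>)"
    unfolding diff_mass_def T_def[symmetric] by (rule nn_integral_add) measurable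
   also have "diff_mass r (%x v. \<bar>fdiff r v fg x\<bar>) <= ennreal (2 ^ r) * ennreal d"
    by (rule order_trans[OF diff_mass_le[OF r]]) (auto simp: fg_def intro!: mult_left_mono g)
   also have "ennreal (2 ^ r) * ennreal d = ennreal (2 ^ r * d)" by (simp add: ennreal_mult')
   finally show ?thesis by (simp add: add_left_mono)
  qed
  have "L1 {0..1/2} (%x. f x - poly q x)
   <= (LN x. eabs (f x - poly g x) * indicator {0..1} x + eabs (poly g x - poly q x) * indicator {0..1/2} x)"
  proof (rule nn_integral_mono)
   fix x :: real
   have "\<bar>f x - poly q x\<bar> <= \<bar>f x - poly g x\<bar> + \<bar>poly g x - poly q x\<bar>" by linarith
   then have "eabs (f x - poly q x) <= eabs (f x - poly g x) + eabs (poly g x - poly q x)" by (simp add: ennreal_plus[symmetric] ennreal_leI del: ennreal_plus)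
   then show "eabs (f x - poly q x) * indicator {0..1/2} x <= eabs (f x - poly g x) * indicator {0..1} x + eabs (poly g x - poly q x) * indicator {0..1/2} x"
    by (auto simp: indicator_def)
  qed
  also have "... = L1 {0..1} (%x. f x - poly g x) + L1 {0..1/2} (%x. poly g x - poly q x)" by (rule nn_integral_add) measurable
  also have "... <= ennreal d + (ennreal C * (diff_mass r (%x v. \<bar>fdiff r v f x\<bar>) + ennreal (2 ^ r * d)) + ennreal (E / 2))"
   using m by (intro add_mono g order_trans[OF q(2)] mult_left_mono) auto
  also have "... = ennreal C * diff_mass r (%x v. \<bar>fdiff r v f x\<bar>) + (ennreal d + ennreal C * ennreal (2 ^ r * d) + ennreal (E / 2))"
   by (simp add: distrib_left ac_simps)
  also have "ennreal d + ennreal C * ennreal (2 ^ r * d) + ennreal (E / 2) = ennreal E"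
  proof -
   have "ennreal d + ennreal C * ennreal (2 ^ r * d) + ennreal (E / 2) = ennreal (d + C * (2 ^ r * d) + E / 2)"
    using d C E by (simp add: ennreal_mult'[symmetric] ennreal_plus[symmetric] del: ennreal_plus)
   also have "d + C * (2 ^ r * d) + E / 2 = d * (1 + C * 2 ^ r) + E / 2" by (simp add: algebra_simps)
   also have "d * (1 + C * 2 ^ r) = E / 2"
   proof -
    have "E / (2 * y) * y = E / 2" if "0 < y" for y using that by simp
    from this[OF p] show ?thesis unfolding d_def .
   qed
   finally show ?thesis by simp
  qed
  also have "ennreal E = ennreal C * ennreal (e / (4 * real r))" by (simp only: E_def ennreal_mult'[OF less_imp_le[OF C]])
  also have "ennreal C * diff_mass r (%x v. \<bar>fdiff r v f x\<bar>) + ennreal C * ennreal (e / (4 * real r))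
    <= ennreal C * diff_mass r (%x v. \<bar>fdiff r v f x\<bar> + e)"
   unfolding distrib_left[symmetric] using e by (intro mult_left_mono diff_mass_add_const[OF r f]) auto
  finally show ?case using q(1) by blast
 qed
qed

text \<open>The difference operator annihilates \<open>q\<close>, so the error at \<open>x\<close>
  equals a difference of f at \<open>x\<close> plus errors at the shifted points; averaging over the
  step turns the latter into an L1 norm already bounded. The estimate holds at every point of the
  quarter interval, the right side possibly being infinite.\<close>

lemma whitney_pointwise:
 fixes r :: nat
 assumes r: "1 <= r"
 obtains C where "0 < C" and "\<And>f e. f \<in> borel_measurable borel ==> L1 {0..1} f < \<infinity> ==> 0 < e ==>
  \<exists>q. degree q < r \<and> (\<forall>x\<in>{0..1/4}. eabs (f x - poly q x)
    <= ennreal C * (LN v. ennreal (\<bar>fdiff r v f x\<bar> + e) * indicator {0<..1 / (4 * real r)} v)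
    + ennreal C * diff_mass r (%x v. \<bar>fdiff r v f x\<bar> + e))"
proof (rule whitney_L1[OF r], goal_cases)
 case (1 C0)
 note C0 = 1(2) and w = 1(3)
 define \<eta> where "\<eta> = 1 / (4 * real r)"
 have \<eta>: "0 < \<eta>" using r by (simp add: \<eta>_def)
 define C where "C = 1 / \<eta> * (1 + 2 ^ r * C0)"
 have C: "0 < C" using \<eta> C0 by (simp add: C_def add_pos_pos)
 have C1: "1 / \<eta> <= C" "1 / \<eta> * (2 ^ r * C0) <= C" using \<eta> C0 by (simp_all add: C_def distrib_left)
 show thesis
 proof (rule that[OF C], goal_cases)
  case (1 f e)
  note f[measurable] = 1(1) and fin = 1(2) and e = 1(3)
  obtain q where q: "degree q < r" and qL: "L1 {0..1/2} (%x. f x - poly q x) <= ennreal C0 * diff_mass r (%x v. \<bar>fdiff r v f x\<bar> + e)"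
   using w[OF f fin e] by blast
  define g where "g x = f x - poly q x" for x
  have [measurable]: "g \<in> borel_measurable borel" unfolding g_def by measurable
  define I where "I = L1 {0..1/2} g"
  have "eabs (g x) <= ennreal C * (LN v. ennreal (\<bar>fdiff r v f x\<bar> + e) * indicator {0<..\<eta>} v) + ennreal C * diff_mass r (%x v. \<bar>fdiff r v f x\<bar> + e)"
   if x: "x \<in> {0..1/4}" for x
  proof -
   define J where "J = (LN v. ennreal (\<bar>fdiff r v f x\<bar> + e) * indicator {0<..\<eta>} v)"
   \<comment> \<open>The term i = 0 of the difference of \<open>g = f - q\<close> is isolated; its
     coefficient is a sign.\<close>
   have pt: "\<bar>g x\<bar> <= \<bar>fdiff r v f x\<bar> + (\<Sum>i=1..r. real (r choose i) * \<bar>g (x + real i * v)\<bar>)" if v: "0 < v" for v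
   proof -
    have "fdiff r v g x = fdiff r v f x" unfolding g_def[abs_def] fdiff_diff using fdiff_poly_eq_0[OF q v] by simp
    moreover have "fdiff r v g x = (\<Sum>i\<in>insert 0 {1..r}. real (r choose i) * (-1) ^ (r - i) * g (x + real i * v))"
     unfolding fdiff_def by (intro sum.cong) auto
    ultimately have "(-1) ^ r * g x = fdiff r v f x - (\<Sum>i=1..r. real (r choose i) * (-1) ^ (r - i) * g (x + real i * v))" by simp
    moreover have "\<bar>(-1) ^ r * g x\<bar> = \<bar>g x\<bar>" by (simp add: abs_mult power_abs)
    ultimately have "\<bar>g x\<bar> <= \<bar>fdiff r v f x\<bar> + \<bar>\<Sum>i=1..r. real (r choose i) * (-1) ^ (r - i) * g (x + real i * v)\<bar>" by linarith
    also have "\<bar>\<Sum>i=1..r. real (r choose i) * (-1) ^ (r - i) * g (x + real i * v)\<bar> <= (\<Sum>i=1..r. real (r choose i) * \<bar>g (x + real i * v)\<bar>)"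
     by (rule order_trans[OF sum_abs]) (simp add: abs_mult power_abs)
    finally show ?thesis by simp
   qed
   have "eabs (g x) * ennreal \<eta> = (LN v. eabs (g x) * indicator {0<..\<eta>} v)" using \<eta> by (subst nn_integral_cmult_indicator) auto
   also have "... <= (LN v. ennreal (\<bar>fdiff r v f x\<bar> + e) * indicator {0<..\<eta>} v
     + (\<Sum>i=1..r. ennreal (real (r choose i)) * (eabs (g (x + real i * v)) * indicator {0<..\<eta>} v)))"
   proof (rule nn_integral_mono)
    fix v
    show "eabs (g x) * indicator {0<..\<eta>} v <= ennreal (\<bar>fdiff r v f x\<bar> + e) * indicator {0<..\<eta>} v
     + (\<Sum>i=1..r. ennreal (real (r choose i)) * (eabs (g (x + real i * v)) * indicator {0<..\<eta>} v))"
    proof (cases "v \<in> {0<..\<eta>}")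
     case True
     then have "0 < v" by simp
     have "\<bar>g x\<bar> <= (\<bar>fdiff r v f x\<bar> + e) + (\<Sum>i=1..r. real (r choose i) * \<bar>g (x + real i * v)\<bar>)"
      using pt[OF \<open>0 < v\<close>] e by linarith
     then have "eabs (g x) <= ennreal ((\<bar>fdiff r v f x\<bar> + e) + (\<Sum>i=1..r. real (r choose i) * \<bar>g (x + real i * v)\<bar>))" by (rule ennreal_leI)
     also have "... = ennreal (\<bar>fdiff r v f x\<bar> + e) + (\<Sum>i=1..r. ennreal (real (r choose i)) * eabs (g (x + real i * v)))"
      using e by (subst ennreal_plus) (auto simp: sum_ennreal[symmetric] ennreal_mult' intro!: sum_nonneg simp del: sum_ennreal)
     finally show ?thesis using True by simp
    qed simp
   qed
   also have "... = J + (\<Sum>i=1..r. ennreal (real (r choose i)) * (LN v. eabs (g (x + real i * v)) * indicator {0<..\<eta>} v))" unfolding J_def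
    by (subst nn_integral_add) (auto simp: nn_integral_sum nn_integral_cmult)
   also have "... <= J + (\<Sum>i=1..r. ennreal (real (r choose i)) * I)"
   proof (intro add_left_mono sum_mono mult_left_mono)
    fix i assume "i \<in> {1..r}"
    then have i: "1 <= i" "i <= r" by auto
    have "(LN v. eabs (g (x + real i * v)) * indicator {0<..\<eta>} v)
      <= (LN v. eabs (g (real i * v + x)) * indicator {0..1/2} (real i * v + x))"
    proof (rule nn_integral_mono)
     fix v
     have "real i * v + x \<in> {0..1/2}" if "v \<in> {0<..\<eta>}"
     proof -
      have "real i * v <= real r * \<eta>" using that i by (intro mult_mono) auto
      also have "... = 1 / 4" using r by (simp add: \<eta>_def)
      finally show ?thesis using that x i by auto
     qed
     then show "eabs (g (x + real i * v)) * indicator {0<..\<eta>} v <= eabs (g (real i * v + x)) * indicator {0..1/2} (real i * v + x)"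
      by (auto simp: indicator_def add.commute)
    qed
    also have "... = ennreal (1 / real i) * (LN v. eabs (g (v + x)) * indicator {0..1/2} (v + x))" using i by (intro nn_integral_dilate) auto
    also have "(LN v. eabs (g (v + x)) * indicator {0..1/2} (v + x)) = I" unfolding I_def by (rule nn_integral_translate) measurable
    also have "ennreal (1 / real i) * I <= 1 * I" using i by (intro mult_right_mono) (auto simp: ennreal_le_1)
    finally show "(LN v. eabs (g (x + real i * v)) * indicator {0<..\<eta>} v) <= I" by simp
   qed simp
   also have "(\<Sum>i=1..r. ennreal (real (r choose i)) * I) <= ennreal (2 ^ r) * I"
   proof -
    have "(\<Sum>i=1..r. real (r choose i)) <= (\<Sum>i\<le>r. real (r choose i))" by (intro sum_mono2) auto
    also have "... = 2 ^ r" by (simp add: of_nat_sum[symmetric] choose_row_sum del: of_nat_sum)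
    finally have "ennreal (\<Sum>i=1..r. real (r choose i)) * I <= ennreal (2 ^ r) * I" by (intro mult_right_mono ennreal_leI) auto
    moreover have "(\<Sum>i=1..r. ennreal (real (r choose i)) * I) = ennreal (\<Sum>i=1..r. real (r choose i)) * I"
     by (simp only: sum_distrib_right[symmetric] sum_ennreal of_nat_0_le_iff)
    ultimately show ?thesis by simp
   qed
   finally have "eabs (g x) * ennreal \<eta> <= J + ennreal (2 ^ r) * I" by (simp add: add_left_mono)
   then have "ennreal (1 / \<eta>) * (eabs (g x) * ennreal \<eta>) <= ennreal (1 / \<eta>) * (J + ennreal (2 ^ r) * I)" by (rule mult_left_mono) simp
   also have "ennreal (1 / \<eta>) * (eabs (g x) * ennreal \<eta>) = eabs (g x)" using \<eta> by (simp add: ennreal_mult''[symmetric])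
   also have "ennreal (1 / \<eta>) * (J + ennreal (2 ^ r) * I) <= ennreal (1 / \<eta>) * (J + ennreal (2 ^ r) * (ennreal C0 * diff_mass r (%x v. \<bar>fdiff r v f x\<bar> + e)))"
    using qL unfolding I_def g_def by (intro mult_left_mono add_left_mono) auto
   also have "... = ennreal (1 / \<eta>) * J + ennreal (1 / \<eta> * (2 ^ r * C0)) * diff_mass r (%x v. \<bar>fdiff r v f x\<bar> + e)"
   proof -
    have h: "ennreal (1 / \<eta> * (2 ^ r * C0)) = ennreal (1 / \<eta>) * (ennreal (2 ^ r) * ennreal C0)"
     using \<eta> C0 by (simp only: ennreal_mult' zero_le_divide_iff zero_le_power less_imp_le zero_le_one zero_le_numeral simp_thms)
    show ?thesis unfolding h distrib_left mult.assoc ..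
   qed
   also have "... <= ennreal C * J + ennreal C * diff_mass r (%x v. \<bar>fdiff r v f x\<bar> + e)"
    using C1 by (intro add_mono mult_right_mono ennreal_leI) auto
   finally show ?thesis unfolding J_def .
  qed
  then show ?case using q unfolding g_def \<eta>_def by blast
 qed
qed

section \<open>Transfer to an interval of either orientation\<close>

lemma nn_integral_abs_scale:
 fixes f :: "real \<Rightarrow> ennreal"
 assumes [measurable]: "f \<in> borel_measurable borel" and c: "c \<noteq> 0"
 shows "(LN x. f (b + c * x)) = ennreal (1 / \<bar>c\<bar>) * (LN x. f x)"
proof -
 have "(LN x. f x) = eabs c * (LN x. f (b + c * x))" using c by (intro nn_integral_real_affine) auto
 then have "ennreal (1 / \<bar>c\<bar>) * (LN x. f x) = ennreal (1 / \<bar>c\<bar>) * eabs c * (LN x. f (b + c * x))" by (simp add: mult.assoc)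
 also have "ennreal (1 / \<bar>c\<bar>) * eabs c = 1" using c by (simp add: ennreal_mult''[symmetric])
 finally show ?thesis by simp
qed

lemma fdiff_affine: "fdiff r v (%x. f (a + l * x)) x = fdiff r (l * v) f (a + l * x)" unfolding fdiff_def by (simp add: algebra_simps)

lemma fdiff_minus_step: "fdiff r (- h) f a = (-1) ^ r * fdiff r h f (a - real r * h)"
proof -
 have "fdiff r (- h) f a = (\<Sum>i\<le>r. real (r choose (r - i)) * (-1) ^ (r - (r - i)) * f (a + real (r - i) * (- h)))"
  unfolding fdiff_def by (rule sum.nat_diff_reindex[symmetric, of _ "Suc r", unfolded lessThan_Suc_atMost, simplified])
 also have "... = (-1) ^ r * fdiff r h f (a - real r * h)" unfolding fdiff_def sum_distrib_left
 proof (intro sum.cong refl)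
  fix i assume "i \<in> {..r}"
  then have i: "i <= r" by simp
  have s: "(-1::real) ^ r * (-1) ^ (r - i) = (-1) ^ i"
  proof -
   have "(-1::real) ^ r = (-1) ^ i * (-1) ^ (r - i)" using i by (simp add: power_add[symmetric])
   then show ?thesis by (simp add: power_mult_distrib[symmetric] mult.assoc)
  qed
  have "a + real (r - i) * (- h) = a - real r * h + real i * h" using i by (simp add: of_nat_diff algebra_simps)
  then have fa: "f (a + real (r - i) * (- h)) = f (a - real r * h + real i * h)" by (rule arg_cong)
  have "real (r choose (r - i)) * (-1) ^ (r - (r - i)) = (-1) ^ r * (real (r choose i) * (-1) ^ (r - i))"
   using s i by (simp add: binomial_symmetric[OF i, symmetric])
  then show "real (r choose (r - i)) * (-1) ^ (r - (r - i)) * f (a + real (r - i) * (- h))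
    = (-1) ^ r * (real (r choose i) * (-1) ^ (r - i) * f (a - real r * h + real i * h))" unfolding fa by (simp only: mult.assoc)
 qed
 finally show ?thesis .
qed

text \<open>Reversing the direction changes an \<open>r\<close>-th difference only by a sign once it
  is described by its midpoint and its positive step; this is why the majorants below are indexed by
  midpoints.\<close>

lemma abs_fdiff_centre:
 "\<bar>fdiff r (l * v) f z\<bar> = \<bar>fdiff r (\<bar>l\<bar> * v) f (z + real r * (l * v) / 2 - real r * (\<bar>l\<bar> * v) / 2)\<bar>"
proof (cases "0 <= l")
 case False
 have "fdiff r (l * v) f z = (-1) ^ r * fdiff r (\<bar>l\<bar> * v) f (z - real r * (\<bar>l\<bar> * v))"
  using fdiff_minus_step[of r "\<bar>l\<bar> * v" f z] False by simp
 moreover have "z - real r * (\<bar>l\<bar> * v) = z + real r * (l * v) / 2 - real r * (\<bar>l\<bar> * v) / 2" using False by simp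
 ultimately show ?thesis by (simp add: abs_mult power_abs)
qed simp

lemma centre_endpoints:
 fixes z l v R :: real
 shows "z + R * (l * v) / 2 - R * (\<bar>l\<bar> * v) / 2 = z \<and> z + R * (l * v) / 2 + R * (\<bar>l\<bar> * v) / 2 = z + R * (l * v)
  \<or> z + R * (l * v) / 2 - R * (\<bar>l\<bar> * v) / 2 = z + R * (l * v) \<and> z + R * (l * v) / 2 + R * (\<bar>l\<bar> * v) / 2 = z"
proof (cases "0 <= l")
 case False
 then have "R * (\<bar>l\<bar> * v) = - (R * (l * v))" by simp
 then show ?thesis by linarith
next
 case True
 then have "R * (\<bar>l\<bar> * v) = R * (l * v)" by simp
 then show ?thesis by linarith
qed
lemma swap_pair_mem: "p = z \<and> q = w \<or> p = w \<and> q = z ==> z \<in> S ==> w \<in> S ==> p \<in> S \<and> q \<in> S"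
 by blast

text \<open>The approximation is obtained on the quarter next to \<open>a\<close>. The sign of
  \<open>l\<close> is free so that the interval can point inwards from either end of [-1,1].
  \<open>G\<close> is any measurable majorant of the differences whose end points lie in the
  interval.\<close>

lemma whitney_interval:
 fixes r :: nat
 assumes r: "1 <= r"
 obtains C where "0 < C" and "\<And>f e a l G. f \<in> borel_measurable borel ==> L1 {-1..1} f < \<infinity> ==> 0 < e ==>
  l \<noteq> 0 ==> a \<in> {-1..1} ==> a + l \<in> {-1..1} ==> case_prod G \<in> borel_measurable (borel \<Otimes>\<^sub>M borel) ==>
  (\<And>y h. 0 < h ==> y - real r * h / 2 \<in> {min a (a + l)..max a (a + l)} ==> y + real r * h / 2 \<in> {min a (a + l)..max a (a + l)} ==>
   ennreal (\<bar>fdiff r h f (y - real r * h / 2)\<bar> + e) <= G y h) ==>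
  \<exists>q. degree q < r \<and> (\<forall>x\<in>{0..1/4}. eabs (f (a + l * x) - poly q (a + l * x))
   <= ennreal (C / \<bar>l\<bar>) * (LN h. G (a + l * x - real r * h / 2) h + G (a + l * x + real r * h / 2) h)
    + ennreal (C / l\<^sup>2) * (LN h. LN y. G y h))"
proof (rule whitney_pointwise[OF r], goal_cases)
 case (1 C)
 note C = 1(2) and W = 1(3)
 show thesis
 proof (rule that[OF C], goal_cases)
  case (1 f e a l   G )
  note f[measurable] = 1(1) and fin = 1(2) and e = 1(3) and l = 1(4) and a = 1(5) 1(6) and G[measurable] = 1(7) and GU = 1(8)
  define F where "F x = f (a + l * x)" for x
  have [measurable]: "F \<in> borel_measurable borel" unfolding F_def by measurable
  have inI: "a + l * x \<in> {min a (a + l)..max a (a + l)}" if "x \<in> {0..1}" for x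
  proof (cases "0 < l")
   case True
   then have "0 <= l * x" "l * x <= l * 1" using that by (auto intro!: mult_left_mono)
   then show ?thesis by auto
  next
   case False
   then have "l * x <= 0" "l * 1 <= l * x" using that l by (auto intro!: mult_left_mono_neg simp: mult_nonpos_nonneg)
   then show ?thesis by auto
  qed
  have in1: "a + l * x \<in> {-1..1}" if "x \<in> {0..1}" for x using inI[OF that] a by auto
  have "L1 {0..1} F <= (LN x. eabs (f (a + l * x)) * indicator {-1..1} (a + l * x))" using in1 by (intro nn_integral_mono) (auto simp: F_def indicator_def)
  also have "... = ennreal (1 / \<bar>l\<bar>) * L1 {-1..1} f" by (rule nn_integral_abs_scale) (use l in measurable)
  also have "... < \<infinity>" using fin by (simp add: ennreal_mult_less_top)
  finally have Ffin: "L1 {0..1} F < \<infinity>" .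
  have U: "ennreal (\<bar>fdiff r v F x\<bar> + e) <= G (a + l * x + real r * (l * v) / 2) (\<bar>l\<bar> * v)"
   if v: "0 < v" "0 <= x" "x + real r * v <= 1" for x v
  proof -
   define z where "z = a + l * x"
   have "0 <= real r * v" using v by simp
   then have "x \<in> {0..1}" "x + real r * v \<in> {0..1}" using v unfolding atLeastAtMost_iff by linarith+
   note x01 = this
   have "a + l * (x + real r * v) = z + real r * (l * v)" by (simp add: z_def algebra_simps)
   then have zI: "z \<in> {min a (a + l)..max a (a + l)}" "z + real r * (l * v) \<in> {min a (a + l)..max a (a + l)}"
    using inI[OF x01(1)] inI[OF x01(2)] unfolding z_def by (simp_all only:)
   have "0 < \<bar>l\<bar> * v" using l v by simp
   moreover have "z + real r * (l * v) / 2 - real r * (\<bar>l\<bar> * v) / 2 \<in> {min a (a + l)..max a (a + l)}"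
    "z + real r * (l * v) / 2 + real r * (\<bar>l\<bar> * v) / 2 \<in> {min a (a + l)..max a (a + l)}"
   proof -
    have m: "z + real r * (l * v) / 2 - real r * (\<bar>l\<bar> * v) / 2 \<in> {min a (a + l)..max a (a + l)} \<and> z + real r * (l * v) / 2 + real r * (\<bar>l\<bar> * v) / 2 \<in> {min a (a + l)..max a (a + l)}"
     using swap_pair_mem[OF centre_endpoints zI] .
    show "z + real r * (l * v) / 2 - real r * (\<bar>l\<bar> * v) / 2 \<in> {min a (a + l)..max a (a + l)}" by (rule m[THEN conjunct1])
    show "z + real r * (l * v) / 2 + real r * (\<bar>l\<bar> * v) / 2 \<in> {min a (a + l)..max a (a + l)}" by (rule m[THEN conjunct2])
   qed
   ultimately have "ennreal (\<bar>fdiff r (\<bar>l\<bar> * v) f (z + real r * (l * v) / 2 - real r * (\<bar>l\<bar> * v) / 2)\<bar> + e)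
     <= G (z + real r * (l * v) / 2) (\<bar>l\<bar> * v)" by (rule GU)
   then show ?thesis unfolding F_def[abs_def] fdiff_affine by (simp only: abs_fdiff_centre[of r l v f "a + l * x"] z_def)
  qed
  obtain q where q: "degree q < r" and qx: "\<And>x. x \<in> {0..1/4} ==> eabs (F x - poly q x)
   <= ennreal C * (LN v. ennreal (\<bar>fdiff r v F x\<bar> + e) * indicator {0<..1 / (4 * real r)} v)
    + ennreal C * diff_mass r (%x v. \<bar>fdiff r v F x\<bar> + e)" using W[OF _ Ffin e] by auto
  define q' where "q' = pcompose q [:- a / l, 1 / l:]"
  have q': "poly q' (a + l * x) = poly q x" for x
  proof -
   have "(a + l * x) / l - a / l = x" using l by (simp add: add_divide_distrib)
   then show ?thesis by (simp add: q'_def poly_pcompose)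
  qed
  have "degree q' < r" using q by (auto simp: q'_def intro!: le_less_trans[OF degree_pcompose_le])
  moreover have "eabs (f (a + l * x) - poly q' (a + l * x))
   <= ennreal (C / \<bar>l\<bar>) * (LN h. G (a + l * x - real r * h / 2) h + G (a + l * x + real r * h / 2) h)
    + ennreal (C / l\<^sup>2) * (LN h. LN y. G y h)" if x: "x \<in> {0..1/4}" for x
  proof -
   define z where "z = a + l * x"
   \<comment> \<open>The point \<open>z\<close> is the left or the right end of the difference
     according to the sign of \<open>l\<close>; both midpoints are kept so that the two orientations
     share one bound.\<close>
   define GG where "GG h = G (z - real r * h / 2) h + G (z + real r * h / 2) h" for h
   have [measurable]: "GG \<in> borel_measurable borel" unfolding GG_def by measurable
   have "(LN v. ennreal (\<bar>fdiff r v F x\<bar> + e) * indicator {0<..1 / (4 * real r)} v)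
    <= (LN v. GG (0 + \<bar>l\<bar> * v))"
   proof (rule nn_integral_mono)
    fix v
    show "ennreal (\<bar>fdiff r v F x\<bar> + e) * indicator {0<..1 / (4 * real r)} v <= GG (0 + \<bar>l\<bar> * v)"
    proof (cases "v \<in> {0<..1 / (4 * real r)}")
     case True
     then have "real r * v <= real r * (1 / (4 * real r))" by (intro mult_left_mono) auto
     also have "... = 1 / 4" using r by simp
     finally have "ennreal (\<bar>fdiff r v F x\<bar> + e) <= G (a + l * x + real r * (l * v) / 2) (\<bar>l\<bar> * v)"
      using x True by (intro U) (auto simp only: greaterThanAtMost_iff atLeastAtMost_iff)
     also have "... <= GG (0 + \<bar>l\<bar> * v)"
     proof (cases "0 <= l")
      case True
      then show ?thesis unfolding GG_def z_def by (simp only: add_0 abs_of_nonneg) (rule add_increasing, simp_all)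
     next
      case False
      then have "\<bar>l\<bar> = - l" by simp
      then show ?thesis unfolding GG_def z_def by (simp only: add_0 mult_minus_left mult_minus_right minus_divide_left[symmetric] diff_minus_eq_add) (rule add_increasing2, simp_all)
     qed
     finally show ?thesis using True by simp
    qed simp
   qed
   also have "... = ennreal (1 / \<bar>\<bar>l\<bar>\<bar>) * (LN h. GG h)" by (rule nn_integral_abs_scale) (use l in auto)
   finally have I1: "ennreal C * (LN v. ennreal (\<bar>fdiff r v F x\<bar> + e) * indicator {0<..1 / (4 * real r)} v)
     <= ennreal C * (ennreal (1 / \<bar>l\<bar>) * (LN h. GG h))" by (intro mult_left_mono) auto
   \<comment> \<open>Point and step are each rescaled by the modulus of \<open>l\<close>, whence the
     square of the length in the second term.\<close>
   have "diff_mass r (%x v. \<bar>fdiff r v F x\<bar> + e) <= (LN v. (LN x. G ((a + real r * (l * v) / 2) + l * x) (\<bar>l\<bar> * v)))"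
    unfolding diff_mass_def
   proof (intro nn_integral_mono)
    fix v x
    show "ennreal (\<bar>fdiff r v F x\<bar> + e) * indicator {(x, v). 0 <= x \<and> 0 < v \<and> x + real r * v <= 1} (x, v)
     <= G ((a + real r * (l * v) / 2) + l * x) (\<bar>l\<bar> * v)" using U[of v x] by (auto simp: indicator_def algebra_simps)
   qed
   also have "... = (LN v. ennreal (1 / \<bar>l\<bar>) * (LN y. G y (0 + \<bar>l\<bar> * v)))"
    using l by (intro nn_integral_cong) (subst nn_integral_abs_scale, auto)
   also have "... = ennreal (1 / \<bar>l\<bar>) * (LN v. (LN y. G y (0 + \<bar>l\<bar> * v)))" by (rule nn_integral_cmult) measurable
   also have "(LN v. (LN y. G y (0 + \<bar>l\<bar> * v))) = ennreal (1 / \<bar>\<bar>l\<bar>\<bar>) * (LN h. (LN y. G y h))"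
   proof (rule nn_integral_abs_scale[where f = "%h. LN y. G y h"])
    show "(%h. LN y. G y h) \<in> borel_measurable borel" by measurable
   qed (use l in simp)
   finally have I2: "ennreal C * diff_mass r (%x v. \<bar>fdiff r v F x\<bar> + e)
     <= ennreal C * (ennreal (1 / \<bar>l\<bar>) * (ennreal (1 / \<bar>l\<bar>) * (LN h. LN y. G y h)))" by (intro mult_left_mono) auto
   have c1: "ennreal C * (ennreal (1 / \<bar>l\<bar>) * X) = ennreal (C / \<bar>l\<bar>) * X" for X
    using C by (simp add: mult.assoc[symmetric] ennreal_mult'[symmetric])
   have c2: "ennreal C * (ennreal (1 / \<bar>l\<bar>) * (ennreal (1 / \<bar>l\<bar>) * X)) = ennreal (C / l\<^sup>2) * X" for X
   proof -
    have "C * (1 / \<bar>l\<bar>) * (1 / \<bar>l\<bar>) = C / l\<^sup>2" by (simp add: power2_eq_square abs_mult_self_eq)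
    then show ?thesis using C by (simp only: mult.assoc[symmetric] ennreal_mult'[symmetric] less_imp_le zero_le_divide_1_iff abs_ge_zero mult_nonneg_nonneg)
   qed
   have "eabs (f (a + l * x) - poly q' (a + l * x)) <= ennreal (C / \<bar>l\<bar>) * (LN h. GG h) + ennreal (C / l\<^sup>2) * (LN h. LN y. G y h)"
    using order_trans[OF qx[OF x] add_mono[OF I1 I2]] unfolding c2 unfolding c1 F_def q' .
   then show ?thesis unfolding GG_def z_def .
  qed
  ultimately show ?case by blast
 qed
qed

section \<open>Polynomial step functions and the angular grid\<close>

lemma fejer_pair_le:
 assumes m: "1 <= m" and t: "0 <= t" "t <= pi" and y: "0 <= y" "y <= pi"
 shows "fejer m (t - y) ^ s + fejer m (t + y) ^ s <= 2 * ((1 + pi) / (1 + real m * \<bar>t - y\<bar>)) ^ (2 * s)"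
proof -
 note sh = sin_half_sum_ge[OF t y]
 have "\<bar>sin ((t - y) / 2)\<bar> = \<bar>sin (\<bar>t - y\<bar> / 2)\<bar>"
 proof -
  have "(t - y) / 2 = \<bar>t - y\<bar> / 2 \<or> (t - y) / 2 = - (\<bar>t - y\<bar> / 2)" by linarith
  then show ?thesis by (elim disjE) (simp_all only: sin_minus abs_minus_cancel)
 qed
 then have "\<bar>t - y\<bar> / pi <= \<bar>sin ((t - y) / 2)\<bar>" using sh(3) by linarith
 then have 1: "fejer m (t - y) ^ s <= ((1 + pi) / (1 + real m * \<bar>t - y\<bar>))\<^sup>2 ^ s" by (intro power_mono fejer_nonneg fejer_decay[OF m]) auto
 have 2: "fejer m (t + y) ^ s <= ((1 + pi) / (1 + real m * \<bar>t - y\<bar>))\<^sup>2 ^ s" using sh(2) by (intro power_mono fejer_nonneg fejer_decay[OF m]) auto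
 from 1 2 show ?thesis by (simp add: power_mult)
qed

text \<open>Of the decay, \<open>j\<close> powers are frozen at the distance \<open>D\<close> and
  two are integrated with an explicit antiderivative. The sign \<sigma> treats the tails on both
  sides of \<theta> at once.\<close>

lemma integral_tail_le:
 fixes k :: "real \<Rightarrow> real"
 assumes m: "1 <= m" and ab: "a <= b" and \<sigma>: "\<sigma> = 1 \<or> \<sigma> = -1" and k: "continuous_on {a..b} k"
  and D: "0 <= D" "\<And>t. t \<in> {a..b} ==> D <= \<sigma> * (t - \<theta>)"
  and le: "\<And>t. t \<in> {a..b} ==> k t <= B / (1 + real m * (\<sigma> * (t - \<theta>))) ^ (j + 2)" and B: "0 <= B"
 shows "integral {a..b} k <= B / (1 + real m * D) ^ j / real m"
proof -
 define u where "u t = 1 + real m * (\<sigma> * (t - \<theta>))" for t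
 have uD: "1 + real m * D <= u t" if "t \<in> {a..b}" for t unfolding u_def using D(2)[OF that] m by (intro add_left_mono mult_left_mono) auto
 have D1: "1 <= 1 + real m * D" using D by simp
 have u1: "1 <= u t" if "t \<in> {a..b}" for t using uD[OF that] D1 by linarith
 define c where "c = B / (1 + real m * D) ^ j"
 have c: "0 <= c" using B D1 by (simp add: c_def)
 define F where "F t = - \<sigma> * (c / (real m * u t))" for t
 have s1: "\<sigma> * \<sigma> = 1" using \<sigma> by auto
 have "((%t. c / (u t)\<^sup>2) has_integral (F b - F a)) {a..b}"
 proof (rule fundamental_theorem_of_calculus[OF ab])
  fix t assume t: "t \<in> {a..b}"
  have ut: "u t \<noteq> 0" using u1[OF t] by auto
  have "(u has_real_derivative real m * \<sigma>) (at t)" unfolding u_def by (auto intro!: derivative_eq_intros)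
  then have "(F has_real_derivative (- \<sigma> * (- (c * (real m * (real m * \<sigma>))) / ((real m * u t) * (real m * u t))))) (at t)"
   unfolding F_def using ut m by (auto intro!: derivative_eq_intros)
  moreover have "- \<sigma> * (- (c * (real m * (real m * \<sigma>))) / ((real m * u t) * (real m * u t))) = (\<sigma> * \<sigma>) * (c / (u t)\<^sup>2)"
   using ut m by (simp add: power2_eq_square)
  ultimately have "(F has_real_derivative c / (u t)\<^sup>2) (at t within {a..b})" unfolding s1 by (auto intro: has_field_derivative_at_within)
  then show "(F has_vector_derivative c / (u t)\<^sup>2) (at t within {a..b})" by (simp add: has_real_derivative_iff_has_vector_derivative)
 qed
 moreover have "k t <= c / (u t)\<^sup>2" if t: "t \<in> {a..b}" for t
 proof -
  have "k t <= B / ((u t) ^ j * (u t)\<^sup>2)" using le[OF t] unfolding u_def[symmetric] power_add .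
  also have "... <= B / ((1 + real m * D) ^ j * (u t)\<^sup>2)"
   using uD[OF t] u1[OF t] D1 B by (intro divide_left_mono mult_right_mono power_mono mult_pos_pos zero_less_power) auto
  finally show ?thesis by (simp add: c_def)
 qed
 ultimately have "integral {a..b} k <= F b - F a" using integrable_continuous_interval[OF k] by (intro has_integral_le[OF integrable_integral]) auto
 also have "... <= c / real m"
 proof -
  have "0 <= c / (real m * u t) \<and> c / (real m * u t) <= c / real m" if "t \<in> {a..b}" for t
  proof -
   have "real m * 1 <= real m * u t" using u1[OF that] by (intro mult_left_mono) auto
   then have "c / (real m * u t) <= c / (real m * 1)" using c m u1[OF that] by (intro divide_left_mono mult_pos_pos) auto
   then show ?thesis using c m u1[OF that] by simp
  qed
  from this[of a] this[of b] show ?thesis using \<sigma> ab by (auto simp: F_def)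
 qed
 finally show ?thesis by (simp add: c_def)
qed

text \<open>The step is smoothed by integrating the symmetrised Fejer power over
  \<open>{\<alpha>..pi}\<close> and dividing by its total mass. The error at \<theta> is the share
  of mass on the other side of \<alpha>; integrating the tail costs two powers of decay, and the
  lower bound of the mass produces the factor 4^s.\<close>

lemma step_poly:
 assumes m: "1 <= m" and s: "1 <= s" and \<alpha>: "0 <= \<alpha>" "\<alpha> <= pi"
 shows "\<exists>R. degree R <= s * (m - 1) \<and> (\<forall>\<theta>\<in>{0..pi}. \<bar>(if \<alpha> <= \<theta> then 1 else 0) - poly R (cos \<theta>)\<bar>
  <= 4 ^ s * (1 + pi) ^ (2 * s) / (1 + real m * \<bar>\<theta> - \<alpha>\<bar>) ^ (2 * s - 2))"
proof -
 obtain a where a: "\<And>k. 0 <= a k" "\<And>u. fejer m u ^ s = (\<Sum>k\<le>s * (m - 1). a k * cos (real k * u))"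
  using cospoly_power[OF cospoly_fejer[of m], of s] unfolding cospoly_def by metis
 define J where "J = s * (m - 1)"
 define K where "K t \<theta> = fejer m (t - \<theta>) ^ s + fejer m (t + \<theta>) ^ s" for t \<theta>
 have K: "K t \<theta> = (\<Sum>k\<le>J. 2 * a k * cos (real k * \<theta>) * cos (real k * t))" for t \<theta>
 proof -
  have "2 * (cos (real k * t) * cos (real k * \<theta>)) = cos (real k * (t - \<theta>)) + cos (real k * (t + \<theta>))" for k
   using cos_add[of "real k * t" "real k * \<theta>"] cos_diff[of "real k * t" "real k * \<theta>"] by (simp add: algebra_simps)
  then have "2 * a k * cos (real k * \<theta>) * cos (real k * t) = a k * cos (real k * (t - \<theta>)) + a k * cos (real k * (t + \<theta>))" for k
   by (simp add: distrib_left[symmetric] mult.left_commute mult.assoc mult.commute)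
  then show ?thesis by (simp add: K_def a(2) sum.distrib J_def)
 qed
 have Kc: "continuous_on S (%t. K t \<theta>)" for S \<theta> unfolding K by (intro continuous_intros)
 have Ki: "(%t. K t \<theta>) integrable_on {x..y}" for x y \<theta> by (rule integrable_continuous_interval[OF Kc])
 have K0: "0 <= K t \<theta>" for t \<theta> by (simp add: K_def fejer_nonneg)
 define c where "c x y k = integral {x..y} (%t. cos (real k * t))" for x y :: real and k :: nat
 have ci: "((%t. cos (real k * t)) has_integral c x y k) {x..y}" for x y k
  unfolding c_def by (intro integrable_integral integrable_continuous_interval continuous_intros)
 have cK: "integral {x..y} (%t. K t \<theta>) = (\<Sum>k\<le>J. 2 * a k * cos (real k * \<theta>) * c x y k)" for x y \<theta>
  unfolding K by (intro integral_unique has_integral_sum has_integral_mult_right ci) auto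
 \<comment> \<open>Only the constant term survives integration over all angles, so the total mass
   \<open>Z\<close> is the same for every \<theta>, although the kernel is not a function of the
   difference of the angles.\<close>
 have c0: "c 0 pi k = 0" if "1 <= k" for k
 proof -
  have "((%t. cos (real k * t)) has_integral (sin (real k * pi) / real k - sin (real k * 0) / real k)) {0..pi}"
  proof (rule fundamental_theorem_of_calculus)
   fix t
   have "((%t. sin (real k * t) / real k) has_real_derivative cos (real k * t) * real k / real k) (at t within {0..pi})"
    using that by (auto intro!: derivative_eq_intros)
   then show "((%t. sin (real k * t) / real k) has_vector_derivative cos (real k * t)) (at t within {0..pi})"
    using that by (simp add: has_real_derivative_iff_has_vector_derivative)
  qed simp
  moreover have "sin (real k * pi) = 0" by simp
  ultimately show ?thesis by (simp add: c_def integral_unique)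
 qed
 define Z where "Z = integral {0..pi} (%t. K t 0)"
 have Z: "integral {0..pi} (%t. K t \<theta>) = Z" for \<theta>
 proof -
  have "2 * a k * cos (real k * \<theta>) * c 0 pi k = 2 * a k * cos (real k * 0) * c 0 pi k" for k using c0[of k] by (cases "k = 0") auto
  then show ?thesis unfolding Z_def cK by (intro sum.cong refl)
 qed
 have mpi: "1 / real m <= pi" proof -
  have "1 / real m <= 1" using m by simp
  then show ?thesis using pi_gt3 by linarith
 qed
 have "integral {0..1 / real m} (%t. 2 * (1 / 4) ^ s) <= integral {0..1 / real m} (%t. K t 0)"
 proof (rule integral_le[OF _ Ki])
  fix t assume "t \<in> {0..1 / real m}"
  then have "1 / 4 <= fejer m t" by (intro fejer_ge m) auto
  then have "(1 / 4) ^ s <= fejer m t ^ s" by (intro power_mono) auto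
  then show "2 * (1 / 4) ^ s <= K t 0" by (simp add: K_def)
 qed (intro integrable_continuous_interval continuous_intros)
 also have "... <= Z" unfolding Z_def using mpi K0 by (intro integral_subset_le Ki) auto
 finally have Zge: "2 * (1 / 4) ^ s / real m <= Z" using m by (simp add: mult.commute)
 have "0 < 2 * (1 / 4) ^ s / real m" using m by simp
 then have Z0: "0 < Z" using Zge by linarith
 define R where "R = (\<Sum>k\<le>J. smult (2 * a k * c \<alpha> pi k / Z) (chebT k))"
 have R: "poly R (cos \<theta>) = integral {\<alpha>..pi} (%t. K t \<theta>) / Z" for \<theta>
  unfolding cK R_def by (simp add: poly_sum poly_chebT_cos sum_divide_distrib mult.commute mult.left_commute)
 have "degree R <= J" unfolding R_def
 proof (rule degree_sum_le)
  fix k assume "k \<in> {..J}"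
  then have "degree (chebT k) <= J" using coeff_chebT[of k] by (intro degree_le) auto
  then show "degree (smult (2 * a k * c \<alpha> pi k / Z) (chebT k)) <= J" by (rule order_trans[OF degree_smult_le])
 qed simp
 moreover have "\<bar>(if \<alpha> <= \<theta> then 1 else 0) - poly R (cos \<theta>)\<bar>
  <= 4 ^ s * (1 + pi) ^ (2 * s) / (1 + real m * \<bar>\<theta> - \<alpha>\<bar>) ^ (2 * s - 2)" if \<theta>: "\<theta> \<in> {0..pi}" for \<theta>
 proof -
  define B where "B = 2 * (1 + pi) ^ (2 * s)"
  have B: "0 <= B" by (simp add: B_def)
  have s2: "2 * s - 2 + 2 = 2 * s" using s by simp
  define I where "I = (if \<alpha> <= \<theta> then integral {0..\<alpha>} (%t. K t \<theta>) else integral {\<alpha>..pi} (%t. K t \<theta>))"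
  have kb: "K t \<theta> <= B / (1 + real m * \<bar>t - \<theta>\<bar>) ^ (2 * s - 2 + 2)" if "t \<in> {0..pi}" for t
   unfolding K_def B_def s2 using fejer_pair_le[OF m, of t \<theta> s] that \<theta> by (simp add: power_divide)
  have I: "I <= B / (1 + real m * \<bar>\<theta> - \<alpha>\<bar>) ^ (2 * s - 2) / real m"
  proof (cases "\<alpha> <= \<theta>")
   case True
   have "integral {0..\<alpha>} (%t. K t \<theta>) <= B / (1 + real m * \<bar>\<theta> - \<alpha>\<bar>) ^ (2 * s - 2) / real m"
   proof (rule integral_tail_le[OF m \<alpha>(1) disjI2[OF refl] Kc, of _ \<theta>])
    fix t assume t: "t \<in> {0..\<alpha>}"
    then have "\<bar>t - \<theta>\<bar> = - 1 * (t - \<theta>)" using True by simp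
    then show "K t \<theta> <= B / (1 + real m * (- 1 * (t - \<theta>))) ^ (2 * s - 2 + 2)" using kb[of t] t \<alpha> by simp
   qed (use B True in auto)
   then show ?thesis using True by (simp add: I_def)
  next
   case False
   have "integral {\<alpha>..pi} (%t. K t \<theta>) <= B / (1 + real m * \<bar>\<theta> - \<alpha>\<bar>) ^ (2 * s - 2) / real m"
   proof (rule integral_tail_le[OF m \<alpha>(2) disjI1[OF refl] Kc, of _ \<theta>])
    fix t assume t: "t \<in> {\<alpha>..pi}"
    then have "\<bar>t - \<theta>\<bar> = 1 * (t - \<theta>)" using False by simp
    then show "K t \<theta> <= B / (1 + real m * (1 * (t - \<theta>))) ^ (2 * s - 2 + 2)" using kb[of t] t \<alpha> by simp
   qed (use B False in auto)
   then show ?thesis using False by (simp add: I_def)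
  qed
  have "integral {0..\<alpha>} (%t. K t \<theta>) + integral {\<alpha>..pi} (%t. K t \<theta>) = Z"
   unfolding Z[of \<theta>, symmetric] using \<alpha> by (intro Henstock_Kurzweil_Integration.integral_combine Ki)
  then have "\<bar>(if \<alpha> <= \<theta> then 1 else 0) - poly R (cos \<theta>)\<bar> = I / Z"
  proof -
   assume e: "integral {0..\<alpha>} (%t. K t \<theta>) + integral {\<alpha>..pi} (%t. K t \<theta>) = Z"
   have p: "0 <= integral {0..\<alpha>} (%t. K t \<theta>)" "0 <= integral {\<alpha>..pi} (%t. K t \<theta>)"
    by (rule Henstock_Kurzweil_Integration.integral_nonneg[OF Ki], rule K0)+
   have "1 - integral {\<alpha>..pi} (%t. K t \<theta>) / Z = integral {0..\<alpha>} (%t. K t \<theta>) / Z" using e Z0 by (simp add: field_simps)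
   then show ?thesis unfolding R I_def using p Z0 by auto
  qed
  also have "... <= B / (1 + real m * \<bar>\<theta> - \<alpha>\<bar>) ^ (2 * s - 2) / real m / (2 * (1 / 4) ^ s / real m)"
  proof -
   have "0 <= integral {x..y} (%t. K t \<theta>)" for x y by (rule Henstock_Kurzweil_Integration.integral_nonneg[OF Ki], rule K0)
   then have "0 <= I" unfolding I_def by simp
   then show ?thesis using I Zge m by (intro frac_le) auto
  qed
  also have "... = 4 ^ s * (1 + pi) ^ (2 * s) / (1 + real m * \<bar>\<theta> - \<alpha>\<bar>) ^ (2 * s - 2)" using m by (simp add: B_def power_divide)
  finally show ?thesis .
 qed
 ultimately show ?thesis unfolding J_def by blast
qed

section \<open>Growth of a polynomial away from an interval\<close>

lemma lagrange_bound:
 fixes q :: "real poly"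
 assumes q: "degree q < r" and h: "0 < h" and y: "\<And>i j. i < r ==> j < r ==> i \<noteq> j ==> h <= \<bar>y i - y j\<bar>"
  and B: "\<And>i. i < r ==> \<bar>poly q (y i)\<bar> <= B" and D: "\<And>i. i < r ==> \<bar>x - y i\<bar> <= D"
 shows "\<bar>poly q x\<bar> <= real r * (B * (D / h) ^ (r - 1))"
proof -
 define w where "w i = (\<Prod>j\<in>{..<r} - {i}. y i - y j)" for i
 define p where "p i = (\<Prod>j\<in>{..<r} - {i}. [:- y j, 1:])" for i
 have yne: "y i \<noteq> y j" if "i < r" "j < r" "i \<noteq> j" for i j using y[OF that] h by auto
 have w0: "w i \<noteq> 0" if "i < r" for i using yne that by (auto simp: w_def)
 have pp: "poly (p i) t = (\<Prod>j\<in>{..<r} - {i}. t - y j)" for i t by (simp add: p_def poly_prod)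
 define L where "L = (\<Sum>i<r. smult (poly q (y i) / w i) (p i))"
 have cardr: "card ({..<r} - {i}) = r - 1" if "i < r" for i using that by (simp add: card_Diff_singleton)
 have "q = L"
 proof (rule poly_eqI_degree[of "y ` {..<r}"])
  fix t assume "t \<in> y ` {..<r}"
  then obtain k where "k \<in> {..<r}" "t = y k" by blast
  then have k: "k < r" "t = y k" by simp_all
  have "poly (p i) (y k) = (if i = k then w k else 0)" if "i < r" for i
  proof (cases "i = k")
   case False
   have "(\<Prod>j\<in>{..<r} - {i}. y k - y j) = 0" using k that False by (intro prod_zero) auto
   then show ?thesis using False by (simp add: pp)
  qed (simp add: pp w_def)
  then have "poly L (y k) = (\<Sum>i<r. if i = k then poly q (y k) else 0)" unfolding L_def poly_sum using w0 by (intro sum.cong refl) auto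
  then show "poly q t = poly L t" using k by simp
 next
  have "inj_on y {..<r}" using yne by (intro inj_onI) auto
  then have c: "card (y ` {..<r}) = r" by (simp add: card_image)
  show "degree q < card (y ` {..<r})" using q c by simp
  have "degree (p i) <= r - 1" if "i < r" for i unfolding p_def using cardr[OF that] by (intro order_trans[OF degree_prod_sum_le]) auto
  then have "degree L <= r - 1" unfolding L_def by (intro degree_sum_le) (auto intro: order_trans[OF degree_smult_le])
  then show "degree L < card (y ` {..<r})" using q c by simp
 qed
 then have "poly q x = poly L x" by (rule arg_cong)
 also have "... = (\<Sum>i<r. poly q (y i) / w i * poly (p i) x)" by (simp add: L_def poly_sum)
 finally have "poly q x = (\<Sum>i<r. poly q (y i) / w i * poly (p i) x)" .
 then have "\<bar>poly q x\<bar> <= (\<Sum>i<r. \<bar>poly q (y i) / w i * poly (p i) x\<bar>)" by (simp only: sum_abs)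
 also have "... <= (\<Sum>i<r. B * (D / h) ^ (r - 1))"
 proof (rule sum_mono)
  fix i assume "i \<in> {..<r}"
  then have i: "i < r" by simp
  have B0: "0 <= B" using B[OF i] by linarith
  have D0: "0 <= D" using D[OF i] by linarith
  have 1: "\<bar>poly (p i) x\<bar> <= D ^ (r - 1)"
  proof -
   have "\<bar>poly (p i) x\<bar> <= (\<Prod>j\<in>{..<r} - {i}. D)" unfolding pp abs_prod using D by (intro prod_mono) auto
   then show ?thesis using cardr[OF i] by simp
  qed
  have 2: "h ^ (r - 1) <= \<bar>w i\<bar>"
  proof -
   have "(\<Prod>j\<in>{..<r} - {i}. h) <= \<bar>w i\<bar>" unfolding w_def abs_prod using y i h by (intro prod_mono) auto
   then show ?thesis using cardr[OF i] by simp
  qed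
  have hp: "0 < h ^ (r - 1)" using h by simp
  have "\<bar>poly q (y i) / w i * poly (p i) x\<bar> = \<bar>poly q (y i)\<bar> * \<bar>poly (p i) x\<bar> / \<bar>w i\<bar>" by (simp add: abs_mult)
  also have "... <= B * D ^ (r - 1) / h ^ (r - 1)" using 1 2 hp B[OF i] B0 D0 by (intro frac_le mult_mono) auto
  finally show "\<bar>poly q (y i) / w i * poly (p i) x\<bar> <= B * (D / h) ^ (r - 1)" by (simp add: power_divide)
 qed
 finally show ?thesis by simp
qed

text \<open>The interval is cut into \<open>r\<close> pieces of length \<open>h\<close> separated by
  gaps of length \<open>h\<close>. In each piece a minimum point of the modulus of \<open>q\<close>
  has value at most the mean over the piece, and Lagrange interpolation at these separated points
  reaches \<open>x\<close>.\<close>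

lemma poly_L1_growth:
 fixes q :: "real poly"
 assumes q: "degree q < r" and ab: "a < b" and z: "z \<in> {a..b}"
 shows "eabs (poly q x) <= ennreal (real r * (2 * real r) ^ r * (1 + \<bar>x - z\<bar> / (b - a)) ^ (r - 1) / (b - a))
   * L1 {a..b} (poly q)"
proof -
 define d where "d = b - a"
 have d: "0 < d" using ab by (simp add: d_def)
 have r: "1 <= r" using q by simp
 define I where "I = L1 {a..b} (poly q)"
 define h where "h = d / (2 * real r)"
 have h: "0 < h" using d r by (simp add: h_def)
 have dh: "d = 2 * real r * h" using r by (simp add: h_def)
 have K: "0 < real r * (2 * real r) ^ r * (1 + \<bar>x - z\<bar> / d) ^ (r - 1) / d"
  using d r by (intro divide_pos_pos mult_pos_pos zero_less_power add_pos_nonneg) auto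
 show ?thesis
 proof (cases I)
  case top
  have "ennreal (real r * (2 * real r) ^ r * (1 + \<bar>x - z\<bar> / d) ^ (r - 1) / d) \<noteq> 0" using K by (simp only: ennreal_eq_0_iff not_le)
  then show ?thesis unfolding I_def[symmetric] d_def[symmetric] top by (simp only: ennreal_mult_top if_False top_greatest)
 next
  case (real B)
  obtain lo where lo: "lo = (%i. a + 2 * real i * h)" by blast
  have lo_a: "a <= lo i" for i using h by (simp add: lo)
  have lo_b: "lo i + h <= b" if "i < r" for i
  proof -
   have "(2 * real i + 1) * h <= d" unfolding dh using that h by (intro mult_right_mono) auto
   then show ?thesis by (simp add: lo d_def distrib_right)
  qed
  have lo_less: "lo i + h + h <= lo j" if "i < j" for i j
  proof -
   have "(2 * real i + 2) * h <= 2 * real j * h" using that h by (intro mult_right_mono) auto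
   then show ?thesis by (simp add: lo distrib_right)
  qed
  have ex: "\<exists>y\<in>{lo i..lo i + h}. \<forall>t\<in>{lo i..lo i + h}. \<bar>poly q y\<bar> <= \<bar>poly q t\<bar>" for i
   using h by (intro continuous_attains_inf continuous_intros) auto
  have "\<forall>i. \<exists>y. y \<in> {lo i..lo i + h} \<and> (\<forall>t\<in>{lo i..lo i + h}. \<bar>poly q y\<bar> <= \<bar>poly q t\<bar>)" using ex by blast
  from choice[OF this] obtain y where yy: "\<forall>i. y i \<in> {lo i..lo i + h} \<and> (\<forall>t\<in>{lo i..lo i + h}. \<bar>poly q (y i)\<bar> <= \<bar>poly q t\<bar>)" by blast
  have y: "y i \<in> {lo i..lo i + h}"
   "t \<in> {lo i..lo i + h} ==> \<bar>poly q (y i)\<bar> <= \<bar>poly q t\<bar>" for i t using yy by blast+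
  have sub: "{lo i..lo i + h} \<subseteq> {a..b}" if "i < r" for i using lo_a[of i] lo_b[OF that] by (intro atLeastatMost_subset_iff[THEN iffD2] disjI2 conjI)
  have yB: "\<bar>poly q (y i)\<bar> <= B / h" if i: "i < r" for i
  proof -
   have "ennreal (\<bar>poly q (y i)\<bar> * h) = eabs (poly q (y i)) * emeasure lborel {lo i..lo i + h}" using h by (simp add: ennreal_mult')
   also have "... = (LN t. eabs (poly q (y i)) * indicator {lo i..lo i + h} t)" by (subst nn_integral_cmult_indicator) auto
   also have "... <= I" unfolding I_def
   proof (rule nn_integral_mono)
    fix t
    show "eabs (poly q (y i)) * indicator {lo i..lo i + h} t <= eabs (poly q t) * indicator {a..b} t"
    proof (cases "t \<in> {lo i..lo i + h}")
     case True
     moreover from True have "t \<in> {a..b}" using sub[OF i] by blast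
     ultimately show ?thesis using y(2)[OF True] by (simp add: ennreal_leI del: atLeastAtMost_iff)
    qed simp
   qed
   finally have "\<bar>poly q (y i)\<bar> * h <= B" using real by simp
   then show ?thesis by (simp only: pos_le_divide_eq[OF h])
  qed
  have sep: "h <= \<bar>y i - y j\<bar>" if "i \<noteq> j" for i j
  proof -
   have *: "h <= y j - y i" if "i < j" for i j using lo_less[OF that] y(1)[of i] y(1)[of j] unfolding atLeastAtMost_iff by linarith
   show ?thesis using *[of i j] *[of j i] that by (cases "i < j") auto
  qed
  have far: "\<bar>x - y i\<bar> <= \<bar>x - z\<bar> + d" if "i < r" for i
  proof -
   have "y i \<in> {a..b}" using y(1)[of i] sub[OF that] by blast
   then show ?thesis using z unfolding d_def atLeastAtMost_iff by linarith
  qed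
  have "\<bar>poly q x\<bar> <= real r * (B / h * ((\<bar>x - z\<bar> + d) / h) ^ (r - 1))" by (rule lagrange_bound[where y = y, OF q h]) (auto intro: sep yB far)
  also have "(\<bar>x - z\<bar> + d) / h = 2 * real r * (1 + \<bar>x - z\<bar> / d)"
  proof -
   have "(\<bar>x - z\<bar> + d) / h = 2 * real r * ((\<bar>x - z\<bar> + d) / d)" by (simp add: h_def)
   then show ?thesis using d by (simp add: add_divide_distrib)
  qed
  also have "B / h = 2 * real r * B / d" using d r by (simp add: h_def)
  also have "real r * (2 * real r * B / d * (2 * real r * (1 + \<bar>x - z\<bar> / d)) ^ (r - 1))
    = real r * (2 * real r) ^ r * (1 + \<bar>x - z\<bar> / d) ^ (r - 1) / d * B"
  proof -
   have "(2 * real r) ^ r = 2 * real r * (2 * real r) ^ (r - 1)" using r by (cases r) auto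
   moreover have "real r * (R * B / d * (R * X) ^ k) = real r * (R * R ^ k) * X ^ k / d * B" for R X and k :: nat by (simp add: power_mult_distrib)
   ultimately show ?thesis by (simp only:)
  qed
  finally have "eabs (poly q x) <= ennreal (real r * (2 * real r) ^ r * (1 + \<bar>x - z\<bar> / d) ^ (r - 1) / d * B)" by (rule ennreal_leI)
  also have "... = ennreal (real r * (2 * real r) ^ r * (1 + \<bar>x - z\<bar> / d) ^ (r - 1) / d) * I"
   unfolding real(2) using K real(1) by (intro ennreal_mult) auto
  finally show ?thesis unfolding I_def d_def .
 qed
qed

text \<open>A short difference that stays in [-1,1] is one of those the modulus sees, even next to
  the endpoints.\<close>

lemma step_le_phi:
 assumes n: "1 <= n" and r: "1 <= r" and z: "z \<in> {-1..1}" and y: "y \<in> {-1..1}"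
  and near: "\<bar>z - y\<bar> <= rho n z / 16" and h: "0 < h" "real r * h <= rho n z / 16"
  and ends: "y - real r * h / 2 \<in> {-1..1}" "y + real r * h / 2 \<in> {-1..1}"
 shows "h <= phi y / real n"
proof -
 have n0: "0 < real n" using n by simp
 have "rho n z / 2 <= rho n y" by (rule rho_compare_near(1)[OF n z y near])
 then have rh: "real r * h <= rho n y / 8" using h by linarith
 have hr: "1 * h <= real r * h" using h r by (intro mult_right_mono) auto
 then have h8: "h <= (phi y / real n + 1 / (real n)\<^sup>2) / 8" using rh unfolding rho_phi by linarith
 show ?thesis
 proof (cases "1 / (real n)\<^sup>2 <= phi y / real n")
  case True
  have "h <= A" if "h <= (A + B) / 8" "B <= A" "0 <= B" for A B :: real
  proof -
   have "8 * h <= A + B" using that(1) by simp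
   then show ?thesis using that(2,3) by linarith
  qed
  from this[OF h8 True] show ?thesis by simp
 next
  case False
  have "h <= B / 4" if "h <= (A + B) / 8" "A <= B" for A B :: real
  proof -
   have "8 * h <= A + B" using that(1) by simp
   then show ?thesis using that(2) by linarith
  qed
  from this[OF h8] False have h4: "h <= 1 / (real n)\<^sup>2 / 4" by simp
  \<comment> \<open>Near an endpoint the position of the end points bounds \<open>h / 2\<close> by 1
    - |y|, hence by phi^2, while h \<le> 1 / (4 n^2); the product of the two gives (n h)^2 \<le>
    phi^2.\<close>
  have "h / 2 <= 1 - \<bar>y\<bar>" using ends hr by auto
  also have "... <= 1 - y\<^sup>2"
  proof -
   have "\<bar>y\<bar> * \<bar>y\<bar> <= 1 * \<bar>y\<bar>" using y by (intro mult_right_mono) auto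
   then show ?thesis by (simp add: power2_eq_square)
  qed
  also have "... = (phi y)\<^sup>2" using phi_sq[OF y] by simp
  finally have p: "h / 2 <= (phi y)\<^sup>2" .
  have "(real n * h)\<^sup>2 = (real n)\<^sup>2 * h * h" by (simp add: power2_eq_square)
  also have "... <= 1 / 4 * h"
  proof -
   have "(real n)\<^sup>2 * h <= (real n)\<^sup>2 * (1 / (real n)\<^sup>2 / 4)" using h4 by (intro mult_left_mono) auto
   also have "... = 1 / 4" using n0 by simp
   finally show ?thesis using h by (intro mult_right_mono) auto
  qed
  also have "... <= (phi y)\<^sup>2" using p h by linarith
  finally have "real n * h <= phi y" using phi_nonneg[OF y] by (rule power2_le_imp_le)
  then show ?thesis using n0 by (simp add: pos_le_divide_eq mult.commute)
 qed
qed

text \<open>Equal angles, decreasing in \<open>x\<close>. The number 512 makes two adjacent cells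
  together no longer than \<open>rho / 64\<close>, so that the fourfold interval needed for
  Whitney's inequality still fits into the radius \<open>rho / 16\<close> of
  \<open>rho_compare_near\<close>.\<close>

definition grid :: "nat \<Rightarrow> nat \<Rightarrow> real" where
 "grid n i = cos (real i * (pi / (512 * real n)))"

lemma grid_angle:
 assumes n: "1 <= n" and i: "i <= 512 * n"
 shows "0 <= real i * (pi / (512 * real n))" "real i * (pi / (512 * real n)) <= pi"
  "arccos (grid n i) = real i * (pi / (512 * real n))"
proof -
 have "real i <= 512 * real n" using i by (metis of_nat_le_iff of_nat_mult of_nat_numeral)
 then have "real i * (pi / (512 * real n)) <= 512 * real n * (pi / (512 * real n))" by (intro mult_right_mono) auto
 also have "... = pi" using n by simp
 finally show 2: "real i * (pi / (512 * real n)) <= pi" .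
 show 1: "0 <= real i * (pi / (512 * real n))" by simp
 show "arccos (grid n i) = real i * (pi / (512 * real n))" unfolding grid_def using 1 2 by (rule arccos_cos)
qed

lemma grid_in: "grid n i \<in> {-1..1}" by (simp add: grid_def)

lemma grid_mono: "1 <= n ==> j <= 512 * n ==> i <= j ==> grid n j <= grid n i"
 unfolding grid_def using grid_angle(1)[of n i] grid_angle(2)[of n j] by (intro cos_monotone_0_pi_le mult_right_mono) auto

text \<open>The length of a double cell is exactly 2 sin(\<alpha>) sin(\<delta>). The constant
  262144 is the square of 512 and comes from the endpoint term 1/n^2 of \<open>rho\<close>.\<close>

lemma grid_gap:
 assumes n: "1 <= n" and i: "i + 2 <= 512 * n"
 shows "grid n i - grid n (i + 2) <= rho n (grid n (i + 1)) / 64"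
  "rho n (grid n (i + 1)) / 262144 <= grid n (i + 1) - grid n (i + 2)"
proof -
 define \<delta> where "\<delta> = pi / (512 * real n)"
 define \<alpha> where "\<alpha> = real (i + 1) * \<delta>"
 have n0: "0 < real n" using n by simp
 have \<delta>: "0 < \<delta>" using n0 by (simp add: \<delta>_def)
 have ang: "real i * \<delta> = \<alpha> - \<delta>" "real (i + 2) * \<delta> = \<alpha> + \<delta>" unfolding \<alpha>_def by (simp_all add: algebra_simps)
 have a: "0 <= \<alpha>" "\<alpha> <= pi" "\<alpha> + \<delta> <= pi" using grid_angle(1,2)[OF n, of "i + 1"] grid_angle(2)[OF n, of "i + 2"] i
  unfolding \<delta>_def[symmetric] ang \<alpha>_def[symmetric] by simp_all
 have e: "grid n i = cos (\<alpha> - \<delta>)" "grid n (i + 1) = cos \<alpha>" "grid n (i + 2) = cos (\<alpha> + \<delta>)"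
  unfolding grid_def \<delta>_def[symmetric] ang \<alpha>_def[symmetric] by simp_all
 have sp: "phi (grid n (i + 1)) = sin \<alpha>" unfolding e(2) by (rule phi_cos) (use a in auto)
 have s0: "0 <= sin \<alpha>" using a by (intro sin_ge_zero) auto
 have "grid n i - grid n (i + 2) = 2 * sin \<alpha> * sin \<delta>" unfolding e by (simp add: cos_add cos_diff)
 also have "... <= 2 * sin \<alpha> * \<delta>" using s0 \<delta> by (intro mult_left_mono sin_x_le_x) auto
 also have "... = sin \<alpha> / real n * (2 * pi / 512)" by (simp add: \<delta>_def mult.commute)
 also have "... <= sin \<alpha> / real n * (1 / 64)" using s0 n0 pi_less_4 by (intro mult_left_mono) auto
 also have "... <= rho n (grid n (i + 1)) / 64" unfolding rho_phi sp by simp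
 finally show "grid n i - grid n (i + 2) <= rho n (grid n (i + 1)) / 64" .
 have c: "\<bar>\<alpha> - (\<alpha> + \<delta>)\<bar> = \<delta>" using \<delta> by simp
 have le: "cos (\<alpha> + \<delta>) <= cos \<alpha>" using a \<delta> by (intro cos_monotone_0_pi_le) auto
 note cd = cos_diff_ge[of \<alpha> "\<alpha> + \<delta>", unfolded c]
 have c1: "sin \<alpha> / (512 * real n) <= cos \<alpha> - cos (\<alpha> + \<delta>)" using cd(1) a \<delta> le by (simp add: \<delta>_def)
 have c2: "2 * (1 / (512 * real n))\<^sup>2 <= cos \<alpha> - cos (\<alpha> + \<delta>)" using cd(2) a \<delta> le by (simp add: \<delta>_def)
 have "rho n (grid n (i + 1)) / 262144 = sin \<alpha> / (512 * real n) / 512 + (1 / (512 * real n))\<^sup>2"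
  unfolding rho_phi sp by (simp add: add_divide_distrib power_divide power_mult_distrib)
 also have "... <= cos \<alpha> - cos (\<alpha> + \<delta>)"
 proof -
  have "A / 512 + B <= D" if "A <= D" "2 * B <= D" "0 <= A" for A B D :: real using that by linarith
  from this[OF c1 c2] show ?thesis using s0 by simp
 qed
 finally show "rho n (grid n (i + 1)) / 262144 <= grid n (i + 1) - grid n (i + 2)" unfolding e(2,3) .
qed

section \<open>Pointwise direct estimate\<close>

text \<open>The mean over the steps of the differences that have \<open>x\<close> as one end point,
  listed by their two possible midpoints.\<close>

definition line_int :: "nat \<Rightarrow> (real \<Rightarrow> real \<Rightarrow> ennreal) \<Rightarrow> real \<Rightarrow> ennreal" where
 "line_int r G x = (LN h. G (x - real r * h / 2) h + G (x + real r * h / 2) h)"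

definition near_mass :: "nat \<Rightarrow> (real \<Rightarrow> real \<Rightarrow> ennreal) \<Rightarrow> real \<Rightarrow> ennreal" where
 "near_mass n G z = (LN h. LN y. G y h * indicator {y \<in> {-1..1}. \<bar>z - y\<bar> <= rho n z / 16} y)"

text \<open>The positive slack \<open>e\<close> is the one that absorbs the error terms in Whitney's
  inequality; carrying it inside \<open>G\<close> keeps the bounds below free of additive
  errors.\<close>

definition diff_dominated :: "nat \<Rightarrow> nat \<Rightarrow> (real \<Rightarrow> real) \<Rightarrow> real \<Rightarrow> (real \<Rightarrow> real \<Rightarrow> ennreal) \<Rightarrow> bool" where
 "diff_dominated n r f e G \<longleftrightarrow> (\<forall>y h. 0 < h \<longrightarrow> h <= phi y / real n \<longrightarrow> y \<in> {-1..1} \<longrightarrow>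
   y - real r * h / 2 \<in> {-1..1} \<longrightarrow> y + real r * h / 2 \<in> {-1..1} \<longrightarrow>
   ennreal (\<bar>fdiff r h f (y - real r * h / 2)\<bar> + e) <= G y h)"

text \<open>Whitney's inequality on the double cell around each grid point. The pointwise bound is
  needed where \<open>x\<close> lies in the cell; the L1 bound, obtained by integrating it, compares
  approximants of neighbouring cells. Double cells are used so that neighbours overlap in a full
  cell.\<close>

lemma local_approx:
 fixes r :: nat
 assumes r: "1 <= r"
 obtains C where "0 < C" and "\<And>n f e G i. 1 <= n ==> f \<in> borel_measurable borel ==> L1 {-1..1} f < \<infinity> ==> 0 < e ==>
  case_prod G \<in> borel_measurable (borel \<Otimes>\<^sub>M borel) ==> diff_dominated n r f e G ==> i + 2 <= 512 * n ==>
  \<exists>q. degree q < r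
   \<and> (\<forall>x\<in>{grid n (i + 2)..grid n i}. eabs (f x - poly q x) <= ennreal (C / rho n (grid n (i + 1))) * line_int r G x
      + ennreal (C / (rho n (grid n (i + 1)))\<^sup>2) * near_mass n G (grid n (i + 1)))
   \<and> L1 {grid n (i + 2)..grid n i} (%x. f x - poly q x)
     <= ennreal (C / rho n (grid n (i + 1))) * near_mass n G (grid n (i + 1))"
proof (rule whitney_interval[OF r], goal_cases)
 case (1 C0)
 note C0 = 1(2) and W = 1(3)
 define C where "C = 3 * (C0 * 262144\<^sup>2)"
 have C: "0 < C" "C0 * 262144 <= C" "C0 * 262144\<^sup>2 <= C" using C0 by (simp_all add: C_def)
 show thesis
 proof (rule that[OF C(1)], goal_cases)
  case (1 n f e G i)
  note n = 1(1) and f[measurable] = 1(2) and fin = 1(3) and e = 1(4) and G[measurable] = 1(5) and dom = 1(6) and i = 1(7)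
  define z where "z = grid n (i + 1)"
  define \<rho> where "\<rho> = rho n z"
  define b t where "b = grid n (i + 2)" and "t = grid n i"
  define d where "d = t - b"
  have zin: "z \<in> {-1..1}" "b \<in> {-1..1}" "t \<in> {-1..1}" unfolding z_def b_def t_def by (rule grid_in)+
  have \<rho>: "0 < \<rho>" unfolding \<rho>_def by (rule rho_pos[OF n zin(1)])
  have bzt: "b <= z" "z <= t" unfolding b_def z_def t_def using i by (auto intro!: grid_mono n)
  have gap: "d <= \<rho> / 64" "\<rho> / 262144 <= z - b" using grid_gap[OF n i] unfolding d_def \<rho>_def z_def b_def t_def by simp_all
  have dge: "\<rho> / 262144 <= d" using gap bzt by (simp add: d_def)
  have d0: "0 < d" using dge \<rho> by (meson divide_pos_pos less_le_trans zero_less_numeral)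
  have \<rho>2: "\<rho> <= 2"
  proof -
   have "phi z / real n <= 1 / 1" using phi_nonneg[OF zin(1)] phi_le_1[of z] n by (intro frac_le) auto
   moreover have "1 / (real n)\<^sup>2 <= 1 / 1" using n by (intro frac_le) auto
   ultimately show ?thesis unfolding \<rho>_def rho_phi by linarith
  qed
  define N where "N = {y \<in> {-1..1}. \<bar>z - y\<bar> <= \<rho> / 16}"
  have [measurable]: "N \<in> sets borel" unfolding N_def by measurable
  \<comment> \<open>Restricting \<open>G\<close> to midpoints near \<open>z\<close> keeps the mass
    local, which later bounds the overlap in the sum over the cells.\<close>
  define H where "H y h = G y h * indicator N y" for y h
  have [measurable]: "case_prod H \<in> borel_measurable (borel \<Otimes>\<^sub>M borel)" unfolding H_def by measurable
  \<comment> \<open>The long interval starts at the end of the double cell farther from 0 on the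
    side of \<open>z\<close> and points inwards, so it stays in [-1,1]; the double cell is its first
    quarter.\<close>
  define l where "l = (if 0 <= z then - (4 * d) else 4 * d)"
  define a where "a = (if 0 <= z then t else b)"
  have l: "l \<noteq> 0" "\<bar>l\<bar> = 4 * d" using d0 by (auto simp: l_def)
  have a: "a \<in> {-1..1}" using zin by (simp add: a_def)
  have al: "a + l \<in> {-1..1}" using zin bzt gap(1) \<rho>2 d0 by (auto simp: a_def l_def)
  have I: "{min a (a + l)..max a (a + l)} = (if 0 <= z then {t - 4 * d..t} else {b..b + 4 * d})" using d0 by (auto simp: a_def l_def)
  have Iz: "\<bar>z - y\<bar> <= 4 * d" "y \<in> {-1..1}" if "y \<in> {min a (a + l)..max a (a + l)}" for y
   using that zin bzt gap(1) \<rho>2 unfolding I by (auto simp: d_def split: if_splits)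
  have "\<exists>q. degree q < r \<and> (\<forall>x\<in>{0..1/4}. eabs (f (a + l * x) - poly q (a + l * x))
   <= ennreal (C0 / \<bar>l\<bar>) * (LN h. H (a + l * x - real r * h / 2) h + H (a + l * x + real r * h / 2) h)
    + ennreal (C0 / l\<^sup>2) * (LN h. LN y. H y h))"
  proof (rule W[OF f fin e l(1) a al])
   fix y h :: real
   assume h: "0 < h" and yI: "y - real r * h / 2 \<in> {min a (a + l)..max a (a + l)}" "y + real r * h / 2 \<in> {min a (a + l)..max a (a + l)}"
   have rh0: "0 < real r * h" using r h by simp
   have yI': "y \<in> {min a (a + l)..max a (a + l)}" using yI rh0 unfolding atLeastAtMost_iff by linarith
   have "real r * h <= 4 * d" using yI unfolding I by (auto split: if_splits)
   then have rh: "real r * h <= \<rho> / 16" using gap(1) by linarith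
   have zy: "\<bar>z - y\<bar> <= \<rho> / 16" using Iz(1)[OF yI'] gap(1) by linarith
   have "h <= phi y / real n" by (rule step_le_phi[OF n r zin(1) Iz(2)[OF yI'] zy[unfolded \<rho>_def] h rh[unfolded \<rho>_def] Iz(2)[OF yI(1)] Iz(2)[OF yI(2)]])
   then have "ennreal (\<bar>fdiff r h f (y - real r * h / 2)\<bar> + e) <= G y h"
    using dom h Iz(2)[OF yI'] Iz(2)[OF yI(1)] Iz(2)[OF yI(2)] unfolding diff_dominated_def by blast
   then show "ennreal (\<bar>fdiff r h f (y - real r * h / 2)\<bar> + e) <= H y h" using zy Iz(2)[OF yI'] by (simp add: H_def N_def)
  qed measurable
  then obtain q where q: "degree q < r" and qb: "\<And>x. x \<in> {0..1/4} ==> eabs (f (a + l * x) - poly q (a + l * x))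
   <= ennreal (C0 / \<bar>l\<bar>) * (LN h. H (a + l * x - real r * h / 2) h + H (a + l * x + real r * h / 2) h)
    + ennreal (C0 / l\<^sup>2) * (LN h. LN y. H y h)" by blast
  define A where "A = (LN h. LN y. H y h)"
  have A: "near_mass n G z = A" unfolding near_mass_def A_def H_def N_def \<rho>_def ..
  have [measurable]: "line_int r H \<in> borel_measurable borel" unfolding line_int_def by measurable
  have qx: "eabs (f x - poly q x) <= ennreal (C0 / \<bar>l\<bar>) * line_int r H x + ennreal (C0 / l\<^sup>2) * A" if x: "x \<in> {b..t}" for x
  proof -
   define u where "u = (x - a) / l"
   have xu: "a + l * u = x" using l by (simp add: u_def)
   have "u \<in> {0..1/4}"
   proof (cases "0 <= z")
    case True
    have "u = (t - x) / (4 * d)" using True d0 by (simp add: u_def l_def a_def minus_divide_right[symmetric] diff_divide_distrib)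
    then show ?thesis using x d0 by (simp add: pos_divide_le_eq d_def)
   next
    case False
    have "u = (x - b) / (4 * d)" using False by (simp add: u_def l_def a_def)
    then show ?thesis using x d0 by (simp add: pos_divide_le_eq d_def)
   qed
   from qb[OF this] show ?thesis unfolding xu A_def line_int_def .
  qed
  have c1: "C0 / \<bar>l\<bar> <= C0 * 262144 / \<rho>"
  proof -
   have "C0 / \<bar>l\<bar> <= C0 / (\<rho> / 262144)" unfolding l(2) using dge \<rho> C0 d0 by (intro divide_left_mono mult_pos_pos) auto
   then show ?thesis by simp
  qed
  have c2: "C0 / l\<^sup>2 <= C0 * 262144\<^sup>2 / \<rho>\<^sup>2"
  proof -
   have "(\<rho> / 262144)\<^sup>2 <= \<bar>l\<bar>\<^sup>2" unfolding l(2) using dge \<rho> d0 by (intro power_mono) auto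
   then have "C0 / l\<^sup>2 <= C0 / (\<rho> / 262144)\<^sup>2" using \<rho> C0 l(1) by (intro divide_left_mono mult_pos_pos) auto
   then show ?thesis by (simp add: power_divide)
  qed
  have "C0 * 262144 / \<rho> <= C / \<rho>" "C0 * 262144\<^sup>2 / \<rho>\<^sup>2 <= C / \<rho>\<^sup>2" using C \<rho> by (intro divide_right_mono; simp)+
  then have c3: "C0 / \<bar>l\<bar> <= C / \<rho>" "C0 / l\<^sup>2 <= C / \<rho>\<^sup>2" using c1 c2 by linarith+
  have 1: "eabs (f x - poly q x) <= ennreal (C / \<rho>) * line_int r G x + ennreal (C / \<rho>\<^sup>2) * A" if x: "x \<in> {b..t}" for x
  proof -
   have "H y h <= G y h" for y h unfolding H_def by (auto simp: indicator_def)
   then have "line_int r H x <= line_int r G x" unfolding line_int_def by (intro nn_integral_mono add_mono)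
   then have "ennreal (C0 / \<bar>l\<bar>) * line_int r H x + ennreal (C0 / l\<^sup>2) * A <= ennreal (C / \<rho>) * line_int r G x + ennreal (C / \<rho>\<^sup>2) * A"
    using c3 by (intro add_mono mult_mono ennreal_leI) auto
   with qx[OF x] show ?thesis by (rule order_trans)
  qed
  \<comment> \<open>For each fixed step, integration over the end point is a translation of
    integration over the midpoint, once for each of the two ends.\<close>
  have LH: "(LN x. line_int r H x) = 2 * A"
  proof -
   have "(LN x. line_int r H x) = (LN h. LN x. H (x - real r * h / 2) h + H (x + real r * h / 2) h)" unfolding line_int_def by (rule lborel_pair.Fubini') measurable
   also have "... = (LN h. 2 * (LN y. H y h))"
   proof (rule nn_integral_cong)
    fix h
    have "(LN x. H (x - real r * h / 2) h + H (x + real r * h / 2) h)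
     = (LN x. H (x - real r * h / 2) h) + (LN x. H (x + real r * h / 2) h)" by (rule nn_integral_add) measurable
    also have "(LN x. H (x - real r * h / 2) h) = (LN y. H y h)" using nn_integral_translate[of "%y. H y h" "- (real r * h / 2)"] by simp
    also have "(LN x. H (x + real r * h / 2) h) = (LN y. H y h)" by (rule nn_integral_translate) measurable
    finally show "(LN x. H (x - real r * h / 2) h + H (x + real r * h / 2) h) = 2 * (LN y. H y h)" by (simp add: mult_2)
   qed
   also have "... = 2 * A" unfolding A_def by (rule nn_integral_cmult) measurable
   finally show ?thesis .
  qed
  have "L1 {b..t} (%x. f x - poly q x)
    <= (LN x. ennreal (C0 / \<bar>l\<bar>) * line_int r H x + ennreal (C0 / l\<^sup>2) * A * indicator {b..t} x)"
  proof (rule nn_integral_mono)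
   fix x
   show "eabs (f x - poly q x) * indicator {b..t} x <= ennreal (C0 / \<bar>l\<bar>) * line_int r H x + ennreal (C0 / l\<^sup>2) * A * indicator {b..t} x"
    using qx[of x] by (cases "x \<in> {b..t}") auto
  qed
  also have "... = ennreal (C0 / \<bar>l\<bar>) * (2 * A) + ennreal (C0 / l\<^sup>2) * A * ennreal d"
  proof -
   have "(LN x. ennreal (C0 / l\<^sup>2) * A * indicator {b..t} x) = ennreal (C0 / l\<^sup>2) * A * ennreal d"
    using d0 by (subst nn_integral_cmult_indicator) (auto simp: d_def)
   then show ?thesis unfolding LH[symmetric] by (subst nn_integral_add) (auto simp: nn_integral_cmult)
  qed
  also have "... = (ennreal (C0 / \<bar>l\<bar>) * 2 + ennreal (C0 / l\<^sup>2) * ennreal d) * A" unfolding distrib_right by (simp only: ac_simps)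
  also have "... <= ennreal (C / \<rho>) * A"
  proof (rule mult_right_mono)
   have "C0 / l\<^sup>2 * d <= C0 / \<bar>l\<bar>"
   proof -
    have "C0 / l\<^sup>2 * d = C0 / \<bar>l\<bar> * (1 / 4)"
    proof -
     have "l\<^sup>2 = \<bar>l\<bar> * (4 * d)" using l(2) by (metis power2_abs power2_eq_square)
     then show ?thesis using d0 by simp
    qed
    also have "... <= C0 / \<bar>l\<bar> * 1" using C0 by (intro mult_left_mono) auto
    finally show ?thesis by simp
   qed
   then have "C0 / \<bar>l\<bar> * 2 + C0 / l\<^sup>2 * d <= 3 * (C0 / \<bar>l\<bar>)" by linarith
   also have "... <= 3 * (C0 * 262144 / \<rho>)" using c1 by linarith
   also have "... = 3 * (C0 * 262144) / \<rho>" by simp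
   also have "... <= C / \<rho>" unfolding C_def using C0 \<rho> by (intro divide_right_mono) auto
   finally have "ennreal (C0 / \<bar>l\<bar> * 2 + C0 / l\<^sup>2 * d) <= ennreal (C / \<rho>)" by (rule ennreal_leI)
   moreover have "ennreal (C0 / \<bar>l\<bar>) * 2 + ennreal (C0 / l\<^sup>2) * ennreal d = ennreal (C0 / \<bar>l\<bar> * 2 + C0 / l\<^sup>2 * d)"
   proof -
    have "ennreal (C0 / \<bar>l\<bar>) * 2 = ennreal (C0 / \<bar>l\<bar> * 2)" using C0 by (subst ennreal_mult) auto
    moreover have "ennreal (C0 / l\<^sup>2) * ennreal d = ennreal (C0 / l\<^sup>2 * d)" using C0 d0 by (subst ennreal_mult) auto
    ultimately show ?thesis using C0 d0 by (subst ennreal_plus) auto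
   qed
   ultimately show "ennreal (C0 / \<bar>l\<bar>) * 2 + ennreal (C0 / l\<^sup>2) * ennreal d <= ennreal (C / \<rho>)" by simp
  qed simp
  finally have 2: "L1 {b..t} (%x. f x - poly q x) <= ennreal (C / \<rho>) * A" .
  show ?case unfolding z_def[symmetric] b_def[symmetric] t_def[symmetric] \<rho>_def[symmetric] A using q 1 2 by blast
 qed
qed

text \<open>Both approximants are close to f in L1 on the shared cell, so their difference is small
  there, and \<open>poly_L1_growth\<close> carries this to all \<open>x\<close>. Distances relative
  to the cell grow like the square of \<open>1 + tau\<close>, hence the exponent 2r.\<close>

lemma jump_bound:
 fixes q q' :: "real poly"
 assumes n: "1 <= n" and i: "i + 3 <= 512 * n" and C: "0 < C" and [measurable]: "f \<in> borel_measurable borel"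
  and q: "degree q < r" "degree q' < r"
  and I: "L1 {grid n (i + 2)..grid n i} (%x. f x - poly q x) <= ennreal (C / rho n (grid n (i + 1))) * A"
  and I': "L1 {grid n (i + 3)..grid n (i + 1)} (%x. f x - poly q' x) <= ennreal (C / rho n (grid n (i + 2))) * A'"
  and x: "x \<in> {-1..1}"
 shows "eabs (poly q' x - poly q x) <= ennreal (real r * (2 * real r) ^ r * 262144 ^ r * 262144 * (2 * C)
   * (1 + tau n x (grid n (i + 1))) ^ (2 * r) / (rho n (grid n (i + 1)))\<^sup>2) * (A + A')"
proof -
 define z b where "z = grid n (i + 1)" and "b = grid n (i + 2)"
 define \<rho> where "\<rho> = rho n z"
 define T where "T = 1 + tau n x z"
 have T: "1 <= T" by (simp add: T_def)
 have zin: "z \<in> {-1..1}" "b \<in> {-1..1}" unfolding z_def b_def by (rule grid_in)+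
 have \<rho>: "0 < \<rho>" unfolding \<rho>_def by (rule rho_pos[OF n zin(1)])
 have i2: "i + 2 <= 512 * n" using i by simp
 have gap: "\<rho> / 262144 <= z - b" using grid_gap(2)[OF n i2] unfolding \<rho>_def z_def b_def .
 have gap1: "z - b <= \<rho> / 64" using grid_gap(1)[OF n i2] grid_mono[OF n, of "i + 1" i] i unfolding \<rho>_def z_def b_def by simp
 have zb: "b < z" using gap \<rho> by (smt (verit) divide_pos_pos zero_less_numeral)
 have \<rho>': "\<rho> / 2 <= rho n b" unfolding \<rho>_def using gap1 zb \<rho> by (intro rho_compare_near(1)[OF n zin]) (simp add: \<rho>_def)
 have rb: "0 < rho n b" by (rule rho_pos[OF n zin(2)])
 define Q where "Q = q' - q"
 have dQ: "degree Q < r" unfolding Q_def using q by (intro degree_diff_less) auto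
 have "L1 {b..z} (poly Q)
  <= (LN t. eabs (f t - poly q t) * indicator {b..grid n i} t + eabs (f t - poly q' t) * indicator {grid n (i + 3)..z} t)"
 proof (rule nn_integral_mono)
  fix t
  show "eabs (poly Q t) * indicator {b..z} t <= eabs (f t - poly q t) * indicator {b..grid n i} t + eabs (f t - poly q' t) * indicator {grid n (i + 3)..z} t"
  proof (cases "t \<in> {b..z}")
   case True
   have "t \<in> {b..grid n i}" "t \<in> {grid n (i + 3)..z}"
    using True grid_mono[OF n, of "i + 1" i] grid_mono[OF n, of "i + 3" "i + 2"] i unfolding z_def b_def by auto
   moreover have "eabs (poly Q t) <= eabs (f t - poly q t) + eabs (f t - poly q' t)"
    unfolding Q_def by (simp add: ennreal_plus[symmetric] ennreal_leI del: ennreal_plus)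
   ultimately show ?thesis using True by simp
  qed simp
 qed
 also have "... = L1 {b..grid n i} (%t. f t - poly q t) + L1 {grid n (i + 3)..z} (%t. f t - poly q' t)" by (rule nn_integral_add) measurable
 also have "... <= ennreal (C / \<rho>) * A + ennreal (C / rho n b) * A'" using I I' unfolding z_def b_def \<rho>_def by (intro add_mono)
 also have "... <= ennreal (2 * C / \<rho>) * A + ennreal (2 * C / \<rho>) * A'"
 proof (intro add_mono mult_right_mono ennreal_leI)
  show "C / \<rho> <= 2 * C / \<rho>" using C \<rho> by (intro divide_right_mono) auto
  have "C / rho n b <= C / (\<rho> / 2)" using \<rho>' \<rho> rb C by (intro divide_left_mono mult_pos_pos) auto
  then show "C / rho n b <= 2 * C / \<rho>" by (simp add: mult.commute)
 qed auto
 finally have IQ: "L1 {b..z} (poly Q) <= ennreal (2 * C / \<rho>) * (A + A')" by (simp add: distrib_left)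
 have c1: "1 / (z - b) <= 262144 / \<rho>"
 proof -
  have "1 / (z - b) <= 1 / (\<rho> / 262144)" using gap \<rho> zb by (intro divide_left_mono mult_pos_pos) auto
  then show ?thesis by simp
 qed
 have c2: "1 + \<bar>x - z\<bar> / (z - b) <= 262144 * T\<^sup>2"
 proof -
  have "\<bar>x - z\<bar> * (1 / (z - b)) <= (\<rho> * (tau n x z + (tau n x z)\<^sup>2)) * (262144 / \<rho>)"
   using abs_diff_le_tau[OF n x zin(1)] c1 \<rho> zb unfolding \<rho>_def[symmetric] by (intro mult_mono) auto
  also have "... = 262144 * (tau n x z + (tau n x z)\<^sup>2)" using \<rho> by simp
  finally have "1 + \<bar>x - z\<bar> / (z - b) <= 1 + 262144 * (tau n x z + (tau n x z)\<^sup>2)" by simp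
  also have "... <= 262144 * T\<^sup>2" unfolding T_def power2_eq_square using tau_nonneg[of n x z] by (simp add: algebra_simps)
  finally show ?thesis .
 qed
 have c3: "(1 + \<bar>x - z\<bar> / (z - b)) ^ (r - 1) <= 262144 ^ r * T ^ (2 * r)"
 proof -
  have "(1 + \<bar>x - z\<bar> / (z - b)) ^ (r - 1) <= (262144 * T\<^sup>2) ^ (r - 1)" using c2 zb by (intro power_mono add_nonneg_nonneg) auto
  also have "... <= (262144 * T\<^sup>2) ^ r"
  proof (intro power_increasing)
   have "1 * 1 <= 262144 * T\<^sup>2" using T by (intro mult_mono) auto
   then show "1 <= 262144 * T\<^sup>2" by simp
  qed simp
  finally show ?thesis by (simp add: power_mult_distrib power_mult)
 qed
 define K where "K = real r * (2 * real r) ^ r"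
 have K: "0 <= K" by (simp add: K_def)
 have "eabs (poly Q x) <= ennreal (K * (1 + \<bar>x - z\<bar> / (z - b)) ^ (r - 1) / (z - b)) * L1 {b..z} (poly Q)"
  unfolding K_def using zb by (intro poly_L1_growth[OF dQ]) auto
 also have "... <= ennreal (K * (262144 ^ r * T ^ (2 * r)) * (262144 / \<rho>)) * (ennreal (2 * C / \<rho>) * (A + A'))"
 proof (intro mult_mono ennreal_leI IQ)
  have "K * (1 + \<bar>x - z\<bar> / (z - b)) ^ (r - 1) * (1 / (z - b)) <= K * (262144 ^ r * T ^ (2 * r)) * (262144 / \<rho>)"
   using c1 c3 K T zb by (intro mult_mono mult_left_mono) auto
  then show "K * (1 + \<bar>x - z\<bar> / (z - b)) ^ (r - 1) / (z - b) <= K * (262144 ^ r * T ^ (2 * r)) * (262144 / \<rho>)" by simp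
 qed auto
 also have "... = ennreal (K * (262144 ^ r * T ^ (2 * r)) * (262144 / \<rho>) * (2 * C / \<rho>)) * (A + A')"
  using K T \<rho> C by (subst ennreal_mult) (auto simp: mult.assoc)
 also have "K * (262144 ^ r * T ^ (2 * r)) * (262144 / \<rho>) * (2 * C / \<rho>) = K * 262144 ^ r * 262144 * (2 * C) * T ^ (2 * r) / \<rho>\<^sup>2"
  by (simp add: power2_eq_square)
 finally show ?thesis unfolding K_def T_def \<rho>_def z_def Q_def by simp
qed

section \<open>Summation over the grid\<close>

lemma card_nat_near: "finite {i :: nat. \<bar>real i - a\<bar> <= real b}" "card {i :: nat. \<bar>real i - a\<bar> <= real b} <= 2 * b + 1"
proof -
 define S where "S = {i :: nat. \<bar>real i - a\<bar> <= real b}"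
 have "finite S \<and> card S <= 2 * b + 1"
 proof (cases "S = {}")
  case False
  define m where "m = (LEAST i. i \<in> S)"
  have m: "m \<in> S" unfolding m_def using False by (metis LeastI ex_in_conv)
  have "S \<subseteq> {m..m + 2 * b}"
  proof
   fix i assume i: "i \<in> S"
   have "m <= i" unfolding m_def using i by (rule Least_le)
   moreover have "real i <= real (m + 2 * b)" using i m unfolding S_def by auto
   then have "i <= m + 2 * b" by (rule of_nat_le_iff[THEN iffD1])
   ultimately show "i \<in> {m..m + 2 * b}" by simp
  qed
  then show ?thesis using finite_subset[of S "{m..m + 2 * b}"] card_mono[of "{m..m + 2 * b}" S] by simp
 qed simp
 then show "finite {i :: nat. \<bar>real i - a\<bar> <= real b}" "card {i :: nat. \<bar>real i - a\<bar> <= real b} <= 2 * b + 1" unfolding S_def by auto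
qed

abbreviation kern_int :: "nat \<Rightarrow> nat \<Rightarrow> (real \<Rightarrow> real \<Rightarrow> ennreal) \<Rightarrow> real \<Rightarrow> ennreal" where
 "kern_int n M G x \<equiv> (LN h. LN y. G y h * (ennreal (kern n M x y / rho n y) * indicator {-1..1} y))"

text \<open>The neighbourhoods of grid points overlap boundedly and the weights are comparable with
  the kernel on each of them. A point of the neighbourhood is within \<open>tau\<close> distance 4,
  whence the base 5; the factor 4 comes from comparing squares of \<open>rho\<close>, and one power
  of decay pays for \<open>rho n x\<close> in the kernel.\<close>

lemma near_mass_sum:
 assumes n: "1 <= n" and M: "1 <= M" and x: "x \<in> {-1..1}" and [measurable]: "case_prod G \<in> borel_measurable (borel \<Otimes>\<^sub>M borel)"
 shows "(\<Sum>i<512 * n - 1. ennreal (1 / ((1 + tau n x (grid n (i + 1))) ^ (2 * M) * (rho n (grid n (i + 1)))\<^sup>2)) * near_mass n G (grid n (i + 1)))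
  <= ennreal (1153 * (4 * 5 ^ (2 * M))) * kern_int n M G x"
proof -
 define z where "z i = grid n (i + 1)" for i
 define wt where "wt i = 1 / ((1 + tau n x (z i)) ^ (2 * M) * (rho n (z i))\<^sup>2)" for i
 define S where "S i = {y \<in> {-1..1}. \<bar>z i - y\<bar> <= rho n (z i) / 16}" for i
 define B :: real where "B = 4 * 5 ^ (2 * M)"
 have n0: "0 < real n" using n by simp
 have [measurable]: "S i \<in> sets borel" for i unfolding S_def by measurable
 have zin: "z i \<in> {-1..1}" for i unfolding z_def by (rule grid_in)
 have wtb: "wt i <= B * (kern n M x y / rho n y)" if y: "y \<in> S i" for i y
 proof -
  have yin: "y \<in> {-1..1}" and yz: "\<bar>z i - y\<bar> <= rho n (z i) / 16" using y by (auto simp: S_def)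
  have \<rho>: "0 < rho n y" "0 < rho n x" by (rule rho_pos[OF n yin] rho_pos[OF n x])+
  have h: "rho n y / 2 <= rho n (z i)" using rho_compare_near(2)[OF n zin yin yz] by simp
  have "tau n (z i) y <= pi * (1 + 2 * (1 / 16))" using yz by (intro tau_le_of_abs_diff_le[OF n zin yin]) auto
  then have t4: "tau n (z i) y <= 4" using pi_approx(2) by (simp add: mult_left_mono)
  define T where "T = 1 + tau n x y"
  have T: "1 <= T" by (simp add: T_def)
  have "T <= (1 + tau n x (z i)) * (1 + tau n (z i) y)" unfolding T_def by (rule one_plus_tau_triangle)
  also have "... <= (1 + tau n x (z i)) * 5" using t4 by (intro mult_left_mono) auto
  finally have T5: "T / 5 <= 1 + tau n x (z i)" by simp
  have "(T / 5) ^ (2 * M) * (rho n y / 2)\<^sup>2 <= (1 + tau n x (z i)) ^ (2 * M) * (rho n (z i))\<^sup>2"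
   using T5 h T \<rho> by (intro mult_mono power_mono) auto
  moreover have "0 < (T / 5) ^ (2 * M) * (rho n y / 2)\<^sup>2" using T \<rho> by simp
  ultimately have "wt i <= 1 / ((T / 5) ^ (2 * M) * (rho n y / 2)\<^sup>2)" unfolding wt_def by (intro frac_le) auto
  also have "... = B * (1 / T ^ (2 * M) / rho n y * (1 / rho n y))" by (simp add: B_def power_divide power2_eq_square ac_simps)
  also have "... <= B * (1 / T ^ (2 * M) / rho n y * (T / rho n x))"
  proof -
   have "rho n x <= T * rho n y" unfolding T_def by (rule rho_ratio[OF n x yin])
   then have "1 / rho n y <= T / rho n x" using \<rho> by (simp add: field_simps)
   then show ?thesis using T \<rho> by (intro mult_left_mono) (auto simp: B_def)
  qed
  also have "... <= B * (kern n M x y / rho n y)"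
  proof -
   have "T / T ^ (2 * M) <= 1 / T ^ M"
   proof -
    have "T * T ^ M = T ^ Suc M" by simp
    also have "... <= T ^ (2 * M)" using T M by (intro power_increasing) auto
    finally have "T * T ^ M <= T ^ (2 * M)" .
    then show ?thesis using T by (simp add: divide_simps)
   qed
   then have "T / T ^ (2 * M) / rho n x / rho n y <= 1 / T ^ M / rho n x / rho n y" using \<rho> by (intro divide_right_mono) auto
   then have "1 / T ^ (2 * M) / rho n y * (T / rho n x) <= kern n M x y / rho n y" unfolding kern_def T_def[symmetric] by (simp add: ac_simps)
   then show ?thesis by (intro mult_left_mono) (auto simp: B_def)
  qed
  finally show ?thesis .
 qed
 \<comment> \<open>Angles differ by at most 9/8 pi / n, that is by at most 512 * 9/8 = 576 grid
   steps, and 2 * 576 + 1 = 1153.\<close>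
 have cnt: "card {i \<in> {..<512 * n - 1}. y \<in> S i} <= 1153" for y
 proof -
  define a where "a = 512 * real n * arccos y / pi - 1"
  have "{i \<in> {..<512 * n - 1}. y \<in> S i} \<subseteq> {i :: nat. \<bar>real i - a\<bar> <= real 576}"
  proof
   fix i assume "i \<in> {i \<in> {..<512 * n - 1}. y \<in> S i}"
   then have i: "i < 512 * n - 1" and yin: "y \<in> {-1..1}" and yz: "\<bar>z i - y\<bar> <= rho n (z i) / 16" by (auto simp: S_def)
   have "tau n (z i) y <= pi * (1 + 2 * (1 / 16))" using yz by (intro tau_le_of_abs_diff_le[OF n zin yin]) auto
   then have "real n * \<bar>real (i + 1) * (pi / (512 * real n)) - arccos y\<bar> <= pi * (9 / 8)"
    unfolding tau_def z_def using grid_angle(3)[OF n, of "i + 1"] i by simp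
   then have "512 / pi * (real n * \<bar>real (i + 1) * (pi / (512 * real n)) - arccos y\<bar>) <= 512 / pi * (pi * (9 / 8))" by (rule mult_left_mono) simp
   also have "512 / pi * (pi * (9 / 8)) = real 576" by simp
   also have "512 / pi * (real n * \<bar>real (i + 1) * (pi / (512 * real n)) - arccos y\<bar>)
    = \<bar>(512 * real n / pi) * (real (i + 1) * (pi / (512 * real n)) - arccos y)\<bar>" unfolding abs_mult using n0 by simp
   also have "(512 * real n / pi) * (real (i + 1) * (pi / (512 * real n)) - arccos y) = real i - a" using n0 by (simp add: a_def right_diff_distrib)
   finally show "i \<in> {i :: nat. \<bar>real i - a\<bar> <= real 576}" by simp
  qed
  from card_mono[OF card_nat_near(1) this] card_nat_near(2)[of a 576] show ?thesis by linarith
 qed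
 have sum_le: "(\<Sum>i<512 * n - 1. ennreal (wt i) * indicator (S i) y) <= ennreal (1153 * B) * (ennreal (kern n M x y / rho n y) * indicator {-1..1} y)" for y
 proof (cases "y \<in> {-1..1}")
  case True
  define V where "V = ennreal (B * (kern n M x y / rho n y))"
  have "(\<Sum>i<512 * n - 1. ennreal (wt i) * indicator (S i) y) = (\<Sum>i\<in>{i \<in> {..<512 * n - 1}. y \<in> S i}. ennreal (wt i))"
   by (simp add: indicator_def sum.If_cases Int_def if_distrib cong: if_cong)
  also have "... <= (\<Sum>i\<in>{i \<in> {..<512 * n - 1}. y \<in> S i}. V)" unfolding V_def using wtb by (intro sum_mono ennreal_leI) auto
  also have "... = of_nat (card {i \<in> {..<512 * n - 1}. y \<in> S i}) * V" by simp
  also have "... <= of_nat 1153 * V" using cnt by (intro mult_right_mono) (auto simp: of_nat_le_iff)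
  also have "... = ennreal (1153 * B) * ennreal (kern n M x y / rho n y)"
  proof -
   have "of_nat 1153 * V = ennreal 1153 * (ennreal B * ennreal (kern n M x y / rho n y))" unfolding V_def by (subst ennreal_mult') (auto simp: B_def)
   also have "... = ennreal (1153 * B) * ennreal (kern n M x y / rho n y)" by (simp only: ennreal_mult'[of 1153 B, OF zero_le_numeral] mult.assoc)
   finally show ?thesis .
  qed
  finally show ?thesis using True by simp
 next
  case False
  then have "(\<Sum>i<512 * n - 1. ennreal (wt i) * indicator (S i) y) = 0" by (intro sum.neutral) (auto simp: S_def)
  then show ?thesis by simp
 qed
 have "(%y. ennreal (kern n M x y / rho n y)) \<in> borel_measurable M0"
 proof -
  have "(%y. kern n M x y) \<in> borel_measurable M0" using x by (intro kern_measurable) auto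
  then show ?thesis using borel_measurable_M0[OF rho_measurable[of n]] by measurable
 qed
 then have km: "(%y. ennreal (kern n M x y / rho n y) * indicator {-1..1} y) \<in> borel_measurable borel"
  by (simp add: borel_measurable_restrict_space_iff_ennreal)
 note [measurable] = km
 have "(\<Sum>i<512 * n - 1. ennreal (wt i) * near_mass n G (z i))
  = (\<Sum>i<512 * n - 1. (LN h. LN y. ennreal (wt i) * (G y h * indicator (S i) y)))" unfolding near_mass_def S_def[symmetric]
 proof (intro sum.cong refl)
  fix i
  have "ennreal (wt i) * (LN h. LN y. G y h * indicator (S i) y)
   = (LN h. ennreal (wt i) * (LN y. G y h * indicator (S i) y))" by (rule nn_integral_cmult[symmetric]) measurable
  also have "... = (LN h. LN y. ennreal (wt i) * (G y h * indicator (S i) y))" by (intro nn_integral_cong nn_integral_cmult[symmetric]) measurable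
  finally show "ennreal (wt i) * (LN h. LN y. G y h * indicator (S i) y)
   = (LN h. LN y. ennreal (wt i) * (G y h * indicator (S i) y))" .
 qed
 also have "... = (LN h. (\<Sum>i<512 * n - 1. (LN y. ennreal (wt i) * (G y h * indicator (S i) y))))" by (rule nn_integral_sum[symmetric]) measurable
 also have "... = (LN h. LN y. (\<Sum>i<512 * n - 1. ennreal (wt i) * (G y h * indicator (S i) y)))"
  by (intro nn_integral_cong nn_integral_sum[symmetric]) measurable
 also have "... <= (LN h. LN y. ennreal (1153 * B) * (G y h * (ennreal (kern n M x y / rho n y) * indicator {-1..1} y)))"
 proof (intro nn_integral_mono)
  fix h y
  have "(\<Sum>i<512 * n - 1. ennreal (wt i) * (G y h * indicator (S i) y)) = G y h * (\<Sum>i<512 * n - 1. ennreal (wt i) * indicator (S i) y)"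
   unfolding sum_distrib_left by (intro sum.cong refl mult.left_commute)
  also have "... <= G y h * (ennreal (1153 * B) * (ennreal (kern n M x y / rho n y) * indicator {-1..1} y))" by (rule mult_left_mono[OF sum_le]) simp
  finally show "(\<Sum>i<512 * n - 1. ennreal (wt i) * (G y h * indicator (S i) y)) <= ennreal (1153 * B) * (G y h * (ennreal (kern n M x y / rho n y) * indicator {-1..1} y))"
   by (simp only: mult.left_commute)
 qed
 also have "... = (LN h. ennreal (1153 * B) * (LN y. (G y h * (ennreal (kern n M x y / rho n y) * indicator {-1..1} y))))"
  by (intro nn_integral_cong nn_integral_cmult) measurable
 also have "... = ennreal (1153 * B) * (LN h. LN y. (G y h * (ennreal (kern n M x y / rho n y) * indicator {-1..1} y)))" by (rule nn_integral_cmult) measurable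
 finally show ?thesis unfolding wt_def z_def B_def .
qed

text \<open>Besides a double cell containing the point, the statement says which exact steps are
  already switched on there, and that the grid point in the middle of the cell is within
  \<open>tau\<close> distance 1.\<close>

lemma grid_cell:
 assumes n: "1 <= n" and \<theta>: "0 <= \<theta>" "\<theta> <= pi"
 obtains j where "j + 2 <= 512 * n" "cos \<theta> \<in> {grid n (j + 2)..grid n j}"
  and "\<And>i. i + 2 < 512 * n ==> arccos (grid n (i + 1)) <= \<theta> \<longleftrightarrow> i < j"
  and "real n * \<bar>\<theta> - arccos (grid n (j + 1))\<bar> <= 1"
proof -
 define \<delta> where "\<delta> = pi / (512 * real n)"
 have n0: "0 < real n" using n by simp
 have \<delta>: "0 < \<delta>" using n0 by (simp add: \<delta>_def)
 have N\<delta>: "real (512 * n) * \<delta> = pi" using n0 by (simp add: \<delta>_def)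
 define k where "k = nat \<lfloor>\<theta> / \<delta>\<rfloor>"
 have q0: "0 <= \<theta> / \<delta>" using \<theta> \<delta> by simp
 have k1: "real k <= \<theta> / \<delta>" "\<theta> / \<delta> < real k + 1" unfolding k_def using q0 by linarith+
 have k: "real k * \<delta> <= \<theta>" "\<theta> < (real k + 1) * \<delta>" using k1 \<delta> by (simp_all only: pos_le_divide_eq pos_divide_less_eq)
 have le: "real i * \<delta> <= \<theta> \<longleftrightarrow> i <= k" for i
 proof
  assume "real i * \<delta> <= \<theta>"
  then have "real i * \<delta> < (real k + 1) * \<delta>" using k by linarith
  then have "real i < real k + 1" using \<delta> by (simp only: mult_less_cancel_right_pos)
  then show "i <= k" by linarith
 next
  assume "i <= k"
  then have "real i * \<delta> <= real k * \<delta>" using \<delta> by (intro mult_right_mono) auto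
  then show "real i * \<delta> <= \<theta>" using k by linarith
 qed
 \<comment> \<open>Clamped at the end of the grid, where a double cell still has to fit; this
   affects only angles in the last cell and the angle pi.\<close>
 define j where "j = min k (512 * n - 2)"
 have j2: "j + 2 <= 512 * n" using n by (simp add: j_def)
 have jl: "real j * \<delta> <= \<theta>" unfolding le by (simp add: j_def)
 have ju: "\<theta> <= real (j + 2) * \<delta>"
 proof (cases "k <= 512 * n - 2")
  case True
  then have "j = k" by (simp add: j_def)
  then have "(real k + 1) * \<delta> <= real (j + 2) * \<delta>" using \<delta> by (intro mult_right_mono) auto
  then show ?thesis using k by linarith
 next
  case False
  then have "j + 2 = 512 * n" using n by (simp add: j_def)
  then show ?thesis using \<theta> N\<delta> by simp
 qed
 have ang: "arccos (grid n i) = real i * \<delta>" "real i * \<delta> <= pi" if "i <= 512 * n" for i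
  using grid_angle[OF n that] by (simp_all add: \<delta>_def)
 have cosj: "cos \<theta> \<in> {grid n (j + 2)..grid n j}"
  unfolding grid_def \<delta>_def[symmetric] using jl ju \<theta> ang(2)[OF j2] \<delta> by (auto intro!: cos_monotone_0_pi_le)
 have iff: "arccos (grid n (i + 1)) <= \<theta> \<longleftrightarrow> i < j" if "i + 2 < 512 * n" for i
  using le[of "i + 1"] that ang(1)[of "i + 1"] by (auto simp: j_def)
 have "\<bar>\<theta> - arccos (grid n (j + 1))\<bar> <= \<delta>" using jl ju ang(1)[of "j + 1"] j2 by (simp add: abs_le_iff algebra_simps)
 then have "real n * \<bar>\<theta> - arccos (grid n (j + 1))\<bar> <= real n * \<delta>" by (intro mult_left_mono) auto
 also have "... = pi / 512" using n0 by (simp add: \<delta>_def)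
 also have "... <= 1" using pi_less_4 by simp
 finally show thesis using that j2 cosj iff by blast
qed

text \<open>Neighbouring grid points are within \<open>tau\<close> distance 1 and their
  \<open>rho\<close> differ by at most a factor 2. A jump involves the masses of two neighbouring
  cells, and this lets both be summed with the same weights.\<close>

lemma weight_succ_le:
 assumes n: "1 <= n" and i: "i + 3 <= 512 * n" and x: "x \<in> {-1..1}"
 shows "1 / ((1 + tau n x (grid n (i + 1))) ^ k * (rho n (grid n (i + 1)))\<^sup>2)
  <= 4 * 2 ^ k * (1 / ((1 + tau n x (grid n (i + 2))) ^ k * (rho n (grid n (i + 2)))\<^sup>2))"
proof -
 define z z' where "z = grid n (i + 1)" and "z' = grid n (i + 2)"
 have zin: "z \<in> {-1..1}" "z' \<in> {-1..1}" unfolding z_def z'_def by (rule grid_in)+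
 have \<rho>: "0 < rho n z" "0 < rho n z'" by (rule rho_pos[OF n zin(1)] rho_pos[OF n zin(2)])+
 have "\<bar>z - z'\<bar> <= rho n z / 16" using grid_gap(1)[OF n, of i] grid_mono[OF n, of "i + 1" i] grid_mono[OF n, of "i + 2" "i + 1"] i \<rho>
  unfolding z_def z'_def by simp
 from rho_compare_near(2)[OF n zin this] have r2: "rho n z' / 2 <= rho n z" by simp
 have "tau n z z' = real n * (pi / (512 * real n))"
 proof -
  have "\<bar>arccos z - arccos z'\<bar> = \<bar>(real (i + 1) - real (i + 2)) * (pi / (512 * real n))\<bar>"
   unfolding z_def z'_def left_diff_distrib using grid_angle(3)[OF n, of "i + 1"] grid_angle(3)[OF n, of "i + 2"] i by simp
  then show ?thesis unfolding tau_def abs_mult by simp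
 qed
 also have "... <= 1" using n pi_less_4 by simp
 finally have t1: "tau n z z' <= 1" .
 have "1 + tau n x z' <= (1 + tau n x z) * (1 + tau n z z')" by (rule one_plus_tau_triangle)
 also have "... <= (1 + tau n x z) * 2" using t1 by (intro mult_left_mono) auto
 finally have t2: "(1 + tau n x z') / 2 <= 1 + tau n x z" by simp
 have T: "0 < 1 + tau n x z'" by (simp add: add_pos_nonneg)
 have "((1 + tau n x z') / 2) ^ k * (rho n z' / 2)\<^sup>2 <= (1 + tau n x z) ^ k * (rho n z)\<^sup>2" using t2 r2 \<rho> T by (intro mult_mono power_mono) auto
 moreover have "0 < ((1 + tau n x z') / 2) ^ k * (rho n z' / 2)\<^sup>2" using T \<rho> by simp
 ultimately have "1 / ((1 + tau n x z) ^ k * (rho n z)\<^sup>2) <= 1 / (((1 + tau n x z') / 2) ^ k * (rho n z' / 2)\<^sup>2)" by (intro frac_le) auto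
 also have "... = 4 * 2 ^ k * (1 / ((1 + tau n x z') ^ k * (rho n z')\<^sup>2))" by (simp add: power_divide)
 finally show ?thesis unfolding z_def z'_def .
qed

text \<open>Where \<open>x\<close> lies in cell \<open>j\<close>, the error is the local error of
  \<open>q j\<close> plus the sum of the jumps times the errors of the step polynomials. The growth
  of a jump away from its cell is beaten by the decay of the step error, and
  \<open>near_mass_sum\<close> adds up the rest.\<close>

lemma direct_pointwise:
 fixes r M :: nat
 assumes r: "1 <= r" and M: "1 <= M"
 obtains C n0 where "0 < C" and "1 <= n0" and "\<And>n f e G. n0 <= n ==> f \<in> borel_measurable borel ==> L1 {-1..1} f < \<infinity> ==> 0 < e ==>
  case_prod G \<in> borel_measurable (borel \<Otimes>\<^sub>M borel) ==> diff_dominated n r f e G ==>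
  \<exists>P. degree P < n \<and> (\<forall>x\<in>{-1..1}. eabs (f x - poly P x) <= ennreal (C / rho n x) * line_int r G x
    + ennreal C * kern_int n M G x)"
proof (rule local_approx[OF r], goal_cases)
 case (1 C0)
 note C0 = 1(2) and LA = 1(3)
 \<comment> \<open>The step error decays with exponent 2s - 2 = 2r + 2M: 2r cancel the growth of the
   jumps and 2M remain for the kernel.\<close>
 define s where "s = r + M + 1"
 have s1: "1 <= s" and s12: "1 <= 2 * s" and s2: "2 * s - 2 = 2 * r + 2 * M" by (simp_all add: s_def)
 define Cr where "Cr = real r * (2 * real r) ^ r * 262144 ^ r * 262144 * (2 * C0)"
 have Cr: "0 <= Cr" using C0 by (simp add: Cr_def)
 define C5 where "C5 = 4 ^ s * (1 + pi) ^ (2 * s) * (4 * real s) ^ (2 * s - 2)"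
 have C5: "0 <= C5" by (simp add: C5_def)
 define D where "D = C0 * 2 ^ (2 * M) + Cr * C5 * (1 + 4 * 2 ^ (2 * M))"
 have D: "0 <= D" using C0 Cr C5 by (simp add: D_def)
 define C where "C = 2 * C0 + D * (1153 * (4 * 5 ^ (2 * M)))"
 have C: "0 < C" "2 * C0 <= C" "D * (1153 * (4 * 5 ^ (2 * M))) <= C" using C0 D by (simp_all add: C_def add_pos_nonneg)
 show thesis
 proof (rule that[OF C(1) s12], goal_cases)
  case (1 n f e G)
  note n0 = 1(1) and f[measurable] = 1(2) and fin = 1(3) and e = 1(4) and G[measurable] = 1(5) and dom = 1(6)
  have n: "1 <= n" using n0 s1 by simp
  define N where "N = 512 * n"
  define z where "z i = grid n (i + 1)" for i
  define A where "A i = near_mass n G (z i)" for i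
  have zin: "z i \<in> {-1..1}" for i unfolding z_def by (rule grid_in)
  have \<rho>: "0 < rho n (z i)" for i by (rule rho_pos[OF n zin])
  have "\<forall>i. \<exists>q. i + 2 <= N \<longrightarrow> degree q < r
   \<and> (\<forall>x\<in>{grid n (i + 2)..grid n i}. eabs (f x - poly q x) <= ennreal (C0 / rho n (z i)) * line_int r G x
      + ennreal (C0 / (rho n (z i))\<^sup>2) * A i)
   \<and> L1 {grid n (i + 2)..grid n i} (%x. f x - poly q x) <= ennreal (C0 / rho n (z i)) * A i" (is "\<forall>i. \<exists>q. ?A i q")
   using LA[OF n f fin e G dom] unfolding N_def z_def A_def by blast
  from choice[OF this] obtain q where q: "\<forall>i. ?A i (q i)" ..
  have qd: "degree (q i) < r" if "i + 2 <= N" for i using q that by blast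
  have qp: "eabs (f x - poly (q i) x) <= ennreal (C0 / rho n (z i)) * line_int r G x + ennreal (C0 / (rho n (z i))\<^sup>2) * A i"
   if "i + 2 <= N" "x \<in> {grid n (i + 2)..grid n i}" for i x using q that by blast
  have qI: "L1 {grid n (i + 2)..grid n i} (%x. f x - poly (q i) x) <= ennreal (C0 / rho n (z i)) * A i"
   if "i + 2 <= N" for i using q that by blast
  have jump: "eabs (poly (q (i + 1)) x - poly (q i) x) <= ennreal (Cr * (1 + tau n x (z i)) ^ (2 * r) / (rho n (z i))\<^sup>2) * (A i + A (i + 1))"
   if i: "i + 3 <= N" and x: "x \<in> {-1..1}" for i x unfolding Cr_def z_def using i qd[of i] qd[of "i + 1"] qI[of i] qI[of "i + 1"] x
   by (intro jump_bound[OF n _ C0 f]) (auto simp: N_def z_def numeral_3_eq_3)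
  \<comment> \<open>Degree budget: the step polynomials have degree at most s (m - 1), and as r < s
    and 2 s m \<le> n, the products stay below degree n. At the same time m is at least n / (4 s),
    so decay at scale m is decay at scale n.\<close>
  define m where "m = n div (2 * s)"
  have m: "1 <= m" unfolding m_def using n0 s1 by (simp add: Suc_le_eq div_greater_zero_iff)
  have m2: "2 * s * m <= n" unfolding m_def by (rule times_div_less_eq_dividend)
  have m3: "real n <= 4 * real s * real m"
  proof -
   have "n < 2 * s * m + 2 * s" unfolding m_def using dividend_less_times_div[of "2 * s" n] s1 by simp
   also have "2 * s * m + 2 * s <= 2 * s * m + 2 * s * m" using m by simp
   finally have "n <= 4 * s * m" by (simp add: ac_simps)
   then have "real n <= real (4 * s * m)" by (rule of_nat_mono)
   then show ?thesis by simp
  qed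
  have "\<forall>i. \<exists>R. i + 1 <= N \<longrightarrow> degree R <= s * (m - 1) \<and> (\<forall>\<theta>\<in>{0..pi}. \<bar>(if arccos (z i) <= \<theta> then 1 else 0) - poly R (cos \<theta>)\<bar>
    <= 4 ^ s * (1 + pi) ^ (2 * s) / (1 + real m * \<bar>\<theta> - arccos (z i)\<bar>) ^ (2 * s - 2))" (is "\<forall>i. \<exists>R. ?B i R")
   using step_poly[OF m s1 arccos_lbound arccos_ubound] zin by auto
  from choice[OF this] obtain R where R: "\<forall>i. ?B i (R i)" ..
  have Rd: "degree (R i) <= s * (m - 1)" if "i + 1 <= N" for i using R that by blast
  have Rb: "\<bar>(if arccos (z i) <= arccos x then 1 else 0) - poly (R i) x\<bar> <= C5 / (1 + tau n x (z i)) ^ (2 * s - 2)"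
   if i: "i + 1 <= N" and x: "x \<in> {-1..1}" for i x
  proof -
   define \<theta> where "\<theta> = arccos x"
   have \<theta>: "\<theta> \<in> {0..pi}" "cos \<theta> = x" using x by (auto simp: \<theta>_def arccos_lbound arccos_ubound)
   define Y where "Y = 1 + real m * \<bar>\<theta> - arccos (z i)\<bar>"
   have Y: "0 < Y" by (simp add: Y_def add_pos_nonneg)
   have "1 + tau n x (z i) <= 4 * real s * Y"
   proof -
    have "1 <= 4 * real s" using s1 by simp
    moreover have "real n * \<bar>\<theta> - arccos (z i)\<bar> <= 4 * real s * real m * \<bar>\<theta> - arccos (z i)\<bar>"
     using m3 by (intro mult_right_mono) auto
    ultimately show ?thesis unfolding tau_def Y_def \<theta>_def[symmetric] by (simp add: distrib_left)
   qed
   then have "(1 + tau n x (z i)) ^ (2 * s - 2) <= (4 * real s * Y) ^ (2 * s - 2)" by (intro power_mono) auto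
   also have "... = (4 * real s) ^ (2 * s - 2) * Y ^ (2 * s - 2)" by (rule power_mult_distrib)
   finally have "1 / Y ^ (2 * s - 2) <= (4 * real s) ^ (2 * s - 2) / (1 + tau n x (z i)) ^ (2 * s - 2)"
    using Y by (subst pos_divide_le_eq) (auto simp: pos_le_divide_eq add_pos_nonneg)
   then have "4 ^ s * (1 + pi) ^ (2 * s) * (1 / Y ^ (2 * s - 2)) <= 4 ^ s * (1 + pi) ^ (2 * s) * ((4 * real s) ^ (2 * s - 2) / (1 + tau n x (z i)) ^ (2 * s - 2))"
    by (rule mult_left_mono) simp
   then have "4 ^ s * (1 + pi) ^ (2 * s) / Y ^ (2 * s - 2) <= C5 / (1 + tau n x (z i)) ^ (2 * s - 2)" by (simp add: C5_def)
   moreover have "\<bar>(if arccos (z i) <= \<theta> then 1 else 0) - poly (R i) (cos \<theta>)\<bar> <= 4 ^ s * (1 + pi) ^ (2 * s) / Y ^ (2 * s - 2)"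
    using R i \<theta>(1) unfolding Y_def by blast
   ultimately show ?thesis unfolding \<theta>(2) unfolding \<theta>_def by (rule order_trans[rotated])
  qed
  \<comment> \<open>With exact step functions in place of \<open>R i\<close> this sum would
    telescope to the approximant of the cell of \<open>x\<close>.\<close>
  define P where "P = q 0 + (\<Sum>i<N - 2. (q (i + 1) - q i) * R i)"
  have dP: "degree P < n"
  proof -
   have sm: "r + s * (m - 1) < n"
   proof -
    have "s * (m - 1) + s = s * m" using m by (cases m) auto
    moreover have "s * m + s * m <= n" using m2 by simp
    moreover have "r < s" "1 <= s * m" using s1 m by (auto simp: s_def)
    ultimately show ?thesis by linarith
   qed
   have "degree ((q (i + 1) - q i) * R i) <= r + s * (m - 1)" if "i < N - 2" for i
   proof -
    have "degree (q (i + 1) - q i) < r" using qd[of i] qd[of "i + 1"] that by (intro degree_diff_less) auto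
    then show ?thesis using Rd[of i] that by (intro order_trans[OF degree_mult_le] add_mono) auto
   qed
   moreover have "degree (q 0) <= r + s * (m - 1)" using qd[of 0] n by (simp add: N_def)
   ultimately have "degree P <= r + s * (m - 1)" unfolding P_def by (intro degree_add_le degree_sum_le) auto
   then show ?thesis using sm by simp
  qed
  define wt where "wt x i = 1 / ((1 + tau n x (z i)) ^ (2 * M) * (rho n (z i))\<^sup>2)" for x i
  have wt: "0 < wt x i" for x i unfolding wt_def using \<rho> by (auto intro!: divide_pos_pos mult_pos_pos zero_less_power add_pos_nonneg)
  have "eabs (f x - poly P x) <= ennreal (C / rho n x) * line_int r G x
    + ennreal C * kern_int n M G x"
   if x: "x \<in> {-1..1}" for x
  proof -
   define S where "S = (\<Sum>i<N - 1. ennreal (wt x i) * A i)"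
   obtain j where j: "j + 2 <= N" "x \<in> {grid n (j + 2)..grid n j}"
    and ji: "\<And>i. i + 2 < N ==> arccos (z i) <= arccos x \<longleftrightarrow> i < j" and jt: "real n * \<bar>arccos x - arccos (z j)\<bar> <= 1"
   proof -
    have ax: "0 <= arccos x" "arccos x <= pi" using x by (auto simp: arccos_lbound arccos_ubound)
    have cx: "cos (arccos x) = x" using x by simp
    show thesis using grid_cell[OF n ax, unfolded cx] that unfolding N_def z_def by blast
   qed
   have xj: "\<bar>z j - x\<bar> <= rho n (z j) / 16"
   proof -
    have "\<bar>z j - x\<bar> <= rho n (z j) / 16" if "a <= z j" "z j <= b" "a <= x" "x <= b" "b - a <= rho n (z j) / 64" for a b
    proof -
     have "\<bar>z j - x\<bar> <= b - a" using that unfolding abs_le_iff by linarith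
     also have "... <= rho n (z j) / 64" by (rule that)
     also have "... <= rho n (z j) / 16" using \<rho>[of j] by simp
     finally show ?thesis .
    qed
    moreover have "grid n (j + 2) <= z j" "z j <= grid n j" unfolding z_def using j(1) by (auto intro!: grid_mono n simp: N_def)
    ultimately show ?thesis using j(2) grid_gap(1)[OF n j(1)[unfolded N_def]] unfolding z_def[symmetric] atLeastAtMost_iff by blast
   qed
   define g where "g i = poly (q (i + 1)) x - poly (q i) x" for i
   define h where "h i = (if i < j then 1 else 0) - poly (R i) x" for i
   have "(\<Sum>i<N - 2. g i * (if i < j then 1 else 0)) = (\<Sum>i\<in>{..<N - 2} \<inter> {..<j}. g i)" by (subst sum.inter_restrict) (auto intro!: sum.cong)
   also have "{..<N - 2} \<inter> {..<j} = {..<j}" using j(1) by auto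
   finally have "(\<Sum>i<N - 2. g i * (if i < j then 1 else 0)) = (\<Sum>i<j. g i)" .
   also have "... = poly (q j) x - poly (q 0) x" unfolding g_def using sum_lessThan_telescope[of "%i. poly (q i) x" j] by simp
   finally have tele: "(\<Sum>i<N - 2. g i * (if i < j then 1 else 0)) = poly (q j) x - poly (q 0) x" .
   have "poly P x = poly (q 0) x + (\<Sum>i<N - 2. g i * poly (R i) x)" by (simp add: P_def poly_sum g_def)
   also have "(\<Sum>i<N - 2. g i * poly (R i) x) = (\<Sum>i<N - 2. g i * (if i < j then 1 else 0)) - (\<Sum>i<N - 2. g i * h i)"
    unfolding sum_subtractf[symmetric] h_def right_diff_distrib by (intro sum.cong refl) linarith
   finally have "f x - poly P x = (f x - poly (q j) x) + (\<Sum>i<N - 2. g i * h i)" using tele by simp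
   then have "\<bar>f x - poly P x\<bar> <= \<bar>f x - poly (q j) x\<bar> + (\<Sum>i<N - 2. \<bar>g i\<bar> * \<bar>h i\<bar>)"
    using sum_abs[of "%i. g i * h i" "{..<N - 2}"] unfolding abs_mult by linarith
   then have "eabs (f x - poly P x) <= ennreal (\<bar>f x - poly (q j) x\<bar> + (\<Sum>i<N - 2. \<bar>g i\<bar> * \<bar>h i\<bar>))" by (rule ennreal_leI)
   also have "... = eabs (f x - poly (q j) x) + (\<Sum>i<N - 2. eabs (g i) * eabs (h i))"
    by (subst ennreal_plus) (auto simp: sum_nonneg sum_ennreal[symmetric] ennreal_mult simp del: sum_ennreal)
   also have "... <= (ennreal (C0 / rho n (z j)) * line_int r G x + ennreal (C0 / (rho n (z j))\<^sup>2) * A j)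
     + (\<Sum>i<N - 2. ennreal (Cr * C5) * (ennreal (wt x i) * A i + ennreal (wt x i) * A (i + 1)))"
   proof (intro add_mono qp j sum_mono)
    fix i assume i: "i \<in> {..<N - 2}"
    define T where "T = 1 + tau n x (z i)"
    have T: "0 < T" by (simp add: T_def add_pos_nonneg)
    have hb: "\<bar>h i\<bar> <= C5 / T ^ (2 * r + 2 * M)" using Rb[of i x] ji[of i] i x unfolding h_def T_def s2 by auto
    have "eabs (g i) * eabs (h i) <= (ennreal (Cr * T ^ (2 * r) / (rho n (z i))\<^sup>2) * (A i + A (i + 1))) * ennreal (C5 / T ^ (2 * r + 2 * M))"
     using i x unfolding g_def T_def by (intro mult_mono jump ennreal_leI hb[unfolded T_def]) auto
    also have "... = ennreal (Cr * T ^ (2 * r) / (rho n (z i))\<^sup>2) * ennreal (C5 / T ^ (2 * r + 2 * M)) * (A i + A (i + 1))" by (simp only: ac_simps)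
    also have "ennreal (Cr * T ^ (2 * r) / (rho n (z i))\<^sup>2) * ennreal (C5 / T ^ (2 * r + 2 * M)) = ennreal (Cr * C5) * ennreal (wt x i)"
    proof -
     have "Cr * T ^ (2 * r) / (rho n (z i))\<^sup>2 * (C5 / T ^ (2 * r + 2 * M)) = Cr * C5 * wt x i" using T unfolding wt_def T_def[symmetric] power_add by simp
     moreover have "ennreal (Cr * T ^ (2 * r) / (rho n (z i))\<^sup>2) * ennreal (C5 / T ^ (2 * r + 2 * M)) = ennreal (Cr * T ^ (2 * r) / (rho n (z i))\<^sup>2 * (C5 / T ^ (2 * r + 2 * M)))"
      using Cr C5 T by (intro ennreal_mult[symmetric]) auto
     moreover have "ennreal (Cr * C5 * wt x i) = ennreal (Cr * C5) * ennreal (wt x i)" using Cr C5 wt[of x i] by (intro ennreal_mult) auto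
     ultimately show ?thesis by simp
    qed
    finally show "eabs (g i) * eabs (h i) <= ennreal (Cr * C5) * (ennreal (wt x i) * A i + ennreal (wt x i) * A (i + 1))" by (simp only: mult.assoc distrib_left)
   qed
   also have "... <= (ennreal (C / rho n x) * line_int r G x + ennreal (C0 * 2 ^ (2 * M)) * S) + ennreal (Cr * C5) * (S + ennreal (4 * 2 ^ (2 * M)) * S)"
   proof (intro add_mono)
    have \<rho>x: "0 < rho n x" by (rule rho_pos[OF n x])
    have "rho n x <= 2 * rho n (z j)" by (rule rho_compare_near(2)[OF n zin x xj])
    then have "C0 / rho n (z j) <= C0 / (rho n x / 2)" using C0 \<rho>x \<rho> by (intro divide_left_mono mult_pos_pos) auto
    also have "... = 2 * C0 / rho n x" by simp
    also have "... <= C / rho n x" using C \<rho>x by (intro divide_right_mono) auto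
    finally show "ennreal (C0 / rho n (z j)) * line_int r G x <= ennreal (C / rho n x) * line_int r G x" by (intro mult_right_mono ennreal_leI) auto
    have "(1 + tau n x (z j)) ^ (2 * M) <= 2 ^ (2 * M)" using jt unfolding tau_def by (intro power_mono) auto
    then have "1 / (2 ^ (2 * M) * (rho n (z j))\<^sup>2) <= wt x j"
     unfolding wt_def using \<rho>[of j] by (intro frac_le mult_pos_pos mult_right_mono) (auto intro!: zero_less_power add_pos_nonneg)
    then have "C0 * 2 ^ (2 * M) * (1 / (2 ^ (2 * M) * (rho n (z j))\<^sup>2)) <= C0 * 2 ^ (2 * M) * wt x j" using C0 by (intro mult_left_mono) auto
    then have "C0 / (rho n (z j))\<^sup>2 <= C0 * 2 ^ (2 * M) * wt x j" by simp
    then have "ennreal (C0 / (rho n (z j))\<^sup>2) * A j <= ennreal (C0 * 2 ^ (2 * M) * wt x j) * A j" by (intro mult_right_mono ennreal_leI) auto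
    also have "... = ennreal (C0 * 2 ^ (2 * M)) * (ennreal (wt x j) * A j)" using C0 wt[of x j] by (subst ennreal_mult) (auto simp: mult.assoc)
    also have "ennreal (wt x j) * A j <= S" unfolding S_def using j by (intro member_le_sum[of j _ "%i. ennreal (wt x i) * A i"]) auto
    finally show "ennreal (C0 / (rho n (z j))\<^sup>2) * A j <= ennreal (C0 * 2 ^ (2 * M)) * S" by (simp add: mult_left_mono)
    have "(\<Sum>i<N - 2. ennreal (wt x i) * A i) <= S" unfolding S_def by (intro sum_mono2) auto
    moreover have "(\<Sum>i<N - 2. ennreal (wt x i) * A (i + 1)) <= ennreal (4 * 2 ^ (2 * M)) * S"
    proof -
     have "(\<Sum>i<N - 2. ennreal (wt x i) * A (i + 1)) <= (\<Sum>i<N - 2. ennreal (4 * 2 ^ (2 * M)) * (ennreal (wt x (Suc i)) * A (Suc i)))"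
     proof (rule sum_mono)
      fix i assume i: "i \<in> {..<N - 2}"
      have "wt x i <= 4 * 2 ^ (2 * M) * wt x (Suc i)" using weight_succ_le[OF n _ x, of i "2 * M"] i unfolding wt_def z_def N_def by simp
      then have "ennreal (wt x i) <= ennreal (4 * 2 ^ (2 * M) * wt x (Suc i))" by (rule ennreal_leI)
      also have "... = ennreal (4 * 2 ^ (2 * M)) * ennreal (wt x (Suc i))" using wt[of x "Suc i"] by (intro ennreal_mult) auto
      finally have "ennreal (wt x i) * A (i + 1) <= ennreal (4 * 2 ^ (2 * M)) * ennreal (wt x (Suc i)) * A (i + 1)" by (rule mult_right_mono) simp
      then show "ennreal (wt x i) * A (i + 1) <= ennreal (4 * 2 ^ (2 * M)) * (ennreal (wt x (Suc i)) * A (Suc i))" by (simp only: mult.assoc Suc_eq_plus1)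
     qed
     also have "... = ennreal (4 * 2 ^ (2 * M)) * (\<Sum>i\<in>Suc ` {..<N - 2}. ennreal (wt x i) * A i)"
      unfolding sum_distrib_left[symmetric] by (subst sum.reindex) auto
     also have "(\<Sum>i\<in>Suc ` {..<N - 2}. ennreal (wt x i) * A i) <= S" unfolding S_def by (intro sum_mono2) auto
     finally show ?thesis by (simp add: mult_left_mono)
    qed
    ultimately have "ennreal (Cr * C5) * ((\<Sum>i<N - 2. ennreal (wt x i) * A i) + (\<Sum>i<N - 2. ennreal (wt x i) * A (i + 1)))
      <= ennreal (Cr * C5) * (S + ennreal (4 * 2 ^ (2 * M)) * S)" by (intro mult_left_mono add_mono) auto
    then show "(\<Sum>i<N - 2. ennreal (Cr * C5) * (ennreal (wt x i) * A i + ennreal (wt x i) * A (i + 1))) <= ennreal (Cr * C5) * (S + ennreal (4 * 2 ^ (2 * M)) * S)"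
     by (simp only: sum_distrib_left[symmetric] sum.distrib)
   qed
   also have "... = ennreal (C / rho n x) * line_int r G x + ennreal D * S"
   proof -
    have "ennreal D = ennreal (C0 * 2 ^ (2 * M)) + ennreal (Cr * C5) * (1 + ennreal (4 * 2 ^ (2 * M)))"
    proof -
     have "ennreal (Cr * C5 * (1 + 4 * 2 ^ (2 * M))) = ennreal (Cr * C5) * ennreal (1 + 4 * 2 ^ (2 * M))" using Cr C5 by (intro ennreal_mult) auto
     moreover have "ennreal (1 + 4 * 2 ^ (2 * M)) = 1 + ennreal (4 * 2 ^ (2 * M))" by (subst ennreal_plus) auto
     moreover have "ennreal D = ennreal (C0 * 2 ^ (2 * M)) + ennreal (Cr * C5 * (1 + 4 * 2 ^ (2 * M)))" unfolding D_def using C0 Cr C5 by (intro ennreal_plus) auto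
     ultimately show ?thesis by simp
    qed
    then show ?thesis by (simp only: distrib_right distrib_left mult_1_left mult_1_right ac_simps)
   qed
   also have "... <= ennreal (C / rho n x) * line_int r G x + ennreal D * (ennreal (1153 * (4 * 5 ^ (2 * M))) *
     kern_int n M G x)" unfolding S_def wt_def A_def z_def N_def by (intro add_left_mono mult_left_mono near_mass_sum n M x G) auto
   also have "... <= ennreal (C / rho n x) * line_int r G x
    + ennreal C * kern_int n M G x"
   proof (intro add_left_mono)
    have "ennreal D * ennreal (1153 * (4 * 5 ^ (2 * M))) = ennreal (D * (1153 * (4 * 5 ^ (2 * M))))" using D by (intro ennreal_mult[symmetric]) auto
    also have "... <= ennreal C" using C(3) by (rule ennreal_leI)
    finally show "ennreal D * (ennreal (1153 * (4 * 5 ^ (2 * M))) *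
     kern_int n M G x)
     <= ennreal C * kern_int n M G x" unfolding mult.assoc[symmetric] by (rule mult_right_mono) simp
   qed
   finally show ?thesis .
  qed
  with dP show ?case by blast
 qed
qed

section \<open>Weighted direct estimate\<close>

text \<open>Centres and steps of the differences occurring in the modulus at t = 1/n: a step
  \<open>k * phi y\<close> with \<open>k\<close> up to 1/n.\<close>

definition step_set :: "nat \<Rightarrow> nat \<Rightarrow> (real \<times> real) set" where
 "step_set n r = {(y, h). y \<in> {-1..1} \<and> 0 < h \<and> h <= phi y / real n
   \<and> y - real r * h / 2 \<in> {-1..1} \<and> y + real r * h / 2 \<in> {-1..1}}"

text \<open>Normalised by \<open>rho n y\<close>, so that the steps at one centre have total mass at
  most 1; this makes the projection to the centre decrease measure.\<close>

definition step_density :: "nat \<Rightarrow> nat \<Rightarrow> real \<times> real \<Rightarrow> real" where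
 "step_density n r p = indicat_real (step_set n r) p / rho n (fst p)"

definition step_measure :: "nat \<Rightarrow> nat \<Rightarrow> (real \<times> real) measure" where
 "step_measure n r = density (M0 \<Otimes>\<^sub>M lborel) (%p. ennreal (step_density n r p))"

lemma step_set_measurable [measurable]: "step_set n r \<in> sets (borel \<Otimes>\<^sub>M borel)"
proof -
 have "{p \<in> space (borel \<Otimes>\<^sub>M borel). -1 <= fst p \<and> fst p <= 1 \<and> 0 < snd p \<and> snd p <= phi (fst p) / real n
   \<and> -1 <= fst p - real r * snd p / 2 \<and> fst p - real r * snd p / 2 <= 1
   \<and> -1 <= fst p + real r * snd p / 2 \<and> fst p + real r * snd p / 2 <= 1} \<in> sets (borel \<Otimes>\<^sub>M borel)" by measurable
 also have "{p \<in> space (borel \<Otimes>\<^sub>M borel). -1 <= fst p \<and> fst p <= 1 \<and> 0 < snd p \<and> snd p <= phi (fst p) / real n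
   \<and> -1 <= fst p - real r * snd p / 2 \<and> fst p - real r * snd p / 2 <= 1
   \<and> -1 <= fst p + real r * snd p / 2 \<and> fst p + real r * snd p / 2 <= 1} = step_set n r" by (auto simp: step_set_def space_pair_measure)
 finally show ?thesis .
qed
lemma step_density_measurable [measurable]: "step_density n r \<in> borel_measurable (borel \<Otimes>\<^sub>M borel)"
 unfolding step_density_def[abs_def] by measurable

lemma step_density_nonneg: "1 <= n ==> 0 <= step_density n r p"
 using rho_pos[of n "fst p"] by (cases "p \<in> step_set n r") (auto simp: step_density_def step_set_def)

lemma step_density_eq_0: "p \<notin> step_set n r ==> step_density n r p = 0" by (simp add: step_density_def)

lemma measurable_M0_pair:
 assumes "Q \<in> borel_measurable (borel \<Otimes>\<^sub>M borel)"
 shows "Q \<in> borel_measurable (M0 \<Otimes>\<^sub>M lborel)"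
proof -
 have "(%x. x) \<in> measurable M0 borel" by (intro measurable_restrict_space1) simp
 then have [measurable]: "fst \<in> measurable (M0 \<Otimes>\<^sub>M lborel) borel" using measurable_compose[OF measurable_fst] by fastforce
 have "snd \<in> measurable (M0 \<Otimes>\<^sub>M lborel) lborel" by (rule measurable_snd)
 then have [measurable]: "snd \<in> measurable (M0 \<Otimes>\<^sub>M lborel) borel" by simp
 have "(%p. (fst p, snd p)) \<in> measurable (M0 \<Otimes>\<^sub>M lborel) (borel \<Otimes>\<^sub>M borel)" by measurable
 then show ?thesis using measurable_compose[OF _ assms, of "%p. p"] by simp
qed

lemma nn_integral_step:
 assumes Q: "Q \<in> borel_measurable (borel \<Otimes>\<^sub>M borel)" and n: "1 <= n"
 shows "(\<integral>\<^sup>+p. Q p \<partial>step_measure n r) = (LN h. LN y. ennreal (step_density n r (y, h)) * Q (y, h))"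
proof -
 note [measurable] = Q measurable_M0_pair[OF Q] measurable_M0_pair[OF step_density_measurable[of n r]]
 interpret M0: sigma_finite_measure M0 by (rule sigma_finite_M0)
 interpret P: pair_sigma_finite M0 "lborel :: real measure" ..
 have "(\<integral>\<^sup>+p. Q p \<partial>step_measure n r) = (\<integral>\<^sup>+p. ennreal (step_density n r p) * Q p \<partial>(M0 \<Otimes>\<^sub>M lborel))"
  unfolding step_measure_def by (rule nn_integral_density) measurable
 also have "... = (LN h. \<integral>\<^sup>+y. ennreal (step_density n r (y, h)) * Q (y, h) \<partial>M0)" by (rule P.nn_integral_snd[symmetric]) measurable
 also have "... = (LN h. LN y. ennreal (step_density n r (y, h)) * Q (y, h))"
 proof (rule nn_integral_cong)
  fix h
  show "(\<integral>\<^sup>+y. ennreal (step_density n r (y, h)) * Q (y, h) \<partial>M0) = (LN y. ennreal (step_density n r (y, h)) * Q (y, h))"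
   unfolding nn_integral_M0
  proof (rule nn_integral_cong)
   fix y
   show "ennreal (step_density n r (y, h)) * Q (y, h) * indicator {-1..1} y = ennreal (step_density n r (y, h)) * Q (y, h)"
    using step_density_eq_0[of "(y, h)" n r] by (cases "y \<in> {-1..1}") (auto simp: step_set_def)
  qed
 qed
 finally show ?thesis .
qed

lemma nn_integral_step_shift:
 assumes [measurable]: "Q \<in> borel_measurable (borel \<Otimes>\<^sub>M borel)" and n: "1 <= n"
 shows "(\<integral>\<^sup>+p. Q p \<partial>step_measure n r)
   = (LN x. LN h. ennreal (step_density n r (x + c * h, h)) * Q (x + c * h, h))"
proof -
 have "(\<integral>\<^sup>+p. Q p \<partial>step_measure n r) = (LN h. LN y. ennreal (step_density n r (y, h)) * Q (y, h))" by (rule nn_integral_step[OF assms])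
 also have "... = (LN h. LN x. ennreal (step_density n r (x + c * h, h)) * Q (x + c * h, h))"
  by (intro nn_integral_cong nn_integral_translate[symmetric]) measurable
 also have "... = (LN x. LN h. ennreal (step_density n r (x + c * h, h)) * Q (x + c * h, h))" by (rule lborel_pair.Fubini') measurable
 finally show ?thesis .
qed

text \<open>Substituting \<open>k * phi y\<close> for the step turns an average over constant steps
  into an average over the parameter of the modulus. The Jacobian \<open>phi y\<close> over
  \<open>rho n y\<close> is at most \<open>n\<close>, which matches the length 1/n of the range of
  \<open>k\<close>.\<close>

lemma nn_integral_step_le:
 assumes [measurable]: "Q \<in> borel_measurable (borel \<Otimes>\<^sub>M borel)" and n: "1 <= n"
 shows "(\<integral>\<^sup>+p. Q p \<partial>step_measure n r)
   <= ennreal (real n) * (LN k. LN y. Q (y, k * phi y) * indicator (step_set n r) (y, k * phi y))"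
proof -
 have "(\<integral>\<^sup>+p. Q p \<partial>step_measure n r)
   = (LN y. LN h. ennreal (step_density n r (y + 0 * h, h)) * Q (y + 0 * h, h))" by (rule nn_integral_step_shift[OF assms])
 also have "... <= (LN y. ennreal (real n) * (LN k. Q (y, k * phi y) * indicator (step_set n r) (y, k * phi y)))"
 proof (rule nn_integral_mono)
  fix y
  show "(LN h. ennreal (step_density n r (y + 0 * h, h)) * Q (y + 0 * h, h))
   <= ennreal (real n) * (LN k. Q (y, k * phi y) * indicator (step_set n r) (y, k * phi y))"
  proof (cases "y \<in> {-1..1} \<and> 0 < phi y")
   case False
   have "(y, h) \<notin> step_set n r" for h
   proof
    assume "(y, h) \<in> step_set n r"
    then have h: "y \<in> {-1..1}" "0 < h" "h <= phi y / real n" by (auto simp: step_set_def)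
    then have "phi y = 0" using False phi_nonneg[of y] by force
    then show False using h by simp
   qed
   then show ?thesis by (simp add: step_density_eq_0)
  next
   case True
   then have y: "y \<in> {-1..1}" and p: "0 < phi y" by auto
   have \<rho>: "0 < rho n y" by (rule rho_pos[OF n y])
   have "(LN h. ennreal (step_density n r (y + 0 * h, h)) * Q (y + 0 * h, h))
    = (LN h. ennreal (1 / rho n y) * (Q (y, h) * indicator (step_set n r) (y, h)))" by (intro nn_integral_cong) (simp add: step_density_def indicator_def)
   also have "... = ennreal (1 / rho n y) * (LN h. Q (y, h) * indicator (step_set n r) (y, h))" by (rule nn_integral_cmult) measurable
   also have "(LN h. Q (y, h) * indicator (step_set n r) (y, h))
    = eabs (phi y) * (LN k. Q (y, 0 + phi y * k) * indicator (step_set n r) (y, 0 + phi y * k))"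
    using p by (intro nn_integral_real_affine[where f = "%h. Q (y, h) * indicator (step_set n r) (y, h)"]) auto
   also have "ennreal (1 / rho n y) * (eabs (phi y) * (LN k. Q (y, 0 + phi y * k) * indicator (step_set n r) (y, 0 + phi y * k)))
    = ennreal (phi y / rho n y) * (LN k. Q (y, k * phi y) * indicator (step_set n r) (y, k * phi y))"
    using p \<rho> by (simp add: mult.assoc[symmetric] ennreal_mult'[symmetric] mult.commute)
   also have "... <= ennreal (real n) * (LN k. Q (y, k * phi y) * indicator (step_set n r) (y, k * phi y))"
   proof (intro mult_right_mono ennreal_leI)
    have "phi y <= real n * rho n y" using phi_le_rho[OF n, of y] n by (simp add: pos_divide_le_eq mult.commute)
    then show "phi y / rho n y <= real n" using \<rho> by (simp add: pos_divide_le_eq)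
   qed simp
   finally show ?thesis .
  qed
 qed
 also have "... = ennreal (real n) * (LN y. LN k. Q (y, k * phi y) * indicator (step_set n r) (y, k * phi y))" by (rule nn_integral_cmult) measurable
 also have "(LN y. LN k. Q (y, k * phi y) * indicator (step_set n r) (y, k * phi y))
  = (LN k. LN y. Q (y, k * phi y) * indicator (step_set n r) (y, k * phi y))" by (rule lborel_pair.Fubini') measurable
 finally show ?thesis .
qed

lemma step_setD: "(y, k * phi y) \<in> step_set n r ==> 1 <= n ==> y \<in> {-1..1} \<and> 0 < k \<and> k <= 1 / real n"
proof -
 assume s: "(y, k * phi y) \<in> step_set n r" and n: "1 <= n"
 then have y: "y \<in> {-1..1}" and k: "0 < k * phi y" "k * phi y <= phi y / real n" by (auto simp: step_set_def)
 have p: "0 < phi y" using k(1) phi_nonneg[OF y] by (cases "phi y = 0") auto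
 have "k * phi y <= (1 / real n) * phi y" using k(2) by simp
 then have "k <= 1 / real n" using p by (rule mult_right_le_imp_le)
 moreover have "0 < k" using k(1) p by (simp add: zero_less_mult_iff)
 ultimately show ?thesis using y by blast
qed

text \<open>A bound valid for every parameter \<open>k\<close> of the modulus holds on average over
  \<open>k\<close>, hence for the function of centre and step on the product space.\<close>

lemma lpb_step:
 assumes p: "1 <= p" and n: "1 <= n" and B: "0 < B" and u[measurable]: "u \<in> borel_measurable (borel \<Otimes>\<^sub>M borel)"
  and v[measurable]: "v \<in> borel_measurable borel"
  and le: "\<And>k. 0 < k ==> k <= 1 / real n ==> lpb M0 p v (%y. if (y, k * phi y) \<in> step_set n r then u (y, k * phi y) else 0) B"
 shows "lpb (step_measure n r) p (%z. v (fst z)) u B"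
proof (rule lpbI[OF p B _ _ order_refl])
 have Qm[measurable]: "(%z. lpi p B \<bar>u z\<bar> (v (fst z))) \<in> borel_measurable (borel \<Otimes>\<^sub>M borel)" by measurable
 show "(%z. lpi p B \<bar>u z\<bar> (v (fst z))) \<in> borel_measurable (step_measure n r)" using measurable_M0_pair[OF Qm] by (simp add: step_measure_def)
 have "(\<integral>\<^sup>+z. lpi p B \<bar>u z\<bar> (v (fst z)) \<partial>step_measure n r) <= ennreal (real n) *
   (LN k. LN y. lpi p B \<bar>u (y, k * phi y)\<bar> (v (fst (y, k * phi y))) * indicator (step_set n r) (y, k * phi y))" by (rule nn_integral_step_le[OF Qm n])
 also have "... <= ennreal (real n) * (LN k. indicator {0..1 / real n} k)"
 proof (intro mult_left_mono nn_integral_mono)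
  fix k :: real
  let ?w = "%y. if (y, k * phi y) \<in> step_set n r then u (y, k * phi y) else 0"
  have "(LN y. lpi p B \<bar>u (y, k * phi y)\<bar> (v (fst (y, k * phi y))) * indicator (step_set n r) (y, k * phi y))
   = (\<integral>\<^sup>+y. lpi p B \<bar>?w y\<bar> (v y) \<partial>M0)"
   unfolding nn_integral_M0 using B by (intro nn_integral_cong) (auto simp: indicator_def step_set_def)
  also have "... <= indicator {0..1 / real n} k"
  proof (cases "0 < k \<and> k <= 1 / real n")
   case True
   then show ?thesis using lpbD[OF p B le[of k]] by (simp add: borel_measurable_M0)
  next
   case False
   then have "(y, k * phi y) \<notin> step_set n r" for y using step_setD[OF _ n] by blast
   then show ?thesis using B by simp
  qed
  finally show "(LN y. lpi p B \<bar>u (y, k * phi y)\<bar> (v (fst (y, k * phi y))) * indicator (step_set n r) (y, k * phi y))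
   <= indicator {0..1 / real n} k" .
 qed simp
 also have "... = ennreal (real n * (1 / real n))" unfolding ennreal_mult'[OF of_nat_0_le_iff] by simp
 also have "... = 1" using n by simp
 finally show "(\<integral>\<^sup>+z. lpi p B \<bar>u z\<bar> (v (fst z)) \<partial>step_measure n r) <= 1" .
qed

lemma step_setI_bounds:
 assumes n: "1 <= n" and x: "x \<in> {-1..1}" and c: "\<bar>c\<bar> <= real r / 2" and s: "(x + c * h, h) \<in> step_set n r"
 shows "x + c * h \<in> {-1..1}" "0 < h" "1 + tau n x (x + c * h) <= 1 + pi * (1 + real r)"
  "rho n x <= (1 + pi * (1 + real r)) * rho n (x + c * h)" "h <= (1 + pi * (1 + real r)) * rho n x"
  "rho n (x + c * h) <= (1 + pi * (1 + real r)) * rho n x"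
proof -
 define y where "y = x + c * h"
 define D where "D = 1 + pi * (1 + real r)"
 have y: "y \<in> {-1..1}" and h: "0 < h" "h <= phi y / real n" using s by (auto simp: step_set_def y_def)
 have \<rho>: "0 < rho n y" "0 < rho n x" by (rule rho_pos[OF n y] rho_pos[OF n x])+
 have hr: "h <= rho n y" using h(2) phi_le_rho[OF n, of y] by linarith
 have "\<bar>y - x\<bar> = \<bar>c\<bar> * h" using h by (simp add: y_def abs_mult)
 also have "... <= real r / 2 * rho n y" using c hr h by (intro mult_mono) auto
 finally have "tau n y x <= pi * (1 + 2 * (real r / 2))" by (rule tau_le_of_abs_diff_le[OF n y x])
 then have tD: "1 + tau n x y <= D" by (simp add: D_def tau_commute)
 have "rho n x <= (1 + tau n x y) * rho n y" by (rule rho_ratio[OF n x y])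
 also have "... <= D * rho n y" using tD \<rho> by (intro mult_right_mono) auto
 finally have r1: "rho n x <= D * rho n y" .
 have "rho n y <= (1 + tau n x y) * rho n x" using rho_ratio[OF n y x] by (simp add: tau_commute)
 also have "... <= D * rho n x" using tD \<rho> by (intro mult_right_mono) auto
 finally have r2: "rho n y <= D * rho n x" .
 show "x + c * h \<in> {-1..1}" "0 < h" "1 + tau n x (x + c * h) <= 1 + pi * (1 + real r)"
  "rho n x <= (1 + pi * (1 + real r)) * rho n (x + c * h)" "h <= (1 + pi * (1 + real r)) * rho n x"
  "rho n (x + c * h) <= (1 + pi * (1 + real r)) * rho n x" using y h(1) tD r1 hr r2 unfolding y_def[symmetric] D_def[symmetric] by linarith+
qed

text \<open>Jensen's inequality over the steps for fixed \<open>x\<close>. Integrated over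
  \<open>x\<close> it becomes an integral over the product space, because for each fixed step the
  passage from \<open>x\<close> to the centre \<open>x + c * h\<close> is a translation.\<close>

lemma lpb_line:
 fixes u :: "real \<times> real \<Rightarrow> real"
 assumes v: "slow n s K v" and K: "0 <= K" and n: "1 <= n" and p: "1 <= p" and c: "\<bar>c\<bar> <= real r / 2"
  and u[measurable]: "u \<in> borel_measurable (borel \<Otimes>\<^sub>M borel)" and A: "0 < A"
  and F: "\<And>x. x \<in> {-1..1} ==> eabs (F x) <= ennreal (A / rho n x) *
   (LN h. eabs (u (x + c * h, h)) * indicator (step_set n r) (x + c * h, h))"
  and B: "0 < B" "lpb (step_measure n r) p (%z. v (fst z)) u B"
 shows "lpb M0 p v F (A * ((1 + pi * (1 + real r)) ^ 3 * (1 + K * (1 + pi * (1 + real r)) ^ s)) * B)"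
proof -
 define D where "D = 1 + pi * (1 + real r)"
 have D: "1 <= D" by (simp add: D_def)
 define K' where "K' = 1 + K * D ^ s"
 have K': "1 <= K'" using K D by (simp add: K'_def)
 have [measurable]: "v \<in> borel_measurable borel" by (rule slowD(1)[OF v])
 define k where "k x h = step_density n r (x + c * h, h)" for x h
 have [measurable]: "(%h. k x h) \<in> borel_measurable borel" for x unfolding k_def by measurable
 have k0: "0 <= k x h" for x h unfolding k_def by (rule step_density_nonneg[OF n])
 have kz: "k x h = 0" if "(x + c * h, h) \<notin> step_set n r" for x h unfolding k_def by (rule step_density_eq_0[OF that])
 note sb = step_setI_bounds[OF n _ c, folded D_def]
 have kD: "k x h <= D / rho n x * indicat_real {0..D * rho n x} h" if x: "x \<in> {-1..1}" for x h
 proof (cases "(x + c * h, h) \<in> step_set n r")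
  case True
  note b = sb[OF x True]
  have \<rho>: "0 < rho n x" "0 < rho n (x + c * h)" by (rule rho_pos[OF n x] rho_pos[OF n b(1)])+
  have "k x h = 1 / rho n (x + c * h)" using True by (simp add: k_def step_density_def)
  also have "... <= D / rho n x" using \<rho> b(4) by (simp add: field_simps)
  finally show ?thesis using b(2,5) by simp
 next
  case False
  then show ?thesis using kz[OF False] D rho_pos[OF n x] by (simp add: indicator_def)
 qed
 have kI: "(LN h. ennreal (k x h)) <= ennreal (D ^ 2)" if x: "x \<in> {-1..1}" for x
 proof -
  have \<rho>: "0 < rho n x" by (rule rho_pos[OF n x])
  have "(LN h. ennreal (k x h)) <= (LN h. ennreal (D / rho n x) * indicator {0..D * rho n x} h)"
  proof (rule nn_integral_mono)
   fix h
   show "ennreal (k x h) <= ennreal (D / rho n x) * indicator {0..D * rho n x} h" using ennreal_leI[OF kD[OF x, of h]] by (auto simp: indicator_def)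
  qed
  also have "... = ennreal (D / rho n x) * ennreal (D * rho n x)" using D \<rho> by (subst nn_integral_cmult_indicator) auto
  also have "... = ennreal (D / rho n x * (D * rho n x))" using D \<rho> by (intro ennreal_mult[symmetric]) auto
  also have "D / rho n x * (D * rho n x) = D ^ 2" using \<rho> by (simp add: power2_eq_square)
  finally show ?thesis .
 qed
 have Fk: "eabs (F x) <= (LN h. ennreal (A * D * \<bar>u (x + c * h, h)\<bar> * k x h))" if x: "x \<in> {-1..1}" for x
 proof -
  have "eabs (F x) <= (LN h. ennreal (A / rho n x) * (eabs (u (x + c * h, h)) * indicator (step_set n r) (x + c * h, h)))"
   using F[OF x] by (subst nn_integral_cmult) auto
  also have "... <= (LN h. ennreal (A * D * \<bar>u (x + c * h, h)\<bar> * k x h))"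
  proof (rule nn_integral_mono)
   fix h
   show "ennreal (A / rho n x) * (eabs (u (x + c * h, h)) * indicator (step_set n r) (x + c * h, h)) <= ennreal (A * D * \<bar>u (x + c * h, h)\<bar> * k x h)"
   proof (cases "(x + c * h, h) \<in> step_set n r")
    case True
    note b = sb[OF x True]
    have \<rho>: "0 < rho n x" "0 < rho n (x + c * h)" by (rule rho_pos[OF n x] rho_pos[OF n b(1)])+
    have "A / rho n x <= A * D / rho n (x + c * h)"
    proof -
     have "1 / rho n x <= D / rho n (x + c * h)" using \<rho> b(6) by (simp add: field_simps)
     from mult_left_mono[OF this, of A] A show ?thesis by simp
    qed
    then have "A / rho n x * \<bar>u (x + c * h, h)\<bar> <= A * D / rho n (x + c * h) * \<bar>u (x + c * h, h)\<bar>" by (rule mult_right_mono) simp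
    also have "... = A * D * \<bar>u (x + c * h, h)\<bar> * k x h" using True by (simp add: k_def step_density_def)
    finally have "ennreal (A / rho n x * \<bar>u (x + c * h, h)\<bar>) <= ennreal (A * D * \<bar>u (x + c * h, h)\<bar> * k x h)" by (rule ennreal_leI)
    moreover have "ennreal (A / rho n x * \<bar>u (x + c * h, h)\<bar>) = ennreal (A / rho n x) * eabs (u (x + c * h, h))"
     using A \<rho> by (intro ennreal_mult) auto
    ultimately show ?thesis using True by simp
   qed simp
  qed
  finally show ?thesis .
 qed
 have vv: "v x <= K' * v (x + c * h)" if x: "x \<in> {-1..1}" and s: "(x + c * h, h) \<in> step_set n r" for x h
 proof -
  note b = sb[OF x s]
  have v0: "0 <= v (x + c * h)" by (rule slowD(2)[OF v b(1)])
  have "v x <= K * (1 + tau n x (x + c * h)) ^ s * v (x + c * h)" by (rule slowD(3)[OF v x b(1)])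
  also have "... <= K * D ^ s * v (x + c * h)" using b(3) K v0 by (intro mult_right_mono mult_left_mono power_mono) auto
  also have "... <= K' * v (x + c * h)" using v0 by (intro mult_right_mono) (auto simp: K'_def)
  finally show ?thesis .
 qed
 define Cst where "Cst = A * (D ^ 3 * K')"
 \<comment> \<open>\<open>A * D\<close> is the kernel's size after normalising at the centre,
   \<open>K'\<close> the change of weight, and \<open>D ^ 2\<close> the mass of the density along
   the line.\<close>
 have Cst: "Cst = A * D * K' * D ^ 2" by (simp add: Cst_def power3_eq_cube power2_eq_square)
 have c0: "0 < A * D * K'" "0 < Cst" using A D K' by (simp_all add: Cst_def)
 define Q where "Q z = lpi p B \<bar>u z\<bar> (v (fst z))" for z
 have [measurable]: "Q \<in> borel_measurable (borel \<Otimes>\<^sub>M borel)" unfolding Q_def[abs_def] by measurable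
 have "lpb M0 p v F (Cst * B)"
 proof (rule lpbI[OF p])
  show "(%x. LN h. ennreal (k x h) * Q (x + c * h, h)) \<in> borel_measurable M0" unfolding k_def by (intro borel_measurable_M0) measurable
  have "(\<integral>\<^sup>+x. (LN h. ennreal (k x h) * Q (x + c * h, h)) \<partial>M0) <= (LN x. (LN h. ennreal (k x h) * Q (x + c * h, h)))"
   unfolding nn_integral_M0 by (intro nn_integral_mono) (simp add: indicator_def)
  also have "... = (\<integral>\<^sup>+z. Q z \<partial>step_measure n r)" unfolding k_def by (rule nn_integral_step_shift[symmetric, OF _ n]) measurable
  also have "... <= 1" unfolding Q_def
   by (intro lpbD[OF p B]) (use measurable_M0_pair[of u] measurable_M0_pair[of "%z. v (fst z)"] in \<open>simp_all add: step_measure_def\<close>)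
  finally show "(\<integral>\<^sup>+x. (LN h. ennreal (k x h) * Q (x + c * h, h)) \<partial>M0) <= 1" .
  fix x assume "x \<in> space M0"
  then have x: "x \<in> {-1..1}" by simp
  have "lpi p (Cst * B) \<bar>F x\<bar> (v x) <= ennreal (1 / Cst) * (LN h. lpi p B \<bar>u (x + c * h, h)\<bar> (v (x + c * h)) * ennreal (A * D * K' * k x h))"
  proof (rule lpi_jensen[OF p B(1), where k = "%h. A * D * k x h"])
   have "(LN h. ennreal (A * D * K' * k x h)) = ennreal (A * D * K') * (LN h. ennreal (k x h))" using c0 by (simp add: ennreal_mult' nn_integral_cmult)
   also have "... <= ennreal (A * D * K') * ennreal (D ^ 2)" using kI[OF x] by (rule mult_left_mono) simp
   also have "... = ennreal Cst" using c0 unfolding Cst by (simp add: ennreal_mult')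
   finally show i: "(LN h. ennreal (A * D * K' * k x h)) <= ennreal Cst" .
   have le: "A * D * k x h <= A * D * K' * k x h" for h using mult_left_mono[OF K', of "A * D * k x h"] A D k0[of x h] by (simp add: ac_simps)
   then have "(LN h. ennreal (A * D * k x h)) <= (LN h. ennreal (A * D * K' * k x h))" by (intro nn_integral_mono ennreal_leI)
   then show "(LN h. ennreal (A * D * k x h)) <= ennreal Cst" using i by (rule order_trans)
   fix h
   show "v x * (A * D * k x h) <= v (x + c * h) * (A * D * K' * k x h)"
   proof (cases "(x + c * h, h) \<in> step_set n r")
    case True
    from mult_right_mono[OF vv[OF x this], of "A * D * k x h"] A D k0[of x h] show ?thesis by (simp add: ac_simps)
   qed (simp add: kz)
  qed (use slowD(2)[OF v x] A D K' k0 c0 Fk[OF x] in \<open>auto simp: ac_simps\<close>)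
  also have "... = ennreal (1 / Cst) * (LN h. ennreal (A * D * K') * (ennreal (k x h) * Q (x + c * h, h)))"
   unfolding ennreal_mult'[OF less_imp_le[OF c0(1)]] Q_def fst_conv by (simp only: ac_simps)
  also have "... = ennreal (1 / Cst) * (ennreal (A * D * K') * (LN h. ennreal (k x h) * Q (x + c * h, h)))" by (subst nn_integral_cmult) auto
  also have "... = ennreal (1 / D ^ 2) * (LN h. ennreal (k x h) * Q (x + c * h, h))"
   using c0 A D K' by (simp add: mult.assoc[symmetric] ennreal_mult'[symmetric] Cst)
  also have "... <= 1 * (LN h. ennreal (k x h) * Q (x + c * h, h))" using D by (intro mult_right_mono) (simp_all add: one_le_power)
  finally show "lpi p (Cst * B) \<bar>F x\<bar> (v x) <= (LN h. ennreal (k x h) * Q (x + c * h, h))" by simp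
 qed (use c0 B in simp)
 then show ?thesis unfolding Cst_def K'_def D_def by (simp only: mult.assoc)
qed

lemma sigma_finite_step: "sigma_finite_measure (step_measure n r)"
proof -
 interpret M0: sigma_finite_measure M0 by (rule sigma_finite_M0)
 interpret P: pair_sigma_finite M0 "lborel :: real measure" ..
 note [measurable] = measurable_M0_pair[OF step_density_measurable[of n r]]
 show ?thesis unfolding step_measure_def by (subst P.sigma_finite_iff_density_finite') auto
qed

lemma sets_step: "sets (step_measure n r) = sets (M0 \<Otimes>\<^sub>M lborel)" "space (step_measure n r) = {-1..1} \<times> UNIV"
 unfolding step_measure_def by (simp_all add: space_pair_measure)

text \<open>At a fixed centre the steps range over at most \<open>rho n y\<close>, which the density
  divides out; this is the image-measure condition of \<open>lpb_kern\<close>.\<close>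

lemma nn_integral_step_fst_le:
 assumes [measurable]: "g \<in> borel_measurable M0" and n: "1 <= n"
 shows "(\<integral>\<^sup>+z. g (fst z) \<partial>step_measure n r) <= (\<integral>\<^sup>+y. g y \<partial>M0)"
proof -
 define g' where "g' y = g y * indicator {-1..1} y" for y
 have [measurable]: "g' \<in> borel_measurable borel" using assms(1) unfolding g'_def[abs_def] by (simp add: borel_measurable_restrict_space_iff_ennreal)
 have "(\<integral>\<^sup>+z. g (fst z) \<partial>step_measure n r) = (\<integral>\<^sup>+z. g' (fst z) \<partial>step_measure n r)"
  by (intro nn_integral_cong) (auto simp: sets_step g'_def)
 also have "... = (LN h. LN y. ennreal (step_density n r (y, h)) * g' (fst (y, h)))" by (rule nn_integral_step[OF _ n]) measurable
 also have "... = (LN y. LN h. ennreal (step_density n r (y, h)) * g' y)" unfolding fst_conv by (rule lborel_pair.Fubini') measurable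
 also have "... <= (LN y. g' y)"
 proof (rule nn_integral_mono)
  fix y
  show "(LN h. ennreal (step_density n r (y, h)) * g' y) <= g' y"
  proof (cases "y \<in> {-1..1}")
   case True
   have \<rho>: "0 < rho n y" by (rule rho_pos[OF n True])
   have "(LN h. ennreal (step_density n r (y, h)) * g' y) <= (LN h. (ennreal (1 / rho n y) * g' y) * indicator {0..rho n y} h)"
   proof (rule nn_integral_mono)
    fix h
    show "ennreal (step_density n r (y, h)) * g' y <= (ennreal (1 / rho n y) * g' y) * indicator {0..rho n y} h"
    proof (cases "(y, h) \<in> step_set n r")
     case s: True
     then have "0 < h" "h <= rho n y" using phi_le_rho[OF n, of y] by (auto simp: step_set_def)
     then show ?thesis using s by (simp add: step_density_def)
    qed (simp add: step_density_eq_0)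
   qed
   also have "... = ennreal (1 / rho n y) * g' y * ennreal (rho n y)" using \<rho> by (subst nn_integral_cmult_indicator) auto
   also have "... = ennreal (1 / rho n y) * ennreal (rho n y) * g' y" by (simp only: ac_simps)
   also have "ennreal (1 / rho n y) * ennreal (rho n y) = 1" using \<rho> by (simp add: ennreal_mult''[symmetric])
   finally show ?thesis by simp
  qed (simp add: g'_def)
 qed
 also have "... = (\<integral>\<^sup>+y. g y \<partial>M0)" by (simp add: nn_integral_M0 g'_def)
 finally show ?thesis .
qed

lemma lpb_mass:
 fixes u :: "real \<times> real \<Rightarrow> real"
 assumes v: "slow n s K v" and K: "0 <= K" and n: "1 <= n" and p: "1 <= p"
  and u[measurable]: "u \<in> borel_measurable (borel \<Otimes>\<^sub>M borel)"
  and F: "\<And>x. x \<in> {-1..1} ==> eabs (F x) <= (\<integral>\<^sup>+z. ennreal (\<bar>u z\<bar> * kern n (s + 5) x (fst z)) \<partial>step_measure n r)"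
  and B: "0 < B" "lpb (step_measure n r) p (%z. v (fst z)) u B"
 shows "lpb M0 p v F (pi * (1 + K) * B)"
proof (rule lpb_kern[OF v K n p sigma_finite_step _ nn_integral_step_fst_le[OF _ n] _ F B])
 have "fst \<in> measurable (M0 \<Otimes>\<^sub>M (lborel :: real measure)) M0" by (rule measurable_fst)
 then show "fst \<in> measurable (step_measure n r) M0" by (subst measurable_cong_sets[OF sets_step(1) refl])
 show "u \<in> borel_measurable (step_measure n r)" using measurable_M0_pair[OF u] by (simp add: step_measure_def)
qed

text \<open>A quantity bounded by three terms is at most three times one of them. This splits the
  error into functions supported where the corresponding term dominates, so that each is bounded by
  a single integral.\<close>

lemma ennreal_le_three_cases:
 fixes a x y z :: ennreal
 assumes "a <= x + y + z"
 shows "a <= 3 * x \<or> a <= 3 * y \<or> a <= 3 * z"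
proof -
 define m where "m = max x (max y z)"
 have "x + y + z <= m + m + m" unfolding m_def by (intro add_mono) (simp_all add: le_max_iff_disj)
 also have "... = 3 * m"
 proof -
  have "(3::ennreal) = 1 + 1 + 1" by simp
  then show ?thesis by (simp only: distrib_right mult_1_left)
 qed
 finally have "a <= 3 * m" using assms by (rule order_trans[rotated])
 moreover have "m = x \<or> m = y \<or> m = z" unfolding m_def by (auto simp: max_def)
 ultimately show ?thesis by auto
qed

text \<open>The pointwise estimate has two line integrals, treated by \<open>lpb_line\<close>, and
  one kernel integral, treated by \<open>lpb_mass\<close>. All three act on the same function of
  centre and step, whose norm is bounded by the modulus.\<close>

lemma direct_estimate:
 fixes r s :: nat and p :: ereal and K :: real
 assumes r: "1 <= r" and p: "1 <= p" and K: "0 <= K"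
 obtains C n0 where "0 < C" and "1 <= n0" and "\<And>n f v B. n0 <= n ==> slow n s K v ==> f \<in> borel_measurable borel ==>
  L1 {-1..1} f < \<infinity> ==> 0 < B ==>
  (\<And>h. 0 < h ==> h <= 1 / real n ==> lpb M0 p v (%x. sym_diff r (h * phi x) f x) B) ==>
  \<exists>P. degree P < n \<and> lpb M0 p v (%x. f x - poly P x) (C * B)"
proof (rule direct_pointwise[OF r, of "s + 5"], goal_cases)
 case (2 C0 n0)
 note C0 = 2(2) and n01 = 2(3) and DP = 2(4)
 define L where "L = (1 + pi * (1 + real r)) ^ 3 * (1 + K * (1 + pi * (1 + real r)) ^ s)"
 have L: "0 < L" using K by (auto simp: L_def intro!: mult_pos_pos add_pos_nonneg zero_less_power)
 define c1 where "c1 = 3 * C0 * L * 2"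
 define c3 where "c3 = 3 * C0 * (pi * (1 + K) * 2)"
 have c: "0 < c1" "0 < c3" using C0 L K by (auto simp: c1_def c3_def intro!: mult_pos_pos add_pos_nonneg)
 define C where "C = c1 + c1 + c3"
 have C: "0 < C" using c by (simp add: C_def)
 show thesis
 proof (rule that[OF C n01], goal_cases)
  case (1 n f v B)
  note n0 = 1(1) and v = 1(2) and f[measurable] = 1(3) and fin = 1(4) and B = 1(5) and mod = 1(6)
  have n: "1 <= n" using n0 n01 by simp
  have v0: "0 <= v 0" by (rule slowD(2)[OF v]) simp
  note vm[measurable] = slowD(1)[OF v]
  note vM0 = borel_measurable_M0[OF vm]
  have vp: "AE x in M0. 0 <= v x" using slowD(2)[OF v] by (intro AE_I2) auto
  \<comment> \<open>The slack \<open>e\<close> is chosen after \<open>n\<close> and \<open>B\<close>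
    so that the constant function \<open>e\<close> itself has weighted norm at most
    \<open>B\<close>; its dependence on \<open>n\<close> therefore does not enter the final
    constant.\<close>
  define W where "W = 2 * (1 + K * (1 + real n * pi) ^ s * v 0)"
  have W: "0 < W" unfolding W_def using K v0 by (intro mult_pos_pos add_pos_nonneg mult_nonneg_nonneg) (auto simp: add_nonneg_nonneg)
  define e where "e = B / W"
  have e: "0 < e" using B W by (simp add: e_def)
  have le: "lpb M0 p v (%x. e) B" using lpb_bounded[OF v K p, of e "%_. e"] e W by (simp add: e_def W_def)
  define u where "u z = \<bar>fdiff r (snd z) f (fst z - real r * snd z / 2)\<bar> + e" for z
  have [measurable]: "u \<in> borel_measurable (borel \<Otimes>\<^sub>M borel)" unfolding u_def[abs_def] by measurable
  have u0: "0 <= u z" for z using e by (simp add: u_def)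
  define G where "G y h = ennreal (u (y, h)) * indicator (step_set n r) (y, h)" for y h
  have [measurable]: "case_prod G \<in> borel_measurable (borel \<Otimes>\<^sub>M borel)" unfolding G_def by measurable
  have dom: "diff_dominated n r f e G" unfolding diff_dominated_def by (auto simp: G_def u_def step_set_def)
  have lu: "lpb (step_measure n r) p (%z. v (fst z)) u (2 * B)"
  proof (rule lpb_step[OF p n])
   fix k :: real assume k: "0 < k" "k <= 1 / real n"
   have sm: "(%x. sym_diff r (k * phi x) f x) \<in> borel_measurable M0" by (intro borel_measurable_M0 sym_diff_measurable f)
   have "lpb M0 p v (%x. \<bar>sym_diff r (k * phi x) f x\<bar> + \<bar>e\<bar>) (B + B)"
    using slowD(2)[OF v] by (intro lpb_add[OF p B B mod[OF k] le sm] vM0) auto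
   then show "lpb M0 p v (%y. if (y, k * phi y) \<in> step_set n r then u (y, k * phi y) else 0) (2 * B)"
   proof (rule lpb_mono_AE)
    show "AE y in M0. \<bar>if (y, k * phi y) \<in> step_set n r then u (y, k * phi y) else 0\<bar> <= \<bar>\<bar>sym_diff r (k * phi y) f y\<bar> + \<bar>e\<bar>\<bar>"
    proof (rule AE_I2)
     fix y
     show "\<bar>if (y, k * phi y) \<in> step_set n r then u (y, k * phi y) else 0\<bar> <= \<bar>\<bar>sym_diff r (k * phi y) f y\<bar> + \<bar>e\<bar>\<bar>"
     proof (cases "(y, k * phi y) \<in> step_set n r")
      case True
      then have "y - real r * (k * phi y) / 2 \<in> {-1..1}" "y + real r * (k * phi y) / 2 \<in> {-1..1}" by (auto simp: step_set_def)
      then have "sym_diff r (k * phi y) f y = fdiff r (k * phi y) f (y - real r * (k * phi y) / 2)" by (simp only: sym_diff_fdiff if_True simp_thms)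
      then show ?thesis using True e by (simp add: u_def)
     qed simp
    qed
   qed (use B p vp in auto)
  qed (use B in auto)
  obtain P where P: "degree P < n" and Pb: "\<And>x. x \<in> {-1..1} ==> eabs (f x - poly P x) <= ennreal (C0 / rho n x) * line_int r G x
    + ennreal C0 * kern_int n (s + 5) G x" using DP[OF n0 f fin e _ dom] by auto
  define F where "F x = f x - poly P x" for x
  have [measurable]: "F \<in> borel_measurable borel" unfolding F_def[abs_def] using poly_borel[of P] by measurable
  define X where "X c x = ennreal (C0 / rho n x) * (LN h. G (x + c * h) h)" for c x
  have [measurable]: "(%x. X c x) \<in> borel_measurable borel" for c unfolding X_def by measurable
  define Y where "Y x = ennreal C0 * (\<integral>\<^sup>+z. ennreal (\<bar>u z\<bar> * kern n (s + 5) x (fst z)) \<partial>step_measure n r)" for x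
  have FXY: "eabs (F x) <= X (- (real r / 2)) x + X (real r / 2) x + Y x" if x: "x \<in> {-1..1}" for x
  proof -
   have "line_int r G x = (LN h. G (x + - (real r / 2) * h) h + G (x + real r / 2 * h) h)" unfolding line_int_def by (simp add: mult.commute)
   also have "... = (LN h. G (x + - (real r / 2) * h) h) + (LN h. G (x + real r / 2 * h) h)" by (rule nn_integral_add) measurable
   finally have 1: "ennreal (C0 / rho n x) * line_int r G x = X (- (real r / 2)) x + X (real r / 2) x" by (simp only: X_def distrib_left)
   have "(%y. ennreal (kern n (s + 5) x y)) \<in> borel_measurable M0"
   proof -
    have "(%y. kern n (s + 5) x y) \<in> borel_measurable M0" using x by (intro kern_measurable) auto
    then show ?thesis by measurable
   qed
   then have [measurable]: "(%y. ennreal (kern n (s + 5) x y) * indicator {-1..1} y) \<in> borel_measurable borel"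
    by (simp add: borel_measurable_restrict_space_iff_ennreal)
   define H where "H y = ennreal (kern n (s + 5) x y) * indicator {-1..1} y" for y
   have [measurable]: "H \<in> borel_measurable borel" unfolding H_def[abs_def] by measurable
   have "(\<integral>\<^sup>+z. ennreal (\<bar>u z\<bar> * kern n (s + 5) x (fst z)) \<partial>step_measure n r) = (\<integral>\<^sup>+z. ennreal (u z) * H (fst z) \<partial>step_measure n r)"
    using u0 kern_nonneg[OF n x] by (intro nn_integral_cong) (auto simp: sets_step H_def ennreal_mult')
   also have "... = (LN h. LN y. ennreal (step_density n r (y, h)) * (ennreal (u (y, h)) * H (fst (y, h))))" by (rule nn_integral_step[OF _ n]) measurable
   also have "... = kern_int n (s + 5) G x"
   proof (intro nn_integral_cong)
    fix h y
    show "ennreal (step_density n r (y, h)) * (ennreal (u (y, h)) * H (fst (y, h))) = G y h * (ennreal (kern n (s + 5) x y / rho n y) * indicator {-1..1} y)"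
    proof (cases "(y, h) \<in> step_set n r")
     case True
     then have y: "y \<in> {-1..1}" by (auto simp: step_set_def)
     have "ennreal (kern n (s + 5) x y / rho n y) = ennreal (1 / rho n y) * ennreal (kern n (s + 5) x y)"
      using rho_pos[OF n y] kern_nonneg[OF n x] by (simp add: ennreal_mult'[symmetric])
     then show ?thesis using True y by (simp add: G_def H_def step_density_def ac_simps)
    qed (simp add: G_def step_density_eq_0)
   qed
   finally have 2: "Y x = ennreal C0 * kern_int n (s + 5) G x" unfolding Y_def by simp
   show ?thesis using Pb[OF x] unfolding 1 2 F_def .
  qed
  define a where "a = - (real r / 2)"
  define b where "b = real r / 2"
  \<comment> \<open>The conditions test which term dominates, so the three pieces are Borel and
    together cover \<open>F\<close>; the pieces \<open>F1\<close> and \<open>F2\<close> may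
    overlap.\<close>
  define F1 where "F1 x = (if eabs (F x) <= 3 * X a x then \<bar>F x\<bar> else 0)" for x
  define F2 where "F2 x = (if eabs (F x) <= 3 * X b x then \<bar>F x\<bar> else 0)" for x
  define F3 where "F3 x = (if eabs (F x) <= 3 * X a x \<or> eabs (F x) <= 3 * X b x then 0 else \<bar>F x\<bar>)" for x
  have Fm[measurable]: "F1 \<in> borel_measurable borel" "F2 \<in> borel_measurable borel" "F3 \<in> borel_measurable borel"
   unfolding F1_def[abs_def] F2_def[abs_def] F3_def[abs_def] by measurable
  have line: "lpb M0 p v Fi c1B" if Fi: "\<And>x. eabs (Fi x) <= 3 * X t x" and t: "\<bar>t\<bar> <= real r / 2" and cB: "c1B = c1 * B" for Fi t c1B
  proof -
   have "lpb M0 p v Fi (3 * C0 * L * (2 * B))" unfolding L_def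
   proof (rule lpb_line[OF v K n p t _ _ _ _ lu])
    fix x :: real assume x: "x \<in> {-1..1}"
    have "3 * X t x = ennreal (3 * C0 / rho n x) * (LN h. G (x + t * h) h)"
    proof -
     have "3 * ennreal (C0 / rho n x) = ennreal (3 * C0 / rho n x)"
     proof -
      have "ennreal (3 * (C0 / rho n x)) = ennreal 3 * ennreal (C0 / rho n x)" using C0 rho_pos[OF n x] by (intro ennreal_mult) auto
      then show ?thesis by simp
     qed
     then show ?thesis unfolding X_def by (simp only: mult.assoc[symmetric])
    qed
    also have "(LN h. G (x + t * h) h) = (LN h. eabs (u (x + t * h, h)) * indicator (step_set n r) (x + t * h, h))" using u0 by (simp add: G_def)
    finally show "eabs (Fi x) <= ennreal (3 * C0 / rho n x) * (LN h. eabs (u (x + t * h, h)) * indicator (step_set n r) (x + t * h, h))" using Fi[of x] by simp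
   qed (use C0 B in auto)
   then show ?thesis by (simp add: cB c1_def ac_simps)
  qed
  have l1: "lpb M0 p v F1 (c1 * B)" by (rule line[of _ a]) (auto simp: F1_def a_def)
  have l2: "lpb M0 p v F2 (c1 * B)" by (rule line[of _ b]) (auto simp: F2_def b_def)
  have l3: "lpb M0 p v F3 (c3 * B)"
  proof -
   define F3' where "F3' x = F3 x / (3 * C0)" for x
   have "lpb M0 p v F3' (pi * (1 + K) * (2 * B))"
   proof (rule lpb_mass[OF v K n p _ _ _ lu])
    fix x :: real assume x: "x \<in> {-1..1}"
    define Z where "Z = (\<integral>\<^sup>+z. ennreal (\<bar>u z\<bar> * kern n (s + 5) x (fst z)) \<partial>step_measure n r)"
    have "eabs (F3 x) <= 3 * Y x" using ennreal_le_three_cases[OF FXY[OF x]] by (auto simp: F3_def a_def b_def)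
    also have "3 * Y x = ennreal (3 * C0) * Z" using C0 by (simp add: Y_def Z_def mult.assoc[symmetric] ennreal_mult')
    finally have "ennreal (1 / (3 * C0)) * eabs (F3 x) <= ennreal (1 / (3 * C0)) * (ennreal (3 * C0) * Z)" by (rule mult_left_mono) simp
    also have "... = Z" using C0 by (simp add: mult.assoc[symmetric] ennreal_mult'[symmetric])
    also have "ennreal (1 / (3 * C0)) * eabs (F3 x) = eabs (F3' x)" using C0 by (simp add: F3'_def ennreal_mult'[symmetric])
    finally show "eabs (F3' x) <= (\<integral>\<^sup>+z. ennreal (\<bar>u z\<bar> * kern n (s + 5) x (fst z)) \<partial>step_measure n r)" unfolding Z_def .
   qed (use B in auto)
   then have "lpb M0 p v (%x. 3 * C0 * F3' x) (3 * C0 * (pi * (1 + K) * (2 * B)))"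
   proof (rule lpb_cmult)
    show "F3' \<in> borel_measurable M0" unfolding F3'_def[abs_def] by (intro borel_measurable_M0) measurable
   qed (use C0 K B p vM0 in auto)
   then show ?thesis using C0 by (simp add: F3'_def c3_def ac_simps)
  qed
  have cB: "0 < c1 * B" "0 < c3 * B" using c B by auto
  have l12: "lpb M0 p v (%x. \<bar>F1 x\<bar> + \<bar>F2 x\<bar>) (c1 * B + c1 * B)"
   using slowD(2)[OF v] by (intro lpb_add[OF p cB(1) cB(1) l1 l2] vM0 borel_measurable_M0 Fm) auto
  have "lpb M0 p v (%x. \<bar>\<bar>F1 x\<bar> + \<bar>F2 x\<bar>\<bar> + \<bar>F3 x\<bar>) (c1 * B + c1 * B + c3 * B)"
   using slowD(2)[OF v] by (intro lpb_add[OF p add_pos_pos[OF cB(1) cB(1)] cB(2) l12 l3] vM0 borel_measurable_M0) auto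
  then have "lpb M0 p v F (C * B)"
  proof (rule lpb_mono_AE)
   show "AE x in M0. \<bar>F x\<bar> <= \<bar>\<bar>\<bar>F1 x\<bar> + \<bar>F2 x\<bar>\<bar> + \<bar>F3 x\<bar>\<bar>"
    by (intro AE_I2) (auto simp: F1_def F2_def F3_def)
   show "0 <= c1 * B + c1 * B + c3 * B" using cB by linarith
  qed (use p vp in \<open>auto simp: C_def distrib_right\<close>)
  then show ?case using P unfolding F_def by blast
 qed
qed simp

section \<open>The equivalence\<close>

lemma AE_lebesgue_on: "(AE x in lebesgue_on {-1..1::real}. P x) \<longleftrightarrow> (AE x in lborel. x \<in> {-1..1} \<longrightarrow> P x)"
 by (simp add: AE_restrict_space_iff AE_completion_iff)

text \<open>Only \<open>g'\<close> is assumed Borel; for \<open>p = \<infinity>\<close> the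
  measurability of \<open>g\<close>, which the essential supremum requires, is inherited from
  \<open>g'\<close> by completeness of Lebesgue measure.\<close>

lemma wnorm_cong_AE:
 assumes [measurable]: "g' \<in> borel_measurable borel" "v \<in> borel_measurable borel"
  and ae: "AE x in lborel. x \<in> {-1..1} \<longrightarrow> g x = g' x"
 shows "wnorm p v g = wnorm p v g'"
proof -
 have ae': "AE x in lebesgue_on {-1..1}. g x = g' x" using ae by (simp only: AE_lebesgue_on)
 show ?thesis
 proof (cases "p = \<infinity>")
  case False
  have "(\<integral>\<^sup>+x. ennreal (\<bar>g x\<bar> powr real_of_ereal p * v x) \<partial>lebesgue_on {-1..1}) = (\<integral>\<^sup>+x. ennreal (\<bar>g' x\<bar> powr real_of_ereal p * v x) \<partial>lebesgue_on {-1..1})"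
   by (rule nn_integral_cong_AE) (use ae' in eventually_elim, simp)
  then show ?thesis using False by (simp add: wnorm_def)
 next
  case True
  have "(%x. indicat_real {-1..1} x *\<^sub>R (\<bar>g' x\<bar> * v x)) \<in> borel_measurable lebesgue" by (intro measurable_completion) measurable
  moreover have "AE x in lebesgue. indicat_real {-1..1} x *\<^sub>R (\<bar>g' x\<bar> * v x) = indicat_real {-1..1} x *\<^sub>R (\<bar>g x\<bar> * v x)"
  proof -
   have "AE x in lborel. indicat_real {-1..1} x *\<^sub>R (\<bar>g' x\<bar> * v x) = indicat_real {-1..1} x *\<^sub>R (\<bar>g x\<bar> * v x)"
    using ae by eventually_elim (auto simp: indicator_def)
   then show ?thesis by (rule AE_completion)
  qed
  ultimately have "(%x. indicat_real {-1..1} x *\<^sub>R (\<bar>g x\<bar> * v x)) \<in> borel_measurable lebesgue" by (rule borel_measurable_AE)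
  then have m: "(%x. \<bar>g x\<bar> * v x) \<in> borel_measurable (lebesgue_on {-1..1})" by (subst borel_measurable_restrict_space_iff) auto
  have m': "(%x. \<bar>g' x\<bar> * v x) \<in> borel_measurable (lebesgue_on {-1..1})" by (intro measurable_restrict_space1 measurable_completion) measurable
  have "esssup (lebesgue_on {-1..1}) (%x. ennreal (\<bar>g x\<bar> * v x)) = esssup (lebesgue_on {-1..1}) (%x. ennreal (\<bar>g' x\<bar> * v x))"
  proof (rule esssup_AE_cong)
   show "(%x. ennreal (\<bar>g x\<bar> * v x)) \<in> borel_measurable (lebesgue_on {-1..1})" using m by measurable
   show "(%x. ennreal (\<bar>g' x\<bar> * v x)) \<in> borel_measurable (lebesgue_on {-1..1})" using m' by measurable
   show "AE x in lebesgue_on {-1..1}. ennreal (\<bar>g x\<bar> * v x) = ennreal (\<bar>g' x\<bar> * v x)" using ae' by eventually_elim simp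
  qed
  then show ?thesis using True by (simp add: wnorm_def)
 qed
qed

text \<open>The difference evaluates f at shifted points, so the exceptional null set must be pulled
  back along each shift; \<open>nn_integral_shift_phi\<close> applied to its indicator shows that
  the preimages are null.\<close>

lemma sym_diff_cong_AE:
 assumes ae: "AE x in lborel. x \<in> {-1..1} \<longrightarrow> f x = g x" and r: "1 <= r" and h: "0 < h"
 shows "AE x in lborel. x \<in> {-1..1} \<longrightarrow> sym_diff r (h * phi x) f x = sym_diff r (h * phi x) g x"
proof -
 obtain N where N: "N \<in> null_sets lborel" "{x. \<not> (x \<in> {-1..1} \<longrightarrow> f x = g x)} \<subseteq> N"
  using AE_E[OF ae] by (auto simp: null_sets_def)
 have [measurable]: "N \<in> sets borel" using N(1) by auto
 define k where "k = real r * h / 2"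
 have k: "0 < k" using r h by (simp add: k_def)
 define Dom where "Dom = {x \<in> {-1..1}. x - k * phi x \<in> {-1..1} \<and> x + k * phi x \<in> {-1..1}}"
 define c where "c i = 2 * real i / real r - 1" for i
 have c: "\<bar>c i\<bar> <= 1" if "i <= r" for i
 proof -
  have "0 <= 2 * real i / real r" "2 * real i / real r <= 2" using that r by (simp_all add: divide_le_eq)
  then show ?thesis unfolding c_def by linarith
 qed
 have "{x \<in> space borel. (-1 <= x \<and> x <= 1) \<and> (-1 <= x - k * phi x \<and> x - k * phi x <= 1) \<and> (-1 <= x + k * phi x \<and> x + k * phi x <= 1)} \<in> sets borel"
  by measurable
 then have [measurable]: "Dom \<in> sets borel" by (simp add: Dom_def)
 have "AE x in lborel. x \<in> Dom \<longrightarrow> x + c i * k * phi x \<notin> N" if i: "i <= r" for i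
 proof -
  have "(LN x. indicator N (x + c i * k * phi x) * indicator Dom x) <= 2 * (\<integral>\<^sup>+x\<in>{-1..1}. indicator N x \<partial>lborel)"
   unfolding Dom_def by (rule nn_integral_shift_phi[OF _ k c[OF i]]) measurable
  also have "(\<integral>\<^sup>+x\<in>{-1..1}. indicator N x \<partial>lborel) <= (LN x. indicator N x)" by (intro nn_integral_mono) (auto simp: indicator_def)
  also have "... = 0" using N(1) by (simp add: null_sets_def)
  finally have "(LN x. indicator N (x + c i * k * phi x) * indicator Dom x) = 0" by (simp add: mult_left_mono)
  then have "AE x in lborel. indicator N (x + c i * k * phi x) * indicator Dom x = (0::ennreal)" by (subst (asm) nn_integral_0_iff_AE) measurable
  then show ?thesis by eventually_elim (auto simp: indicator_def split: if_splits)
 qed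
 then have "AE x in lborel. \<forall>i\<in>{..r}. x \<in> Dom \<longrightarrow> x + c i * k * phi x \<notin> N" by (intro AE_finite_allI) auto
 then show ?thesis
 proof eventually_elim
  case (elim x)
  show ?case
  proof
   assume x: "x \<in> {-1..1}"
   show "sym_diff r (h * phi x) f x = sym_diff r (h * phi x) g x"
   proof (cases "x - k * phi x \<in> {-1..1} \<and> x + k * phi x \<in> {-1..1}")
    case False
    have "real r * (h * phi x) / 2 = k * phi x" by (simp add: k_def)
    then show ?thesis using False unfolding sym_diff_fdiff by (simp only: if_False simp_thms)
   next
    case True
    then have xD: "x \<in> Dom" using x by (simp add: Dom_def)
    have "f (x - real r * (h * phi x) / 2 + real i * (h * phi x)) = g (x - real r * (h * phi x) / 2 + real i * (h * phi x))" if i: "i <= r" for i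
    proof -
     have e: "x - real r * (h * phi x) / 2 + real i * (h * phi x) = x + c i * k * phi x"
     proof -
      have "c i * k = real i * h - real r * h / 2" using r by (simp add: c_def k_def left_diff_distrib)
      then show ?thesis by (simp add: left_diff_distrib mult.assoc)
     qed
     have "x + c i * k * phi x \<in> {-1..1}" using phi_dom_segment(1)[OF x _ _ c[OF i], of k] True k by auto
     moreover have "x + c i * k * phi x \<notin> N" using elim i xD by auto
     ultimately show ?thesis unfolding e using N(2) by auto
    qed
    then have "fdiff r (h * phi x) f (x - real r * (h * phi x) / 2) = fdiff r (h * phi x) g (x - real r * (h * phi x) / 2)" by (rule fdiff_cong)
    then show ?thesis by (simp only: sym_diff_fdiff)
   qed
  qed
 qed
qed

text \<open>A Borel representative makes the product-measure arguments applicable; it is integrable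
  because |g| is at most 1 + |g|^q, or bounded when \<open>p = \<infinity>\<close>.\<close>

lemma Lp_interval_borel:
 assumes f: "f \<in> Lp_interval p" and p: "1 <= p"
 obtains g where "g \<in> borel_measurable borel" "AE x in lborel. x \<in> {-1..1} \<longrightarrow> f x = g x"
  "L1 {-1..1} g < \<infinity>"
proof -
 have fm: "f \<in> borel_measurable (lebesgue_on {-1..1})" and fn: "wnorm p (%_. 1) f < \<infinity>" using f by (auto simp: Lp_interval_def)
 have "(%x. indicat_real {-1..1} x *\<^sub>R f x) \<in> borel_measurable lebesgue" using fm by (subst (asm) borel_measurable_restrict_space_iff) auto
 from completion_ex_borel_measurable_real[OF this] obtain g where g: "g \<in> borel_measurable lborel"
  "AE x in lborel. indicat_real {-1..1} x *\<^sub>R f x = g x" by blast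
 have gm[measurable]: "g \<in> borel_measurable borel" using g(1) by simp
 have ae: "AE x in lborel. x \<in> {-1..1} \<longrightarrow> f x = g x" using g(2) by eventually_elim auto
 have "wnorm p (%_. 1) g < \<infinity>" using fn wnorm_cong_AE[OF gm _ ae, of "%_. 1" p] by simp
 then obtain B where "0 <= B" "wnorm p (%_. 1) g <= ennreal B" by (cases "wnorm p (%_. 1) g") auto
 then have l: "0 <= B" "lpb M0 p (%_. 1) g B" using wnorm_le_iff_lpb[OF p _ gm, of B "%_. 1"] by auto
 have "(\<integral>\<^sup>+x. eabs (g x) \<partial>M0) < \<infinity>"
 proof (cases "p = \<infinity>")
  case True
  have "(\<integral>\<^sup>+x. eabs (g x) \<partial>M0) <= (\<integral>\<^sup>+x. ennreal B \<partial>M0)"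
   by (rule nn_integral_mono_AE) (use l True in \<open>auto simp: lpb_def elim!: eventually_mono intro!: ennreal_leI\<close>)
  also have "... < \<infinity>" by (simp add: emeasure_restrict_space ennreal_mult_less_top)
  finally show ?thesis .
 next
  case False
  define q where "q = real_of_ereal p"
  have q: "1 <= q" using real_of_ereal_ge_1[OF p False] by (simp add: q_def)
  have "(\<integral>\<^sup>+x. eabs (g x) \<partial>M0) <= (\<integral>\<^sup>+x. 1 + ennreal (\<bar>g x\<bar> powr q * 1) \<partial>M0)"
  proof (rule nn_integral_mono)
   fix x
   have "\<bar>g x\<bar> <= 1 + \<bar>g x\<bar> powr q"
   proof (cases "\<bar>g x\<bar> <= 1")
    case True
    then show ?thesis by (simp add: add_increasing2)
   next
    case False
    then have "\<bar>g x\<bar> powr 1 <= \<bar>g x\<bar> powr q" using q by (intro powr_mono) auto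
    then show ?thesis using False by simp
   qed
   then have "eabs (g x) <= ennreal (1 + \<bar>g x\<bar> powr q)" by (rule ennreal_leI)
   then show "eabs (g x) <= 1 + ennreal (\<bar>g x\<bar> powr q * 1)" by simp
  qed
  also have "... = (\<integral>\<^sup>+x. 1 \<partial>M0) + (\<integral>\<^sup>+x. ennreal (\<bar>g x\<bar> powr q * 1) \<partial>M0)"
   using borel_measurable_M0[OF gm] by (intro nn_integral_add) auto
  also have "... <= (\<integral>\<^sup>+x. 1 \<partial>M0) + ennreal (B powr q)" using l(2) False by (intro add_left_mono) (simp add: lpb_def q_def)
  also have "... < \<infinity>" by (simp add: emeasure_restrict_space)
  finally show ?thesis .
 qed
 then show thesis using that[OF gm ae] by (simp add: nn_integral_M0)
qed

theorem corollary7p6: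
  fixes r :: nat and p :: ereal and f w :: "real \<Rightarrow> real" and \<delta> \<gamma> \<alpha> :: real
  assumes "1 \<le> r" and "1 \<le> p" and "f \<in> Lp_interval p"
    and "0 \<le> \<delta>" and "0 \<le> \<gamma>" and "w \<in> W_class \<delta> \<gamma>"
    and "\<gamma> \<le> real r * lambda_p p"
    and "0 < \<alpha>" and "\<alpha> < real r - \<delta> / lambda_p p"
  shows "ennreal_bigo (\<lambda>n. best_approx n f p (weight_avg w n)) (\<lambda>n. real n powr (-\<alpha>))
     \<longleftrightarrow> ennreal_bigo (\<lambda>n. modulus_phi r f (1 / real n) p (weight_avg w n)) (\<lambda>n. real n powr (-\<alpha>))"
proof -
 note r = assms(1) and p = assms(2)
 have dw: "doubling_weight w" using assms(6) by (simp add: W_class_def)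
 obtain \<Lambda> where \<Lambda>: "0 < \<Lambda>" "W_ineq \<Lambda> \<delta> \<gamma> w" using assms(6) unfolding W_class_def W_ineq_def by blast
 have vm: "weight_avg w n \<in> borel_measurable borel" for n by (rule weight_avg_borel[OF dw])
 obtain g where g: "g \<in> borel_measurable borel" "AE x in lborel. x \<in> {-1..1} \<longrightarrow> f x = g x"
  "L1 {-1..1} g < \<infinity>" using Lp_interval_borel[OF assms(3) p] by blast
 note gm[measurable] = g(1)
 \<comment> \<open>Neither side of the equivalence changes when f is replaced by its Borel
   representative.\<close>
 have best: "best_approx n f p (weight_avg w n) = best_approx n g p (weight_avg w n)" for n unfolding best_approx_def
 proof (intro INF_cong refl wnorm_cong_AE vm)
  fix P :: "real poly"
  show "(%x. g x - poly P x) \<in> borel_measurable borel" using poly_borel[of P] by measurable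
  show "AE x in lborel. x \<in> {-1..1} \<longrightarrow> f x - poly P x = g x - poly P x" using g(2) by eventually_elim simp
 qed
 have modulus: "modulus_phi r f t p (weight_avg w n) = modulus_phi r g t p (weight_avg w n)" for t n unfolding modulus_phi_def
  by (intro SUP_cong refl wnorm_cong_AE vm sym_diff_measurable gm sym_diff_cong_AE g(2) r) auto
 show ?thesis unfolding best modulus
 proof
  assume "ennreal_bigo (%n. best_approx n g p (weight_avg w n)) (%n. real n powr (-\<alpha>))"
  then show "ennreal_bigo (%n. modulus_phi r g (1 / real n) p (weight_avg w n)) (%n. real n powr (-\<alpha>))"
   by (rule inverse_estimate[OF r p gm dw \<Lambda> assms(7,8,9)])
 next
  assume "ennreal_bigo (%n. modulus_phi r g (1 / real n) p (weight_avg w n)) (%n. real n powr (-\<alpha>))"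
  then obtain Cm where Cm: "0 < Cm" and ev: "\<forall>\<^sub>F n in sequentially. modulus_phi r g (1 / real n) p (weight_avg w n) <= ennreal (Cm * real n powr (-\<alpha>))"
   unfolding ennreal_bigo_def by blast
  obtain s K where K: "0 <= K" and sl: "\<And>n. 1 <= n ==> slow n s K (weight_avg w n)" by (rule doubling_imp_slow[OF dw]) blast
  show "ennreal_bigo (%n. best_approx n g p (weight_avg w n)) (%n. real n powr (-\<alpha>))"
  proof (rule direct_estimate[OF r p K, of s], goal_cases)
   case (1 C n0)
   note C = 1(1) and n0 = 1(2) and DE = 1(3)
   have "\<forall>\<^sub>F n in sequentially. best_approx n g p (weight_avg w n) <= ennreal (C * Cm * real n powr (-\<alpha>))"
    using ev eventually_ge_at_top[of n0]
   proof eventually_elim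
    case (elim n)
    have n: "1 <= n" using elim n0 by simp
    define B where "B = Cm * real n powr (-\<alpha>)"
    have B: "0 < B" using Cm n by (simp add: B_def)
    have "\<exists>P. degree P < n \<and> lpb M0 p (weight_avg w n) (%x. g x - poly P x) (C * B)"
    proof (rule DE[OF elim(2) sl[OF n] gm g(3) B])
     fix h :: real assume h: "0 < h" "h <= 1 / real n"
     have "wnorm p (weight_avg w n) (%x. sym_diff r (h * phi x) g x) <= modulus_phi r g (1 / real n) p (weight_avg w n)"
      unfolding modulus_phi_def using h by (intro SUP_upper2[of h]) auto
     also have "... <= ennreal B" using elim(1) by (simp add: B_def)
     finally show "lpb M0 p (weight_avg w n) (%x. sym_diff r (h * phi x) g x) B"
      using B by (subst (asm) wnorm_le_iff_lpb[OF p _ sym_diff_measurable[OF gm] vm]) auto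
    qed
    then obtain P where P: "degree P < n" "lpb M0 p (weight_avg w n) (%x. g x - poly P x) (C * B)" by blast
    have "(%x. g x - poly P x) \<in> borel_measurable borel" using poly_borel[of P] by measurable
    then have "wnorm p (weight_avg w n) (%x. g x - poly P x) <= ennreal (C * B)" using P(2) C B by (subst wnorm_le_iff_lpb[OF p _ _ vm]) auto
    then have "best_approx n g p (weight_avg w n) <= ennreal (C * B)" unfolding best_approx_def using P(1) by (intro INF_lower2[of P]) auto
    then show ?case by (simp add: B_def mult.assoc)
   qed
   then show ?case unfolding ennreal_bigo_def using C Cm by (intro exI[of _ "C * Cm"]) auto
  qed
 qed
qed

end
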